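(* As $\kappa\to+\infty$, the probability measures $\mathbb Q^{\kappa}_{0,0}$ on $\mathcal C([0,1],\mathbb R)$ (with the uniform topology), defined for $\kappa>0$ by $$\mathbb Q^{\kappa}_{0,0}(\mathrm dw)=Z_\kappa^{-1}\exp\Big(-2\kappa\int_0^1\mathbf 1_{\mathbb R_-}(w_x)\,\mathrm dx\Big)\,\mathbb W_{0,0}(\mathrm dw),$$ converge weakly to $\mathbb P^3_{0,0}$, the law of the $3$-dimensional Bessel bridge from $0$ to $0$ on $[0,1]$ (which is also the law of the normalised Brownian excursion).
   Context: $\mathbb W_{0,0}$ is the law of the standard Brownian bridge from $0$ to $0$ on $[0,1]$, and $Z_\kappa\in(0,\infty)$ is the constant making $\mathbb Q^\kappa_{0,0}$ a probability measure. *)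

theory Defs
  imports "HOL-Probability.Probability"
begin

section \<open>The path space \<open>C([0,1], R)\<close>\<close>

text \<open>Paths are functions of type \<^typ>\<open>real \<Rightarrow> real\<close> that are continuous on \<open>[0,1]\<close> and take the
  dummy value \<^const>\<open>undefined\<close> outside (\<^const>\<open>extensional\<close>); the metric is the sup distance over
  \<open>[0,1]\<close>.\<close>

definition path_metric :: "(real \<Rightarrow> real) metric" where
  "path_metric = cfunspace (top_of_set {0..1}) euclidean_metric"

abbreviation path_topology :: "(real \<Rightarrow> real) topology" where
  "path_topology \<equiv> mtopology_of path_metric"

definition borel_of :: "'a topology \<Rightarrow> 'a measure" where
  "borel_of X = sigma (topspace X) {U. openin X U}"

lemma mspace_path_metric:
  "mspace path_metric = {w. continuous_on {0..1} w \<and> w \<in> extensional {0..1}}"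
proof -
  have "bounded (w ` {0..1})" if "continuous_on {0..1} w" for w :: "real \<Rightarrow> real"
    using that by (intro compact_imp_bounded compact_continuous_image) auto
  then show ?thesis
    by (auto simp: path_metric_def Met_TC.fspace_def)
qed

lemma mdist_path_metric:
  assumes "v \<in> mspace path_metric" "w \<in> mspace path_metric"
  shows "mdist path_metric v w = (SUP x\<in>{0..1}. \<bar>v x - w x\<bar>)"
  using assms unfolding path_metric_def
  by (subst mdist_cfunspace_eq_mdist_funspace) (auto simp: Met_TC.fdist_def Met_TC.fspace_def dist_real_def)

text \<open>Weak convergence along a filter: integrals of bounded continuous functions converge. It is
  meant for probability measures on \<^term>\<open>borel_of X\<close>.\<close>

definition converges_weakly ::
  "'a topology \<Rightarrow> ('i \<Rightarrow> 'a measure) \<Rightarrow> 'a measure \<Rightarrow> 'i filter \<Rightarrow> bool" where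
  "converges_weakly X N M F \<longleftrightarrow>
     (\<forall>f. continuous_map X euclideanreal f \<and> bounded (f ` topspace X) \<longrightarrow>
        ((\<lambda>i. \<integral>w. f w \<partial>N i) \<longlongrightarrow> (\<integral>w. f w \<partial>M)) F)"


section \<open>Brownian bridge, Bessel bridges, normalised excursion\<close>

text \<open>The normal distribution \<open>N(0,v)\<close>, including the degenerate case \<open>v = 0\<close>.\<close>

definition centred_normal :: "real \<Rightarrow> real measure" where
  "centred_normal v =
     (if v = 0 then return borel 0 else density lborel (normal_density 0 (sqrt v)))"

text \<open>\<open>W\<close> is the law on the path space of the standard Brownian bridge from \<open>0\<close> to \<open>0\<close>: the
  centred Gaussian process (all finite linear combinations of coordinates are centred normal) with
  covariance \<open>min s t - s t\<close>. These conditions determine \<open>W\<close>.\<close>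

definition brownian_bridge_law :: "(real \<Rightarrow> real) measure \<Rightarrow> bool" where
  "brownian_bridge_law W \<longleftrightarrow>
     prob_space W \<and> sets W = sets (borel_of path_topology) \<and>
     (\<forall>I c. finite I \<and> I \<subseteq> {0..1} \<longrightarrow>
        distr W borel (\<lambda>w. \<Sum>t\<in>I. c t * w t) =
        centred_normal (\<Sum>s\<in>I. \<Sum>t\<in>I. c s * c t * (min s t - s * t)))"

text \<open>The law of the \<open>d\<close>-dimensional Bessel bridge from \<open>0\<close> to \<open>0\<close>, for integer \<open>d\<close>: the Euclidean
  norm of a \<open>d\<close>-dimensional Brownian bridge, i.e. of \<open>d\<close> independent copies of the
  Brownian bridge with law \<open>W\<close>.\<close>

definition bessel_bridge_law :: "(real \<Rightarrow> real) measure \<Rightarrow> nat \<Rightarrow> (real \<Rightarrow> real) measure" where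
  "bessel_bridge_law W d =
     distr (Pi\<^sub>M {..<d} (\<lambda>_. W)) (borel_of path_topology)
       (\<lambda>b. \<lambda>x\<in>{0..1}. L2_set (\<lambda>i. b i x) {..<d})"

text \<open>For \<open>x, y > 0\<close>: the transition density of Brownian motion killed at \<open>0\<close>, and the density at
  \<open>t\<close> of the time at which Brownian motion started from \<open>x\<close> first hits \<open>0\<close>. As a function of \<open>x\<close>
  the latter is also, up to a constant, the entrance density at time \<open>t\<close> of Ito's measure of
  positive excursions.\<close>

definition killed_density :: "real \<Rightarrow> real \<Rightarrow> real \<Rightarrow> real" where
  "killed_density t x y = normal_density 0 (sqrt t) (y - x) - normal_density 0 (sqrt t) (y + x)"

definition hitting_density :: "real \<Rightarrow> real \<Rightarrow> real" where
  "hitting_density t x = x / sqrt (2 * pi * t ^ 3) * exp (- x\<^sup>2 / (2 * t))"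

text \<open>\<open>P\<close> is the law of the normalised Brownian excursion, i.e. Ito's measure of positive excursions
  conditioned on duration \<open>1\<close>, given through its finite-dimensional distributions at times
  \<open>0 < t 1 < \<dots> < t n < 1\<close>. The factor \<open>2 sqrt (2 pi)\<close> normalises the density to total mass 1.\<close>

definition normalised_excursion_law :: "(real \<Rightarrow> real) measure \<Rightarrow> bool" where
  "normalised_excursion_law P \<longleftrightarrow>
     prob_space P \<and> sets P = sets (borel_of path_topology) \<and>
     (\<forall>n t. n \<ge> 1 \<and> strict_mono_on {1..n} t \<and> 0 < t 1 \<and> t n < 1 \<longrightarrow>
        distributed P (Pi\<^sub>M {1..n} (\<lambda>_. lborel)) (\<lambda>w. \<lambda>i\<in>{1..n}. w (t i))
          (\<lambda>x. if \<forall>i\<in>{1..n}. 0 < x i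
               then ennreal (2 * sqrt (2 * pi) * hitting_density (t 1) (x 1) *
                      (\<Prod>i=1..<n. killed_density (t (Suc i) - t i) (x i) (x (Suc i))) *
                      hitting_density (1 - t n) (x n))
               else 0))"


section \<open>The penalised bridge\<close>

text \<open>The weight of a path depends on the time it spends in \<open>R\<^sub>- = (-\<infinity>, 0]\<close>.\<close>

definition penalty_weight :: "real \<Rightarrow> (real \<Rightarrow> real) \<Rightarrow> real" where
  "penalty_weight \<kappa> w = exp (- 2 * \<kappa> * (LBINT x:{0..1}. indicator {..0} (w x)))"

definition partition_constant :: "(real \<Rightarrow> real) measure \<Rightarrow> real \<Rightarrow> real" where
  "partition_constant W \<kappa> = (\<integral>w. penalty_weight \<kappa> w \<partial>W)"

definition penalised_bridge :: "(real \<Rightarrow> real) measure \<Rightarrow> real \<Rightarrow> (real \<Rightarrow> real) measure" where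
  "penalised_bridge W \<kappa> =
     density W (\<lambda>w. ennreal (inverse (partition_constant W \<kappa>) * penalty_weight \<kappa> w))"

end

theory Submission
  imports Defs "HOL-Real_Asymp.Real_Asymp"
begin

text \<open>
  The bridge law is invariant under cyclic shifts of the increments. Averaging over the shift by
  \<open>v\<close> turns the weight \<open>exp (- 2 \<kappa> A)\<close>, \<open>A\<close> the time spent in \<open>R\<^sub>-\<close>, into \<open>exp (- 2 \<kappa> F (w v))\<close> with \<open>F\<close>
  the distribution function of the occupation measure of \<open>w\<close>. As \<open>F (w v)\<close> is uniform in \<open>v\<close>, the
  partition constant is \<open>(1 - exp (- 2 \<kappa>)) / (2 \<kappa>)\<close>, and as \<open>\<kappa> \<rightarrow> \<infinity>\<close> the normalised weight concentrates
  at the almost surely unique minimum of \<open>w\<close>. Hence the penalised laws converge weakly to the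
  law of the Vervaat transform \<open>V\<close>, the shift of \<open>w\<close> by its argmin.

  To identify this law, resample a penalised path on \<open>[s,t]\<close>: if it stays positive there, the penalty
  is unaffected. In the limit, given its values at \<open>s\<close> and \<open>t\<close>, the path \<open>V\<close> is on \<open>[s,t]\<close> a Brownian
  bridge conditioned to be positive. Its finite-dimensional densities are ratios of killed heat
  kernels: chains of killed kernels are unchanged when the grid is refined, while their survival
  factors tend to the indicator of positivity. The ratios converge to the excursion densities as \<open>s \<rightarrow> 0\<close>, \<open>t \<rightarrow> 1\<close>, and Scheffe's lemma passes to the limit.
  Integrating Gaussian kernels over spheres gives the same densities for the norm of a
  three-dimensional bridge.
\<close>

section \<open>The Borel sets of the path space\<close>

text \<open>The penalised laws have no explicit finite-dimensional distributions, so the limit is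
  first shown to exist and only afterwards identified. Averaging over shifts writes a penalised
  expectation as an expectation under \<open>W\<close> of an average that converges for almost every
  path; dominated convergence then gives weak convergence along all real \<kappa>, without a
  tightness argument. The resampling identity has to survive this limit although the indicator of
  positivity on [s,t] is not continuous.

  Conditional laws never occur: \<open>splice\<close> sends two independent bridges to a bridge, so
  that conditioning on the path outside an interval becomes an inner integral over a second copy of
  \<open>W\<close>.

  Scheffe's lemma asks for total mass 1 of the excursion density. This is not computed but read off
  from the three-dimensional bridge, whose norm has the same densities and a law of mass 1. Hence
  the spherical computation also enters the identification of the limit.\<close>

abbreviation path_borel :: "(real \<Rightarrow> real) measure" where
  "path_borel \<equiv> borel_of path_topology"

lemma sets_path_borel: "sets path_borel = sigma_sets (mspace path_metric) {U. openin path_topology U}"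
  unfolding borel_of_def using openin_subset[of path_topology]
  by (subst sets_measure_of) (auto simp: Pow_def)

lemma space_path_borel: "space path_borel = {w. continuous_on {0..1} w \<and> w \<in> extensional {0..1}}"
  unfolding borel_of_def using openin_subset[of path_topology]
  by (subst space_measure_of) (auto simp: mspace_path_metric Pow_def)

lemma path_borel_continuous: "w \<in> space path_borel \<Longrightarrow> continuous_on {0..1} w"
  by (simp add: space_path_borel)

lemma mspace_eq_space: "mspace path_metric = space path_borel"
  by (simp add: mspace_path_metric space_path_borel)

lemma mdist_path_le:
  assumes "v \<in> space path_borel" "w \<in> space path_borel"
  shows "mdist path_metric v w \<le> a \<longleftrightarrow> (\<forall>x\<in>{0..1}. \<bar>v x - w x\<bar> \<le> a)"
  using cfunspace_mdist_le[of v "top_of_set {0..1}" euclidean_metric w a] assms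
  by (simp add: path_metric_def[symmetric] mspace_eq_space dist_real_def)

text \<open>Closed balls are used because a supremum is at most r exactly when all values are, so
  that later arguments only see pointwise bounds on [0,1].\<close>

lemma openin_path:
  "openin path_topology U \<longleftrightarrow> U \<subseteq> space path_borel \<and>
     (\<forall>w\<in>U. \<exists>r>0. \<forall>v\<in>space path_borel. (\<forall>x\<in>{0..1}. \<bar>v x - w x\<bar> \<le> r) \<longrightarrow> v \<in> U)"
proof -
  interpret Metric_space "mspace path_metric" "mdist path_metric" by simp
  have "path_topology = mtopology" by (simp add: mtopology_of_def)
  then have "openin path_topology U \<longleftrightarrow> U \<subseteq> mspace path_metric \<and>
     (\<forall>w. w \<in> U \<longrightarrow> (\<exists>r>0. mcball w r \<subseteq> U))"
    by (simp only: openin_mtopology_mcball)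
  moreover have "mcball w r = {v \<in> space path_borel. \<forall>x\<in>{0..1}. \<bar>v x - w x\<bar> \<le> r}"
    if "w \<in> space path_borel" for w r
    unfolding set_eq_iff in_mcball mem_Collect_eq using that
    by (auto simp: mspace_eq_space mdist_path_le abs_minus_commute)
  ultimately show ?thesis
    by (auto simp: mspace_eq_space) (smt (verit, best) mem_Collect_eq subset_iff)+
qed

section \<open>Continuous functionals and coordinate maps\<close>

lemma continuous_map_path_tendsto:
  assumes f: "continuous_map path_topology euclideanreal f"
    and w: "w \<in> space path_borel" and v: "\<And>i. v i \<in> space path_borel"
    and lim: "\<And>r. r > 0 \<Longrightarrow> \<forall>\<^sub>F i in F. \<forall>x\<in>{0..1}. \<bar>v i x - w x\<bar> \<le> r"
  shows "((\<lambda>i. f (v i)) \<longlongrightarrow> f w) F"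
proof (rule topological_tendstoI)
  fix S :: "real set" assume S: "open S" "f w \<in> S"
  have "openin path_topology {x \<in> topspace path_topology. f x \<in> S}"
    using f S by (auto simp: continuous_map_def)
  then obtain r where r: "r > 0"
    "\<And>u. u \<in> space path_borel \<Longrightarrow> (\<forall>x\<in>{0..1}. \<bar>u x - w x\<bar> \<le> r) \<Longrightarrow> f u \<in> S"
    unfolding openin_path using w S(2) by (auto simp: mspace_eq_space)
  show "\<forall>\<^sub>F i in F. f (v i) \<in> S"
    using lim[OF r(1)] by eventually_elim (use r(2) v in auto)
qed

lemma continuous_map_path_eval:
  assumes "x \<in> {0..1}" shows "continuous_map path_topology euclideanreal (\<lambda>w. w x)"
  unfolding continuous_map_def
proof (intro conjI allI impI)
  fix S :: "real set" assume "openin euclideanreal S"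
  then have S: "open S" by simp
  show "openin path_topology {w \<in> topspace path_topology. w x \<in> S}"
    unfolding openin_path
  proof (intro conjI ballI)
    fix w assume w: "w \<in> {w \<in> topspace path_topology. w x \<in> S}"
    then obtain e where e: "e > 0" "cball (w x) e \<subseteq> S"
      using S open_contains_cball by blast
    then show "\<exists>r>0. \<forall>v\<in>space path_borel. (\<forall>x\<in>{0..1}. \<bar>v x - w x\<bar> \<le> r) \<longrightarrow>
        v \<in> {w \<in> topspace path_topology. w x \<in> S}"
      using assms by (intro exI[of _ e])
        (auto simp: subset_iff dist_real_def abs_minus_commute mspace_eq_space)
  qed (auto simp: mspace_eq_space)
qed auto

lemma continuous_map_path_measurable:
  assumes "continuous_map path_topology euclideanreal f"
  shows "f \<in> borel_measurable path_borel"
proof (rule borel_measurableI)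
  fix S :: "real set" assume "open S"
  then have "openin path_topology {x \<in> topspace path_topology. f x \<in> S}"
    using assms by (auto simp: continuous_map_def)
  moreover have "f -` S \<inter> space path_borel = {x \<in> topspace path_topology. f x \<in> S}"
    by (auto simp: mspace_eq_space)
  ultimately show "f -` S \<inter> space path_borel \<in> sets path_borel"
    unfolding sets_path_borel by auto
qed

lemma measurable_path_eval:
  assumes "x \<in> {0..1}" shows "(\<lambda>w. w x) \<in> borel_measurable path_borel"
  by (intro continuous_map_path_measurable continuous_map_path_eval assms)

section \<open>Separability and generators of the Borel sets\<close>

text \<open>A countable dense family in the path space. A list of n + 1 coefficients encodes a
  polynomial of degree n, hence the \<open>length l - 1\<close>.\<close>

definition rational_bernstein :: "rat list \<Rightarrow> real \<Rightarrow> real" where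
  "rational_bernstein l = (\<lambda>x\<in>{0..1}. \<Sum>k\<le>length l - 1. of_rat (l ! k) * Bernstein (length l - 1) k x)"

lemma rational_bernstein_in: "rational_bernstein l \<in> space path_borel"
proof -
  have "continuous_on {0..1} (\<lambda>x. \<Sum>k\<le>length l - 1. of_rat (l ! k) * Bernstein (length l - 1) k x)"
    unfolding Bernstein_def by (intro continuous_intros)
  then show ?thesis
    unfolding space_path_borel rational_bernstein_def
    by (auto intro: continuous_on_eq)
qed

text \<open>The Bernstein basis is nonnegative and sums to 1, so rounding each coefficient of the
  approximating polynomial by at most e / 2 changes its value at any point of [0,1] by at most e /
  2.\<close>

lemma rational_bernstein_dense:
  assumes w: "w \<in> space path_borel" and e: "e > 0"
  obtains l where "\<forall>x\<in>{0..1}. \<bar>w x - rational_bernstein l x\<bar> \<le> e"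
proof -
  obtain n where n: "\<forall>x\<in>{0..1}. \<bar>w x - (\<Sum>k\<le>n. w (real k / real n) * Bernstein n k x)\<bar> < e / 2"
    using Bernstein_Weierstrass[OF path_borel_continuous[OF w], of "e/2"] e by (auto simp: Ball_def)
  have "\<exists>q::rat. \<bar>w (real k / real n) - of_rat q\<bar> \<le> e / 2" for k
  proof -
    obtain q where "q \<in> \<rat>" "w (real k / real n) < q" "q < w (real k / real n) + e/2"
      using Rats_dense_in_real[of "w (real k / real n)" "w (real k / real n) + e/2"] e by auto
    then obtain r where "q = of_rat r" by (auto elim!: Rats_cases)
    then show ?thesis using \<open>w (real k / real n) < q\<close> \<open>q < w (real k / real n) + e/2\<close>
      by (intro exI[of _ r]) auto
  qed
  then obtain q :: "nat \<Rightarrow> rat" where q: "\<And>k. \<bar>w (real k / real n) - of_rat (q k)\<bar> \<le> e / 2" by metis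
  define l where "l = map q [0..<Suc n]"
  have len: "length l - 1 = n" by (simp add: l_def)
  have lk: "l ! k = q k" if "k \<le> n" for k
    using that by (simp add: l_def del: upt_Suc)
  have "\<bar>w x - rational_bernstein l x\<bar> \<le> e" if x: "x \<in> {0..1}" for x
  proof -
    have "\<bar>(\<Sum>k\<le>n. w (real k / real n) * Bernstein n k x) - rational_bernstein l x\<bar>
      = \<bar>\<Sum>k\<le>n. (w (real k / real n) - of_rat (q k)) * Bernstein n k x\<bar>"
      using x unfolding rational_bernstein_def len
      by (simp add: lk sum_subtractf[symmetric] left_diff_distrib)
    also have "\<dots> \<le> (\<Sum>k\<le>n. (e/2) * Bernstein n k x)"
    proof (intro order_trans[OF sum_abs] sum_mono)
      fix k
      have "0 \<le> Bernstein n k x" using x by (auto intro: Bernstein_nonneg)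
      then show "\<bar>(w (real k / real n) - of_rat (q k)) * Bernstein n k x\<bar> \<le> (e/2) * Bernstein n k x"
        using q[of k] by (simp only: abs_mult abs_of_nonneg mult_right_mono)
    qed
    also have "\<dots> = e / 2" by (subst sum_distrib_left[symmetric]) simp
    finally show ?thesis using bspec[OF n x] by linarith
  qed
  then show ?thesis using that by blast
qed

text \<open>The complement of a closed ball is detected by coordinates in a countable dense set of times,
  and by separability every open set is a countable union of closed balls.\<close>

lemma openin_path_countable_union:
  assumes U: "openin path_topology U"
  shows "\<exists>C :: (rat list \<times> rat) set. U = (\<Union>(l, r)\<in>C. {w \<in> space path_borel.
     \<forall>x\<in>\<rat> \<inter> {0<..<1}. \<bar>w x - rational_bernstein l x\<bar> \<le> of_rat r})"
proof -
  define B where "B l r = {w \<in> space path_borel.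
     \<forall>x\<in>\<rat> \<inter> {0<..<1}. \<bar>w x - rational_bernstein l x\<bar> \<le> of_rat r}" for l and r :: rat
  \<comment> \<open>By continuity a bound on a dense set of times extends to [0,1], so
    \<open>B l r\<close> is a closed ball although it is cut out by countably many coordinate
    conditions.\<close>
  have B: "B l r = {w \<in> space path_borel. \<forall>x\<in>{0..1}. \<bar>w x - rational_bernstein l x\<bar> \<le> of_rat r}" for l r
  proof -
    have "\<bar>w x - rational_bernstein l x\<bar> \<le> of_rat r" if "w \<in> B l r" "x \<in> {0..1}" for w x
    proof -
      have "continuous_on {0..1} (\<lambda>x. \<bar>w x - rational_bernstein l x\<bar>)"
        using that rational_bernstein_in[of l]
        by (intro continuous_intros) (auto simp: B_def space_path_borel)
      moreover have "closure (\<rat> \<inter> {0<..<1}) = {0..1::real}"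
      proof -
        have "closure ({0<..<1} \<inter> \<rat>) = closure {0<..<1::real}"
          using Rats_closure_real by (intro closure_open_Int_superset) auto
        then show ?thesis by (simp add: Int_commute)
      qed
      ultimately show ?thesis
        using that continuous_le_on_closure[of "\<rat> \<inter> {0<..<1::real}" "\<lambda>x. \<bar>w x - rational_bernstein l x\<bar>" x "of_rat r"]
        by (auto simp: B_def)
    qed
    then show ?thesis by (auto simp: B_def)
  qed
  define C where "C = {(l, r). B l r \<subseteq> U}"
  have "w \<in> (\<Union>(l, r)\<in>C. B l r)" if w: "w \<in> U" for w
  proof -
    have ws: "w \<in> space path_borel" using U w by (auto simp: openin_path)
    obtain e where e: "e > 0" "\<And>v. v\<in>space path_borel \<Longrightarrow> (\<forall>x\<in>{0..1}. \<bar>v x - w x\<bar> \<le> e) \<Longrightarrow> v \<in> U"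
      using U w by (auto simp: openin_path)
    \<comment> \<open>With a radius below e / 2, a ball of this radius whose centre is within that
      radius of w stays inside the e-ball around w.\<close>
    obtain q where "q \<in> \<rat>" "0 < q" "q < e / 2"
      using Rats_dense_in_real[of 0 "e/2"] e by auto
    then obtain r where r: "0 < real_of_rat r" "real_of_rat r < e/2" by (auto elim!: Rats_cases)
    obtain l where l: "\<forall>x\<in>{0..1}. \<bar>w x - rational_bernstein l x\<bar> \<le> of_rat r"
      using rational_bernstein_dense[OF ws r(1)] .
    have "v \<in> U" if "v \<in> B l r" for v
    proof (rule e(2))
      show "v \<in> space path_borel" using that by (auto simp: B_def)
      show "\<forall>x\<in>{0..1}. \<bar>v x - w x\<bar> \<le> e"
      proof
        fix x :: real assume x: "x \<in> {0..1}"
        show "\<bar>v x - w x\<bar> \<le> e"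
          using bspec[OF l x] that x r unfolding B by (auto dest!: bspec[of _ _ x]) 
      qed
    qed
    moreover have "w \<in> B l r" using ws l by (simp add: B)
    ultimately show ?thesis by (auto simp: C_def)
  qed
  then have "U = (\<Union>(l, r)\<in>C. B l r)" by (auto simp: C_def)
  then show ?thesis unfolding B_def by blast
qed

text \<open>Interior times are enough, because an open set is a countable union of sets described by
  coordinates at rational times of (0,1). Measurability into the path space thus never involves the
  endpoints.\<close>

lemma measurable_path_borel:
  assumes f: "\<And>\<omega>. \<omega> \<in> space M \<Longrightarrow> f \<omega> \<in> space path_borel"
    and m: "\<And>x. 0 < x \<Longrightarrow> x < 1 \<Longrightarrow> (\<lambda>\<omega>. f \<omega> x) \<in> borel_measurable M"
  shows "f \<in> measurable M path_borel"
  unfolding borel_of_def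
proof (rule measurable_measure_of)
  show "{U. openin path_topology U} \<subseteq> Pow (topspace path_topology)"
    using openin_subset by blast
  show "f \<in> space M \<rightarrow> topspace path_topology" using f by (auto simp: mspace_eq_space)
  fix U assume "U \<in> {U. openin path_topology U}"
  then obtain C :: "(rat list \<times> rat) set" where U: "U = (\<Union>(l, r)\<in>C. {w \<in> space path_borel.
     \<forall>x\<in>\<rat> \<inter> {0<..<1}. \<bar>w x - rational_bernstein l x\<bar> \<le> of_rat r})"
    using openin_path_countable_union[of U] by auto
  have "f -` U \<inter> space M = (\<Union>p\<in>C. {\<omega> \<in> space M.
     \<forall>x\<in>\<rat> \<inter> {0<..<1}. \<bar>f \<omega> x - rational_bernstein (fst p) x\<bar> \<le> of_rat (snd p)})"
    using f by (auto simp: U split_beta)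
  also have "\<dots> \<in> sets M"
  proof (rule sets.countable_UN'')
    show "countable C" by simp
    fix p assume "p \<in> C"
    have "{\<omega> \<in> space M. \<bar>f \<omega> x - rational_bernstein (fst p) x\<bar> \<le> of_rat (snd p)} \<in> sets M"
      if "x \<in> \<rat> \<inter> {0<..<1}" for x
      using m[of x] that by (intro borel_measurable_le borel_measurable_abs borel_measurable_diff) auto
    moreover have "countable (\<rat> \<inter> {0<..<1::real})" using countable_rat by blast
    ultimately show "{\<omega> \<in> space M.
       \<forall>x\<in>\<rat> \<inter> {0<..<1}. \<bar>f \<omega> x - rational_bernstein (fst p) x\<bar> \<le> of_rat (snd p)} \<in> sets M"
      by (intro sets.sets_Collect_countable_All') auto
  qed
  finally show "f -` U \<inter> space M \<in> sets M" .
qed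

text \<open>Boxes at finitely many interior times are stable under intersection. They generate the
  Borel sets because the identity into the path space is measurable for the sigma-algebra of the
  boxes.\<close>

lemma measure_eqI_path:
  assumes M: "finite_measure M" "sets M = sets path_borel"
    and N: "finite_measure N" "sets N = sets path_borel"
    and eq: "\<And>I B. finite I \<Longrightarrow> I \<subseteq> {0<..<1} \<Longrightarrow> (\<And>t. t \<in> I \<Longrightarrow> B t \<in> sets borel) \<Longrightarrow>
      emeasure M {w \<in> space path_borel. \<forall>t\<in>I. w t \<in> B t} = emeasure N {w \<in> space path_borel. \<forall>t\<in>I. w t \<in> B t}"
  shows "M = N"
proof -
  define box where "box I B = {w \<in> space path_borel. \<forall>t\<in>I. w t \<in> B t}" for I and B :: "real \<Rightarrow> real set"
  define G where "G = {box I B | I B. finite I \<and> I \<subseteq> {0<..<1} \<and> (\<forall>t. B t \<in> sets borel)}"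
  have Gm: "A \<in> sets path_borel" if AG: "A \<in> G" for A
  proof -
    obtain I B where A: "A = box I B" "finite I" "I \<subseteq> {0<..<1}" "\<forall>t. B t \<in> sets borel"
      using AG unfolding G_def by blast
    have "{w \<in> space path_borel. w t \<in> B t} \<in> sets path_borel" if "t \<in> I" for t
      using measurable_sets[OF measurable_path_eval[of t], of "B t"] A that
      by (auto simp: vimage_def Int_def conj_commute subset_iff less_imp_le)
    then show ?thesis unfolding A box_def using A(2) by (intro sets.sets_Collect_finite_All) auto
  qed
  have G_sp: "G \<subseteq> Pow (space path_borel)" by (auto simp: G_def box_def)
  have gen: "sets path_borel = sigma_sets (space path_borel) G"
  proof
    show "sigma_sets (space path_borel) G \<subseteq> sets path_borel"
      using Gm by (intro sets.sigma_sets_subset) auto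
    let ?S = "sigma (space path_borel) G"
    have "(\<lambda>w. w) \<in> measurable ?S path_borel"
    proof (rule measurable_path_borel)
      fix x :: real assume x: "0 < x" "x < 1"
      show "(\<lambda>w. w x) \<in> borel_measurable ?S"
      proof (rule measurableI)
        fix A :: "real set" assume A: "A \<in> sets borel"
        have "(\<lambda>w. w x) -` A \<inter> space ?S = box {x} (\<lambda>_. A)" by (auto simp: box_def space_measure_of_conv)
        moreover have "box {x} (\<lambda>_. A) \<in> G" using A x unfolding G_def mem_Collect_eq
          by (intro exI[of _ "{x}"] exI[of _ "\<lambda>_. A"]) simp
        ultimately show "(\<lambda>w. w x) -` A \<inter> space ?S \<in> sets ?S"
          using G_sp by (auto simp: sets_measure_of)
      qed auto
    qed (auto simp: space_measure_of_conv)
    then show "sets path_borel \<subseteq> sigma_sets (space path_borel) G"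
      using measurable_sets[of "\<lambda>w. w" ?S path_borel] G_sp sets.sets_into_space[of _ path_borel]
      by (auto simp: space_measure_of_conv sets_measure_of Int_absorb2)
  qed
  show ?thesis
  proof (rule measure_eqI_generator_eq[where \<Omega>="space path_borel" and E=G and A="\<lambda>_. space path_borel"])
    show "Int_stable G"
    proof (rule Int_stableI)
      fix a b assume "a \<in> G" "b \<in> G"
      then obtain I B J C where ab: "a = box I B" "b = box J C" "finite I" "finite J" "I \<subseteq> {0<..<1}"
        "J \<subseteq> {0<..<1}" "\<forall>t. B t \<in> sets borel" "\<forall>t. C t \<in> sets borel"
        unfolding G_def by blast
      \<comment> \<open>Boxes over different sets of times are brought to a common one by padding
        with \<open>UNIV\<close>.\<close>
      have "a \<inter> b = box (I \<union> J) (\<lambda>t. (if t \<in> I then B t else UNIV) \<inter> (if t \<in> J then C t else UNIV))"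
        by (auto simp: ab box_def)
      moreover have "\<forall>t. (if t \<in> I then B t else UNIV) \<inter> (if t \<in> J then C t else UNIV) \<in> sets borel"
        using ab(7,8) by auto
      moreover have "finite (I \<union> J)" "I \<union> J \<subseteq> {0<..<1}" using ab by auto
      ultimately show "a \<inter> b \<in> G" unfolding G_def mem_Collect_eq
        by (intro exI[of _ "I \<union> J"] exI[of _ "\<lambda>t. (if t \<in> I then B t else UNIV) \<inter> (if t \<in> J then C t else UNIV)"] conjI)
    qed
    show "emeasure M X = emeasure N X" if XG: "X \<in> G" for X
    proof -
      obtain I B where "X = box I B" "finite I" "I \<subseteq> {0<..<1}" "\<forall>t. B t \<in> sets borel"
        using XG unfolding G_def by blast
      then show ?thesis using eq[of I B] by (simp add: box_def)
    qed
    have "space path_borel = box {} (\<lambda>_. UNIV)" by (auto simp: box_def)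
    then have "space path_borel \<in> G" unfolding G_def mem_Collect_eq
      by (intro exI[of _ "{}"] exI[of _ "\<lambda>_. UNIV"]) simp
    then show "range (\<lambda>_. space path_borel) \<subseteq> G" by auto
    show "emeasure M (space path_borel) \<noteq> \<infinity>"
      using M by (simp add: finite_measure.emeasure_finite)
  qed (use G_sp gen M N in auto)
qed

text \<open>The random time is rounded down to a multiple of 1 / (n + 1), which takes countably many
  values, and path continuity recovers the value at the time itself.\<close>

lemma measurable_path_eval_pair:
  assumes f: "f \<in> measurable M path_borel" and u: "u \<in> borel_measurable M"
    and r: "\<And>\<omega>. \<omega> \<in> space M \<Longrightarrow> u \<omega> \<in> {0..1}"
  shows "(\<lambda>\<omega>. f \<omega> (u \<omega>)) \<in> borel_measurable M"
proof (rule borel_measurable_LIMSEQ_real[where u="\<lambda>n \<omega>. f \<omega> (real_of_int \<lfloor>u \<omega> * real (Suc n)\<rfloor> / real (Suc n))"])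
  define v where "v n x = real_of_int \<lfloor>x * real (Suc n)\<rfloor> / real (Suc n)" for n and x :: real
  have v_bound: "x - 1 / real (Suc n) \<le> v n x" "v n x \<le> x" for n x
  proof -
    have "x * real (Suc n) - 1 \<le> real_of_int \<lfloor>x * real (Suc n)\<rfloor>" by linarith
    then show "x - 1 / real (Suc n) \<le> v n x"
      unfolding v_def by (subst pos_le_divide_eq) (simp_all add: algebra_simps del: of_nat_Suc)
    have "real_of_int \<lfloor>x * real (Suc n)\<rfloor> \<le> x * real (Suc n)" by linarith
    then show "v n x \<le> x" by (simp add: v_def field_simps)
  qed
  have v_nn: "0 \<le> v n x" if "0 \<le> x" for n x
    using that by (simp add: v_def)
  show "(\<lambda>n. f \<omega> (real_of_int \<lfloor>u \<omega> * real (Suc n)\<rfloor> / real (Suc n))) \<longlonglongrightarrow> f \<omega> (u \<omega>)"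
    if \<omega>: "\<omega> \<in> space M" for \<omega>
  proof -
  have lim: "(\<lambda>n. v n (u \<omega>)) \<longlonglongrightarrow> u \<omega>"
  proof (rule tendsto_sandwich)
    show "(\<lambda>n. u \<omega> - 1 / real (Suc n)) \<longlonglongrightarrow> u \<omega>"
      using LIMSEQ_inverse_real_of_nat_add_minus[of "u \<omega>"] by (simp add: inverse_eq_divide)
  qed (use v_bound in auto)
  have "continuous_on {0..1} (f \<omega>)"
    using measurable_space[OF f \<omega>] by (rule path_borel_continuous)
  then have "(\<lambda>n. f \<omega> (v n (u \<omega>))) \<longlonglongrightarrow> f \<omega> (u \<omega>)"
    by (rule continuous_on_tendsto_compose) (use lim r[OF \<omega>] v_nn order_trans[OF v_bound(2)[of _ "u \<omega>"]] in \<open>auto intro!: always_eventually\<close>)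
  then show ?thesis by (simp add: v_def)
  qed
next
  fix n
  let ?i = "\<lambda>\<omega>. nat \<lfloor>u \<omega> * real (Suc n)\<rfloor>"
  \<comment> \<open>The cap \<open>min 1\<close> makes every index an admissible time; it changes
    nothing at the indices that occur.\<close>
  have "(\<lambda>\<omega>. (\<lambda>i \<omega>. f \<omega> (min 1 (real i / real (Suc n)))) (?i \<omega>) \<omega>) \<in> borel_measurable M"
  proof (rule measurable_compose_countable[where f="\<lambda>i \<omega>. f \<omega> (min 1 (real i / real (Suc n)))" and g="?i"])
    fix i show "(\<lambda>\<omega>. f \<omega> (min 1 (real i / real (Suc n)))) \<in> borel_measurable M"
      by (rule measurable_compose[OF f measurable_path_eval]) auto
    show "?i \<in> measurable M (count_space UNIV)" using u by measurable
  qed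
  also have "(\<lambda>\<omega>. (\<lambda>i \<omega>. f \<omega> (min 1 (real i / real (Suc n)))) (?i \<omega>) \<omega>) \<in> borel_measurable M \<longleftrightarrow>
     (\<lambda>\<omega>. f \<omega> (real_of_int \<lfloor>u \<omega> * real (Suc n)\<rfloor> / real (Suc n))) \<in> borel_measurable M"
  proof (rule measurable_cong)
    fix \<omega> assume "\<omega> \<in> space M"
    from r[OF this] have "0 \<le> u \<omega>" "u \<omega> \<le> 1" by auto
    then have "real_of_int \<lfloor>u \<omega> * real (Suc n)\<rfloor> \<le> real (Suc n)"
      using order_trans[OF of_int_floor_le[of "u \<omega> * real (Suc n)"] mult_right_mono[of "u \<omega>" 1 "real (Suc n)"]]
      by (simp del: of_nat_Suc)
    moreover have "real (nat \<lfloor>u \<omega> * real (Suc n)\<rfloor>) = real_of_int \<lfloor>u \<omega> * real (Suc n)\<rfloor>"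
      using \<open>0 \<le> u \<omega>\<close> by simp
    ultimately show "(\<lambda>i \<omega>. f \<omega> (min 1 (real i / real (Suc n)))) (?i \<omega>) \<omega> =
        f \<omega> (real_of_int \<lfloor>u \<omega> * real (Suc n)\<rfloor> / real (Suc n))"
      by (simp add: min_def field_simps)
  qed
  finally show "(\<lambda>\<omega>. f \<omega> (real_of_int \<lfloor>u \<omega> * real (Suc n)\<rfloor> / real (Suc n))) \<in> borel_measurable M" .
qed

section \<open>Uniqueness from characteristic functions\<close>

text \<open>Levy's theorem concerns probability laws. The common total mass is the characteristic
  function at 0, and both measures are divided by it; total mass 0 is a separate case.\<close>

lemma finite_measure_char_eq:
  fixes X :: "'a \<Rightarrow> real" and Y :: "'b \<Rightarrow> real"
  assumes M: "finite_measure M" and N: "finite_measure N"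
    and X [measurable]: "X \<in> borel_measurable M" and Y [measurable]: "Y \<in> borel_measurable N"
    and eq: "\<And>\<theta>. (CLINT \<omega>|M. iexp (\<theta> * X \<omega>)) = (CLINT \<omega>|N. iexp (\<theta> * Y \<omega>))"
  shows "distr M borel X = distr N borel Y"
proof -
  interpret M: finite_measure M by fact
  interpret N: finite_measure N by fact
  define m where "m = measure M (space M)"
  have mN: "m = measure N (space N)"
    using eq[of 0] by (simp add: m_def)
  show ?thesis
  proof (cases "m = 0")
    case True
    have "emeasure M (space M) = 0" "emeasure N (space N) = 0"
      using True mN by (simp_all add: M.emeasure_eq_measure N.emeasure_eq_measure m_def)
    then have "emeasure M A = 0" "emeasure N B = 0" for A B
      by (metis emeasure_space le_zero_eq)+
    then show ?thesis
      by (intro measure_eqI) (auto simp: emeasure_distr)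
  next
    case False
    then have m: "m > 0" by (simp add: m_def zero_less_measure_iff)
    define M' where "M' = density (distr M borel X) (\<lambda>_. ennreal (1 / m))"
    define N' where "N' = density (distr N borel Y) (\<lambda>_. ennreal (1 / m))"
    have "emeasure M' (space M') = 1"
      using m by (simp add: M'_def emeasure_density nn_integral_cmult emeasure_distr
          M.emeasure_eq_measure m_def[symmetric] ennreal_mult[symmetric] del: ennreal_1)
    then have pM: "prob_space M'" by (rule prob_spaceI)
    have "emeasure N' (space N') = 1"
      using m by (simp add: N'_def emeasure_density nn_integral_cmult emeasure_distr
          N.emeasure_eq_measure mN[symmetric] ennreal_mult[symmetric] del: ennreal_1)
    then have pN: "prob_space N'" by (rule prob_spaceI)
    have "M' = N'"
    proof (rule Levy_uniqueness)
      show "real_distribution M'" "real_distribution N'"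
        using pM pN by (auto simp: real_distribution_def real_distribution_axioms_def M'_def N'_def)
      show "char M' = char N'"
      proof
        fix t
        have "char M' t = (1/m) *\<^sub>R (CLINT \<omega>|M. iexp (t * X \<omega>))"
          using m unfolding char_def M'_def
          by (subst integral_density) (auto simp: integral_distr)
        also have "\<dots> = char N' t"
          using m unfolding eq char_def N'_def
          by (subst integral_density) (auto simp: integral_distr)
        finally show "char M' t = char N' t" .
      qed
    qed
    have "distr M borel X = density M' (\<lambda>_. ennreal m)"
      using m unfolding M'_def by (subst density_density_eq) (auto simp: ennreal_mult[symmetric] density_1)
    also have "\<dots> = distr N borel Y"
      using m unfolding \<open>M' = N'\<close> unfolding N'_def
      by (subst density_density_eq) (auto simp: ennreal_mult[symmetric] density_1)
    finally show ?thesis .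
  qed
qed

text \<open>A bounded nonnegative weight is absorbed into the measure as a density, and the measure
  stays finite.\<close>

lemma integral_weight_char_eq:
  fixes Z :: "'a \<Rightarrow> real" and Z' :: "'b \<Rightarrow> real" and q :: "'a \<Rightarrow> real" and q' :: "'b \<Rightarrow> real"
  assumes M: "finite_measure M" and N: "finite_measure N"
    and [measurable]: "Z \<in> borel_measurable M" "Z' \<in> borel_measurable N" "B \<in> sets borel"
    "q \<in> borel_measurable M" "q' \<in> borel_measurable N"
    and q: "\<And>\<omega>. 0 \<le> q \<omega> \<and> q \<omega> \<le> b" "\<And>\<omega>. 0 \<le> q' \<omega> \<and> q' \<omega> \<le> b"
    and eq: "\<And>\<theta>. (CLINT \<omega>|M. q \<omega> *\<^sub>R iexp (\<theta> * Z \<omega>)) = (CLINT \<omega>|N. q' \<omega> *\<^sub>R iexp (\<theta> * Z' \<omega>))"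
  shows "(\<integral>\<omega>. q \<omega> * indicator B (Z \<omega>) \<partial>M) = (\<integral>\<omega>. q' \<omega> * indicator B (Z' \<omega>) \<partial>N)"
proof -
  interpret M: finite_measure M by fact
  interpret N: finite_measure N by fact
  have fin: "finite_measure (density K r)" if "finite_measure K" "r \<in> borel_measurable K"
    "\<And>\<omega>. 0 \<le> r \<omega> \<and> r \<omega> \<le> b" for K :: "'c measure" and r :: "'c \<Rightarrow> real"
  proof (rule finite_measureI)
    interpret K: finite_measure K by fact
    have "emeasure (density K r) (space (density K r)) = (\<integral>\<^sup>+\<omega>. r \<omega> \<partial>K)"
      using that by (simp add: emeasure_density cong: nn_integral_cong)
    also have "\<dots> \<le> (\<integral>\<^sup>+\<omega>. b \<partial>K)" using that(3) by (intro nn_integral_mono ennreal_leI) blast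
    also have "\<dots> < \<infinity>" by (simp add: ennreal_mult_eq_top_iff K.emeasure_finite less_top[symmetric])
    finally show "emeasure (density K r) (space (density K r)) \<noteq> \<infinity>" by simp
  qed
  have "distr (density M q) borel Z = distr (density N q') borel Z'"
  proof (rule finite_measure_char_eq)
    show "finite_measure (density M q)" "finite_measure (density N q')"
      using M N q by (intro fin; simp)+
    show "(CLINT \<omega>|density M q. iexp (\<theta> * Z \<omega>)) = (CLINT \<omega>|density N q'. iexp (\<theta> * Z' \<omega>))" for \<theta>
      using eq[of \<theta>] q by (subst (1 2) integral_density) auto
  qed auto
  moreover have "measure (distr (density M q) borel Z) B = (\<integral>\<omega>. q \<omega> * indicator B (Z \<omega>) \<partial>M)"
  proof -
    have "measure (distr (density M q) borel Z) B = (\<integral>x. indicator B x \<partial>distr (density M q) borel Z)"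
      by simp
    also have "\<dots> = (\<integral>\<omega>. q \<omega> * indicator B (Z \<omega>) \<partial>M)"
      using q by (subst integral_distr, simp, simp) (subst integral_density; simp)
    finally show ?thesis .
  qed
  moreover have "measure (distr (density N q') borel Z') B = (\<integral>\<omega>. q' \<omega> * indicator B (Z' \<omega>) \<partial>N)"
  proof -
    have "measure (distr (density N q') borel Z') B = (\<integral>x. indicator B x \<partial>distr (density N q') borel Z')"
      by simp
    also have "\<dots> = (\<integral>\<omega>. q' \<omega> * indicator B (Z' \<omega>) \<partial>N)"
      using q by (subst integral_distr, simp, simp) (subst integral_density; simp)
    finally show ?thesis .
  qed
  ultimately show ?thesis by simp
qed

text \<open>Restricting to \<open>Z \<in> B\<close> preserves equality of characteristic functions: under the
  positive weights \<open>2 + cos S\<close> and \<open>2 + sin S\<close> the laws of \<open>Z\<close> agree by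
  one-dimensional uniqueness.\<close>

lemma char_restrict_eq:
  fixes S Z :: "'a \<Rightarrow> real" and S' Z' :: "'b \<Rightarrow> real"
  assumes M: "finite_measure M" and N: "finite_measure N"
    and meas [measurable]: "Z \<in> borel_measurable M" "Z' \<in> borel_measurable N" "B \<in> sets borel"
    "S \<in> borel_measurable M" "S' \<in> borel_measurable N"
    and eq: "\<And>\<alpha> \<theta>. (CLINT \<omega>|M. iexp (\<alpha> * S \<omega> + \<theta> * Z \<omega>)) = (CLINT \<omega>|N. iexp (\<alpha> * S' \<omega> + \<theta> * Z' \<omega>))"
  shows "(CLINT \<omega>|M. indicator B (Z \<omega>) *\<^sub>R iexp (S \<omega>)) = (CLINT \<omega>|N. indicator B (Z' \<omega>) *\<^sub>R iexp (S' \<omega>))"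
proof -
  interpret M: finite_measure M by fact
  interpret N: finite_measure N by fact
  have iM: "integrable M f" if "f \<in> borel_measurable M" "\<And>\<omega>. norm (f \<omega>) \<le> 3" for f :: "'a \<Rightarrow> 'c::{banach,second_countable_topology}"
    using that by (intro M.integrable_const_bound[of _ 3]) auto
  have iN: "integrable N f" if "f \<in> borel_measurable N" "\<And>\<omega>. norm (f \<omega>) \<le> 3" for f :: "'b \<Rightarrow> 'c::{banach,second_countable_topology}"
    using that by (intro N.integrable_const_bound[of _ 3]) auto
  have iexp3: "norm (iexp x) \<le> 3" for x by simp
  \<comment> \<open>Written through exponentials, the weights cos and sin turn the weighted
    characteristic function of Z into joint ones with the coefficients 0, 1 and -1 in front of S, to
    which \<open>eq\<close> applies.\<close>
  have cosM: "(CLINT \<omega>|K. (2 + cos (T \<omega>)) *\<^sub>R iexp (\<theta> * V \<omega>)) =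
      2 * (CLINT \<omega>|K. iexp (0 * T \<omega> + \<theta> * V \<omega>)) + (CLINT \<omega>|K. iexp (1 * T \<omega> + \<theta> * V \<omega>)) / 2
      + (CLINT \<omega>|K. iexp ((-1) * T \<omega> + \<theta> * V \<omega>)) / 2" (is ?cos)
    and sinM: "(CLINT \<omega>|K. (2 + sin (T \<omega>)) *\<^sub>R iexp (\<theta> * V \<omega>)) =
      2 * (CLINT \<omega>|K. iexp (0 * T \<omega> + \<theta> * V \<omega>)) + (CLINT \<omega>|K. iexp (1 * T \<omega> + \<theta> * V \<omega>)) / (2*\<i>)
      - (CLINT \<omega>|K. iexp ((-1) * T \<omega> + \<theta> * V \<omega>)) / (2*\<i>)" (is ?sin)
    if [measurable]: "T \<in> borel_measurable K" "V \<in> borel_measurable K" and K: "finite_measure K"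
    for K :: "'c measure" and T V :: "'c \<Rightarrow> real" and \<theta>
  proof -
    interpret K: finite_measure K by fact
    have iK: "integrable K (\<lambda>\<omega>. iexp (a * T \<omega> + \<theta> * V \<omega>))" for a
      by (intro K.integrable_const_bound[of _ 1]) auto
    have c: "complex_of_real (cos x) = (iexp x + iexp (-x)) / 2"
      "complex_of_real (sin x) = (iexp x - iexp (-x)) / (2*\<i>)" for x :: real
      by (simp_all add: cos_of_real[symmetric] sin_of_real[symmetric] cos_exp_eq sin_exp_eq)
    have lin: "(CLINT \<omega>|K. 2 * f \<omega> + g \<omega> / a + h \<omega> / b) = 2 * (CLINT \<omega>|K. f \<omega>) + (CLINT \<omega>|K. g \<omega>) / a + (CLINT \<omega>|K. h \<omega>) / b"
      "(CLINT \<omega>|K. 2 * f \<omega> + g \<omega> / a - h \<omega> / b) = 2 * (CLINT \<omega>|K. f \<omega>) + (CLINT \<omega>|K. g \<omega>) / a - (CLINT \<omega>|K. h \<omega>) / b"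
      if "integrable K f" "integrable K g" "integrable K h" for f g h :: "'c \<Rightarrow> complex" and a b
      using that by simp_all
    have "(CLINT \<omega>|K. (2 + cos (T \<omega>)) *\<^sub>R iexp (\<theta> * V \<omega>)) =
      (CLINT \<omega>|K. 2 * iexp (0 * T \<omega> + \<theta> * V \<omega>) + iexp (1 * T \<omega> + \<theta> * V \<omega>) / 2
         + iexp ((-1) * T \<omega> + \<theta> * V \<omega>) / 2)"
      by (intro Bochner_Integration.integral_cong refl)
        (simp add: scaleR_conv_of_real c exp_add[symmetric] field_simps)
    also have "\<dots> = 2 * (CLINT \<omega>|K. iexp (0 * T \<omega> + \<theta> * V \<omega>)) + (CLINT \<omega>|K. iexp (1 * T \<omega> + \<theta> * V \<omega>)) / 2
      + (CLINT \<omega>|K. iexp ((-1) * T \<omega> + \<theta> * V \<omega>)) / 2"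
      by (rule lin(1)[OF iK iK iK])
    finally show ?cos .
    have "(CLINT \<omega>|K. (2 + sin (T \<omega>)) *\<^sub>R iexp (\<theta> * V \<omega>)) =
      (CLINT \<omega>|K. 2 * iexp (0 * T \<omega> + \<theta> * V \<omega>) + iexp (1 * T \<omega> + \<theta> * V \<omega>) / (2*\<i>)
         - iexp ((-1) * T \<omega> + \<theta> * V \<omega>) / (2*\<i>))"
      by (intro Bochner_Integration.integral_cong refl)
        (simp add: scaleR_conv_of_real c exp_add[symmetric] field_simps)
    also have "\<dots> = 2 * (CLINT \<omega>|K. iexp (0 * T \<omega> + \<theta> * V \<omega>)) + (CLINT \<omega>|K. iexp (1 * T \<omega> + \<theta> * V \<omega>)) / (2*\<i>)
      - (CLINT \<omega>|K. iexp ((-1) * T \<omega> + \<theta> * V \<omega>)) / (2*\<i>)"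
      by (rule lin(2)[OF iK iK iK])
    finally show ?sin .
  qed
  have bd: "0 \<le> 2 + cos x \<and> 2 + cos x \<le> 3" "0 \<le> 2 + sin x \<and> 2 + sin x \<le> 3" for x :: real
    using cos_ge_minus_one[of x] cos_le_one[of x] sin_ge_minus_one[of x] sin_le_one[of x]
    by linarith+
  have c: "(\<integral>\<omega>. (2 + cos (S \<omega>)) * indicator B (Z \<omega>) \<partial>M) = (\<integral>\<omega>. (2 + cos (S' \<omega>)) * indicator B (Z' \<omega>) \<partial>N)"
  proof (rule integral_weight_char_eq[where b=3, OF M N])
    show "(CLINT \<omega>|M. (2 + cos (S \<omega>)) *\<^sub>R iexp (\<theta> * Z \<omega>)) = (CLINT \<omega>|N. (2 + cos (S' \<omega>)) *\<^sub>R iexp (\<theta> * Z' \<omega>))" for \<theta>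
      unfolding cosM[OF meas(4,1) M] cosM[OF meas(5,2) N] by (simp only: eq)
  qed (use bd in auto)
  have s: "(\<integral>\<omega>. (2 + sin (S \<omega>)) * indicator B (Z \<omega>) \<partial>M) = (\<integral>\<omega>. (2 + sin (S' \<omega>)) * indicator B (Z' \<omega>) \<partial>N)"
  proof (rule integral_weight_char_eq[where b=3, OF M N])
    show "(CLINT \<omega>|M. (2 + sin (S \<omega>)) *\<^sub>R iexp (\<theta> * Z \<omega>)) = (CLINT \<omega>|N. (2 + sin (S' \<omega>)) *\<^sub>R iexp (\<theta> * Z' \<omega>))" for \<theta>
      unfolding sinM[OF meas(4,1) M] sinM[OF meas(5,2) N] by (simp only: eq)
  qed (use bd in auto)
  \<comment> \<open>Equality for the constant weight allows the 2 that made the weights positive to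
    be removed again, leaving cos and sin alone.\<close>
  have o: "(\<integral>\<omega>. (1::real) * indicator B (Z \<omega>) \<partial>M) = (\<integral>\<omega>. (1::real) * indicator B (Z' \<omega>) \<partial>N)"
  proof (rule integral_weight_char_eq[where b=1 and q="\<lambda>_. 1" and q'="\<lambda>_. 1", OF M N])
    show "(CLINT \<omega>|M. 1 *\<^sub>R iexp (\<theta> * Z \<omega>)) = (CLINT \<omega>|N. 1 *\<^sub>R iexp (\<theta> * Z' \<omega>))" for \<theta>
      using eq[of 0 \<theta>] by simp
  qed auto
  have cos_eq: "(\<integral>\<omega>. indicator B (Z \<omega>) * cos (S \<omega>) \<partial>M) = (\<integral>\<omega>. indicator B (Z' \<omega>) * cos (S' \<omega>) \<partial>N)"
  proof -
    have "(\<integral>\<omega>. (2 + cos (S \<omega>)) * indicator B (Z \<omega>) \<partial>M) =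
      2 * (\<integral>\<omega>. (1::real) * indicator B (Z \<omega>) \<partial>M) + (\<integral>\<omega>. indicator B (Z \<omega>) * cos (S \<omega>) \<partial>M)"
      by (subst integral_mult_right_zero[symmetric], subst Bochner_Integration.integral_add[symmetric])
        (auto intro!: iM Bochner_Integration.integral_cong simp: indicator_def algebra_simps abs_cos_le_one order_trans[OF abs_cos_le_one])
    moreover have "(\<integral>\<omega>. (2 + cos (S' \<omega>)) * indicator B (Z' \<omega>) \<partial>N) =
      2 * (\<integral>\<omega>. (1::real) * indicator B (Z' \<omega>) \<partial>N) + (\<integral>\<omega>. indicator B (Z' \<omega>) * cos (S' \<omega>) \<partial>N)"
      by (subst integral_mult_right_zero[symmetric], subst Bochner_Integration.integral_add[symmetric])
        (auto intro!: iN Bochner_Integration.integral_cong simp: indicator_def algebra_simps abs_cos_le_one order_trans[OF abs_cos_le_one])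
    ultimately show ?thesis using c o by simp
  qed
  have sin_eq: "(\<integral>\<omega>. indicator B (Z \<omega>) * sin (S \<omega>) \<partial>M) = (\<integral>\<omega>. indicator B (Z' \<omega>) * sin (S' \<omega>) \<partial>N)"
  proof -
    have "(\<integral>\<omega>. (2 + sin (S \<omega>)) * indicator B (Z \<omega>) \<partial>M) =
      2 * (\<integral>\<omega>. (1::real) * indicator B (Z \<omega>) \<partial>M) + (\<integral>\<omega>. indicator B (Z \<omega>) * sin (S \<omega>) \<partial>M)"
      by (subst integral_mult_right_zero[symmetric], subst Bochner_Integration.integral_add[symmetric])
        (auto intro!: iM Bochner_Integration.integral_cong simp: indicator_def algebra_simps abs_sin_le_one order_trans[OF abs_sin_le_one])
    moreover have "(\<integral>\<omega>. (2 + sin (S' \<omega>)) * indicator B (Z' \<omega>) \<partial>N) =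
      2 * (\<integral>\<omega>. (1::real) * indicator B (Z' \<omega>) \<partial>N) + (\<integral>\<omega>. indicator B (Z' \<omega>) * sin (S' \<omega>) \<partial>N)"
      by (subst integral_mult_right_zero[symmetric], subst Bochner_Integration.integral_add[symmetric])
        (auto intro!: iN Bochner_Integration.integral_cong simp: indicator_def algebra_simps abs_sin_le_one order_trans[OF abs_sin_le_one])
    ultimately show ?thesis using s o by simp
  qed
  have "integrable M (\<lambda>\<omega>. indicator B (Z \<omega>) *\<^sub>R iexp (S \<omega>))" "integrable N (\<lambda>\<omega>. indicator B (Z' \<omega>) *\<^sub>R iexp (S' \<omega>))"
    by (rule iM iN; simp add: indicator_def)+
  note int = this
  show ?thesis
  proof (rule complex_eqI)
    show "Re (CLINT \<omega>|M. indicator B (Z \<omega>) *\<^sub>R iexp (S \<omega>)) = Re (CLINT \<omega>|N. indicator B (Z' \<omega>) *\<^sub>R iexp (S' \<omega>))"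
      using cos_eq int by (simp add: integral_Re[symmetric] Re_exp)
    show "Im (CLINT \<omega>|M. indicator B (Z \<omega>) *\<^sub>R iexp (S \<omega>)) = Im (CLINT \<omega>|N. indicator B (Z' \<omega>) *\<^sub>R iexp (S' \<omega>))"
      using sin_eq int by (simp add: integral_Im[symmetric] Im_exp)
  qed
qed

text \<open>Induction on the coordinates: after both measures are restricted to the event for
  coordinate \<open>j\<close>, the characteristic functions of the remaining coordinates still agree
  by \<open>char_restrict_eq\<close>. Restriction loses mass, so the induction runs over finite
  measures.\<close>

lemma cramer_wold_boxes:
  fixes X :: "'i \<Rightarrow> 'a \<Rightarrow> real" and Y :: "'i \<Rightarrow> 'b \<Rightarrow> real"
  assumes "finite I" and "finite_measure M" and "finite_measure N"
    and "\<And>i. i \<in> I \<Longrightarrow> X i \<in> borel_measurable M" "\<And>i. i \<in> I \<Longrightarrow> Y i \<in> borel_measurable N"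
    and "\<And>c. (CLINT \<omega>|M. iexp (\<Sum>i\<in>I. c i * X i \<omega>)) = (CLINT \<omega>|N. iexp (\<Sum>i\<in>I. c i * Y i \<omega>))"
    and "\<And>i. i \<in> I \<Longrightarrow> B i \<in> sets borel"
  shows "emeasure M {\<omega> \<in> space M. \<forall>i\<in>I. X i \<omega> \<in> B i} = emeasure N {\<omega> \<in> space N. \<forall>i\<in>I. Y i \<omega> \<in> B i}"
  using assms
proof (induction I arbitrary: M N rule: finite_induct)
  case empty
  interpret M: finite_measure M by fact
  interpret N: finite_measure N by fact
  have "measure M (space M) = measure N (space N)" using empty(5)[of "\<lambda>_. 0"] by simp
  then show ?case by (simp add: M.emeasure_eq_measure N.emeasure_eq_measure)
next
  case (insert j F)
  interpret M: finite_measure M by fact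
  interpret N: finite_measure N by fact
  have [measurable]: "X i \<in> borel_measurable M" "Y i \<in> borel_measurable N" "B i \<in> sets borel"
    if "i \<in> insert j F" for i using insert that by auto
  have XY [measurable]: "X j \<in> borel_measurable M" "Y j \<in> borel_measurable N" "B j \<in> sets borel"
    using insert by auto
  let ?M = "density M (\<lambda>\<omega>. indicator (B j) (X j \<omega>))"
  let ?N = "density N (\<lambda>\<omega>. indicator (B j) (Y j \<omega>))"
  have fM: "finite_measure ?M"
  proof (rule finite_measureI)
    have "emeasure ?M (space ?M) \<le> (\<integral>\<^sup>+\<omega>. 1 \<partial>M)"
      by (subst emeasure_density) (auto simp: indicator_def simp del: nn_integral_const intro!: nn_integral_mono)
    then show "emeasure ?M (space ?M) \<noteq> \<infinity>" using M.emeasure_finite[of "space M"] by (auto simp: top_unique)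
  qed
  have fN: "finite_measure ?N"
  proof (rule finite_measureI)
    have "emeasure ?N (space ?N) \<le> (\<integral>\<^sup>+\<omega>. 1 \<partial>N)"
      by (subst emeasure_density) (auto simp: indicator_def simp del: nn_integral_const intro!: nn_integral_mono)
    then show "emeasure ?N (space ?N) \<noteq> \<infinity>" using N.emeasure_finite[of "space N"] by (auto simp: top_unique)
  qed
  have "emeasure ?M {\<omega> \<in> space ?M. \<forall>i\<in>F. X i \<omega> \<in> B i} = emeasure ?N {\<omega> \<in> space ?N. \<forall>i\<in>F. Y i \<omega> \<in> B i}"
  proof (rule insert.IH[OF fM fN])
    fix c :: "'i \<Rightarrow> real"
    have *: "(CLINT \<omega>|M. indicator (B j) (X j \<omega>) *\<^sub>R iexp (\<Sum>i\<in>F. c i * X i \<omega>)) =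
      (CLINT \<omega>|N. indicator (B j) (Y j \<omega>) *\<^sub>R iexp (\<Sum>i\<in>F. c i * Y i \<omega>))"
    proof (rule char_restrict_eq)
      fix \<alpha> \<theta> :: real
      have "j \<notin> F" by fact
      then have "(\<Sum>i\<in>F. (if i = j then \<theta> else \<alpha> * c i) * f i) = \<alpha> * (\<Sum>i\<in>F. c i * f i)" for f :: "'i \<Rightarrow> real"
        by (auto simp: sum_distrib_left intro!: sum.cong)
      then have "(\<Sum>i\<in>insert j F. (if i = j then \<theta> else \<alpha> * c i) * f i) = \<alpha> * (\<Sum>i\<in>F. c i * f i) + \<theta> * f j"
        for f :: "'i \<Rightarrow> real" using insert.hyps by simp
      then show "(CLINT \<omega>|M. iexp (\<alpha> * (\<Sum>i\<in>F. c i * X i \<omega>) + \<theta> * X j \<omega>)) =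
        (CLINT \<omega>|N. iexp (\<alpha> * (\<Sum>i\<in>F. c i * Y i \<omega>) + \<theta> * Y j \<omega>))"
        using insert.prems(5)[of "\<lambda>i. if i = j then \<theta> else \<alpha> * c i"] by simp
    qed (use insert in \<open>auto intro!: borel_measurable_sum borel_measurable_times\<close>)
    show "(CLINT \<omega>|?M. iexp (\<Sum>i\<in>F. c i * X i \<omega>)) = (CLINT \<omega>|?N. iexp (\<Sum>i\<in>F. c i * Y i \<omega>))"
    proof -
      have mX: "(\<lambda>\<omega>. iexp (\<Sum>i\<in>F. c i * X i \<omega>)) \<in> borel_measurable M" by measurable
      have mY: "(\<lambda>\<omega>. iexp (\<Sum>i\<in>F. c i * Y i \<omega>)) \<in> borel_measurable N" by measurable
      have "density M (\<lambda>\<omega>. indicator (B j) (X j \<omega>)) = density M (\<lambda>\<omega>. ennreal (indicator (B j) (X j \<omega>)))"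
        "density N (\<lambda>\<omega>. indicator (B j) (Y j \<omega>)) = density N (\<lambda>\<omega>. ennreal (indicator (B j) (Y j \<omega>)))"
        by (simp_all add: ennreal_indicator)
      then show ?thesis using * mX mY by (simp only:) (subst (1 2) integral_density; simp)
    qed
  qed (use insert in auto)
  moreover have "emeasure ?M {\<omega> \<in> space ?M. \<forall>i\<in>F. X i \<omega> \<in> B i} = emeasure M {\<omega> \<in> space M. \<forall>i\<in>insert j F. X i \<omega> \<in> B i}"
  proof -
    have "{\<omega> \<in> space M. X i \<omega> \<in> B i} \<in> sets M" if "i \<in> insert j F" for i
      using that by measurable
    then have m: "{\<omega> \<in> space M. \<forall>i\<in>F. X i \<omega> \<in> B i} \<in> sets M" "{\<omega> \<in> space M. \<forall>i\<in>insert j F. X i \<omega> \<in> B i} \<in> sets M"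
      using insert.hyps(1) by (auto intro!: sets.sets_Collect_finite_All simp del: ball_simps)
    show ?thesis
    proof -
      have "emeasure ?M {\<omega> \<in> space ?M. \<forall>i\<in>F. X i \<omega> \<in> B i} =
        (\<integral>\<^sup>+\<omega>. indicator {\<omega> \<in> space M. \<forall>i\<in>insert j F. X i \<omega> \<in> B i} \<omega> \<partial>M)"
        using emeasure_density[of "\<lambda>\<omega>. indicator (B j) (X j \<omega>)" M, OF _ m(1)]
        by (simp only: space_density) (auto intro!: nn_integral_cong simp: indicator_def simp del: nn_integral_indicator)
      then show ?thesis using m(2) by (simp del: ball_simps)
    qed
  qed
  moreover have "emeasure ?N {\<omega> \<in> space ?N. \<forall>i\<in>F. Y i \<omega> \<in> B i} = emeasure N {\<omega> \<in> space N. \<forall>i\<in>insert j F. Y i \<omega> \<in> B i}"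
  proof -
    have "{\<omega> \<in> space N. Y i \<omega> \<in> B i} \<in> sets N" if "i \<in> insert j F" for i
      using that by measurable
    then have m: "{\<omega> \<in> space N. \<forall>i\<in>F. Y i \<omega> \<in> B i} \<in> sets N" "{\<omega> \<in> space N. \<forall>i\<in>insert j F. Y i \<omega> \<in> B i} \<in> sets N"
      using insert.hyps(1) by (auto intro!: sets.sets_Collect_finite_All simp del: ball_simps)
    show ?thesis
    proof -
      have "emeasure ?N {\<omega> \<in> space ?N. \<forall>i\<in>F. Y i \<omega> \<in> B i} =
        (\<integral>\<^sup>+\<omega>. indicator {\<omega> \<in> space N. \<forall>i\<in>insert j F. Y i \<omega> \<in> B i} \<omega> \<partial>N)"
        using emeasure_density[of "\<lambda>\<omega>. indicator (B j) (Y j \<omega>)" N, OF _ m(1)]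
        by (simp only: space_density) (auto intro!: nn_integral_cong simp: indicator_def simp del: nn_integral_indicator)
      then show ?thesis using m(2) by (simp del: ball_simps)
    qed
  qed
  ultimately show ?case by simp
qed

lemma measure_eqI_path_char:
  assumes M: "finite_measure M" "sets M = sets path_borel"
    and N: "finite_measure N" "sets N = sets path_borel"
    and eq: "\<And>I c. finite I \<Longrightarrow> I \<subseteq> {0<..<1} \<Longrightarrow>
      (CLINT w|M. iexp (\<Sum>t\<in>I. c t * w t)) = (CLINT w|N. iexp (\<Sum>t\<in>I. c t * w t))"
  shows "M = N"
proof (rule measure_eqI_path[OF M N])
  fix I :: "real set" and B :: "real \<Rightarrow> real set"
  assume I: "finite I" "I \<subseteq> {0<..<1}" and B: "\<And>t. t \<in> I \<Longrightarrow> B t \<in> sets borel"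
  have m: "(\<lambda>w. w t) \<in> borel_measurable M" "(\<lambda>w. w t) \<in> borel_measurable N" if "t \<in> I" for t
    using measurable_path_eval[of t] subsetD[OF I(2) that] by (simp_all add: measurable_cong_sets[OF M(2) refl] measurable_cong_sets[OF N(2) refl])
  show "emeasure M {w \<in> space path_borel. \<forall>t\<in>I. w t \<in> B t} = emeasure N {w \<in> space path_borel. \<forall>t\<in>I. w t \<in> B t}"
    using cramer_wold_boxes[where I=I and B=B, OF I(1) M(1) N(1) m] B eq[OF I] sets_eq_imp_space_eq[OF M(2)] sets_eq_imp_space_eq[OF N(2)]
    by simp
qed

section \<open>Invariance of the bridge under cyclic shifts and splicing\<close>

definition bb_cov :: "real \<Rightarrow> real \<Rightarrow> real" where
  "bb_cov s t = min s t - s * t"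

text \<open>The covariance is the Gram matrix in L2 of the functions 1_[0,t] - t 1_[0,1], so the
  quadratic form is the integral of a square. It is the variance handed to
  \<open>char_centred_normal\<close>.\<close>

lemma bb_cov_nonneg_definite:
  assumes "finite I" "I \<subseteq> {0..1}"
  shows "0 \<le> (\<Sum>s\<in>I. \<Sum>t\<in>I. c s * c t * bb_cov s t)"
proof -
  define f where "f t x = indicator {0..t} x - t * indicator {0..1} x" for t x :: real
  have ff: "integrable lborel (\<lambda>x. f s x * f t x) \<and> (\<integral>x. f s x * f t x \<partial>lborel) = bb_cov s t"
    if "s \<in> I" "t \<in> I" for s t
  proof -
    have st: "0 \<le> s" "s \<le> 1" "0 \<le> t" "t \<le> 1" using that assms by auto
    have "(\<lambda>x. f s x * f t x) = (\<lambda>x. indicator {0..min s t} x - t * indicator {0..s} x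
        - s * indicator {0..t} x + s * t * indicator {0..1} x)"
      using st by (auto simp: f_def indicator_def fun_eq_iff algebra_simps min_def)
    then show ?thesis
      using st by (simp add: bb_cov_def)
  qed
  have "0 \<le> (\<integral>x. (\<Sum>s\<in>I. c s * f s x)\<^sup>2 \<partial>lborel)"
    by simp
  also have "(\<lambda>x. (\<Sum>s\<in>I. c s * f s x)\<^sup>2) = (\<lambda>x. \<Sum>s\<in>I. \<Sum>t\<in>I. c s * c t * (f s x * f t x))"
    by (simp add: power2_eq_square sum_product algebra_simps)
  also have "(\<integral>x. (\<Sum>s\<in>I. \<Sum>t\<in>I. c s * c t * (f s x * f t x)) \<partial>lborel) = (\<Sum>s\<in>I. \<Sum>t\<in>I. c s * c t * bb_cov s t)"
    using ff by (subst Bochner_Integration.integral_sum; (intro Bochner_Integration.integrable_sum)?; simp)+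
  finally show ?thesis .
qed

lemma char_centred_normal:
  assumes "0 \<le> v"
  shows "(CLINT x|centred_normal v. iexp x) = exp (- v / 2)"
proof (cases "v = 0")
  case True
  then show ?thesis by (simp add: centred_normal_def integral_return)
next
  case False
  then have v: "v > 0" using assms by simp
  have "(CLINT x|centred_normal v. iexp x) = (CLINT x|lborel. normal_density 0 (sqrt v) x *\<^sub>R iexp x)"
    using v unfolding centred_normal_def by (simp add: integral_density)
  also have "\<dots> = sqrt v *\<^sub>R (CLINT x|lborel. normal_density 0 (sqrt v) (0 + sqrt v * x) *\<^sub>R iexp (0 + sqrt v * x))"
    using v lborel_integral_real_affine[of "sqrt v" "\<lambda>x. normal_density 0 (sqrt v) x *\<^sub>R iexp x" 0] by simp
  also have "\<dots> = (CLINT x|lborel. std_normal_density x *\<^sub>R iexp (sqrt v * x))"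
    using v by (subst integral_scaleR_right[symmetric])
      (auto simp: normal_density_def real_sqrt_mult power_mult_distrib intro!: Bochner_Integration.integral_cong)
  also have "\<dots> = char std_normal_distribution (sqrt v)"
    unfolding char_def by (subst integral_density) auto
  also have "\<dots> = exp (- v / 2)"
    using v by (simp add: char_std_normal_distribution)
  finally show ?thesis .
qed

text \<open>For t outside the open interval from p to p + d, the covariance with time t is affine
  along that interval, so interpolation between the ends reproduces it.\<close>

lemma bb_cov_splice_outside:
  assumes "t \<le> p \<or> p + d \<le> t" "0 \<le> \<alpha>" "\<alpha> \<le> 1" "0 < d"
  shows "(1 - \<alpha>) * bb_cov p t + \<alpha> * bb_cov (p + d) t = bb_cov (p + \<alpha> * d) t"
proof -
  have "0 \<le> \<alpha> * d" "\<alpha> * d \<le> d" using assms by (auto simp: mult_left_le_one_le)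
  then have "t \<le> p \<and> min p t = t \<and> min (p + d) t = t \<and> min (p + \<alpha> * d) t = t \<or>
    p + d \<le> t \<and> min p t = p \<and> min (p + d) t = p + d \<and> min (p + \<alpha> * d) t = p + \<alpha> * d"
    using assms by linarith
  then show ?thesis by (auto simp: bb_cov_def algebra_simps)
qed

text \<open>Inside the interval the covariance splits into that of the interpolated end values and d
  times a standard bridge covariance: the Markov property and Brownian scaling at the level of
  covariances.\<close>

lemma bb_cov_splice_inside:
  assumes "0 \<le> \<alpha>" "\<alpha> \<le> 1" "0 \<le> \<beta>" "\<beta> \<le> 1" "0 < d"
  shows "(1 - \<alpha>) * ((1 - \<beta>) * bb_cov p p + \<beta> * bb_cov p (p + d)) +
    \<alpha> * ((1 - \<beta>) * bb_cov (p + d) p + \<beta> * bb_cov (p + d) (p + d)) + d * bb_cov \<alpha> \<beta> =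
    bb_cov (p + \<alpha> * d) (p + \<beta> * d)"
proof -
  have "min (p + \<alpha> * d) (p + \<beta> * d) = p + d * min \<alpha> \<beta>"
    using assms by (auto simp: min_def)
  moreover have "min p (p + d) = p" "min (p + d) p = p" using assms by auto
  ultimately show ?thesis unfolding bb_cov_def by (simp add: algebra_simps)
qed

text \<open>Linear interpolation between the points (s,a) and (t,b) plus a standard bridge rescaled
  to length t - s. The end values are a and b only if w vanishes at 0 and 1, which holds almost
  surely under the bridge law.\<close>

definition bridge :: "real \<Rightarrow> real \<Rightarrow> real \<Rightarrow> real \<Rightarrow> (real \<Rightarrow> real) \<Rightarrow> real \<Rightarrow> real" where
  "bridge s t a b w x = ((t - x) * a + (x - s) * b) / (t - s) + sqrt (t - s) * w ((x - s) / (t - s))"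

text \<open>For a path vanishing at 0 and 1 this is x |-> w ((u + x) mod 1) - w u. One of the two
  truncated arguments is always an endpoint, which makes the formula continuous in x even for paths
  that do not vanish at the endpoints.\<close>

definition cyclic_shift :: "real \<Rightarrow> (real \<Rightarrow> real) \<Rightarrow> real \<Rightarrow> real" where
  "cyclic_shift u w = (\<lambda>x\<in>{0..1}. w (min 1 (u + x)) + w (max 0 (u + x - 1)) - w 0 - w u)"

text \<open>Clamping x to [p,q] gives a single formula. Inside, the two w-terms cancel and the
  bridge driven by v remains; outside, the bridge takes an end value that cancels against w p or w q
  once v vanishes at 0 and 1. The result is continuous for every v.\<close>

definition splice :: "real \<Rightarrow> real \<Rightarrow> (real \<Rightarrow> real) \<Rightarrow> (real \<Rightarrow> real) \<Rightarrow> real \<Rightarrow> real" where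
  "splice p q w v = (\<lambda>x\<in>{0..1}. w x - w (max p (min q x)) + bridge p q (w p) (w q) v (max p (min q x)))"

section \<open>Continuity and measurability of the path operations\<close>

lemma cyclic_shift_in_space:
  assumes w: "w \<in> space path_borel" and u: "u \<in> {0..1}"
  shows "cyclic_shift u w \<in> space path_borel"
proof -
  have c: "continuous_on {0..1} w" using w by (rule path_borel_continuous)
  have "continuous_on {0..1} (\<lambda>x. w (min 1 (u + x)) + w (max 0 (u + x - 1)) - w 0 - w u)"
    using u by (intro continuous_intros continuous_on_compose2[OF c]) auto
  then show ?thesis
    unfolding space_path_borel cyclic_shift_def by (auto intro: continuous_on_eq)
qed

lemma splice_in_space:
  assumes w: "w \<in> space path_borel" and v: "v \<in> space path_borel" and pq: "0 \<le> p" "p < q" "q \<le> 1"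
  shows "splice p q w v \<in> space path_borel"
proof -
  have c: "continuous_on {0..1} w" "continuous_on {0..1} v" using w v by (auto intro: path_borel_continuous)
  have "continuous_on {0..1} (\<lambda>x. w x - w (max p (min q x)) + bridge p q (w p) (w q) v (max p (min q x)))"
    unfolding bridge_def using pq
    by (intro continuous_intros continuous_on_compose2[OF c(1)] continuous_on_compose2[OF c(2)]) (auto simp: divide_simps)
  then show ?thesis
    unfolding space_path_borel splice_def by (auto intro: continuous_on_eq)
qed

lemma measurable_cyclic_shift:
  assumes f: "f \<in> measurable M path_borel" and u: "u \<in> borel_measurable M" "\<And>\<omega>. \<omega> \<in> space M \<Longrightarrow> u \<omega> \<in> {0..1}"
  shows "(\<lambda>\<omega>. cyclic_shift (u \<omega>) (f \<omega>)) \<in> measurable M path_borel"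
proof (rule measurable_path_borel)
  fix \<omega> assume "\<omega> \<in> space M"
  then show "cyclic_shift (u \<omega>) (f \<omega>) \<in> space path_borel"
    using measurable_space[OF f] u(2) by (intro cyclic_shift_in_space) auto
next
  fix x :: real assume x: "0 < x" "x < 1"
  note u(1) [measurable]
  have [measurable]: "(\<lambda>\<omega>. f \<omega> (min 1 (u \<omega> + x))) \<in> borel_measurable M" 
    using x u(2) by (intro measurable_path_eval_pair[OF f]) (auto simp: min_def dest: order_trans)
  have [measurable]: "(\<lambda>\<omega>. f \<omega> (max 0 (u \<omega> + x - 1))) \<in> borel_measurable M"
    using x u(2) by (intro measurable_path_eval_pair[OF f]) (force simp: max_def)+
  have [measurable]: "(\<lambda>\<omega>. f \<omega> 0) \<in> borel_measurable M" "(\<lambda>\<omega>. f \<omega> (u \<omega>)) \<in> borel_measurable M"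
    using u(2) by (intro measurable_path_eval_pair[OF f]; simp)+
  show "(\<lambda>\<omega>. cyclic_shift (u \<omega>) (f \<omega>) x) \<in> borel_measurable M"
    using x by (simp add: cyclic_shift_def)
qed

lemma measurable_bridge:
  assumes f: "f \<in> measurable M path_borel" and "s < t" "x \<in> {s..t}"
    and [measurable]: "a \<in> borel_measurable M" "b \<in> borel_measurable M"
  shows "(\<lambda>\<omega>. bridge s t (a \<omega>) (b \<omega>) (f \<omega>) x) \<in> borel_measurable M"
proof -
  have [measurable]: "(\<lambda>\<omega>. f \<omega> ((x - s) / (t - s))) \<in> borel_measurable M"
    using assms by (intro measurable_path_eval_pair[OF f]) (auto simp: divide_simps)
  show ?thesis unfolding bridge_def by measurable
qed

lemma measurable_splice:
  assumes f: "f \<in> measurable M path_borel" and g: "g \<in> measurable M path_borel" and pq: "0 \<le> p" "p < q" "q \<le> 1"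
  shows "(\<lambda>\<omega>. splice p q (f \<omega>) (g \<omega>)) \<in> measurable M path_borel"
proof (rule measurable_path_borel)
  fix \<omega> assume "\<omega> \<in> space M"
  then show "splice p q (f \<omega>) (g \<omega>) \<in> space path_borel"
    using measurable_space[OF f] measurable_space[OF g] pq by (intro splice_in_space) auto
next
  fix x :: real assume x: "0 < x" "x < 1"
  have m: "(\<lambda>\<omega>. f \<omega> y) \<in> borel_measurable M" if "y \<in> {0..1}" for y
    using that by (intro measurable_path_eval_pair[OF f]) auto
  have "(\<lambda>\<omega>. f \<omega> x) \<in> borel_measurable M" "(\<lambda>\<omega>. f \<omega> (max p (min q x))) \<in> borel_measurable M"
    "(\<lambda>\<omega>. f \<omega> p) \<in> borel_measurable M" "(\<lambda>\<omega>. f \<omega> q) \<in> borel_measurable M"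
    using x pq by (intro m; auto)+
  moreover have "(\<lambda>\<omega>. bridge p q (f \<omega> p) (f \<omega> q) (g \<omega>) (max p (min q x))) \<in> borel_measurable M"
    using pq calculation by (intro measurable_bridge[OF g]) auto
  ultimately show "(\<lambda>\<omega>. splice p q (f \<omega>) (g \<omega>) x) \<in> borel_measurable M"
    using x by (simp add: splice_def)
qed

section \<open>The bridge law through characteristic functions, and its invariances\<close>

locale brownian_bridge =
  fixes W :: "(real \<Rightarrow> real) measure"
  assumes law: "brownian_bridge_law W"
begin

sublocale prob_space W using law by (simp add: brownian_bridge_law_def)

lemma sets_W [measurable_cong]: "sets W = sets path_borel" using law by (simp add: brownian_bridge_law_def)

lemma space_W: "space W = space path_borel" using sets_eq_imp_space_eq[OF sets_W] .

lemma measurable_eval: "x \<in> {0..1} \<Longrightarrow> (\<lambda>w. w x) \<in> borel_measurable W"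
  using measurable_path_eval by (simp add: measurable_cong_sets[OF sets_W refl])

lemma AE_endpoints: "AE w in W. w 0 = 0 \<and> w 1 = 0"
proof -
  have "AE w in W. w t = 0" if t: "t = 0 \<or> t = 1" for t :: real
  proof -
    have "distr W borel (\<lambda>w. \<Sum>s\<in>{t}. (\<lambda>_. 1) s * w s) =
        centred_normal (\<Sum>r\<in>{t}. \<Sum>s\<in>{t}. (\<lambda>_. 1) r * (\<lambda>_. 1) s * (min r s - r * s))"
    proof -
      have "\<forall>I c. finite I \<and> I \<subseteq> {0..1} \<longrightarrow> distr W borel (\<lambda>w. \<Sum>t\<in>I. c t * w t) =
        centred_normal (\<Sum>s\<in>I. \<Sum>t\<in>I. c s * c t * (min s t - s * t))"
        using law unfolding brownian_bridge_law_def by blast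
      from this[rule_format, of "{t}" "\<lambda>_. 1"] show ?thesis using t by auto
    qed
    then have "distr W borel (\<lambda>w. w t) = return borel 0"
      using t by (auto simp: centred_normal_def)
    then have "AE x in distr W borel (\<lambda>w. w t). x = 0"
      unfolding \<open>distr W borel (\<lambda>w. w t) = return borel 0\<close> by (subst AE_return) auto
    then show ?thesis
      using t measurable_eval[of t] by (subst (asm) AE_distr_iff) auto
  qed
  then show ?thesis by auto
qed

text \<open>The defining condition on \<open>W\<close> speaks of sets of times, whereas shifted and
  spliced paths evaluate w at several times that may coincide. Coefficients of equal times are added
  up first.\<close>

lemma char_linear:
  fixes \<tau> :: "'j \<Rightarrow> real"
  assumes J: "finite J" "\<And>j. j \<in> J \<Longrightarrow> \<tau> j \<in> {0..1}"
  shows "(CLINT w|W. iexp (\<Sum>j\<in>J. c j * w (\<tau> j))) =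
    exp (- (\<Sum>i\<in>J. \<Sum>j\<in>J. c i * c j * bb_cov (\<tau> i) (\<tau> j)) / 2)"
proof -
  define I where "I = \<tau> ` J"
  define d where "d t = (\<Sum>j\<in>{j\<in>J. \<tau> j = t}. c j)" for t
  have I: "finite I" "I \<subseteq> {0..1}" using J by (auto simp: I_def)
  have agg: "(\<Sum>t\<in>I. d t * h t) = (\<Sum>j\<in>J. c j * h (\<tau> j))" for h :: "real \<Rightarrow> real"
    unfolding I_def sum.image_gen[OF J(1), of "\<lambda>j. c j * h (\<tau> j)" \<tau>] d_def
    by (auto simp: sum_distrib_right intro!: sum.cong)
  have m: "(\<lambda>w. \<Sum>t\<in>I. d t * w t) \<in> borel_measurable W"
    using I by (intro borel_measurable_sum borel_measurable_times measurable_eval) auto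
  have "(CLINT w|W. iexp (\<Sum>j\<in>J. c j * w (\<tau> j))) = (CLINT w|W. iexp (\<Sum>t\<in>I. d t * w t))"
    by (simp add: agg)
  also have "\<dots> = (CLINT x|distr W borel (\<lambda>w. \<Sum>t\<in>I. d t * w t). iexp x)"
    using m by (subst integral_distr) auto
  also have "distr W borel (\<lambda>w. \<Sum>t\<in>I. d t * w t) = centred_normal (\<Sum>s\<in>I. \<Sum>t\<in>I. d s * d t * bb_cov s t)"
    using law I unfolding brownian_bridge_law_def bb_cov_def by auto
  also have "(CLINT x|\<dots>. iexp x) = exp (- (\<Sum>s\<in>I. \<Sum>t\<in>I. d s * d t * bb_cov s t) / 2)"
    by (intro char_centred_normal bb_cov_nonneg_definite I)
  also have "(\<Sum>s\<in>I. \<Sum>t\<in>I. d s * d t * bb_cov s t) = (\<Sum>s\<in>I. d s * (\<Sum>t\<in>I. d t * bb_cov s t))"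
    by (simp add: sum_distrib_left mult.assoc)
  also have "\<dots> = (\<Sum>i\<in>J. \<Sum>j\<in>J. c i * c j * bb_cov (\<tau> i) (\<tau> j))"
    by (simp add: agg) (simp add: sum_distrib_left mult.assoc)
  finally show ?thesis .
qed

lemma distr_eq_W:
  assumes T: "T \<in> measurable M path_borel" and M: "prob_space M"
    and eq: "\<And>I c. finite I \<Longrightarrow> I \<subseteq> {0<..<1} \<Longrightarrow> (CLINT \<omega>|M. iexp (\<Sum>t\<in>I. c t * T \<omega> t)) =
      exp (- (\<Sum>s\<in>I. \<Sum>t\<in>I. c s * c t * bb_cov s t) / 2)"
  shows "distr M path_borel T = W"
proof (rule measure_eqI_path_char)
  show "finite_measure (distr M path_borel T)"
    using prob_space.prob_space_distr[OF M T] by (simp add: prob_space_def)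
  show "finite_measure W" by unfold_locales
  fix I :: "real set" and c :: "real \<Rightarrow> real" assume I: "finite I" "I \<subseteq> {0<..<1}"
  have "(\<lambda>w. \<Sum>t\<in>I. c t * w t) \<in> borel_measurable path_borel"
    using I by (intro borel_measurable_sum borel_measurable_times measurable_path_eval) auto
  then have "(\<lambda>w. iexp (\<Sum>t\<in>I. c t * w t)) \<in> borel_measurable path_borel" by measurable
  then have "(CLINT w|distr M path_borel T. iexp (\<Sum>t\<in>I. c t * w t)) = (CLINT \<omega>|M. iexp (\<Sum>t\<in>I. c t * T \<omega> t))"
    by (rule integral_distr[OF T])
  also have "\<dots> = (CLINT w|W. iexp (\<Sum>t\<in>I. c t * w t))"
    using I by (subst eq, simp, simp, subst char_linear) (auto simp: subset_iff)
  finally show "(CLINT w|distr M path_borel T. iexp (\<Sum>t\<in>I. c t * w t)) = (CLINT w|W. iexp (\<Sum>t\<in>I. c t * w t))" .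
qed (auto simp: sets_W)

text \<open>Almost surely w 0 = 0, so a shifted value is a signed sum of three values of w, hence
  Gaussian. It remains to compare covariances, in four cases according to which of the two times
  wrap around.\<close>

lemma distr_cyclic_shift:
  assumes u: "u \<in> {0..1}"
  shows "distr W path_borel (cyclic_shift u) = W"
proof (rule distr_eq_W)
  show m: "cyclic_shift u \<in> measurable W path_borel"
    using u by (intro measurable_cyclic_shift[of "\<lambda>w. w"]) (auto simp: measurable_ident_sets[OF sets_W])
  show "prob_space W" by unfold_locales
  fix I :: "real set" and c :: "real \<Rightarrow> real" assume I: "finite I" "I \<subseteq> {0<..<1}"
  have I01: "0 \<le> t \<and> t \<le> 1" if "t \<in> I" for t using I that by (force simp: subset_iff)
  define \<tau> where "\<tau> x k = (if k = 0 then min 1 (u + x) else if k = 1 then max 0 (u + x - 1) else u)" for x and k :: nat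
  define \<alpha> where "\<alpha> k = (if k = 2 then - 1 else 1::real)" for k :: nat
  have \<tau>01: "\<tau> (fst j) (snd j) \<in> {0..1}" if "j \<in> I \<times> {..<3}" for j
    using that I01[of "fst j"] u by (cases j) (auto simp: \<tau>_def)
  have cov: "(\<Sum>k<3. \<Sum>l<3. \<alpha> k * \<alpha> l * bb_cov (\<tau> s k) (\<tau> t l)) = bb_cov s t" if "s \<in> I" "t \<in> I" for s t
  proof -
    have st: "0 < s" "s < 1" "0 < t" "t < 1" "0 \<le> u" "u \<le> 1" using that I u by auto
    have *: "u + x \<le> 1 \<and> min 1 (u + x) = u + x \<and> max 0 (u + x - 1) = 0 \<or>
      1 < u + x \<and> min 1 (u + x) = 1 \<and> max 0 (u + x - 1) = u + x - 1" for x
      by (auto simp: min_def max_def)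
    have "(\<Sum>k<3. \<Sum>l<3. \<alpha> k * \<alpha> l * bb_cov (\<tau> s k) (\<tau> t l)) =
      (\<Sum>k<3. \<alpha> k * (bb_cov (\<tau> s k) (\<tau> t 0) + bb_cov (\<tau> s k) (\<tau> t (Suc 0)) - bb_cov (\<tau> s k) (\<tau> t (Suc (Suc 0)))))"
      by (simp add: numeral_3_eq_3 \<alpha>_def)
    also have "\<dots> = bb_cov s t"
      using *[of s] *[of t]
    proof (elim disjE conjE)
      assume "u + s \<le> 1" "min 1 (u + s) = u + s" "max 0 (u + s - 1) = 0"
        "u + t \<le> 1" "min 1 (u + t) = u + t" "max 0 (u + t - 1) = 0"
      moreover have "min (u + s) (u + t) = u + min s t" "min (u + s) u = u" "min u (u + t) = u" "0 \<le> u + s" "0 \<le> u + t"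
        using st by auto
      ultimately show ?thesis using st by (simp add: numeral_3_eq_3 \<tau>_def \<alpha>_def bb_cov_def) (simp add: algebra_simps)
    next
      assume "u + s \<le> 1" "min 1 (u + s) = u + s" "max 0 (u + s - 1) = 0"
        "1 < u + t" "min 1 (u + t) = 1" "max 0 (u + t - 1) = u + t - 1"
      moreover have "min (u + s) (u + t - 1) = u + t - 1" "min u (u + t - 1) = u + t - 1" "min s t = s" "min (u + s) u = u" "0 \<le> u + s"
        using st calculation by auto
      ultimately show ?thesis using st by (simp add: numeral_3_eq_3 \<tau>_def \<alpha>_def bb_cov_def) (simp add: algebra_simps)
    next
      assume "u + t \<le> 1" "min 1 (u + t) = u + t" "max 0 (u + t - 1) = 0"
        "1 < u + s" "min 1 (u + s) = 1" "max 0 (u + s - 1) = u + s - 1"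
      moreover have "min (u + s - 1) (u + t) = u + s - 1" "min (u + s - 1) u = u + s - 1" "min s t = t" "min u (u + t) = u" "0 \<le> u + t"
        using st calculation by auto
      ultimately show ?thesis using st by (simp add: numeral_3_eq_3 \<tau>_def \<alpha>_def bb_cov_def) (simp add: algebra_simps)
    next
      assume "1 < u + t" "min 1 (u + t) = 1" "max 0 (u + t - 1) = u + t - 1"
        "1 < u + s" "min 1 (u + s) = 1" "max 0 (u + s - 1) = u + s - 1"
      moreover have "min (u + s - 1) (u + t - 1) = u - 1 + min s t" "min (u + s - 1) u = u + s - 1" "min u (u + t - 1) = u + t - 1"
        using st calculation by auto
      ultimately show ?thesis using st by (simp add: numeral_3_eq_3 \<tau>_def \<alpha>_def bb_cov_def) (simp add: algebra_simps)
    qed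
    finally show ?thesis .
  qed
  have "(CLINT w|W. iexp (\<Sum>t\<in>I. c t * cyclic_shift u w t)) =
    (CLINT w|W. iexp (\<Sum>j\<in>I \<times> {..<3}. (c (fst j) * \<alpha> (snd j)) * w (\<tau> (fst j) (snd j))))"
  proof (rule integral_cong_AE)
    have "(\<lambda>w. \<Sum>j\<in>I \<times> {..<3}. (c (fst j) * \<alpha> (snd j)) * w (\<tau> (fst j) (snd j))) \<in> borel_measurable W"
      using \<tau>01 by (intro borel_measurable_sum borel_measurable_times borel_measurable_const measurable_eval)
    then show "(\<lambda>w. iexp (\<Sum>j\<in>I \<times> {..<3}. (c (fst j) * \<alpha> (snd j)) * w (\<tau> (fst j) (snd j)))) \<in> borel_measurable W" by measurable
    have "(\<lambda>w. \<Sum>t\<in>I. c t * cyclic_shift u w t) \<in> borel_measurable W"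
      using I measurable_compose[OF m measurable_path_eval]
      by (intro borel_measurable_sum borel_measurable_times) (auto intro: I01)
    then show "(\<lambda>w. iexp (\<Sum>t\<in>I. c t * cyclic_shift u w t)) \<in> borel_measurable W" by measurable
    show "AE w in W. iexp (\<Sum>t\<in>I. c t * cyclic_shift u w t) =
      iexp (\<Sum>j\<in>I \<times> {..<3}. (c (fst j) * \<alpha> (snd j)) * w (\<tau> (fst j) (snd j)))"
      using AE_endpoints
    proof eventually_elim
      fix w :: "real \<Rightarrow> real" assume w: "w 0 = 0 \<and> w 1 = 0"
      have "(\<Sum>j\<in>I \<times> {..<3}. (c (fst j) * \<alpha> (snd j)) * w (\<tau> (fst j) (snd j))) =
        (\<Sum>t\<in>I. \<Sum>k<3. (c t * \<alpha> k) * w (\<tau> t k))"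
        by (simp add: sum.cartesian_product')
      also have "\<dots> = (\<Sum>t\<in>I. c t * cyclic_shift u w t)"
        using I01 w by (intro sum.cong refl) (simp add: numeral_3_eq_3 \<tau>_def \<alpha>_def cyclic_shift_def algebra_simps)
      finally show "iexp (\<Sum>t\<in>I. c t * cyclic_shift u w t) =
        iexp (\<Sum>j\<in>I \<times> {..<3}. (c (fst j) * \<alpha> (snd j)) * w (\<tau> (fst j) (snd j)))" by simp
    qed
  qed
  also have "\<dots> = exp (- (\<Sum>i\<in>I \<times> {..<3}. \<Sum>j\<in>I \<times> {..<3}. (c (fst i) * \<alpha> (snd i)) * (c (fst j) * \<alpha> (snd j)) *
      bb_cov (\<tau> (fst i) (snd i)) (\<tau> (fst j) (snd j))) / 2)"
    using I \<tau>01 by (subst char_linear) auto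
  also have "(\<Sum>i\<in>I \<times> {..<3}. \<Sum>j\<in>I \<times> {..<3}. (c (fst i) * \<alpha> (snd i)) * (c (fst j) * \<alpha> (snd j)) *
      bb_cov (\<tau> (fst i) (snd i)) (\<tau> (fst j) (snd j))) =
      (\<Sum>s\<in>I. \<Sum>k<3. \<Sum>t\<in>I. \<Sum>l<3. (c s * \<alpha> k) * (c t * \<alpha> l) * bb_cov (\<tau> s k) (\<tau> t l))"
    by (simp add: sum.cartesian_product')
  also have "\<dots> = (\<Sum>s\<in>I. \<Sum>t\<in>I. c s * c t * (\<Sum>k<3. \<Sum>l<3. \<alpha> k * \<alpha> l * bb_cov (\<tau> s k) (\<tau> t l)))"
    by (subst sum.swap) (simp add: sum_distrib_left mult_ac)
  also have "\<dots> = (\<Sum>s\<in>I. \<Sum>t\<in>I. c s * c t * bb_cov s t)"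
    by (intro sum.cong) (auto simp: cov)
  finally show "(CLINT w|W. iexp (\<Sum>t\<in>I. c t * cyclic_shift u w t)) =
    exp (- (\<Sum>s\<in>I. \<Sum>t\<in>I. c s * c t * bb_cov s t) / 2)" .
qed

sublocale WW: pair_prob_space W W ..

text \<open>A spliced value is a combination of four values of w plus an independent rescaled value
  of v. The characteristic function factorises by Fubini, and the two quadratic forms add up to that
  of the bridge.\<close>

lemma distr_splice:
  assumes pq: "0 \<le> p" "p < q" "q \<le> 1"
  shows "distr (W \<Otimes>\<^sub>M W) path_borel (\<lambda>(w, v). splice p q w v) = W"
proof (rule distr_eq_W)
  have mf: "fst \<in> measurable (W \<Otimes>\<^sub>M W) path_borel" "snd \<in> measurable (W \<Otimes>\<^sub>M W) path_borel"
    by (simp_all add: measurable_cong_sets[OF refl sets_W, symmetric])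
  show m: "(\<lambda>(w, v). splice p q w v) \<in> measurable (W \<Otimes>\<^sub>M W) path_borel"
    unfolding split_beta by (intro measurable_splice mf pq)
  show "prob_space (W \<Otimes>\<^sub>M W)" by unfold_locales
  fix I :: "real set" and c :: "real \<Rightarrow> real" assume I: "finite I" "I \<subseteq> {0<..<1}"
  have I01: "0 \<le> t \<and> t \<le> 1" if "t \<in> I" for t using I that by (force simp: subset_iff)
  define y where "y x = max p (min q x)" for x
  have y: "p \<le> y x" "y x \<le> q" "0 \<le> y x" "y x \<le> 1" for x using pq by (auto simp: y_def)
  define r where "r x = (y x - p) / (q - p)" for x
  have r: "0 \<le> r x" "r x \<le> 1" for x using y[of x] pq by (auto simp: r_def divide_simps)
  have yr: "y x = p + r x * (q - p)" for x using pq by (simp add: r_def field_simps)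
  define \<tau> where "\<tau> x k = (if k = 0 then x else if k = 1 then y x else if k = 2 then p else q)" for x and k :: nat
  define \<alpha> where "\<alpha> x k = (if k = 0 then 1 else if k = 1 then - 1 else if k = 2 then 1 - r x else r x)" for x and k :: nat
  define d where "d = q - p"
  have d: "d > 0" "q = p + d" using pq by (auto simp: d_def)
  \<comment> \<open>\<open>A t f\<close> is the effect of the four-term combination on a function f:
    interpolation between p and q if t lies inside the interval, evaluation at t otherwise. The
    covariance is obtained by applying it in both arguments.\<close>
  define A where "A t f = f t - f (y t) + (1 - r t) * f p + r t * f q" for t and f :: "real \<Rightarrow> real"
  have A: "(\<Sum>l<4. \<alpha> t l * f (\<tau> t l)) = A t f" for t and f :: "real \<Rightarrow> real"
    by (simp add: eval_nat_numeral \<alpha>_def \<tau>_def A_def)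
  have inside: "A t f = (1 - r t) * f p + r t * f q" if "p \<le> t" "t \<le> q" for t f
    using that by (simp add: A_def y_def)
  have outside: "A t f = f t" "bb_cov (r s) (r t) = 0" "bb_cov (r t) (r s) = 0" if "t \<le> p \<or> q \<le> t" for s t f
    using that pq r[of s] by (auto simp: A_def y_def r_def bb_cov_def max_def)
  have cov: "(\<Sum>k<4. \<Sum>l<4. \<alpha> s k * \<alpha> t l * bb_cov (\<tau> s k) (\<tau> t l)) + (q - p) * bb_cov (r s) (r t) = bb_cov s t" for s t
  proof -
    have "(\<Sum>k<4. \<Sum>l<4. \<alpha> s k * \<alpha> t l * bb_cov (\<tau> s k) (\<tau> t l)) = (\<Sum>k<4. \<alpha> s k * A t (bb_cov (\<tau> s k)))"
      unfolding A[symmetric] by (simp add: sum_distrib_left mult_ac)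
    also have "\<dots> = A s (\<lambda>x. A t (bb_cov x))" by (rule A)
    finally have *: "(\<Sum>k<4. \<Sum>l<4. \<alpha> s k * \<alpha> t l * bb_cov (\<tau> s k) (\<tau> t l)) = A s (\<lambda>x. A t (bb_cov x))" .
    have sym: "bb_cov a b = bb_cov b a" for a b by (simp add: bb_cov_def min.commute)
    have yr': "x = p + r x * d" if "p \<le> x" "x \<le> q" for x using that yr[of x] by (simp add: y_def d_def)
    show ?thesis
    proof (cases "s \<le> p \<or> q \<le> s")
      case s: True
      show ?thesis
      proof (cases "t \<le> p \<or> q \<le> t")
        case False
        then show ?thesis unfolding * using s bb_cov_splice_outside[of s p d "r t"] r[of t] yr'[of t] d
          by (simp add: outside inside sym)
      qed (use s in \<open>simp add: * outside\<close>)
    next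
      case s: False
      show ?thesis
      proof (cases "t \<le> p \<or> q \<le> t")
        case True
        then show ?thesis unfolding * using s bb_cov_splice_outside[of t p d "r s"] r[of s] yr'[of s] d
          by (simp add: outside inside)
      next
        case False
        then show ?thesis unfolding * using s bb_cov_splice_inside[of "r s" "r t" d p] r[of s] r[of t] yr'[of s] yr'[of t] d
          by (simp add: inside)
      qed
    qed
  qed
  let ?X = "\<lambda>w. \<Sum>j\<in>I \<times> {..<4}. (c (fst j) * \<alpha> (fst j) (snd j)) * w (\<tau> (fst j) (snd j))"
  let ?Y = "\<lambda>v. \<Sum>t\<in>I. (c t * sqrt (q - p)) * v (r t)"
  have \<tau>01: "\<tau> (fst j) (snd j) \<in> {0..1}" if "j \<in> I \<times> {..<4}" for j
    using that I01[of "fst j"] pq y by (cases j) (auto simp: \<tau>_def)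
  have sp: "splice p q w v t = (\<Sum>k<4. \<alpha> t k * w (\<tau> t k)) + sqrt (q - p) * v (r t)" if "t \<in> I" for w v t
  proof -
    have "((q - y t) * a + (y t - p) * b) / (q - p) = (1 - r t) * a + r t * b" for a b
    proof -
      have "1 - r t = (q - y t) / (q - p)" using pq by (simp add: r_def diff_divide_eq_iff)
      then show ?thesis by (simp add: r_def add_divide_distrib)
    qed
    then show ?thesis
      using I01[OF that] by (simp add: splice_def bridge_def eval_nat_numeral \<tau>_def \<alpha>_def y_def[symmetric] r_def[symmetric])
  qed
  have XY: "(\<Sum>t\<in>I. c t * splice p q w v t) = ?X w + ?Y v" for w v
  proof -
    have "?X w = (\<Sum>t\<in>I. \<Sum>k<4. (c t * \<alpha> t k) * w (\<tau> t k))"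
      by (simp add: sum.cartesian_product')
    then show ?thesis
      by (simp add: sp sum.distrib[symmetric] distrib_left sum_distrib_left mult_ac)
  qed
  have mX: "?X \<in> borel_measurable W"
    using \<tau>01 by (intro borel_measurable_sum borel_measurable_times borel_measurable_const measurable_eval)
  have mY: "?Y \<in> borel_measurable W"
    using r by (intro borel_measurable_sum borel_measurable_times borel_measurable_const measurable_eval) auto
  have "(CLINT \<omega>|W \<Otimes>\<^sub>M W. iexp (\<Sum>t\<in>I. c t * (case \<omega> of (w, v) \<Rightarrow> splice p q w v) t)) =
    (CLINT \<omega>|W \<Otimes>\<^sub>M W. iexp (?X (fst \<omega>)) * iexp (?Y (snd \<omega>)))"
    by (simp add: split_beta XY exp_add[symmetric] distrib_left)
  also have "\<dots> = (CLINT w|W. (CLINT v|W. iexp (?X w) * iexp (?Y v)))"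
  proof -
    have [measurable]: "(\<lambda>\<omega>. ?X (fst \<omega>)) \<in> borel_measurable (W \<Otimes>\<^sub>M W)" "(\<lambda>\<omega>. ?Y (snd \<omega>)) \<in> borel_measurable (W \<Otimes>\<^sub>M W)"
      by (rule measurable_compose[OF measurable_fst mX] measurable_compose[OF measurable_snd mY])+
    have "(\<lambda>\<omega>. iexp (?X (fst \<omega>)) * iexp (?Y (snd \<omega>))) \<in> borel_measurable (W \<Otimes>\<^sub>M W)"
      by measurable
    moreover have "AE \<omega> in W \<Otimes>\<^sub>M W. norm (iexp (?X (fst \<omega>)) * iexp (?Y (snd \<omega>))) \<le> 1"
      by (intro AE_I2) (simp only: norm_mult norm_exp_i_times mult_1_right order_refl)
    ultimately have "integrable (W \<Otimes>\<^sub>M W) (\<lambda>\<omega>. iexp (?X (fst \<omega>)) * iexp (?Y (snd \<omega>)))"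
      by (intro WW.integrable_const_bound)
    from WW.integral_fst'[OF this] show ?thesis by simp
  qed
  also have "\<dots> = (CLINT w|W. iexp (?X w)) * (CLINT v|W. iexp (?Y v))"
    by simp
  also have "(CLINT w|W. iexp (?X w)) = exp (- (\<Sum>i\<in>I \<times> {..<4}. \<Sum>j\<in>I \<times> {..<4}. (c (fst i) * \<alpha> (fst i) (snd i)) * (c (fst j) * \<alpha> (fst j) (snd j)) *
      bb_cov (\<tau> (fst i) (snd i)) (\<tau> (fst j) (snd j))) / 2)"
    using I \<tau>01 by (subst char_linear) auto
  also have "(\<Sum>i\<in>I \<times> {..<4}. \<Sum>j\<in>I \<times> {..<4}. (c (fst i) * \<alpha> (fst i) (snd i)) * (c (fst j) * \<alpha> (fst j) (snd j)) *
      bb_cov (\<tau> (fst i) (snd i)) (\<tau> (fst j) (snd j))) =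
      (\<Sum>s\<in>I. \<Sum>k<4. \<Sum>t\<in>I. \<Sum>l<4. (c s * \<alpha> s k) * (c t * \<alpha> t l) * bb_cov (\<tau> s k) (\<tau> t l))"
    by (simp add: sum.cartesian_product')
  also have "\<dots> = (\<Sum>s\<in>I. \<Sum>t\<in>I. c s * c t * (\<Sum>k<4. \<Sum>l<4. \<alpha> s k * \<alpha> t l * bb_cov (\<tau> s k) (\<tau> t l)))" (is "_ = ?Q")
    by (subst sum.swap) (simp add: sum_distrib_left mult_ac)
  also have "(CLINT v|W. iexp (?Y v)) = exp (- (\<Sum>s\<in>I. \<Sum>t\<in>I. (c s * sqrt (q - p)) * (c t * sqrt (q - p)) * bb_cov (r s) (r t)) / 2)"
    using I r by (subst char_linear) auto
  also have "(\<Sum>s\<in>I. \<Sum>t\<in>I. (c s * sqrt (q - p)) * (c t * sqrt (q - p)) * bb_cov (r s) (r t)) =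
      (\<Sum>s\<in>I. \<Sum>t\<in>I. c s * c t * ((q - p) * bb_cov (r s) (r t)))" (is "_ = ?R")
  proof (intro sum.cong refl)
    fix s t
    have "sqrt (q - p) * sqrt (q - p) = q - p" using pq by simp
    then show "c s * sqrt (q - p) * (c t * sqrt (q - p)) * bb_cov (r s) (r t) = c s * c t * ((q - p) * bb_cov (r s) (r t))"
      by (metis (no_types, lifting) mult.assoc mult.left_commute)
  qed
  also have "complex_of_real (exp (- ?Q / 2)) * complex_of_real (exp (- ?R / 2)) = exp (- (?Q + ?R) / 2)"
    by (simp add: exp_add[symmetric] add_divide_distrib del: of_real_exp flip: of_real_mult)
  also have "?Q + ?R = (\<Sum>s\<in>I. \<Sum>t\<in>I. c s * c t * bb_cov s t)"
    unfolding sum.distrib[symmetric] distrib_left[symmetric] by (intro sum.cong refl) (simp only: cov)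
  finally show "(CLINT \<omega>|W \<Otimes>\<^sub>M W. iexp (\<Sum>t\<in>I. c t * (case \<omega> of (w, v) \<Rightarrow> splice p q w v) t)) =
    exp (- (\<Sum>s\<in>I. \<Sum>t\<in>I. c s * c t * bb_cov s t) / 2)" .
qed

end

section \<open>The Markov property and the killed kernel\<close>

abbreviation heat :: "real \<Rightarrow> real \<Rightarrow> real" where
  "heat d x \<equiv> normal_density 0 (sqrt d) x"

lemma heat_eq: "0 < d \<Longrightarrow> heat d x = exp (- x\<^sup>2 / (2 * d)) / sqrt (2 * pi * d)"
  by (simp add: normal_density_def)

lemma heat_pos: "0 < d \<Longrightarrow> 0 < heat d x"
  by (intro normal_density_pos) simp

lemma heat_minus [simp]: "heat d (- x) = heat d x"
  by (simp add: normal_density_def)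

lemma heat_commute: "heat d (x - y) = heat d (y - x)"
  using heat_minus[of d "x - y"] by simp

text \<open>Completing the square. The right side is the density of the standard bridge at the
  fraction A / (A + B) of its time. The left side is the usual ratio of heat kernels, pulled back
  along the affine map applied by \<open>bridge\<close>, whose Jacobian is sqrt (A + B).\<close>

lemma heat_bridge_product:
  assumes "0 < A" "0 < B"
  shows "sqrt (A + B) * (heat A ((B * a + A * b) / (A + B) + sqrt (A + B) * z - a) *
     heat B (b - ((B * a + A * b) / (A + B) + sqrt (A + B) * z)) / heat (A + B) (b - a)) =
     heat (A * B / (A + B)\<^sup>2) z"
proof -
  define T where "T = A + B"
  define u where "u = sqrt T * z"
  define D where "D = b - a"
  have T: "T > 0" "T \<noteq> 0" "A \<noteq> 0" "B \<noteq> 0" using assms by (auto simp: T_def)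
  have BT: "B = T - A" by (simp add: T_def)
  have m: "(B * a + A * b) / T + u - a = A * D / T + u" "b - ((B * a + A * b) / T + u) = B * D / T - u"
    using T by (simp_all add: field_simps D_def T_def)
  have u2: "u\<^sup>2 = T * z\<^sup>2" using T by (simp add: u_def power_mult_distrib)
  have "- ((A * D / T + u)\<^sup>2 / (2 * A)) - (B * D / T - u)\<^sup>2 / (2 * B) + D\<^sup>2 / (2 * T) = - (u\<^sup>2 * T / (2 * A * B))"
  proof -
    have 1: "(A * D / T + u)\<^sup>2 / (2 * A) = A * D\<^sup>2 / (2 * T\<^sup>2) + D * u / T + u\<^sup>2 / (2 * A)"
      using T by (simp add: power2_sum power_mult_distrib power_divide add_divide_distrib) (simp add: power2_eq_square)
    have 2: "(B * D / T - u)\<^sup>2 / (2 * B) = B * D\<^sup>2 / (2 * T\<^sup>2) - D * u / T + u\<^sup>2 / (2 * B)"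
      using T by (simp add: power2_diff power_mult_distrib power_divide add_divide_distrib diff_divide_distrib) (simp add: power2_eq_square)
    have 3: "A * D\<^sup>2 / (2 * T\<^sup>2) + B * D\<^sup>2 / (2 * T\<^sup>2) = D\<^sup>2 / (2 * T)"
    proof -
      have "A * D\<^sup>2 / (2 * T\<^sup>2) + B * D\<^sup>2 / (2 * T\<^sup>2) = (T * D\<^sup>2) / (2 * T\<^sup>2)"
        by (simp add: T_def add_divide_distrib distrib_right)
      also have "\<dots> = D\<^sup>2 / (2 * T)" using T by (simp add: power2_eq_square)
      finally show ?thesis .
    qed
    have 4: "u\<^sup>2 / (2 * A) + u\<^sup>2 / (2 * B) = u\<^sup>2 * T / (2 * A * B)"
      using T by (simp add: T_def field_simps)
    show ?thesis using 1 2 3 4 by linarith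
  qed
  also have "\<dots> = - (z\<^sup>2 / (2 * (A * B / T\<^sup>2)))"
    unfolding u2 using T by (simp add: power2_eq_square mult_ac)
  finally have E: "- ((A * D / T + u)\<^sup>2 / (2 * A)) - (B * D / T - u)\<^sup>2 / (2 * B) + D\<^sup>2 / (2 * T) = - (z\<^sup>2 / (2 * (A * B / T\<^sup>2)))" .
  have C: "sqrt T * sqrt (2 * pi * T) / (sqrt (2 * pi * A) * sqrt (2 * pi * B)) = 1 / sqrt (2 * pi * (A * B / T\<^sup>2))"
  proof -
    have "sqrt T * sqrt (2 * pi * T) / (sqrt (2 * pi * A) * sqrt (2 * pi * B)) =
      sqrt (T * (2 * pi * T) / ((2 * pi * A) * (2 * pi * B)))"
      by (simp only: real_sqrt_mult real_sqrt_divide)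
    also have "T * (2 * pi * T) / ((2 * pi * A) * (2 * pi * B)) = 1 / (2 * pi * (A * B / T\<^sup>2))"
      using T by (simp add: power2_eq_square)
    finally show ?thesis by (simp only: real_sqrt_divide real_sqrt_one)
  qed
  have "heat A (A * D / T + u) * heat B (B * D / T - u) / heat T D =
    exp (- ((A * D / T + u)\<^sup>2 / (2 * A)) - (B * D / T - u)\<^sup>2 / (2 * B) + D\<^sup>2 / (2 * T)) *
     (sqrt (2 * pi * T) / (sqrt (2 * pi * A) * sqrt (2 * pi * B)))"
  proof -
    have "exp e / c * (exp e' / c') / (exp e'' / c'') = exp (e + e' - e'') * (c'' / (c * c'))" for e e' e'' c c' c'' :: real
      by (simp add: exp_add exp_diff)
    then show ?thesis unfolding heat_eq[OF assms(1)] heat_eq[OF assms(2)] heat_eq[OF T(1)] by simp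
  qed
  also have "sqrt T * \<dots> = exp (- (z\<^sup>2 / (2 * (A * B / T\<^sup>2)))) * (1 / sqrt (2 * pi * (A * B / T\<^sup>2)))"
    unfolding E C[symmetric] by simp
  also have "\<dots> = heat (A * B / T\<^sup>2) z"
    using assms T by (subst heat_eq) auto
  finally show ?thesis unfolding T_def[symmetric] u_def[symmetric] m D_def[symmetric] .
qed

text \<open>The iterated integral of \<open>K 0 x x1 * ... * K (k - 1) x' xk * e xk\<close>, with x'
  the variable before the last. The recursion absorbs the last kernel into the terminal function
  \<open>e\<close>, in step with the Markov property, where the last time is integrated out
  first.\<close>

primrec chain :: "(nat \<Rightarrow> 'a \<Rightarrow> 'a \<Rightarrow> ennreal) \<Rightarrow> 'a measure \<Rightarrow> 'a \<Rightarrow> nat \<Rightarrow> ('a \<Rightarrow> ennreal) \<Rightarrow> ennreal" where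
  "chain K M x 0 e = e x"
| "chain K M x (Suc k) e = chain K M x k (\<lambda>x. \<integral>\<^sup>+y. K k x y * e y \<partial>M)"

section \<open>Bridges between given end values\<close>

lemma continuous_on_bridge:
  assumes "w \<in> space path_borel" "s < t"
  shows "continuous_on {s..t} (bridge s t a b w)"
  unfolding bridge_def using assms
  by (intro continuous_intros continuous_on_compose2[OF path_borel_continuous[OF assms(1)]]) (auto simp: divide_simps)

lemma bridge_add: "s < t \<Longrightarrow> bridge s t (a + c) (b + c) w x = bridge s t a b w x + c"
  by (simp add: bridge_def field_simps)

lemma bridge_start: "s < t \<Longrightarrow> w 0 = 0 \<Longrightarrow> bridge s t a b w s = a"
  by (simp add: bridge_def)

lemma bridge_end: "s < t \<Longrightarrow> w 1 = 0 \<Longrightarrow> bridge s t a b w t = b"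
  by (simp add: bridge_def)

text \<open>Resampling the driving bridge after the fraction (p - s) / (t - s) of its time amounts
  to continuing the bridge over [s,t] from its value at p by a fresh bridge over [p,t].\<close>

lemma bridge_splice:
  assumes "s \<le> p" "p < t" "x \<in> {p..t}" "w 1 = 0"
  shows "bridge s t a b (splice ((p - s) / (t - s)) 1 w v) x = bridge p t (bridge s t a b w p) b v x"
proof -
  define y where "y = (x - s) / (t - s)"
  define \<tau> where "\<tau> = (p - s) / (t - s)"
  have st: "t - s > 0" "t - p > 0" using assms by auto
  have y: "0 \<le> \<tau>" "\<tau> \<le> y" "y \<le> 1" "\<tau> < 1" using assms st by (auto simp: y_def \<tau>_def divide_simps)
  have "splice \<tau> 1 w v y = bridge \<tau> 1 (w \<tau>) 0 v y"
    using y assms by (simp add: splice_def min_absorb1 min_absorb2 max_absorb1 max_absorb2)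
  also have "\<dots> = (1 - y) * w \<tau> / (1 - \<tau>) + sqrt (1 - \<tau>) * v ((y - \<tau>) / (1 - \<tau>))"
    by (simp add: bridge_def)
  also have "1 - \<tau> = (t - p) / (t - s)" using st by (simp add: \<tau>_def field_simps)
  also have "1 - y = (t - x) / (t - s)" using st by (simp add: y_def field_simps)
  also have "(y - \<tau>) / ((t - p) / (t - s)) = (x - p) / (t - p)" 
  proof -
    have "y - \<tau> = (x - p) / (t - s)" by (simp add: y_def \<tau>_def diff_divide_distrib[symmetric])
    then show ?thesis using st by simp
  qed
  finally have S: "splice \<tau> 1 w v y = (t - x) * w \<tau> / (t - p) + sqrt (t - p) / sqrt (t - s) * v ((x - p) / (t - p))"
    using st by (simp add: real_sqrt_divide)
  have "((t - x) * a + (x - s) * b) / (t - s) = ((t - x) * (((t - p) * a + (p - s) * b) / (t - s)) + (x - p) * b) / (t - p)"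
  proof -
    have "(t - x) * ((t - p) * a + (p - s) * b) + (x - p) * b * (t - s) = (t - p) * ((t - x) * a + (x - s) * b)"
      by algebra
    then show ?thesis using st by (simp add: divide_simps)
  qed
  then show ?thesis
    using st unfolding bridge_def y_def[symmetric] \<tau>_def[symmetric] S
    by (simp add: distrib_left add_divide_distrib)
qed

context brownian_bridge
begin

lemma nn_integral_bridge:
  assumes x: "s < x" "x < t" and h [measurable]: "h \<in> borel_measurable borel"
  shows "(\<integral>\<^sup>+v. h (bridge s t a b v x) \<partial>W) =
    (\<integral>\<^sup>+y. ennreal (heat (x - s) (y - a) * heat (t - x) (b - y) / heat (t - s) (b - a)) * h y \<partial>lborel)"
proof -
  define A where "A = x - s"
  define B where "B = t - x"
  have AB: "A > 0" "B > 0" "t - s = A + B" using x by (auto simp: A_def B_def)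
  define \<sigma> where "\<sigma> = A / (A + B)"
  define m where "m = (B * a + A * b) / (A + B)"
  have \<sigma>: "0 < \<sigma>" "\<sigma> < 1" using AB by (auto simp: \<sigma>_def)
  have var: "\<sigma> - \<sigma> * \<sigma> = A * B / (A + B)\<^sup>2"
  proof -
    have "1 - \<sigma> = B / (A + B)" using AB by (simp add: \<sigma>_def field_simps)
    moreover have "\<sigma> - \<sigma> * \<sigma> = \<sigma> * (1 - \<sigma>)" by (simp add: algebra_simps)
    ultimately show ?thesis by (simp add: \<sigma>_def power2_eq_square)
  qed
  have "distr W borel (\<lambda>w. \<Sum>t\<in>{\<sigma>}. (\<lambda>_. 1) t * w t) =
        centred_normal (\<Sum>s\<in>{\<sigma>}. \<Sum>t\<in>{\<sigma>}. (\<lambda>_. 1) s * (\<lambda>_. 1) t * (min s t - s * t))"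
  proof -
    have "\<forall>I c. finite I \<and> I \<subseteq> {0..1} \<longrightarrow> distr W borel (\<lambda>w. \<Sum>t\<in>I. c t * w t) =
      centred_normal (\<Sum>s\<in>I. \<Sum>t\<in>I. c s * c t * (min s t - s * t))"
      using law unfolding brownian_bridge_law_def by blast
    from this[rule_format, of "{\<sigma>}" "\<lambda>_. 1"] show ?thesis using \<sigma> by auto
  qed
  then have d: "distr W borel (\<lambda>w. w \<sigma>) = centred_normal (A * B / (A + B)\<^sup>2)"
    by (simp add: var)
  have m\<sigma>: "(\<lambda>w. w \<sigma>) \<in> borel_measurable W" using \<sigma> by (intro measurable_eval) auto
  have "(\<integral>\<^sup>+v. h (bridge s t a b v x) \<partial>W) = (\<integral>\<^sup>+v. h (m + sqrt (A + B) * v \<sigma>) \<partial>W)"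
    by (simp add: bridge_def m_def \<sigma>_def AB A_def[symmetric] B_def[symmetric])
  also have "\<dots> = (\<integral>\<^sup>+z. h (m + sqrt (A + B) * z) \<partial>centred_normal (A * B / (A + B)\<^sup>2))"
    using m\<sigma> by (subst d[symmetric], subst nn_integral_distr) auto
  also have "\<dots> = (\<integral>\<^sup>+z. ennreal (heat (A * B / (A + B)\<^sup>2) z) * h (m + sqrt (A + B) * z) \<partial>lborel)"
    using AB by (simp add: centred_normal_def nn_integral_density del: real_sqrt_divide)
  also have "\<dots> = (\<integral>\<^sup>+z. ennreal (sqrt (A + B)) * (ennreal (heat A ((m + sqrt (A + B) * z) - a) * heat B (b - (m + sqrt (A + B) * z)) / heat (A + B) (b - a)) * h (m + sqrt (A + B) * z)) \<partial>lborel)"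
    unfolding heat_bridge_product[OF AB(1,2), of a b, symmetric] m_def[symmetric]
    using AB by (intro nn_integral_cong) (subst ennreal_mult', simp, simp only: mult.assoc)
  also have "\<dots> = ennreal (sqrt (A + B)) * (\<integral>\<^sup>+z. ennreal (heat A ((m + sqrt (A + B) * z) - a) * heat B (b - (m + sqrt (A + B) * z)) / heat (A + B) (b - a)) * h (m + sqrt (A + B) * z) \<partial>lborel)"
    by (intro nn_integral_cmult) measurable
  also have "\<dots> = (\<integral>\<^sup>+y. ennreal (heat A (y - a) * heat B (b - y) / heat (A + B) (b - a)) * h y \<partial>lborel)"
    using AB by (subst nn_integral_real_affine[where c="sqrt (A + B)" and t=m and f="\<lambda>y. ennreal (heat A (y - a) * heat B (b - y) / heat (A + B) (b - a)) * h y"]) auto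
  finally show ?thesis unfolding AB(3) A_def[symmetric] B_def[symmetric] .
qed

lemma nn_integral_splice:
  assumes pq: "0 \<le> p" "p < q" "q \<le> 1" and f [measurable]: "f \<in> borel_measurable path_borel"
  shows "(\<integral>\<^sup>+w. f w \<partial>W) = (\<integral>\<^sup>+w. \<integral>\<^sup>+v. f (splice p q w v) \<partial>W \<partial>W)"
proof -
  have mf: "fst \<in> measurable (W \<Otimes>\<^sub>M W) path_borel" "snd \<in> measurable (W \<Otimes>\<^sub>M W) path_borel"
    by (simp_all add: measurable_cong_sets[OF refl sets_W, symmetric])
  have m [measurable]: "(\<lambda>(w, v). splice p q w v) \<in> measurable (W \<Otimes>\<^sub>M W) path_borel"
    unfolding split_beta by (intro measurable_splice mf pq)
  have "(\<integral>\<^sup>+w. f w \<partial>W) = (\<integral>\<^sup>+w. f w \<partial>distr (W \<Otimes>\<^sub>M W) path_borel (\<lambda>(w, v). splice p q w v))"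
    by (simp add: distr_splice[OF pq])
  also have "\<dots> = (\<integral>\<^sup>+\<omega>. f (case \<omega> of (w, v) \<Rightarrow> splice p q w v) \<partial>(W \<Otimes>\<^sub>M W))"
    by (intro nn_integral_distr m) simp
  also have "\<dots> = (\<integral>\<^sup>+w. \<integral>\<^sup>+v. f (splice p q w v) \<partial>W \<partial>W)"
    using nn_integral_fst[of "\<lambda>\<omega>. f (case \<omega> of (w, v) \<Rightarrow> splice p q w v)" W] by simp
  finally show ?thesis .
qed

text \<open>The Markov property of the bridge: the part of the path after time \<open>p\<close> is
  resampled by splicing in an independent bridge.\<close>

lemma nn_integral_bridge_step:
  assumes "s \<le> p" "p < q" "q < t"
    and \<Phi>: "(\<lambda>(w, z). \<Phi> w z) \<in> borel_measurable (path_borel \<Otimes>\<^sub>M borel)"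
    and past: "\<And>w w' z. \<lbrakk>w \<in> space path_borel; w' \<in> space path_borel;
      \<And>x. 0 \<le> x \<Longrightarrow> x \<le> (p - s) / (t - s) \<Longrightarrow> w x = w' x\<rbrakk> \<Longrightarrow> \<Phi> w z = \<Phi> w' z"
  shows "(\<integral>\<^sup>+w. \<Phi> w (bridge s t a b w q) \<partial>W) =
    (\<integral>\<^sup>+w. \<integral>\<^sup>+y. ennreal (heat (q - p) (y - bridge s t a b w p) * heat (t - q) (b - y) /
        heat (t - p) (b - bridge s t a b w p)) * \<Phi> w y \<partial>lborel \<partial>W)"
proof -
  \<comment> \<open>The time p on the clock of the driving standard bridge.\<close>
  define \<tau> where "\<tau> = (p - s) / (t - s)"
  have \<tau>: "0 \<le> \<tau>" "\<tau> < 1" using assms(1-3) by (auto simp: \<tau>_def divide_simps)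
  have [measurable]: "(\<lambda>w. bridge s t a b w q) \<in> borel_measurable path_borel"
    using assms by (intro measurable_bridge) auto
  note \<Phi>[measurable]
  have \<Phi>w: "\<Phi> w \<in> borel_measurable borel" if "w \<in> space path_borel" for w
    using measurable_Pair2[OF \<Phi> that] by simp
  have "(\<integral>\<^sup>+w. \<Phi> w (bridge s t a b w q) \<partial>W) =
    (\<integral>\<^sup>+w. \<integral>\<^sup>+v. \<Phi> (splice \<tau> 1 w v) (bridge s t a b (splice \<tau> 1 w v) q) \<partial>W \<partial>W)"
    using \<tau> by (intro nn_integral_splice) auto
  also have "\<dots> = (\<integral>\<^sup>+w. \<integral>\<^sup>+v. \<Phi> w (bridge p t (bridge s t a b w p) b v q) \<partial>W \<partial>W)"
  proof (intro nn_integral_cong_AE)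
    show "AE w in W. (\<integral>\<^sup>+v. \<Phi> (splice \<tau> 1 w v) (bridge s t a b (splice \<tau> 1 w v) q) \<partial>W) =
      (\<integral>\<^sup>+v. \<Phi> w (bridge p t (bridge s t a b w p) b v q) \<partial>W)"
      using AE_endpoints AE_space
    proof eventually_elim
      case w: (elim w)
      show ?case
      proof (rule nn_integral_cong_AE)
        show "AE v in W. \<Phi> (splice \<tau> 1 w v) (bridge s t a b (splice \<tau> 1 w v) q) =
          \<Phi> w (bridge p t (bridge s t a b w p) b v q)"
          using AE_endpoints AE_space
        proof eventually_elim
          case v: (elim v)
          have "\<Phi> (splice \<tau> 1 w v) z = \<Phi> w z" for z
          proof (rule past)
            show "splice \<tau> 1 w v \<in> space path_borel"
              using w v \<tau> by (intro splice_in_space) (auto simp: space_W)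
            fix x assume x: "0 \<le> x" "x \<le> (p - s) / (t - s)"
            then have "max \<tau> (min 1 x) = \<tau>" "x \<le> 1" using \<tau> by (auto simp: \<tau>_def[symmetric])
            then show "splice \<tau> 1 w v x = w x"
              using x \<tau> v by (simp add: splice_def bridge_start)
          qed (use w in \<open>simp add: space_W\<close>)
          moreover have "bridge s t a b (splice \<tau> 1 w v) q = bridge p t (bridge s t a b w p) b v q"
            using w assms unfolding \<tau>_def by (intro bridge_splice) auto
          ultimately show ?case by simp
        qed
      qed
    qed
  qed
  also have "\<dots> = (\<integral>\<^sup>+w. \<integral>\<^sup>+y. ennreal (heat (q - p) (y - bridge s t a b w p) * heat (t - q) (b - y) /
        heat (t - p) (b - bridge s t a b w p)) * \<Phi> w y \<partial>lborel \<partial>W)"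
  proof (rule nn_integral_cong)
    fix w assume "w \<in> space W"
    then show "(\<integral>\<^sup>+v. \<Phi> w (bridge p t (bridge s t a b w p) b v q) \<partial>W) =
      (\<integral>\<^sup>+y. ennreal (heat (q - p) (y - bridge s t a b w p) * heat (t - q) (b - y) /
        heat (t - p) (b - bridge s t a b w p)) * \<Phi> w y \<partial>lborel)"
      using assms by (intro nn_integral_bridge[where h="\<Phi> w"] \<Phi>w) (simp_all add: space_W)
  qed
  finally show ?thesis .
qed

text \<open>The factors \<open>G\<close> see consecutive values, so that they can carry survival
  factors as well as marks. The denominators of the bridge transition densities telescope, and the
  one left over is cancelled by the heat kernel of the whole interval.\<close>

lemma bridge_fdd:
  assumes st: "s < t" and \<tau>: "\<tau> 0 = s" "\<And>i. i < k \<Longrightarrow> \<tau> i < \<tau> (Suc i)" "\<tau> k < t"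
    and G [measurable]: "\<And>i. (\<lambda>(x, y). G i x y) \<in> borel_measurable (borel \<Otimes>\<^sub>M borel)"
    and h [measurable]: "h \<in> borel_measurable borel"
  shows "(\<integral>\<^sup>+w. (\<Prod>i<k. G i (bridge s t a b w (\<tau> i)) (bridge s t a b w (\<tau> (Suc i)))) * h (bridge s t a b w (\<tau> k)) \<partial>W)
      * ennreal (heat (t - s) (b - a)) =
    chain (\<lambda>i x y. ennreal (heat (\<tau> (Suc i) - \<tau> i) (y - x)) * G i x y) lborel a k
      (\<lambda>x. ennreal (heat (t - \<tau> k) (b - x)) * h x)"
  using \<tau> h
proof (induction k arbitrary: h)
  case 0
  have "(\<integral>\<^sup>+w. h (bridge s t a b w s) \<partial>W) = (\<integral>\<^sup>+w. h a \<partial>W)"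
  proof (rule nn_integral_cong_AE)
    show "AE w in W. h (bridge s t a b w s) = h a"
      using AE_endpoints by eventually_elim (simp add: bridge_start st)
  qed
  then show ?case using 0 by (simp add: emeasure_space_1 mult.commute)
next
  case (Suc k)
  note Suc.prems(4) [measurable]
  let ?X = "\<lambda>w x. bridge s t a b w x"
  have mono: "\<tau> i \<le> \<tau> j" if "i \<le> j" "j \<le> Suc k" for i j
    using that Suc.prems(2) by (induction j) (auto simp: le_Suc_eq less_imp_le intro: order_trans less_imp_le)
  have in_st: "s \<le> \<tau> i" "\<tau> i < t" if "i \<le> Suc k" for i
    using mono[of 0 i] mono[of i "Suc k"] that Suc.prems(1,3) by auto
  have [measurable]: "(\<lambda>\<omega>. ?X (fst \<omega>) (\<tau> i)) \<in> borel_measurable (path_borel \<Otimes>\<^sub>M borel)"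
    "(\<lambda>w. ?X w (\<tau> i)) \<in> borel_measurable path_borel" if "i \<le> Suc k" for i
    using in_st[OF that] st by (intro measurable_bridge; auto)+
  define dens where "dens x y = heat (\<tau> (Suc k) - \<tau> k) (y - x) * heat (t - \<tau> (Suc k)) (b - y) / heat (t - \<tau> k) (b - x)" for x y
  define H where "H x = (\<integral>\<^sup>+y. ennreal (dens x y) * (G k x y * h y) \<partial>lborel)" for x
  have [measurable]: "(\<lambda>(x, y). ennreal (dens x y) * (G k x y * h y)) \<in> borel_measurable (borel \<Otimes>\<^sub>M lborel)"
    unfolding dens_def by measurable
  have H [measurable]: "H \<in> borel_measurable borel"
    unfolding H_def by measurable
  define P where "P w = (\<Prod>i<k. G i (?X w (\<tau> i)) (?X w (\<tau> (Suc i))))" for w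
  have P [measurable]: "(\<lambda>\<omega>. P (fst \<omega>)) \<in> borel_measurable (path_borel \<Otimes>\<^sub>M borel)"
    unfolding P_def by (intro borel_measurable_prod_ennreal) (auto intro!: measurable_Pair_compose_split[OF G])
  have "(\<integral>\<^sup>+w. (\<Prod>i<Suc k. G i (?X w (\<tau> i)) (?X w (\<tau> (Suc i)))) * h (?X w (\<tau> (Suc k))) \<partial>W) =
    (\<integral>\<^sup>+w. P w * G k (?X w (\<tau> k)) (?X w (\<tau> (Suc k))) * h (?X w (\<tau> (Suc k))) \<partial>W)"
    by (simp add: P_def)
  also have "\<dots> = (\<integral>\<^sup>+w. \<integral>\<^sup>+y. ennreal (dens (?X w (\<tau> k)) y) * (P w * G k (?X w (\<tau> k)) y * h y) \<partial>lborel \<partial>W)"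
    unfolding dens_def
  proof (rule nn_integral_bridge_step[where \<Phi>="\<lambda>w z. P w * G k (?X w (\<tau> k)) z * h z"])
    show "(\<lambda>(w, z). P w * G k (?X w (\<tau> k)) z * h z) \<in> borel_measurable (path_borel \<Otimes>\<^sub>M borel)"
      unfolding split_beta by measurable
    fix w w' :: "real \<Rightarrow> real" and z
    assume eq: "\<And>x. 0 \<le> x \<Longrightarrow> x \<le> (\<tau> k - s) / (t - s) \<Longrightarrow> w x = w' x"
    have "?X w (\<tau> i) = ?X w' (\<tau> i)" if "i \<le> k" for i
      using in_st[of i] mono[of i k] that st by (simp add: bridge_def eq divide_right_mono)
    then show "P w * G k (?X w (\<tau> k)) z * h z = P w' * G k (?X w' (\<tau> k)) z * h z"
      by (simp add: P_def)
  qed (use in_st[of k] Suc.prems in auto)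
  also have "\<dots> = (\<integral>\<^sup>+w. P w * H (?X w (\<tau> k)) \<partial>W)"
    unfolding H_def
  proof (intro nn_integral_cong)
    fix w
    have "(\<integral>\<^sup>+y. ennreal (dens (?X w (\<tau> k)) y) * (P w * G k (?X w (\<tau> k)) y * h y) \<partial>lborel) =
      (\<integral>\<^sup>+y. P w * (ennreal (dens (?X w (\<tau> k)) y) * (G k (?X w (\<tau> k)) y * h y)) \<partial>lborel)"
      by (simp add: mult_ac)
    also have "\<dots> = P w * (\<integral>\<^sup>+y. ennreal (dens (?X w (\<tau> k)) y) * (G k (?X w (\<tau> k)) y * h y) \<partial>lborel)"
      unfolding dens_def by (intro nn_integral_cmult) measurable
    finally show "(\<integral>\<^sup>+y. ennreal (dens (?X w (\<tau> k)) y) * (P w * G k (?X w (\<tau> k)) y * h y) \<partial>lborel) =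
      P w * (\<integral>\<^sup>+y. ennreal (dens (?X w (\<tau> k)) y) * (G k (?X w (\<tau> k)) y * h y) \<partial>lborel)" .
  qed
  also have "\<dots> * ennreal (heat (t - s) (b - a)) =
    chain (\<lambda>i x y. ennreal (heat (\<tau> (Suc i) - \<tau> i) (y - x)) * G i x y) lborel a k
      (\<lambda>x. ennreal (heat (t - \<tau> k) (b - x)) * H x)"
    unfolding P_def using Suc.prems in_st[of k] by (intro Suc.IH H) auto
  \<comment> \<open>The denominator of \<open>dens\<close> cancels against the kernel leading to b,
    which leaves exactly one more step of the chain.\<close>
  also have "(\<lambda>x. ennreal (heat (t - \<tau> k) (b - x)) * H x) =
    (\<lambda>x. \<integral>\<^sup>+y. (ennreal (heat (\<tau> (Suc k) - \<tau> k) (y - x)) * G k x y) * (ennreal (heat (t - \<tau> (Suc k)) (b - y)) * h y) \<partial>lborel)"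
  proof
    fix x
    have pos: "heat (t - \<tau> k) (b - x) > 0" using in_st[of k] by (intro heat_pos) auto
    have "ennreal (heat (t - \<tau> k) (b - x)) * H x = (\<integral>\<^sup>+y. ennreal (heat (t - \<tau> k) (b - x)) * (ennreal (dens x y) * (G k x y * h y)) \<partial>lborel)"
      unfolding H_def by (subst nn_integral_cmult) (simp_all add: dens_def)
    also have "\<dots> = (\<integral>\<^sup>+y. (ennreal (heat (\<tau> (Suc k) - \<tau> k) (y - x)) * G k x y) * (ennreal (heat (t - \<tau> (Suc k)) (b - y)) * h y) \<partial>lborel)"
    proof (intro nn_integral_cong)
      fix y
      have "heat (t - \<tau> k) (b - x) * dens x y = heat (\<tau> (Suc k) - \<tau> k) (y - x) * heat (t - \<tau> (Suc k)) (b - y)"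
        using pos by (simp add: dens_def)
      then have "ennreal (heat (t - \<tau> k) (b - x)) * ennreal (dens x y) =
        ennreal (heat (\<tau> (Suc k) - \<tau> k) (y - x)) * ennreal (heat (t - \<tau> (Suc k)) (b - y))"
        using pos by (simp add: ennreal_mult[symmetric] dens_def)
      then show "ennreal (heat (t - \<tau> k) (b - x)) * (ennreal (dens x y) * (G k x y * h y)) =
        (ennreal (heat (\<tau> (Suc k) - \<tau> k) (y - x)) * G k x y) * (ennreal (heat (t - \<tau> (Suc k)) (b - y)) * h y)"
      proof -
        have "p * (q * (g * k)) = (r * g) * (v * k)" if "p * q = r * v" for p q r v g k :: ennreal
        proof -
          have "p * (q * (g * k)) = (p * q) * (g * k)" by (simp only: mult.assoc)
          then show ?thesis unfolding that by (simp only: mult_ac)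
        qed
        then show ?thesis
          using \<open>ennreal (heat (t - \<tau> k) (b - x)) * ennreal (dens x y) = _\<close> by blast
      qed
    qed
    finally show "ennreal (heat (t - \<tau> k) (b - x)) * H x = (\<integral>\<^sup>+y. (ennreal (heat (\<tau> (Suc k) - \<tau> k) (y - x)) * G k x y) * (ennreal (heat (t - \<tau> (Suc k)) (b - y)) * h y) \<partial>lborel)" .
  qed
  finally show ?case by simp
qed

end

section \<open>Semigroup property of the killed kernel\<close>

lemma heat_convolution:
  assumes d: "0 < d" "0 < d'"
  shows "has_bochner_integral lborel (\<lambda>y. heat d (y - x) * heat d' (z - y)) (heat (d + d') (z - x))"
proof (rule has_bochner_integral_nn_integral)
  have "(\<integral>\<^sup>+y. ennreal (heat d (z - x - y) * heat d' y) \<partial>lborel) = heat (d + d') (z - x)"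
    using fun_cong[OF conv_normal_density_zero_mean[of "sqrt d" "sqrt d'"], of "z - x"] d by simp
  then show "(\<integral>\<^sup>+y. ennreal (heat d (y - x) * heat d' (z - y)) \<partial>lborel) = ennreal (heat (d + d') (z - x))"
  proof -
    have "(\<integral>\<^sup>+y. ennreal (heat d (y - x) * heat d' (z - y)) \<partial>lborel) =
      (\<integral>\<^sup>+y. ennreal (heat d (z - y - x) * heat d' (z - (z - y))) \<partial>lborel)"
      using nn_integral_real_affine[of "\<lambda>y. ennreal (heat d (y - x) * heat d' (z - y))" "- 1" z] by simp
    also have "\<dots> = (\<integral>\<^sup>+y. ennreal (heat d (z - x - y) * heat d' y) \<partial>lborel)"
    proof (rule nn_integral_cong)
      fix y
      have "z - y - x = z - x - y" "z - (z - y) = y" by simp_all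
      then show "ennreal (heat d (z - y - x) * heat d' (z - (z - y))) = ennreal (heat d (z - x - y) * heat d' y)"
        by (simp only:)
    qed
    finally show ?thesis
      using \<open>(\<integral>\<^sup>+y. ennreal (heat d (z - x - y) * heat d' y) \<partial>lborel) = heat (d + d') (z - x)\<close> by simp
  qed
qed (auto intro!: borel_measurable_times)

definition killed :: "real \<Rightarrow> real \<Rightarrow> real \<Rightarrow> ennreal" where
  "killed d x y = (if 0 < x \<and> 0 < y then ennreal (killed_density d x y) else 0)"

text \<open>The probability that a Brownian bridge of length d from x to y stays positive, in the
  form given by the reflection principle; see \<open>prob_bridge_pos\<close>.\<close>

definition survival :: "real \<Rightarrow> real \<Rightarrow> real \<Rightarrow> real" where
  "survival d x y = (if 0 < x \<and> 0 < y then 1 - exp (- 2 * x * y / d) else 0)"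

lemma survival_bounds: "0 < d \<Longrightarrow> 0 \<le> survival d x y \<and> survival d x y \<le> 1"
  by (simp add: survival_def)

lemma killed_density_heat:
  assumes "0 < d" shows "killed_density d x y = heat d (y - x) * (1 - exp (- 2 * x * y / d))"
proof -
  have "- ((y + x)\<^sup>2 / (2 * d)) = - ((y - x)\<^sup>2 / (2 * d)) + (- 2 * x * y / d)"
    using assms by (simp add: field_simps power2_eq_square)
  then have "exp (- ((y + x)\<^sup>2 / (2 * d))) = exp (- ((y - x)\<^sup>2 / (2 * d))) * exp (- 2 * x * y / d)"
    by (metis exp_add)
  then show ?thesis
    using assms by (simp add: killed_density_def heat_eq right_diff_distrib)
qed

lemma killed_eq: "0 < d \<Longrightarrow> killed d x y = ennreal (heat d (y - x)) * ennreal (survival d x y)"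
  by (simp add: killed_def survival_def killed_density_heat ennreal_mult'[OF normal_density_nonneg])

lemma measurable_survival [measurable]: "(\<lambda>(x, y). survival d x y) \<in> borel_measurable (borel \<Otimes>\<^sub>M borel)"
  unfolding survival_def by measurable

lemma measurable_killed [measurable]: "(\<lambda>(x, y). killed d x y) \<in> borel_measurable (borel \<Otimes>\<^sub>M borel)"
  unfolding killed_def killed_density_def by measurable

lemma killed_density_nonneg: "0 < d \<Longrightarrow> 0 \<le> x * y \<Longrightarrow> 0 \<le> killed_density d x y"
  unfolding killed_density_heat
  by (intro mult_nonneg_nonneg normal_density_nonneg) (simp add: mult.assoc)

lemma killed_density_minus: "killed_density d x (- y) = - killed_density d x y" "killed_density d (- x) y = - killed_density d x y"
  using heat_minus[of d "y + x"] heat_minus[of d "y - x"] by (simp_all add: killed_density_def)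

text \<open>The integrand is even in the intermediate point, so the integral over the half line
  is half of a Gaussian convolution integral.\<close>

lemma killed_chapman_kolmogorov:
  assumes d: "0 < d" "0 < d'"
  shows "(\<integral>\<^sup>+y. killed d x y * killed d' y z \<partial>lborel) = killed (d + d') x z"
proof (cases "0 < x \<and> 0 < z")
  case False
  then have "(\<lambda>y. killed d x y * killed d' y z) = (\<lambda>_. 0)" by (auto simp: killed_def)
  moreover have "killed (d + d') x z = 0" using False by (auto simp: killed_def)
  ultimately show ?thesis by simp
next
  case xz: True
  define f where "f y = killed_density d x y * killed_density d' y z" for y
  have f_even: "f (- y) = f y" for y by (simp add: f_def killed_density_minus)
  have f_pos: "0 \<le> f y" if "0 \<le> y" for y
    using that xz d unfolding f_def by (intro mult_nonneg_nonneg killed_density_nonneg) auto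
  have f_nn: "0 \<le> f y" for y using f_pos[of y] f_pos[of "- y"] f_even[of y] by (cases "0 \<le> y") auto
  have [measurable]: "f \<in> borel_measurable borel" unfolding f_def killed_density_def by measurable
  have "has_bochner_integral lborel (\<lambda>y. heat d (y - x) * heat d' (z - y) - heat d (y - x) * heat d' (- z - y)
      - heat d (y - (- x)) * heat d' (z - y) + heat d (y - (- x)) * heat d' (- z - y))
     (heat (d + d') (z - x) - heat (d + d') (- z - x) - heat (d + d') (z - (- x)) + heat (d + d') (- z - (- x)))"
    by (intro has_bochner_integral_add has_bochner_integral_diff heat_convolution d)
  also have "(\<lambda>y. heat d (y - x) * heat d' (z - y) - heat d (y - x) * heat d' (- z - y)
      - heat d (y - (- x)) * heat d' (z - y) + heat d (y - (- x)) * heat d' (- z - y)) = f"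
  proof
    fix y
    have "heat d' (- z - y) = heat d' (z + y)" using heat_minus[of d' "z + y"] by simp
    then show "heat d (y - x) * heat d' (z - y) - heat d (y - x) * heat d' (- z - y)
      - heat d (y - (- x)) * heat d' (z - y) + heat d (y - (- x)) * heat d' (- z - y) = f y"
      by (simp add: f_def killed_density_def algebra_simps)
  qed
  also have "heat (d + d') (z - x) - heat (d + d') (- z - x) - heat (d + d') (z - (- x)) + heat (d + d') (- z - (- x)) =
     2 * killed_density (d + d') x z"
    using heat_minus[of "d + d'" "z + x"] heat_minus[of "d + d'" "z - x"] by (simp add: killed_density_def)
  finally have "has_bochner_integral lborel f (2 * killed_density (d + d') x z)" .
  then have tot: "(\<integral>\<^sup>+y. ennreal (f y) \<partial>lborel) = ennreal (2 * killed_density (d + d') x z)"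
    using nn_integral_eq_integral[of lborel f] f_nn by (auto simp: has_bochner_integral_iff)
  have half: "(\<integral>\<^sup>+y. ennreal (f y) * indicator {..<0} y \<partial>lborel) = (\<integral>\<^sup>+y. ennreal (f y) * indicator {0<..} y \<partial>lborel)"
    by (subst nn_integral_real_affine[where c="-1" and t=0]) (auto simp: f_even indicator_def intro!: nn_integral_cong)
  have "(\<integral>\<^sup>+y. ennreal (f y) \<partial>lborel) = (\<integral>\<^sup>+y. ennreal (f y) * indicator {..<0} y + ennreal (f y) * indicator {0<..} y \<partial>lborel)"
  proof (rule nn_integral_cong_AE)
    show "AE y in lborel. ennreal (f y) = ennreal (f y) * indicator {..<0} y + ennreal (f y) * indicator {0<..} y"
      using AE_lborel_singleton[of 0] by eventually_elim (auto simp: indicator_def)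
  qed
  also have "\<dots> = 2 * (\<integral>\<^sup>+y. ennreal (f y) * indicator {0<..} y \<partial>lborel)"
    by (subst nn_integral_add) (auto simp: half mult_2)
  finally have "2 * (\<integral>\<^sup>+y. ennreal (f y) * indicator {0<..} y \<partial>lborel) = 2 * ennreal (killed_density (d + d') x z)"
    using tot by (simp add: ennreal_mult')
  then have *: "(\<integral>\<^sup>+y. ennreal (f y) * indicator {0<..} y \<partial>lborel) = ennreal (killed_density (d + d') x z)"
    by (simp add: ennreal_mult_cancel_left)
  have "killed d x y * killed d' y z = ennreal (f y) * indicator {0<..} y" for y
    using xz d killed_density_nonneg[of d x y] by (auto simp: killed_def f_def indicator_def ennreal_mult')
  then show ?thesis using xz * by (simp add: killed_def)
qed

section \<open>Bridges conditioned to be positive\<close>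

lemma chain_cong:
  "(\<And>i. i < k \<Longrightarrow> K i = K' i) \<Longrightarrow> chain K M a k e = chain K' M a k e"
  by (induction k arbitrary: e) simp_all

definition refine :: "(nat \<Rightarrow> real) \<Rightarrow> nat \<Rightarrow> real" where
  "refine \<tau> j = (if even j then \<tau> (j div 2) else (\<tau> (j div 2) + \<tau> (Suc (j div 2))) / 2)"

text \<open>The mark of step \<open>j\<close> sits at the right end of that step. Steps with even
  index end in an inserted midpoint, so they are the ones with a trivial mark.\<close>

definition refine_weight :: "(nat \<Rightarrow> real \<Rightarrow> ennreal) \<Rightarrow> nat \<Rightarrow> real \<Rightarrow> ennreal" where
  "refine_weight g j = (if even j then (\<lambda>_. 1) else g (j div 2))"

definition weighted_killed :: "(nat \<Rightarrow> real) \<Rightarrow> (nat \<Rightarrow> real \<Rightarrow> ennreal) \<Rightarrow> nat \<Rightarrow> real \<Rightarrow> real \<Rightarrow> ennreal" where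
  "weighted_killed \<tau> g i x y = killed (\<tau> (Suc i) - \<tau> i) x y * g i y"

definition survival_prod :: "(nat \<Rightarrow> real) \<Rightarrow> nat \<Rightarrow> (real \<Rightarrow> real) \<Rightarrow> real" where
  "survival_prod \<tau> n v = (\<Prod>i<n. survival (\<tau> (Suc i) - \<tau> i) (v (\<tau> i)) (v (\<tau> (Suc i))))"

text \<open>\<open>k\<close> counts interior grid points: the marks \<open>g 0\<close>, ...,
  \<open>g (k - 1)\<close> sit at \<open>\<tau> 1\<close>, ..., \<open>\<tau> k\<close>, and the
  final step from \<open>\<tau> k\<close> to \<open>\<tau> (Suc k)\<close> ends in b without a
  mark.\<close>

definition killed_chain :: "(nat \<Rightarrow> real) \<Rightarrow> (nat \<Rightarrow> real \<Rightarrow> ennreal) \<Rightarrow> nat \<Rightarrow> real \<Rightarrow> real \<Rightarrow> ennreal" where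
  "killed_chain \<tau> g k a b = chain (weighted_killed \<tau> g) lborel a k (\<lambda>x. killed (\<tau> (Suc k) - \<tau> k) x b)"

lemma refine_even [simp]: "refine \<tau> (2 * n) = \<tau> n"
  and refine_odd [simp]: "refine \<tau> (Suc (2 * n)) = (\<tau> n + \<tau> (Suc n)) / 2"
  and refine_even2 [simp]: "refine \<tau> (Suc (Suc (2 * n))) = \<tau> (Suc n)"
  by (simp_all add: refine_def)

lemma refine_weight_even [simp]: "refine_weight g (2 * n) = (\<lambda>_. 1)"
  and refine_weight_odd [simp]: "refine_weight g (Suc (2 * n)) = g n"
  by (simp_all add: refine_weight_def)

lemma measurable_killed_fst [measurable]: "(\<lambda>x. killed d x y) \<in> borel_measurable borel"
  and measurable_killed_snd [measurable]: "killed d x \<in> borel_measurable borel"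
  unfolding killed_def killed_density_def by measurable

lemma killed_refine_step:
  assumes "r < s" "h \<in> borel_measurable borel"
  shows "(\<integral>\<^sup>+y. killed ((r + s) / 2 - r) x y * (\<integral>\<^sup>+z. killed (s - (r + s) / 2) y z * h z \<partial>lborel) \<partial>lborel) =
     (\<integral>\<^sup>+z. killed (s - r) x z * h z \<partial>lborel)"
proof -
  note assms(2) [measurable]
  define d where "d = (s - r) / 2"
  have d: "d > 0" "(r + s) / 2 - r = d" "s - (r + s) / 2 = d" "s - r = d + d" using assms by (auto simp: d_def field_simps)
  have [measurable]: "(\<lambda>(y, z). killed d x y * (killed d y z * h z)) \<in> borel_measurable (borel \<Otimes>\<^sub>M borel)"
    unfolding killed_def killed_density_def by measurable
  have "(\<integral>\<^sup>+y. killed d x y * (\<integral>\<^sup>+z. killed d y z * h z \<partial>lborel) \<partial>lborel) =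
    (\<integral>\<^sup>+y. \<integral>\<^sup>+z. killed d x y * (killed d y z * h z) \<partial>lborel \<partial>lborel)"
    by (intro nn_integral_cong nn_integral_cmult[symmetric]) measurable
  also have "\<dots> = (\<integral>\<^sup>+z. \<integral>\<^sup>+y. killed d x y * (killed d y z * h z) \<partial>lborel \<partial>lborel)"
    by (rule lborel_pair.Fubini') simp
  also have "\<dots> = (\<integral>\<^sup>+z. (\<integral>\<^sup>+y. killed d x y * killed d y z \<partial>lborel) * h z \<partial>lborel)"
    by (subst nn_integral_multc[symmetric]) (simp_all add: mult.assoc)
  finally show ?thesis unfolding d(2-4) killed_chapman_kolmogorov[OF d(1) d(1)] .
qed

lemma chain_refine:
  assumes "\<And>i. i < n \<Longrightarrow> \<tau> i < \<tau> (Suc i)" and g: "\<And>i. g i \<in> borel_measurable borel" and "e \<in> borel_measurable borel"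
  shows "chain (weighted_killed (refine \<tau>) (refine_weight g)) lborel a (2 * n) e = chain (weighted_killed \<tau> g) lborel a n e"
  using assms(1,3)
proof (induction n arbitrary: e)
  case (Suc n)
  note g [measurable] Suc.prems(2) [measurable]
  define e' where "e' x = (\<integral>\<^sup>+z. killed (\<tau> (Suc n) - \<tau> n) x z * (g n z * e z) \<partial>lborel)" for x
  have e' [measurable]: "e' \<in> borel_measurable borel"
    unfolding e'_def killed_def killed_density_def by measurable
  have "chain (weighted_killed (refine \<tau>) (refine_weight g)) lborel a (2 * Suc n) e =
    chain (weighted_killed (refine \<tau>) (refine_weight g)) lborel a (2 * n) e'"
  proof -
    have "(\<lambda>x. \<integral>\<^sup>+y. killed ((\<tau> n + \<tau> (Suc n)) / 2 - \<tau> n) x y * 1 *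
        (\<integral>\<^sup>+z. killed (\<tau> (Suc n) - (\<tau> n + \<tau> (Suc n)) / 2) y z * g n z * e z \<partial>lborel) \<partial>lborel) = e'"
    proof
      fix x show "(\<integral>\<^sup>+y. killed ((\<tau> n + \<tau> (Suc n)) / 2 - \<tau> n) x y * 1 *
        (\<integral>\<^sup>+z. killed (\<tau> (Suc n) - (\<tau> n + \<tau> (Suc n)) / 2) y z * g n z * e z \<partial>lborel) \<partial>lborel) = e' x"
        unfolding e'_def mult.assoc mult_1_right mult_1_left using Suc.prems(1)[of n]
        by (intro killed_refine_step[where h="\<lambda>z. g n z * e z"]) auto
    qed
    then show ?thesis by (simp add: weighted_killed_def)
  qed
  also have "\<dots> = chain (weighted_killed \<tau> g) lborel a n e'"
    using Suc.prems by (intro Suc.IH) auto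
  also have "\<dots> = chain (weighted_killed \<tau> g) lborel a (Suc n) e"
    by (simp add: weighted_killed_def e'_def[abs_def] mult.assoc)
  finally show ?case .
qed simp

text \<open>Each of the k + 1 steps receives a midpoint, so k interior points become 2k + 1.
  Chapman-Kolmogorov integrates the midpoints out; the one in the unmarked final step is treated
  separately from those in the chain.\<close>

lemma killed_chain_refine:
  assumes "\<And>i. i \<le> k \<Longrightarrow> \<tau> i < \<tau> (Suc i)" and g: "\<And>i. g i \<in> borel_measurable borel"
  shows "killed_chain (refine \<tau>) (refine_weight g) (Suc (2 * k)) a b = killed_chain \<tau> g k a b"
proof -
  have "(\<lambda>x. \<integral>\<^sup>+y. weighted_killed (refine \<tau>) (refine_weight g) (2 * k) x y *
      killed (refine \<tau> (Suc (Suc (2 * k))) - refine \<tau> (Suc (2 * k))) y b \<partial>lborel) =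
    (\<lambda>x. killed (\<tau> (Suc k) - \<tau> k) x b)"
  proof
    fix x
    define d where "d = (\<tau> (Suc k) - \<tau> k) / 2"
    have d: "d > 0" "(\<tau> k + \<tau> (Suc k)) / 2 - \<tau> k = d" "\<tau> (Suc k) - (\<tau> k + \<tau> (Suc k)) / 2 = d" "\<tau> (Suc k) - \<tau> k = d + d"
      using assms(1)[of k] by (auto simp: d_def field_simps)
    show "(\<integral>\<^sup>+y. weighted_killed (refine \<tau>) (refine_weight g) (2 * k) x y *
      killed (refine \<tau> (Suc (Suc (2 * k))) - refine \<tau> (Suc (2 * k))) y b \<partial>lborel) = killed (\<tau> (Suc k) - \<tau> k) x b"
      unfolding weighted_killed_def refine_even refine_odd refine_even2 refine_weight_even mult_1_right d(2-4)
      by (rule killed_chapman_kolmogorov[OF d(1) d(1)])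
  qed
  then show ?thesis
    unfolding killed_chain_def using assms by (simp add: chain_refine)
qed

lemma prod_refine_weight:
  "(\<Prod>i<2 * n. refine_weight g i (v (refine \<tau> (Suc i)))) = (\<Prod>i<n. g i (v (\<tau> (Suc i))))"
  by (induction n) (simp_all)

section \<open>Survival products along a path\<close>

lemma one_minus_sum_le_prod:
  fixes e :: "nat \<Rightarrow> real"
  assumes "\<And>i. i < n \<Longrightarrow> 0 \<le> e i \<and> e i \<le> 1"
  shows "1 - (\<Sum>i<n. e i) \<le> (\<Prod>i<n. 1 - e i)"
  using assms
proof (induction n)
  case (Suc n)
  have p: "0 \<le> (\<Prod>i<n. 1 - e i)" "(\<Prod>i<n. 1 - e i) \<le> 1"
    using Suc.prems by (auto intro!: prod_nonneg prod_le_1)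
  have "(\<Prod>i<n. 1 - e i) * e n \<le> 1 * e n" using p Suc.prems[of n] by (intro mult_right_mono) auto
  then show ?case using Suc by (simp add: algebra_simps)
qed simp

lemma increasing_grid_cover:
  fixes \<tau> :: "nat \<Rightarrow> real"
  assumes "\<tau> 0 \<le> x" "x \<le> \<tau> (Suc n)"
  shows "\<exists>i\<le>n. \<tau> i \<le> x \<and> x \<le> \<tau> (Suc i)"
  using assms(2)
proof (induction n)
  case (Suc n)
  then show ?case by (cases "x \<le> \<tau> (Suc n)") (auto intro: le_SucI)
qed (use assms in auto)

lemma survival_prod_bounds:
  assumes "\<And>i. i < n \<Longrightarrow> \<tau> i < \<tau> (Suc i)"
  shows "0 \<le> survival_prod \<tau> n v" "survival_prod \<tau> n v \<le> 1"
  unfolding survival_prod_def using assms by (auto intro!: prod_nonneg prod_le_1 simp: survival_bounds)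

text \<open>A step of length d fails with at most exp (- z) for z = 2 \<mu>^2 / d, and exp z >= z^2
  / 2 bounds this by d^2 / (2 \<mu>^4). Summing over the grid leaves mesh times total length, so the
  product tends to 1 under refinement.\<close>

lemma survival_prod_lower_bound:
  assumes \<tau>: "\<And>i. i < n \<Longrightarrow> \<tau> i < \<tau> (Suc i) \<and> \<tau> (Suc i) - \<tau> i \<le> D" and m: "0 < \<mu>"
    and v: "\<And>i. i \<le> n \<Longrightarrow> \<mu> \<le> v (\<tau> i)" and D: "0 \<le> D"
  shows "1 - D * (\<tau> n - \<tau> 0) / (2 * \<mu> ^ 4) \<le> survival_prod \<tau> n v"
proof -
  define e where "e i = exp (- 2 * v (\<tau> i) * v (\<tau> (Suc i)) / (\<tau> (Suc i) - \<tau> i))" for i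
  have e: "0 \<le> e i \<and> e i \<le> 1 \<and> e i \<le> (\<tau> (Suc i) - \<tau> i) * D / (2 * \<mu> ^ 4)" if "i < n" for i
  proof -
    define d where "d = \<tau> (Suc i) - \<tau> i"
    have d: "0 < d" "d \<le> D" using \<tau>[OF that] by (auto simp: d_def)
    have vv: "\<mu> * \<mu> \<le> v (\<tau> i) * v (\<tau> (Suc i))"
      using m v[of i] v[of "Suc i"] that by (intro mult_mono) auto
    define z where "z = 2 * (\<mu> * \<mu>) / d"
    have z: "z > 0" using m d by (simp add: z_def)
    have "e i \<le> exp (- z)"
      unfolding e_def z_def d_def[symmetric] using vv d by (simp add: divide_right_mono)
    also have "\<dots> = 1 / exp z" by (simp add: exp_minus inverse_eq_divide)
    also have "\<dots> \<le> 1 / (z\<^sup>2 / 2)"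
      using z exp_lower_Taylor_quadratic[of z] by (intro divide_left_mono) auto
    also have "\<dots> = d * d / (2 * \<mu> ^ 4)"
      using d m by (simp add: z_def power2_eq_square power4_eq_xxxx)
    also have "\<dots> \<le> d * D / (2 * \<mu> ^ 4)"
      using d m by (intro divide_right_mono mult_left_mono) auto
    finally have 1: "e i \<le> d * D / (2 * \<mu> ^ 4)" .
    have "0 \<le> v (\<tau> i) * v (\<tau> (Suc i)) / d" using vv m d by (intro divide_nonneg_nonneg) (auto intro: order_trans[OF _ vv])
    then have "e i \<le> 1" by (simp add: e_def d_def[symmetric] mult.assoc)
    then show ?thesis using 1 by (simp add: e_def d_def)
  qed
  have "D * (\<tau> n - \<tau> 0) / (2 * \<mu> ^ 4) = (\<Sum>i<n. (\<tau> (Suc i) - \<tau> i) * D / (2 * \<mu> ^ 4))"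
    by (simp add: sum_divide_distrib[symmetric] sum_distrib_right[symmetric] sum_lessThan_telescope)
  also have "\<dots> \<ge> (\<Sum>i<n. e i)" using e by (intro sum_mono) auto
  finally have "1 - D * (\<tau> n - \<tau> 0) / (2 * \<mu> ^ 4) \<le> 1 - (\<Sum>i<n. e i)" by simp
  also have "\<dots> \<le> (\<Prod>i<n. 1 - e i)" using e by (intro one_minus_sum_le_prod) auto
  also have "\<dots> = survival_prod \<tau> n v"
    unfolding survival_prod_def
  proof (intro prod.cong refl)
    fix i assume "i \<in> {..<n}"
    then have "0 < v (\<tau> i)" "0 < v (\<tau> (Suc i))" using v[of i] v[of "Suc i"] m by auto
    then show "1 - e i = survival (\<tau> (Suc i) - \<tau> i) (v (\<tau> i)) (v (\<tau> (Suc i)))"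
      by (simp add: survival_def e_def)
  qed
  finally show ?thesis .
qed

text \<open>Without the case distinction, continuity across the boundary of the positive quadrant
  and measurability are immediate.\<close>

lemma survival_max: "survival d x y = 1 - exp (- 2 * max 0 x * max 0 y / d)"
  by (auto simp: survival_def max_def)

lemma survival_tendsto [tendsto_intros]:
  assumes "(f \<longlongrightarrow> x) F" "(g \<longlongrightarrow> y) F" "d \<noteq> 0"
  shows "((\<lambda>n. survival d (f n) (g n)) \<longlongrightarrow> survival d x y) F"
  unfolding survival_max using assms by (intro tendsto_intros) auto

lemma continuous_ge_iff_rational:
  fixes f :: "real \<Rightarrow> real"
  assumes "continuous_on {s..t} f" "s < t"
  shows "(\<forall>x\<in>{s..t}. c \<le> f x) \<longleftrightarrow> (\<forall>x\<in>\<rat> \<inter> {s<..<t}. c \<le> f x)"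
proof (intro iffI ballI)
  fix x assume *: "\<forall>x\<in>\<rat> \<inter> {s<..<t}. c \<le> f x" and x: "x \<in> {s..t}"
  have "closure (\<rat> \<inter> {s<..<t}) = {s..t}"
  proof -
    have "closure ({s<..<t} \<inter> \<rat>) = closure {s<..<t}"
      using Rats_closure_real by (intro closure_open_Int_superset) auto
    then show ?thesis using assms by (simp add: Int_commute)
  qed
  then show "c \<le> f x"
    using continuous_ge_on_closure[of "\<rat> \<inter> {s<..<t}" f x c] x * assms by auto
qed auto

text \<open>By compactness a strict bound on the interval is a uniform one. The event becomes a
  countable union of events with non-strict inequalities, which rational times decide.\<close>

lemma bridge_gt_iff_nat:
  assumes "w \<in> space path_borel" "s < t"
  shows "(\<forall>x\<in>{s..t}. c < bridge s t a b w x) \<longleftrightarrow> (\<exists>n. \<forall>x\<in>{s..t}. c + 1 / real (Suc n) \<le> bridge s t a b w x)"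
proof
  assume *: "\<forall>x\<in>{s..t}. c < bridge s t a b w x"
  obtain x0 where x0: "x0 \<in> {s..t}" "\<forall>x\<in>{s..t}. bridge s t a b w x0 \<le> bridge s t a b w x"
    using continuous_attains_inf[of "{s..t}" "bridge s t a b w"] continuous_on_bridge[OF assms] assms(2) by fastforce
  then obtain n where "1 / real (Suc n) < bridge s t a b w x0 - c"
    using * reals_Archimedean[of "bridge s t a b w x0 - c"] by (auto simp: inverse_eq_divide)
  then show "\<exists>n. \<forall>x\<in>{s..t}. c + 1 / real (Suc n) \<le> bridge s t a b w x"
    using x0 by (intro exI[of _ n]) fastforce
next
  assume "\<exists>n. \<forall>x\<in>{s..t}. c + 1 / real (Suc n) \<le> bridge s t a b w x"
  then obtain n where n: "\<forall>x\<in>{s..t}. c + 1 / real (Suc n) \<le> bridge s t a b w x" by blast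
  have "0 < 1 / real (Suc n)" by simp
  show "\<forall>x\<in>{s..t}. c < bridge s t a b w x"
  proof
    fix x assume "x \<in> {s..t}"
    then show "c < bridge s t a b w x" using bspec[OF n, of x] \<open>0 < 1 / real (Suc n)\<close> by linarith
  qed
qed

lemma sets_bridge_ge:
  assumes f: "f \<in> measurable M path_borel" and st: "s < t"
    and [measurable]: "a \<in> borel_measurable M" "b \<in> borel_measurable M" "c \<in> borel_measurable M"
  shows "{\<omega> \<in> space M. \<forall>x\<in>{s..t}. c \<omega> \<le> bridge s t (a \<omega>) (b \<omega>) (f \<omega>) x} \<in> sets M" (is "?A \<in> _")
proof -
  have "?A = {\<omega> \<in> space M. \<forall>x\<in>\<rat> \<inter> {s<..<t}. c \<omega> \<le> bridge s t (a \<omega>) (b \<omega>) (f \<omega>) x}"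
    using continuous_ge_iff_rational[OF continuous_on_bridge[OF measurable_space[OF f] st] st] by blast
  also have "\<dots> \<in> sets M"
  proof (intro sets.sets_Collect_countable_All')
    show "countable (\<rat> \<inter> {s<..<t})" using countable_rat by blast
    fix x assume "x \<in> \<rat> \<inter> {s<..<t}"
    then have [measurable]: "(\<lambda>\<omega>. bridge s t (a \<omega>) (b \<omega>) (f \<omega>) x) \<in> borel_measurable M"
      using st by (intro measurable_bridge[OF f]) auto
    show "{\<omega> \<in> space M. c \<omega> \<le> bridge s t (a \<omega>) (b \<omega>) (f \<omega>) x} \<in> sets M" by measurable
  qed
  finally show ?thesis .
qed

lemma sets_bridge_gt:
  assumes f: "f \<in> measurable M path_borel" and st: "s < t"
    and [measurable]: "a \<in> borel_measurable M" "b \<in> borel_measurable M" "c \<in> borel_measurable M"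
  shows "{\<omega> \<in> space M. \<forall>x\<in>{s..t}. c \<omega> < bridge s t (a \<omega>) (b \<omega>) (f \<omega>) x} \<in> sets M" (is "?A \<in> _")
proof -
  have "?A = {\<omega> \<in> space M. \<exists>n. \<forall>x\<in>{s..t}. c \<omega> + 1 / real (Suc n) \<le> bridge s t (a \<omega>) (b \<omega>) (f \<omega>) x}"
    using bridge_gt_iff_nat[OF measurable_space[OF f] st] by blast
  also have "\<dots> \<in> sets M"
    by (intro sets.sets_Collect_countable_Ex sets_bridge_ge[OF f st]) measurable
  finally show ?thesis .
qed

text \<open>The inner power counts the interior points after m refinements; a grid with n interior
  points has n + 1 steps, hence the outer \<open>Suc\<close>.\<close>

definition refined_survival :: "(nat \<Rightarrow> real) \<Rightarrow> nat \<Rightarrow> nat \<Rightarrow> (real \<Rightarrow> real) \<Rightarrow> real" where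
  "refined_survival \<tau> k m = survival_prod ((refine ^^ m) \<tau>) (Suc (((\<lambda>k. Suc (2 * k)) ^^ m) k))"

definition grid :: "real \<Rightarrow> real \<Rightarrow> (nat \<Rightarrow> real) \<Rightarrow> nat \<Rightarrow> bool" where
  "grid s t \<tau> k \<longleftrightarrow> \<tau> 0 = s \<and> \<tau> (Suc k) = t \<and> (\<forall>i\<le>k. \<tau> i < \<tau> (Suc i))"

lemma gridD:
  assumes "grid s t \<tau> k"
  shows "\<tau> 0 = s" "\<tau> (Suc k) = t" "i \<le> k \<Longrightarrow> \<tau> i < \<tau> (Suc i)" "i \<le> j \<Longrightarrow> j \<le> Suc k \<Longrightarrow> \<tau> i \<le> \<tau> j"
    "i \<le> Suc k \<Longrightarrow> s \<le> \<tau> i" "i \<le> Suc k \<Longrightarrow> \<tau> i \<le> t" "s < t"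
proof -
  show 1: "\<tau> 0 = s" "\<tau> (Suc k) = t" "i \<le> k \<Longrightarrow> \<tau> i < \<tau> (Suc i)" for i using assms by (auto simp: grid_def)
  show 2: "i \<le> j \<Longrightarrow> j \<le> Suc k \<Longrightarrow> \<tau> i \<le> \<tau> j" for i j
  proof (induction j)
    case (Suc j)
    then show ?case using 1(3)[of j] by (auto simp: le_Suc_eq)
  qed simp
  show "i \<le> Suc k \<Longrightarrow> s \<le> \<tau> i" "i \<le> Suc k \<Longrightarrow> \<tau> i \<le> t" using 2[of 0 i] 2[of i "Suc k"] 1 by auto
  have "s \<le> \<tau> k" using 2[of 0 k] 1 by simp
  then show "s < t" using 1(3)[of k] 1(2) by simp
qed

lemma grid_refine:
  assumes "grid s t \<tau> k" shows "grid s t (refine \<tau>) (Suc (2 * k))"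
proof -
  have "refine \<tau> i < refine \<tau> (Suc i)" if "i \<le> Suc (2 * k)" for i
  proof (cases "even i")
    case True
    then obtain j where "i = 2 * j" by blast
    then show ?thesis using that gridD(3)[OF assms, of j] by simp
  next
    case False
    then obtain j where "i = Suc (2 * j)" by (auto elim: oddE)
    then show ?thesis using that gridD(3)[OF assms, of j] by simp
  qed
  moreover have "refine \<tau> (Suc (Suc (2 * k))) = t" using gridD(2)[OF assms] by simp
  ultimately show ?thesis using gridD(1)[OF assms] refine_even[of \<tau> 0] by (simp add: grid_def del: refine_even2)
qed

lemma refine_gap:
  assumes "\<And>i. i \<le> k \<Longrightarrow> \<tau> (Suc i) - \<tau> i \<le> D" "i \<le> Suc (2 * k)"
  shows "refine \<tau> (Suc i) - refine \<tau> i \<le> D / 2"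
proof (cases "even i")
  case True
  then obtain j where "i = 2 * j" by blast
  then show ?thesis using assms(1)[of j] assms(2) by simp
next
  case False
  then obtain j where j: "i = Suc (2 * j)" by (auto elim: oddE)
  then have "\<tau> (Suc j) - \<tau> j \<le> D" using assms by simp
  moreover have "\<tau> (Suc j) - (\<tau> j + \<tau> (Suc j)) / 2 = (\<tau> (Suc j) - \<tau> j) / 2" by (simp add: field_simps)
  ultimately show ?thesis unfolding j refine_odd refine_even2 by simp
qed

section \<open>Probability that a bridge stays positive\<close>

context brownian_bridge
begin

text \<open>The killed kernel is the heat kernel times a survival factor, so
  \<open>bridge_fdd\<close> applies with survival times mark as \<open>G\<close>. In the last step
  the end value b may be inserted because the bridge takes it almost surely.\<close>

lemma bridge_survival:
  assumes grid: "grid s t \<tau> k" and g [measurable]: "\<And>i. g i \<in> borel_measurable borel"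
  shows "(\<integral>\<^sup>+w. (\<Prod>i<k. g i (bridge s t a b w (\<tau> (Suc i)))) * ennreal (survival_prod \<tau> (Suc k) (bridge s t a b w)) \<partial>W)
      * ennreal (heat (t - s) (b - a)) = killed_chain \<tau> g k a b"
proof -
  note st = gridD(7)[OF grid]
  let ?X = "\<lambda>w x. bridge s t a b w x"
  let ?S = "\<lambda>i x y. survival (\<tau> (Suc i) - \<tau> i) x y"
  have gap: "0 < \<tau> (Suc i) - \<tau> i" if "i \<le> k" for i using gridD(3)[OF grid that] by simp
  have eq: "(\<integral>\<^sup>+w. (\<Prod>i<k. g i (?X w (\<tau> (Suc i)))) * ennreal (survival_prod \<tau> (Suc k) (?X w)) \<partial>W) =
    (\<integral>\<^sup>+w. (\<Prod>i<k. ennreal (?S i (?X w (\<tau> i)) (?X w (\<tau> (Suc i)))) * g i (?X w (\<tau> (Suc i)))) * ennreal (?S k (?X w (\<tau> k)) b) \<partial>W)"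
  proof (rule nn_integral_cong_AE)
    show "AE w in W. (\<Prod>i<k. g i (?X w (\<tau> (Suc i)))) * ennreal (survival_prod \<tau> (Suc k) (?X w)) =
      (\<Prod>i<k. ennreal (?S i (?X w (\<tau> i)) (?X w (\<tau> (Suc i)))) * g i (?X w (\<tau> (Suc i)))) * ennreal (?S k (?X w (\<tau> k)) b)"
      using AE_endpoints
    proof eventually_elim
      case (elim w)
      have "ennreal (survival_prod \<tau> (Suc k) (?X w)) = (\<Prod>i<Suc k. ennreal (?S i (?X w (\<tau> i)) (?X w (\<tau> (Suc i)))))"
        unfolding survival_prod_def using gap by (intro prod_ennreal[symmetric]) (simp add: survival_bounds)
      also have "\<dots> = (\<Prod>i<k. ennreal (?S i (?X w (\<tau> i)) (?X w (\<tau> (Suc i))))) * ennreal (?S k (?X w (\<tau> k)) b)"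
        using elim st gridD(2)[OF grid] by (simp add: bridge_end)
      finally show ?case by (simp add: prod.distrib mult_ac)
    qed
  qed
  have "(\<integral>\<^sup>+w. (\<Prod>i<k. ennreal (?S i (?X w (\<tau> i)) (?X w (\<tau> (Suc i)))) * g i (?X w (\<tau> (Suc i)))) * ennreal (?S k (?X w (\<tau> k)) b) \<partial>W)
      * ennreal (heat (t - s) (b - a)) =
    chain (\<lambda>i x y. ennreal (heat (\<tau> (Suc i) - \<tau> i) (y - x)) * (ennreal (?S i x y) * g i y)) lborel a k
      (\<lambda>x. ennreal (heat (t - \<tau> k) (b - x)) * ennreal (?S k x b))"
    using st gridD[OF grid] gridD(3)[OF grid, of k]
    by (intro bridge_fdd[where G="\<lambda>i x y. ennreal (?S i x y) * g i y"]) (auto simp: survival_def)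
  also have "\<dots> = killed_chain \<tau> g k a b"
  proof -
    have "ennreal (heat (\<tau> (Suc i) - \<tau> i) (y - x)) * (ennreal (?S i x y) * g i y) = weighted_killed \<tau> g i x y"
      if "i < k" for i x y
      unfolding weighted_killed_def killed_eq[OF gap[OF less_imp_le[OF that]]] by (rule mult.assoc[symmetric])
    then have "chain (\<lambda>i x y. ennreal (heat (\<tau> (Suc i) - \<tau> i) (y - x)) * (ennreal (?S i x y) * g i y)) lborel a k e =
      chain (weighted_killed \<tau> g) lborel a k e" for e
      by (intro chain_cong ext) blast
    moreover have "(\<lambda>x. ennreal (heat (t - \<tau> k) (b - x)) * ennreal (?S k x b)) = (\<lambda>x. killed (\<tau> (Suc k) - \<tau> k) x b)"
    proof -
      have "0 < t - \<tau> k" using gap[OF order_refl] unfolding gridD(2)[OF grid] .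
      then show ?thesis unfolding gridD(2)[OF grid] by (simp only: killed_eq)
    qed
    ultimately show ?thesis by (simp add: killed_chain_def)
  qed
  finally show ?thesis by (simp only: eq)
qed

text \<open>Under iterated refinement the killed chain does not change, while the survival products
  converge to the indicator of positivity.\<close>

lemma bridge_survival_limit:
  fixes a b :: real
  assumes grid: "grid s t \<tau> k" and g [measurable]: "\<And>i. g i \<in> borel_measurable borel"
  defines "H \<equiv> \<lambda>m w. refined_survival \<tau> k m (bridge s t a b w)"
  shows "\<And>m. H m \<in> borel_measurable W"
    "\<And>m. (\<integral>\<^sup>+w. (\<Prod>i<k. g i (bridge s t a b w (\<tau> (Suc i)))) * ennreal (H m w) \<partial>W) * ennreal (heat (t - s) (b - a)) = killed_chain \<tau> g k a b"
    "\<And>m w. 0 \<le> H m w \<and> H m w \<le> 1"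
    "\<And>w. w \<in> space W \<Longrightarrow> \<forall>x\<in>{s..t}. 0 < bridge s t a b w x \<Longrightarrow> (\<lambda>m. H m w) \<longlonglongrightarrow> 1"
    "\<And>w x. w \<in> space W \<Longrightarrow> x \<in> {s..t} \<Longrightarrow> bridge s t a b w x < 0 \<Longrightarrow> (\<lambda>m. H m w) \<longlonglongrightarrow> 0"
proof -
  note st = gridD(7)[OF grid]
  define T where "T m = (refine ^^ m) \<tau>" for m
  define G where "G m = (refine_weight ^^ m) g" for m
  define N where "N m = ((\<lambda>k. Suc (2 * k)) ^^ m) k" for m
  \<comment> \<open>Refinement halves the mesh and preserves both the killed chain and the product
    of the marks; only the survival product depends on m.\<close>
  have inv: "grid s t (T m) (N m) \<and> (\<forall>i\<le>N m. T m (Suc i) - T m i \<le> (t - s) / 2 ^ m) \<and> (\<forall>i. G m i \<in> borel_measurable borel) \<and>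
      killed_chain (T m) (G m) (N m) a b = killed_chain \<tau> g k a b \<and>
      (\<forall>v. (\<Prod>i<N m. G m i (v (T m (Suc i)))) = (\<Prod>i<k. g i (v (\<tau> (Suc i)))))" for m
  proof (induction m)
    case 0
    have "\<tau> (Suc i) - \<tau> i \<le> t - s" if "i \<le> k" for i
      using gridD(5)[OF grid, of i] gridD(6)[OF grid, of "Suc i"] that by auto
    then show ?case using grid by (auto simp: T_def G_def N_def)
  next
    case (Suc m)
    have "killed_chain (refine (T m)) (refine_weight (G m)) (Suc (2 * N m)) a b = killed_chain (T m) (G m) (N m) a b"
      using Suc gridD(3)[of s t "T m" "N m"] by (intro killed_chain_refine) auto
    moreover have "(\<Prod>i<Suc (2 * N m). refine_weight (G m) i (v (refine (T m) (Suc i)))) = (\<Prod>i<N m. G m i (v (T m (Suc i))))" for v :: "real \<Rightarrow> real"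
      using prod_refine_weight[where n="N m" and g="G m" and v=v and \<tau>="T m"] by simp
    moreover have "refine_weight (G m) i \<in> borel_measurable borel" for i
      using Suc by (simp add: refine_weight_def)
    moreover have "refine (T m) (Suc i) - refine (T m) i \<le> (t - s) / 2 ^ Suc m" if "i \<le> Suc (2 * N m)" for i
      using refine_gap[of "N m" "T m" "(t - s) / 2 ^ m" i] that Suc by simp
    moreover have "grid s t (refine (T m)) (Suc (2 * N m))" using Suc by (intro grid_refine) simp
    ultimately show ?case using Suc unfolding T_def G_def N_def funpow.simps comp_def by presburger
  qed
  have T: "grid s t (T m) (N m)" and gap: "i \<le> N m \<Longrightarrow> T m (Suc i) - T m i \<le> (t - s) / 2 ^ m" for i m using inv[of m] by auto
  have H_def: "H m w = survival_prod (T m) (Suc (N m)) (bridge s t a b w)" for m w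
    unfolding H_def refined_survival_def T_def N_def ..
  have inc: "T m i < T m (Suc i)" if "i < Suc (N m)" for m i using gridD(3)[OF T, of i m] that by simp
  {
    fix m
    have X: "(\<lambda>w. bridge s t a b w (T m i)) \<in> borel_measurable W" if "i \<le> Suc (N m)" for i
      using gridD(5,6)[OF T that] st by (intro measurable_bridge) (auto simp: measurable_ident_sets[OF sets_W])
    then show "H m \<in> borel_measurable W"
      unfolding H_def survival_prod_def survival_max
      by (intro borel_measurable_prod borel_measurable_diff borel_measurable_const borel_measurable_exp borel_measurable_divide borel_measurable_times borel_measurable_max borel_measurable_uminus) auto
    have "(\<integral>\<^sup>+w. (\<Prod>i<N m. G m i (bridge s t a b w (T m (Suc i)))) * ennreal (H m w) \<partial>W) * ennreal (heat (t - s) (b - a)) = killed_chain (T m) (G m) (N m) a b"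
      unfolding H_def using inv[of m] by (intro bridge_survival) auto
    moreover have "(\<Prod>i<N m. G m i (bridge s t a b w (T m (Suc i)))) = (\<Prod>i<k. g i (bridge s t a b w (\<tau> (Suc i))))" for w
      using inv[of m] by blast
    ultimately show "(\<integral>\<^sup>+w. (\<Prod>i<k. g i (bridge s t a b w (\<tau> (Suc i)))) * ennreal (H m w) \<partial>W) * ennreal (heat (t - s) (b - a)) = killed_chain \<tau> g k a b"
      using inv[of m] by simp
    show "0 \<le> H m w \<and> H m w \<le> 1" for w
      unfolding H_def using survival_prod_bounds[of "Suc (N m)" "T m"] inc by blast
  }
  {
    fix w assume w: "w \<in> space W" and pos: "\<forall>x\<in>{s..t}. 0 < bridge s t a b w x"
    have wp: "w \<in> space path_borel" using w by (simp add: space_W)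
    obtain x0 where x0: "x0 \<in> {s..t}" "\<forall>x\<in>{s..t}. bridge s t a b w x0 \<le> bridge s t a b w x"
      using continuous_attains_inf[of "{s..t}" "bridge s t a b w"] continuous_on_bridge[OF wp st] st by fastforce
    define \<mu> where "\<mu> = bridge s t a b w x0"
    have \<mu>: "\<mu> > 0" using pos x0 by (simp add: \<mu>_def)
    show "(\<lambda>m. H m w) \<longlonglongrightarrow> 1"
    proof (rule tendsto_sandwich)
      have "(\<lambda>m. 1 - (t - s) * (1 / 2) ^ m * (t - s) / (2 * \<mu> ^ 4)) \<longlonglongrightarrow> 1 - (t - s) * 0 * (t - s) / (2 * \<mu> ^ 4)"
        using \<mu> by (intro tendsto_intros LIMSEQ_power_zero) auto
      then show "(\<lambda>m. 1 - (t - s) / 2 ^ m * (t - s) / (2 * \<mu> ^ 4)) \<longlonglongrightarrow> 1"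
        by (simp add: power_divide)
      show "\<forall>\<^sub>F m in sequentially. 1 - (t - s) / 2 ^ m * (t - s) / (2 * \<mu> ^ 4) \<le> H m w"
      proof (intro always_eventually allI)
        fix m
        have "1 - (t - s) / 2 ^ m * (T m (Suc (N m)) - T m 0) / (2 * \<mu> ^ 4) \<le> H m w"
          unfolding H_def
        proof (rule survival_prod_lower_bound[OF _ \<mu>])
          show "T m i < T m (Suc i) \<and> T m (Suc i) - T m i \<le> (t - s) / 2 ^ m" if "i < Suc (N m)" for i
            using inc[OF that] gap[of i m] that by simp
          show "\<mu> \<le> bridge s t a b w (T m i)" if "i \<le> Suc (N m)" for i
            unfolding \<mu>_def using x0(2) gridD(5,6)[OF T that] by auto
        qed (use st in simp)
        then show "1 - (t - s) / 2 ^ m * (t - s) / (2 * \<mu> ^ 4) \<le> H m w"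
          using gridD(1,2)[OF T[of m]] by simp
      qed
      show "\<forall>\<^sub>F m in sequentially. H m w \<le> 1"
        unfolding H_def using survival_prod_bounds[of "Suc (N _)" "T _"] inc by (intro always_eventually allI) blast
    qed simp
  }
  {
    fix w x assume w: "w \<in> space W" and x: "x \<in> {s..t}" and neg: "bridge s t a b w x < 0"
    have wp: "w \<in> space path_borel" using w by (simp add: space_W)
    obtain d where d: "d > 0" "\<And>y. y \<in> {s..t} \<Longrightarrow> dist y x < d \<Longrightarrow> dist (bridge s t a b w y) (bridge s t a b w x) < - bridge s t a b w x"
      using continuous_on_bridge[OF wp st, of a b, unfolded continuous_on_iff] x neg
      by (metis neg_0_less_iff_less)
    \<comment> \<open>Once the mesh is below d, the grid point to the left of x is so close to x
      that the path is negative there, and one survival factor vanishes.\<close>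
    have "(\<lambda>m. (t - s) * (1 / 2) ^ m) \<longlonglongrightarrow> (t - s) * 0"
      by (intro tendsto_intros LIMSEQ_power_zero) auto
    then have "\<forall>\<^sub>F m in sequentially. (t - s) * (1 / 2) ^ m < d"
      using d by (intro order_tendstoD) auto
    then have "\<forall>\<^sub>F m in sequentially. H m w = 0"
    proof eventually_elim
      case (elim m)
      obtain i where i: "i \<le> N m" "T m i \<le> x" "x \<le> T m (Suc i)"
        using increasing_grid_cover[of "T m" x "N m"] gridD(1,2)[OF T[of m]] x by auto
      have "dist (T m i) x < d"
        using i gap[of i m] elim by (simp add: dist_real_def power_divide)
      then have "bridge s t a b w (T m i) < 0"
        using d(2)[of "T m i"] gridD(5,6)[OF T, of i m] i by (auto simp: dist_real_def)
      then have "survival (T m (Suc i) - T m i) (bridge s t a b w (T m i)) (bridge s t a b w (T m (Suc i))) = 0"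
        by (simp add: survival_def)
      then show ?case unfolding H_def survival_prod_def using i by (intro prod_zero) auto
    qed
    then show "(\<lambda>m. H m w) \<longlonglongrightarrow> 0" by (rule tendsto_eventually)
  }
qed

lemma sets_bridge_W:
  assumes "s < t"
  shows "{w \<in> space W. \<forall>x\<in>{s..t}. c \<le> bridge s t a b w x} \<in> sets W"
    "{w \<in> space W. \<forall>x\<in>{s..t}. c < bridge s t a b w x} \<in> sets W"
  using assms by (intro sets_bridge_ge sets_bridge_gt; simp add: measurable_ident_sets[OF sets_W])+

text \<open>The limit of the survival products is not controlled on paths that touch 0 without
  crossing it, so at first there is only a sandwich: strict positivity has at most, nonnegativity at
  least the claimed probability. Raising both end values by \<delta> > 0 turns nonnegativity into
  strict positivity, and continuity of \<open>survival\<close> closes the gap.\<close>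

lemma
  assumes st: "s < t"
  shows prob_bridge_pos: "prob {w \<in> space W. \<forall>x\<in>{s..t}. 0 < bridge s t a b w x} = survival (t - s) a b" (is "?A a b")
    and prob_bridge_nonneg: "prob {w \<in> space W. \<forall>x\<in>{s..t}. 0 \<le> bridge s t a b w x} = survival (t - s) a b" (is "?B a b")
proof -
  define L where "L a b = {w \<in> space W. \<forall>x\<in>{s..t}. 0 < bridge s t a b w x}" for a b
  define U where "U a b = {w \<in> space W. \<forall>x\<in>{s..t}. 0 \<le> bridge s t a b w x}" for a b
  have [measurable]: "L a b \<in> sets W" "U a b \<in> sets W" for a b
    unfolding L_def U_def using sets_bridge_W[OF st] by auto
  have LU: "prob (L a b) \<le> survival (t - s) a b \<and> survival (t - s) a b \<le> prob (U a b)" for a b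
  proof -
    have g: "grid s t (\<lambda>i. if i = 0 then s else t) 0" using st by (simp add: grid_def)
    define H where "H m w = refined_survival (\<lambda>i. if i = 0 then s else t) 0 m (bridge s t a b w)" for m w
    note H' = bridge_survival_limit[OF g, where g="\<lambda>_ _. 1" and a=a and b=b, OF borel_measurable_const, folded H_def]
    have H: "H m \<in> borel_measurable W"
      "(\<integral>\<^sup>+w. ennreal (H m w) \<partial>W) * ennreal (heat (t - s) (b - a)) = killed (t - s) a b"
      "0 \<le> H m w \<and> H m w \<le> 1" for m w
      using H'(1,3)[of m] H'(2)[of m] by (simp_all add: killed_chain_def)
    note H(1) [measurable]
    have iH: "integrable W (H m)" for m
      using H(3) by (intro integrable_const_bound[of _ 1]) auto
    have EH: "expectation (H m) = survival (t - s) a b" for m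
    proof -
      have hp: "0 < heat (t - s) (b - a)" using st by (intro heat_pos) auto
      have "ennreal (expectation (H m)) * ennreal (heat (t - s) (b - a)) = killed (t - s) a b"
        using H(2)[of m] H(3) by (simp add: nn_integral_eq_integral[OF iH])
      also have "\<dots> = ennreal (survival (t - s) a b) * ennreal (heat (t - s) (b - a))"
        using st by (simp add: killed_eq mult.commute)
      finally have "ennreal (expectation (H m) * heat (t - s) (b - a)) = ennreal (survival (t - s) a b * heat (t - s) (b - a))"
        using hp by (simp add: ennreal_mult'')
      then have "expectation (H m) * heat (t - s) (b - a) = survival (t - s) a b * heat (t - s) (b - a)"
        using hp H(3) survival_bounds[of "t - s" a b] st
        by (subst (asm) ennreal_inj) (auto intro!: mult_nonneg_nonneg integral_nonneg_AE)
      then show ?thesis using hp by simp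
    qed
    have "(\<lambda>m. expectation (\<lambda>w. indicator (L a b) w * H m w)) \<longlonglongrightarrow> expectation (\<lambda>w. indicator (L a b) w * 1)"
    proof (rule integral_dominated_convergence[where w="\<lambda>_. 1"])
      show "AE w in W. (\<lambda>m. indicator (L a b) w * H m w) \<longlonglongrightarrow> indicator (L a b) w * (1::real)"
        using H'(4) by (intro AE_I2) (auto simp: indicator_def L_def)
    qed (use H(3) in \<open>auto simp: indicator_def\<close>)
    moreover have "expectation (\<lambda>w. indicator (L a b) w * H m w) \<le> survival (t - s) a b" for m
      unfolding EH[of m, symmetric] using H(3)
      by (intro integral_mono iH integrable_const_bound[of _ 1]) (auto simp: indicator_def)
    ultimately have 1: "prob (L a b) \<le> survival (t - s) a b"
      by (intro LIMSEQ_le_const2[of "\<lambda>m. expectation (\<lambda>w. indicator (L a b) w * H m w)"]) auto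
    have "(\<lambda>m. expectation (\<lambda>w. indicator (space W - U a b) w * H m w)) \<longlonglongrightarrow> expectation (\<lambda>w. 0)"
    proof (rule integral_dominated_convergence[where w="\<lambda>_. 1"])
      show "AE w in W. (\<lambda>m. indicator (space W - U a b) w * H m w) \<longlonglongrightarrow> 0"
        using H'(5) by (intro AE_I2) (auto simp: indicator_def U_def not_le)
    qed (use H(3) in \<open>auto simp: indicator_def\<close>)
    then have lim: "(\<lambda>m. prob (U a b) + expectation (\<lambda>w. indicator (space W - U a b) w * H m w)) \<longlonglongrightarrow> prob (U a b) + 0"
      by (intro tendsto_intros) simp
    have "survival (t - s) a b \<le> prob (U a b) + expectation (\<lambda>w. indicator (space W - U a b) w * H m w)" for m
    proof -
      have "expectation (H m) \<le> expectation (\<lambda>w. indicator (U a b) w + indicator (space W - U a b) w * H m w)"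
      proof (intro integral_mono iH integrable_const_bound[of _ 2])
        have "H m x \<le> 2" for x using H(3)[of m x] by simp
        then show "AE x in W. norm (indicator (U a b) x + indicator (space W - U a b) x * H m x) \<le> 2"
          using H(3) by (auto simp: indicator_def)
      qed (use H(3) in \<open>auto simp: indicator_def\<close>)
      also have "\<dots> = prob (U a b) + expectation (\<lambda>w. indicator (space W - U a b) w * H m w)"
        using H(3) by (subst Bochner_Integration.integral_add) (auto intro!: integrable_const_bound[of _ 1] simp: indicator_def)
      finally show ?thesis by (simp add: EH)
    qed
    then have 2: "survival (t - s) a b \<le> prob (U a b)"
      using LIMSEQ_le_const[OF lim] by auto
    show ?thesis using 1 2 by simp
  qed
  have UL: "prob (U a b) \<le> prob (L (a + \<delta>) (b + \<delta>))" if "\<delta> > 0" for a b \<delta>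
  proof (rule finite_measure_mono)
    show "U a b \<subseteq> L (a + \<delta>) (b + \<delta>)"
      using that bridge_add[OF st, of a \<delta> b] by (auto simp: U_def L_def add_nonneg_pos)
  qed measurable
  have lim: "(\<lambda>n. survival (t - s) (a + c * inverse (real (Suc n))) (b + c * inverse (real (Suc n)))) \<longlonglongrightarrow> survival (t - s) a b" for a b c
  proof -
    have "(\<lambda>n. survival (t - s) (a + c * inverse (real (Suc n))) (b + c * inverse (real (Suc n)))) \<longlonglongrightarrow> survival (t - s) (a + c * 0) (b + c * 0)"
      using st by (intro tendsto_intros LIMSEQ_inverse_real_of_nat) auto
    then show ?thesis by simp
  qed
  have "prob (U a b) \<le> survival (t - s) a b" for a b
  proof (rule LIMSEQ_le_const[OF lim[of a 1 b]])
    show "\<exists>N. \<forall>n\<ge>N. prob (U a b) \<le> survival (t - s) (a + 1 * inverse (real (Suc n))) (b + 1 * inverse (real (Suc n)))"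
    proof (intro exI allI impI)
      fix n :: nat
      have "prob (U a b) \<le> prob (L (a + inverse (real (Suc n))) (b + inverse (real (Suc n))))" by (intro UL) simp
      also have "\<dots> \<le> survival (t - s) (a + 1 * inverse (real (Suc n))) (b + 1 * inverse (real (Suc n)))"
        using LU by (simp only: mult_1_left)
      finally show "prob (U a b) \<le> survival (t - s) (a + 1 * inverse (real (Suc n))) (b + 1 * inverse (real (Suc n)))" .
    qed
  qed
  moreover have "survival (t - s) a b \<le> prob (L a b)" for a b
  proof (rule LIMSEQ_le_const2[OF lim[of a "- 1" b]])
    have "survival (t - s) (a + (- 1) * inverse (real (Suc n))) (b + (- 1) * inverse (real (Suc n))) \<le> prob (L a b)" for n
    proof -
      have "survival (t - s) (a + (- 1) * inverse (real (Suc n))) (b + (- 1) * inverse (real (Suc n))) \<le>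
        prob (U (a + (- 1) * inverse (real (Suc n))) (b + (- 1) * inverse (real (Suc n))))" using LU by blast
      also have "\<dots> \<le> prob (L (a + (- 1) * inverse (real (Suc n)) + inverse (real (Suc n))) (b + (- 1) * inverse (real (Suc n)) + inverse (real (Suc n))))"
        by (intro UL) simp
      finally show ?thesis by simp
    qed
    then show "\<exists>N. \<forall>n\<ge>N. survival (t - s) (a + (- 1) * inverse (real (Suc n))) (b + (- 1) * inverse (real (Suc n))) \<le> prob (L a b)" by blast
  qed
  ultimately show "?A a b" "?B a b"
    using LU unfolding L_def[symmetric] U_def[symmetric] by (meson order.antisym order.trans)+
qed

text \<open>The two events have equal probability, so the minimum of a bridge almost surely differs
  from any prescribed level.\<close>

lemma AE_bridge_min:
  assumes st: "s < t"
  shows "AE w in W. (\<forall>x\<in>{s..t}. c \<le> bridge s t a b w x) \<longrightarrow> (\<forall>x\<in>{s..t}. c < bridge s t a b w x)"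
proof -
  let ?U = "{w \<in> space W. \<forall>x\<in>{s..t}. c \<le> bridge s t a b w x}" and ?L = "{w \<in> space W. \<forall>x\<in>{s..t}. c < bridge s t a b w x}"
  have "bridge s t a b w x = bridge s t (a - c) (b - c) w x + c" for w x
    using bridge_add[OF st, of "a - c" c "b - c" w x] by simp
  then have "?U = {w \<in> space W. \<forall>x\<in>{s..t}. 0 \<le> bridge s t (a - c) (b - c) w x}" "?L = {w \<in> space W. \<forall>x\<in>{s..t}. 0 < bridge s t (a - c) (b - c) w x}"
    by simp_all
  then have "prob ?U = prob ?L" using prob_bridge_pos[OF st] prob_bridge_nonneg[OF st] by simp
  then have "prob (?U - ?L) = 0"
    using sets_bridge_W[OF st] by (subst finite_measure_Diff) (auto intro: less_imp_le)
  then have "AE w in W. w \<notin> ?U - ?L"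
    using sets_bridge_W[OF st] by (subst (asm) prob_eq_0) auto
  then show ?thesis using AE_space by eventually_elim blast
qed

text \<open>Dominated convergence under refinement; the paths with minimum exactly 0, on which the
  survival products are not controlled, form a null set.\<close>

lemma bridge_positive_fdd:
  assumes grid: "grid s t \<tau> k" and g [measurable]: "\<And>i. g i \<in> borel_measurable borel" and g1: "\<And>i x. g i x \<le> 1"
  shows "(\<integral>\<^sup>+w. (\<Prod>i<k. g i (bridge s t a b w (\<tau> (Suc i)))) * indicator {w. \<forall>x\<in>{s..t}. 0 < bridge s t a b w x} w \<partial>W)
      * ennreal (heat (t - s) (b - a)) = killed_chain \<tau> g k a b"
proof -
  note st = gridD(7)[OF grid]
  define H where "H m w = refined_survival \<tau> k m (bridge s t a b w)" for m w
  note H = bridge_survival_limit[where g=g and a=a and b=b, OF grid g, folded H_def]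
  note H(1) [measurable]
  define P where "P w = (\<Prod>i<k. g i (bridge s t a b w (\<tau> (Suc i))))" for w
  have X: "(\<lambda>w. bridge s t a b w (\<tau> i)) \<in> borel_measurable W" if "i \<le> Suc k" for i
    using gridD(5,6)[OF grid that] st by (intro measurable_bridge) (auto simp: measurable_ident_sets[OF sets_W])
  have [measurable]: "P \<in> borel_measurable W"
    unfolding P_def by (intro borel_measurable_prod_ennreal measurable_compose[OF X g]) auto
  have P1: "P w \<le> 1" for w unfolding P_def by (intro prod_le_1) (simp add: g1)
  have "(\<lambda>m. \<integral>\<^sup>+w. P w * ennreal (H m w) \<partial>W) \<longlonglongrightarrow> (\<integral>\<^sup>+w. P w * indicator {w. \<forall>x\<in>{s..t}. 0 < bridge s t a b w x} w \<partial>W)"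
  proof (rule nn_integral_dominated_convergence[where w="\<lambda>_. 1"])
    have "(\<lambda>w. indicator {w \<in> space W. \<forall>x\<in>{s..t}. 0 < bridge s t a b w x} w :: ennreal) \<in> borel_measurable W"
      using sets_bridge_W[OF st] by simp
    then have "(\<lambda>w. P w * indicator {w \<in> space W. \<forall>x\<in>{s..t}. 0 < bridge s t a b w x} w) \<in> borel_measurable W" by simp
    then show "(\<lambda>w. P w * indicator {w. \<forall>x\<in>{s..t}. 0 < bridge s t a b w x} w) \<in> borel_measurable W"
      by (rule measurable_cong[THEN iffD1, rotated]) (auto simp: indicator_def)
    show "AE w in W. P w * ennreal (H m w) \<le> 1" for m
    proof (intro AE_I2)
      fix w
      have "P w * ennreal (H m w) \<le> 1 * 1" using P1 H(3)[of m w] by (intro mult_mono) auto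
      then show "P w * ennreal (H m w) \<le> 1" by simp
    qed
    show "AE w in W. (\<lambda>m. P w * ennreal (H m w)) \<longlonglongrightarrow> P w * indicator {w. \<forall>x\<in>{s..t}. 0 < bridge s t a b w x} w"
      using AE_bridge_min[OF st, of 0 a b] AE_space
    proof eventually_elim
      case (elim w)
      have "(\<lambda>m. H m w) \<longlonglongrightarrow> indicator {w. \<forall>x\<in>{s..t}. 0 < bridge s t a b w x} w"
      proof (cases "\<forall>x\<in>{s..t}. 0 < bridge s t a b w x")
        case False
        then obtain x where "x \<in> {s..t}" "bridge s t a b w x < 0" using elim(1) by (meson not_le)
        then show ?thesis using H(5)[OF elim(2)] False by simp
      qed (use H(4)[OF elim(2)] in simp)
      then have "(\<lambda>m. ennreal (H m w)) \<longlonglongrightarrow> ennreal (indicator {w. \<forall>x\<in>{s..t}. 0 < bridge s t a b w x} w)"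
        by (rule tendsto_ennrealI)
      then show ?case using P1[of w]
        by (intro ennreal_tendsto_cmult) (auto simp: ennreal_indicator less_top[symmetric] top_unique)
    qed
  qed (auto simp: emeasure_space_1)
  moreover have hp: "0 < heat (t - s) (b - a)" using st by (intro heat_pos) auto
  ultimately have "(\<lambda>m. (\<integral>\<^sup>+w. P w * ennreal (H m w) \<partial>W) * ennreal (heat (t - s) (b - a))) \<longlonglongrightarrow>
    (\<integral>\<^sup>+w. P w * indicator {w. \<forall>x\<in>{s..t}. 0 < bridge s t a b w x} w \<partial>W) * ennreal (heat (t - s) (b - a))"
    unfolding mult.commute[of _ "ennreal (heat (t - s) (b - a))"] by (intro ennreal_tendsto_cmult) auto
  then show ?thesis
    unfolding P_def H(2) by (rule LIMSEQ_unique[OF _ tendsto_const, symmetric, THEN sym])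
qed

end

section \<open>Occupation measure and minimum of the bridge\<close>

abbreviation unit_lborel :: "real measure" where
  "unit_lborel \<equiv> density lborel (indicator {0..1})"

interpretation unit_lborel: prob_space unit_lborel
  by (intro prob_spaceI) (simp add: emeasure_density)

lemma AE_unit_lborel: "AE x in unit_lborel. 0 < x \<and> x < 1"
proof -
  have "AE x in lborel. x \<in> {0..1} \<longrightarrow> 0 < x \<and> x < (1::real)"
    using AE_lborel_singleton[of 0] AE_lborel_singleton[of 1] by eventually_elim auto
  then show ?thesis by (subst AE_density) (auto simp: indicator_def elim: eventually_mono)
qed

lemma measurable_eval_pair:
  "(\<lambda>(w, u). w u) \<in> borel_measurable (path_borel \<Otimes>\<^sub>M borel)"
proof -
  have [measurable]: "(\<lambda>\<omega>. fst \<omega> (max 0 (min 1 (snd \<omega>)))) \<in> borel_measurable (path_borel \<Otimes>\<^sub>M (borel :: real measure))"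
    by (intro measurable_path_eval_pair[where f=fst]) auto
  \<comment> \<open>Paths equal \<open>undefined\<close> outside [0,1], so joint measurability
    extends to all real times.\<close>
  have "(\<lambda>\<omega>. if 0 \<le> snd \<omega> \<and> snd \<omega> \<le> 1 then fst \<omega> (max 0 (min 1 (snd \<omega>))) else undefined)
    \<in> borel_measurable (path_borel \<Otimes>\<^sub>M (borel :: real measure))"
    by measurable
  also have "?this \<longleftrightarrow> (\<lambda>(w, u). w u) \<in> borel_measurable (path_borel \<Otimes>\<^sub>M (borel :: real measure))"
    by (intro measurable_cong) (auto simp: space_pair_measure space_path_borel extensional_def)
  finally show ?thesis .
qed

lemma measurable_eval_compose:
  assumes "f \<in> measurable M path_borel" "u \<in> borel_measurable M"
  shows "(\<lambda>\<omega>. f \<omega> (u \<omega>)) \<in> borel_measurable M"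
  using measurable_compose[OF measurable_Pair[OF assms] measurable_eval_pair] by simp

lemma measurable_path: "w \<in> space path_borel \<Longrightarrow> w \<in> borel_measurable borel"
  using measurable_Pair2[OF measurable_eval_pair, of w] by simp

definition path_inf :: "real \<Rightarrow> real \<Rightarrow> (real \<Rightarrow> real) \<Rightarrow> real" where
  "path_inf p q w = (INF x\<in>{p..q}. w x)"

lemma path_inf_attained:
  assumes "continuous_on {p..q} w" "p \<le> q"
  obtains x where "x \<in> {p..q}" "path_inf p q w = w x" "\<forall>y\<in>{p..q}. w x \<le> w y"
proof -
  obtain x where x: "x \<in> {p..q}" "\<forall>y\<in>{p..q}. w x \<le> w y"
    using continuous_attains_inf[of "{p..q}" w] assms by fastforce
  then have "path_inf p q w = w x"
    unfolding path_inf_def by (intro cInf_eq_minimum) auto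
  then show ?thesis using that x by blast
qed

lemma measurable_path_inf:
  assumes "0 \<le> p" "p < q" "q \<le> 1"
  shows "path_inf p q \<in> borel_measurable path_borel"
proof (rule borel_measurableI_ge)
  fix c
  have "{w \<in> space path_borel. c \<le> path_inf p q w} = {w \<in> space path_borel. \<forall>x\<in>\<rat> \<inter> {p<..<q}. c \<le> w x}"
  proof (rule Collect_cong, rule conj_cong[OF refl])
    fix w assume w: "w \<in> space path_borel"
    have c: "continuous_on {p..q} w"
      using path_borel_continuous[OF w] assms by (auto elim: continuous_on_subset)
    obtain x where "x \<in> {p..q}" "path_inf p q w = w x" "\<forall>y\<in>{p..q}. w x \<le> w y"
      using path_inf_attained[OF c less_imp_le[OF assms(2)]] by blast
    then have "c \<le> path_inf p q w \<longleftrightarrow> (\<forall>x\<in>{p..q}. c \<le> w x)" by (metis order_trans)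
    then show "c \<le> path_inf p q w \<longleftrightarrow> (\<forall>x\<in>\<rat> \<inter> {p<..<q}. c \<le> w x)"
      using continuous_ge_iff_rational[OF c assms(2)] by simp
  qed
  also have "\<dots> \<in> sets path_borel"
  proof (intro sets.sets_Collect_countable_All')
    show "countable (\<rat> \<inter> {p<..<q})" using countable_rat by blast
    fix x assume "x \<in> \<rat> \<inter> {p<..<q}"
    then have [measurable]: "(\<lambda>w. w x) \<in> borel_measurable path_borel"
      using assms by (intro measurable_path_eval) auto
    show "{w \<in> space path_borel. c \<le> w x} \<in> sets path_borel" by measurable
  qed
  finally show "{w \<in> space path_borel. c \<le> path_inf p q w} \<in> sets path_borel" .
qed

text \<open>The almost sure properties that make the concentration argument deterministic. Absence
  of occupation atoms makes the occupation distribution function uniform at a uniform time, and the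
  strict interior minimum is where the weights accumulate.\<close>

definition generic_path :: "(real \<Rightarrow> real) \<Rightarrow> real \<Rightarrow> bool" where
  "generic_path w u \<longleftrightarrow> w \<in> space path_borel \<and> w 0 = 0 \<and> w 1 = 0 \<and>
     (\<forall>y. measure unit_lborel {x. w x = y} = 0) \<and>
     0 < u \<and> u < 1 \<and> (\<forall>x\<in>{0..1}. x \<noteq> u \<longrightarrow> w u < w x)"

section \<open>Almost sure properties of bridge paths\<close>

context brownian_bridge
begin

lemma AE_eval_neq:
  assumes "0 < s" "s < t" "t < 1"
  shows "AE w in W. w s \<noteq> w t"
proof -
  define v where "v = (\<Sum>r\<in>{s, t}. \<Sum>r'\<in>{s, t}. (if r = s then 1 else - 1) * (if r' = s then 1 else - 1) * (min r r' - r * r'))"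
  have "\<forall>I c. finite I \<and> I \<subseteq> {0..1} \<longrightarrow> distr W borel (\<lambda>w. \<Sum>t\<in>I. c t * w t) =
    centred_normal (\<Sum>s\<in>I. \<Sum>t\<in>I. c s * c t * (min s t - s * t))"
    using law unfolding brownian_bridge_law_def by blast
  from this[rule_format, of "{s, t}" "\<lambda>r. if r = s then 1 else - 1"]
  have d: "distr W borel (\<lambda>w. w s - w t) = centred_normal v"
    using assms unfolding v_def by simp
  have "v = (t - s) * (1 - (t - s))"
    using assms by (simp add: v_def algebra_simps)
  then have v: "v > 0" using assms by simp
  have m: "(\<lambda>w. w s - w t) \<in> borel_measurable W"
    using assms by (intro borel_measurable_diff measurable_eval) auto
  have "AE x in centred_normal v. x \<noteq> 0"
    using v AE_lborel_singleton[of 0] unfolding centred_normal_def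
    by (simp, subst AE_density) (auto elim: eventually_mono)
  then have "AE w in W. w s - w t \<noteq> 0"
    unfolding d[symmetric] using m by (subst (asm) AE_distr_iff) auto
  then show ?thesis by eventually_elim simp
qed

text \<open>By Fubini almost every path satisfies w s \<noteq> w t for almost every pair of times,
  while an atom of mass m would produce a set of pairs of measure m^2 violating this.\<close>

lemma AE_no_atoms: "AE w in W. \<forall>y. measure unit_lborel {x. w x = y} = 0"
proof -
  note measurable_eval_compose [measurable (raw)]
  let ?e = "\<lambda>w s t. (if w s = w t then 1 else 0 :: ennreal)"
  have W_path: "(\<lambda>x. x) \<in> measurable W path_borel" by (simp add: measurable_ident_sets[OF sets_W])
  have m3 [measurable]: "(\<lambda>p. ?e (fst p) (fst (snd p)) (snd (snd p))) \<in> borel_measurable (W \<Otimes>\<^sub>M (unit_lborel \<Otimes>\<^sub>M unit_lborel))"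
    using measurable_compose[OF measurable_fst W_path] by measurable
  interpret U2: pair_prob_space unit_lborel unit_lborel ..
  interpret WU: pair_sigma_finite W "unit_lborel \<Otimes>\<^sub>M unit_lborel" ..
  have "(\<integral>\<^sup>+w. \<integral>\<^sup>+p. ?e w (fst p) (snd p) \<partial>(unit_lborel \<Otimes>\<^sub>M unit_lborel) \<partial>W) =
    (\<integral>\<^sup>+p. \<integral>\<^sup>+w. ?e w (fst p) (snd p) \<partial>W \<partial>(unit_lborel \<Otimes>\<^sub>M unit_lborel))"
    using WU.Fubini'[of "\<lambda>w p. ?e w (fst p) (snd p)"] m3 by (simp add: split_beta)
  also have "\<dots> = (\<integral>\<^sup>+s. \<integral>\<^sup>+t. \<integral>\<^sup>+w. ?e w s t \<partial>W \<partial>unit_lborel \<partial>unit_lborel)"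
  proof -
    have "(\<lambda>p. \<integral>\<^sup>+w. ?e w (fst p) (snd p) \<partial>W) \<in> borel_measurable (unit_lborel \<Otimes>\<^sub>M unit_lborel)"
      using measurable_compose[OF measurable_snd W_path] by measurable
    from unit_lborel.nn_integral_fst[OF this] show ?thesis by simp
  qed
  also have "\<dots> = (\<integral>\<^sup>+s. 0 \<partial>unit_lborel)"
  proof (rule nn_integral_cong_AE)
    show "AE s in unit_lborel. (\<integral>\<^sup>+t. \<integral>\<^sup>+w. ?e w s t \<partial>W \<partial>unit_lborel) = 0"
      using AE_unit_lborel
    proof eventually_elim
      case s: (elim s)
      have "AE t in unit_lborel. t \<noteq> s"
        using AE_lborel_singleton[of s] by (subst AE_density) (auto elim: eventually_mono)
      then have "AE t in unit_lborel. (\<integral>\<^sup>+w. ?e w s t \<partial>W) = 0"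
        using AE_unit_lborel
      proof eventually_elim
        case t: (elim t)
        have "AE w in W. w s \<noteq> w t"
        proof (cases "s < t")
          case True
          then show ?thesis using AE_eval_neq[of s t] s t by simp
        next
          case False
          then have "AE w in W. w t \<noteq> w s" using AE_eval_neq[of t s] s t by simp
          then show ?thesis by eventually_elim simp
        qed
        then have "(\<integral>\<^sup>+w. ?e w s t \<partial>W) = (\<integral>\<^sup>+w. 0 \<partial>W)"
          by (intro nn_integral_cong_AE) (auto elim: eventually_mono)
        then show ?case by simp
      qed
      then have "(\<integral>\<^sup>+t. \<integral>\<^sup>+w. ?e w s t \<partial>W \<partial>unit_lborel) = (\<integral>\<^sup>+t. 0 \<partial>unit_lborel)"
        by (rule nn_integral_cong_AE)
      then show ?case by simp
    qed
  qed
  finally have "(\<integral>\<^sup>+w. \<integral>\<^sup>+p. ?e w (fst p) (snd p) \<partial>(unit_lborel \<Otimes>\<^sub>M unit_lborel) \<partial>W) = 0" by simp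
  moreover have "(\<lambda>w. \<integral>\<^sup>+p. ?e w (fst p) (snd p) \<partial>(unit_lborel \<Otimes>\<^sub>M unit_lborel)) \<in> borel_measurable W"
    using measurable_compose[OF measurable_fst W_path] by measurable
  ultimately have "AE w in W. (\<integral>\<^sup>+p. ?e w (fst p) (snd p) \<partial>(unit_lborel \<Otimes>\<^sub>M unit_lborel)) = 0"
    by (subst (asm) nn_integral_0_iff_AE) auto
  then show ?thesis using AE_space
  proof eventually_elim
    case (elim w)
    have w [measurable]: "w \<in> borel_measurable borel" using elim(2) by (intro measurable_path) (simp add: space_W)
    show ?case
    proof
      fix y
      define S where "S = {x. w x = y}"
      have S [measurable]: "S \<in> sets borel" unfolding S_def by measurable
      have "emeasure unit_lborel S * emeasure unit_lborel S = emeasure (unit_lborel \<Otimes>\<^sub>M unit_lborel) (S \<times> S)"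
        by (rule unit_lborel.emeasure_pair_measure_Times[symmetric]) simp_all
      also have "\<dots> = (\<integral>\<^sup>+p. indicator (S \<times> S) p \<partial>(unit_lborel \<Otimes>\<^sub>M unit_lborel))" by simp
      also have "\<dots> \<le> (\<integral>\<^sup>+p. ?e w (fst p) (snd p) \<partial>(unit_lborel \<Otimes>\<^sub>M unit_lborel))"
        by (intro nn_integral_mono) (auto simp: indicator_def S_def)
      finally have "emeasure unit_lborel S = 0" using elim(1) by simp
      then show "measure unit_lborel {x. w x = y} = 0" by (simp add: S_def measure_def)
    qed
  qed
qed

text \<open>Given the path outside [p,q], the outer minimum is a fixed level, and the minimum of the
  spliced bridge avoids it almost surely.\<close>

lemma AE_path_inf_neq:
  assumes pq: "0 < p" "p < q" "q < 1"
  shows "AE w in W. path_inf p q w \<noteq> min (path_inf 0 p w) (path_inf q 1 w)"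
proof -
  have [measurable]: "path_inf p q \<in> borel_measurable path_borel" "path_inf 0 p \<in> borel_measurable path_borel"
    "path_inf q 1 \<in> borel_measurable path_borel"
    using pq by (intro measurable_path_inf; simp)+
  let ?f = "\<lambda>w. (if path_inf p q w = min (path_inf 0 p w) (path_inf q 1 w) then 1 else 0 :: ennreal)"
  have f: "?f \<in> borel_measurable path_borel" by measurable
  have "(\<integral>\<^sup>+w. ?f w \<partial>W) = (\<integral>\<^sup>+w. \<integral>\<^sup>+v. ?f (splice p q w v) \<partial>W \<partial>W)"
    using pq by (intro nn_integral_splice f) auto
  also have "\<dots> = (\<integral>\<^sup>+w. 0 \<partial>W)"
  proof (rule nn_integral_cong)
    fix w assume w: "w \<in> space W"
    define m where "m = min (path_inf 0 p w) (path_inf q 1 w)"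
    have "(\<integral>\<^sup>+v. ?f (splice p q w v) \<partial>W) = (\<integral>\<^sup>+v. 0 \<partial>W)"
    proof (rule nn_integral_cong_AE)
      show "AE v in W. ?f (splice p q w v) = 0"
        using AE_endpoints AE_bridge_min[OF pq(2), of m "w p" "w q"] AE_space
      proof eventually_elim
        case (elim v)
        have in_out: "splice p q w v x = w x" if "x \<in> {0..1}" "x \<le> p \<or> q \<le> x" for x
          using that pq elim(1) by (auto simp: splice_def min_def max_def bridge_start bridge_end)
        have "path_inf 0 p (splice p q w v) = path_inf 0 p w" "path_inf q 1 (splice p q w v) = path_inf q 1 w"
          unfolding path_inf_def using in_out pq by (auto intro!: INF_cong)
        then have 1: "min (path_inf 0 p (splice p q w v)) (path_inf q 1 (splice p q w v)) = m" by (simp add: m_def)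
        have "splice p q w v x = bridge p q (w p) (w q) v x" if "x \<in> {p..q}" for x
          using that pq by (auto simp: splice_def min_def max_def)
        then have 2: "path_inf p q (splice p q w v) = path_inf p q (bridge p q (w p) (w q) v)"
          unfolding path_inf_def by (auto intro!: INF_cong)
        have "continuous_on {p..q} (bridge p q (w p) (w q) v)"
          using elim(3) pq by (intro continuous_on_bridge) (auto simp: space_W)
        then obtain x where "x \<in> {p..q}" "path_inf p q (bridge p q (w p) (w q) v) = bridge p q (w p) (w q) v x"
          "\<forall>y\<in>{p..q}. bridge p q (w p) (w q) v x \<le> bridge p q (w p) (w q) v y"
          by (rule path_inf_attained[OF _ less_imp_le[OF pq(2)]])
        then have "path_inf p q (bridge p q (w p) (w q) v) \<noteq> m" using elim(2) by (metis less_irrefl)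
        then show ?case using 1 2 by simp
      qed
    qed
    then show "(\<integral>\<^sup>+v. ?f (splice p q w v) \<partial>W) = 0" by simp
  qed
  finally have "(\<integral>\<^sup>+w. ?f w \<partial>W) = 0" by simp
  then have "AE w in W. ?f w = 0"
    using f by (subst (asm) nn_integral_0_iff_AE) auto
  then show ?thesis by eventually_elim (auto split: if_splits)
qed

text \<open>For two minimisers x < y there are rationals with x < p < y < q < 1, and the minimum
  over [p,q] would equal the minimum outside. The minimiser is interior because the path is negative
  somewhere: a bridge from 0 to 0 stays nonnegative with probability \<open>survival 1 0 0\<close>,
  which is 0.\<close>

lemma AE_generic_path: "AE w in W. \<exists>u. generic_path w u"
proof -
  have neg: "AE w in W. \<exists>x\<in>{0..1}. w x < 0"
  proof -
    have b: "bridge 0 1 0 0 w x = w x" for w x by (simp add: bridge_def)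
    have "prob {w \<in> space W. \<forall>x\<in>{0..1}. 0 \<le> w x} = 0"
      using prob_bridge_nonneg[of 0 1 0 0] by (simp add: b survival_def)
    moreover have "{w \<in> space W. \<forall>x\<in>{0..1}. 0 \<le> w x} \<in> events"
      using sets_bridge_W(1)[of 0 1 0 0 0] by (simp add: b)
    ultimately have "AE w in W. w \<notin> {w \<in> space W. \<forall>x\<in>{0..1}. 0 \<le> w x}"
      by (subst (asm) prob_eq_0) auto
    then show ?thesis using AE_space by eventually_elim (auto simp: not_le)
  qed
  have "AE w in W. \<forall>p\<in>\<rat>. \<forall>q\<in>\<rat>. 0 < p \<and> p < q \<and> q < 1 \<longrightarrow> path_inf p q w \<noteq> min (path_inf 0 p w) (path_inf q 1 w)"
    unfolding AE_ball_countable[OF countable_rat]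
    using AE_path_inf_neq by (intro ballI AE_impI) auto
  then show ?thesis using neg AE_no_atoms AE_endpoints AE_space
  proof eventually_elim
    case (elim w)
    have ws: "w \<in> space path_borel" using elim by (simp add: space_W)
    have cont: "continuous_on {p..q} w" if "0 \<le> p" "q \<le> 1" for p q
      using path_borel_continuous[OF ws] that by (auto elim!: continuous_on_subset)
    obtain u where u: "u \<in> {0..1}" "path_inf 0 1 w = w u" "\<forall>y\<in>{0..1}. w u \<le> w y"
      by (rule path_inf_attained[OF cont[of 0 1]]) simp_all
    note u = u(1) u(3)[rule_format]
    have wu: "w u < 0" using elim(2) u(2) by (meson le_less_trans)
    have inner: "0 < x \<and> x < 1" if "x \<in> {0..1}" "w x = w u" for x
      using that wu elim(4) by (cases "x = 0"; cases "x = 1") auto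
    have sep: "\<not> (0 < x \<and> x < y \<and> y < 1 \<and> w x = w u \<and> w y = w u)" for x y
    proof
      assume xy: "0 < x \<and> x < y \<and> y < 1 \<and> w x = w u \<and> w y = w u"
      obtain p where p: "p \<in> \<rat>" "x < p" "p < y" using Rats_dense_in_real[of x y] xy by auto
      obtain q where q: "q \<in> \<rat>" "y < q" "q < 1" using Rats_dense_in_real[of y 1] xy by auto
      have low: "w u \<le> path_inf r r' w" if rr: "0 \<le> r" "r < r'" "r' \<le> 1" for r r'
      proof -
        obtain z where "z \<in> {r..r'}" "path_inf r r' w = w z" "\<forall>y\<in>{r..r'}. w z \<le> w y"
          by (rule path_inf_attained[OF cont[OF rr(1,3)] less_imp_le[OF rr(2)]])
        then show ?thesis using u(2)[of z] rr by auto
      qed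
      have att: "path_inf r r' w \<le> w z" if rr: "0 \<le> r" "r < r'" "r' \<le> 1" "z \<in> {r..r'}" for r r' z
      proof -
        obtain z' where "z' \<in> {r..r'}" "path_inf r r' w = w z'" "\<forall>y\<in>{r..r'}. w z' \<le> w y"
          by (rule path_inf_attained[OF cont[OF rr(1,3)] less_imp_le[OF rr(2)]])
        then show ?thesis using rr by simp
      qed
      have "path_inf p q w = w u" using low[of p q] att[of p q y] p q xy by auto
      moreover have "path_inf 0 p w = w u" using low[of 0 p] att[of 0 p x] p q xy by auto
      moreover have "w u \<le> path_inf q 1 w" using low[of q 1] p q xy by auto
      ultimately have "path_inf p q w = min (path_inf 0 p w) (path_inf q 1 w)" by simp
      then show False using elim(1) p q xy by auto
    qed
    have "w u < w x" if x: "x \<in> {0..1}" "x \<noteq> u" for x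
    proof (rule ccontr)
      assume "\<not> w u < w x"
      then have eq: "w x = w u" using u(2)[of x] x by simp
      show False using sep[of x u] sep[of u x] inner[of x] inner[of u] x u(1) eq by (cases "x < u") auto
    qed
    then show ?case using ws elim inner[of u] u(1) unfolding generic_path_def by blast
  qed
qed

end

section \<open>Concentration at the Vervaat transform\<close>

definition occupation :: "(real \<Rightarrow> real) \<Rightarrow> real \<Rightarrow> real" where
  "occupation w y = measure unit_lborel {x. w x \<le> y}"

text \<open>The factor 2 \<kappa> makes this nearly a probability density in v: over [0,1] it
  integrates to 1 - exp (- 2 \<kappa>) if the occupation measure of w has no atoms.\<close>

definition level_weight :: "real \<Rightarrow> (real \<Rightarrow> real) \<Rightarrow> real \<Rightarrow> real" where
  "level_weight \<kappa> w v = 2 * \<kappa> * exp (- 2 * \<kappa> * occupation w (w v))"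

lemma norm_integral_le_integral:
  fixes f :: "'a \<Rightarrow> 'b::{banach, second_countable_topology}"
  assumes "integrable M f" "integrable M g" "AE x in M. norm (f x) \<le> g x"
  shows "norm (\<integral>x. f x \<partial>M) \<le> (\<integral>x. g x \<partial>M)"
  using assms by (intro order_trans[OF integral_norm_bound integral_mono_AE]) auto

lemma occupation_bounds: "0 \<le> occupation w y" "occupation w y \<le> 1"
  by (simp_all add: occupation_def)

lemma occupation_integral:
  assumes "w \<in> space path_borel"
  shows "occupation w y = (\<integral>x. (if w x \<le> y then 1 else 0) \<partial>unit_lborel)"
proof -
  note measurable_path[OF assms, measurable]
  have "occupation w y = (\<integral>x. indicator {x. w x \<le> y} x \<partial>unit_lborel)"
    unfolding occupation_def by simp
  also have "\<dots> = (\<integral>x. (if w x \<le> y then 1 else 0) \<partial>unit_lborel)"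
    by (intro Bochner_Integration.integral_cong) (auto simp: indicator_def)
  finally show ?thesis .
qed

lemma penalty_weight_occupation:
  assumes "w \<in> space path_borel"
  shows "penalty_weight \<kappa> w = exp (- 2 * \<kappa> * occupation w 0)"
proof -
  note measurable_path[OF assms, measurable]
  have "occupation w 0 = (\<integral>x. (if w x \<le> 0 then 1 else 0) \<partial>density lborel (\<lambda>x. ennreal (indicator {0..1} x)))"
    using occupation_integral[OF assms, of 0] by (simp add: ennreal_indicator)
  also have "\<dots> = (\<integral>x. indicator {0..1} x *\<^sub>R (if w x \<le> 0 then 1 else 0) \<partial>lborel)"
    by (intro integral_density) auto
  also have "\<dots> = (LBINT x:{0..1}. indicator {..0} (w x))"
    unfolding set_lebesgue_integral_def by (intro Bochner_Integration.integral_cong) (auto simp: indicator_def)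
  finally show ?thesis by (simp add: penalty_weight_def)
qed

lemma measurable_occupation:
  assumes [measurable]: "f \<in> measurable M path_borel" "y \<in> borel_measurable M"
  shows "(\<lambda>\<omega>. occupation (f \<omega>) (y \<omega>)) \<in> borel_measurable M"
proof -
  note measurable_eval_compose [measurable (raw)]
  have "(\<lambda>\<omega>. \<integral>x. (if f \<omega> x \<le> y \<omega> then 1 else 0 :: real) \<partial>unit_lborel) \<in> borel_measurable M"
    by measurable
  also have "?this \<longleftrightarrow> (\<lambda>\<omega>. occupation (f \<omega>) (y \<omega>)) \<in> borel_measurable M"
    using measurable_space[OF assms(1)] by (intro measurable_cong) (simp add: occupation_integral)
  finally show ?thesis .
qed

lemma measurable_level_weight:
  assumes [measurable]: "f \<in> measurable M path_borel" "v \<in> borel_measurable M"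
  shows "(\<lambda>\<omega>. level_weight \<kappa> (f \<omega>) (v \<omega>)) \<in> borel_measurable M"
proof -
  have [measurable]: "(\<lambda>\<omega>. occupation (f \<omega>) (f \<omega> (v \<omega>))) \<in> borel_measurable M"
    by (rule measurable_occupation[OF assms(1) measurable_eval_compose[OF assms]])
  show ?thesis unfolding level_weight_def by measurable
qed

lemma measurable_level_weight_path:
  "w \<in> space path_borel \<Longrightarrow> level_weight \<kappa> w \<in> borel_measurable borel"
  using measurable_level_weight[of "\<lambda>_. w" borel "\<lambda>v. v" \<kappa>] by simp

lemma measurable_level_weight_integral:
  assumes "sets M = sets path_borel" "(\<lambda>p. h (fst p) (snd p)) \<in> borel_measurable (M \<Otimes>\<^sub>M unit_lborel)"
  shows "(\<lambda>w. \<integral>v. h w v * level_weight \<kappa> w v \<partial>unit_lborel) \<in> borel_measurable M"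
proof -
  have "(\<lambda>p. level_weight \<kappa> (fst p) (snd p)) \<in> borel_measurable (M \<Otimes>\<^sub>M unit_lborel)"
    by (intro measurable_level_weight) (simp_all add: measurable_cong_sets[OF refl assms(1), symmetric])
  then show ?thesis
    using assms(2) by (intro unit_lborel.borel_measurable_lebesgue_integral) (simp add: split_beta)
qed

text \<open>The shifted path at x is w at (v + x) mod 1 minus w v, hence nonpositive exactly where w
  is at most w v, and a rotation of the unit interval preserves Lebesgue measure.\<close>

lemma occupation_cyclic_shift:
  assumes w: "w \<in> space path_borel" and w01: "w 0 = 0" "w 1 = 0" and v: "v \<in> {0..1}"
  shows "occupation (cyclic_shift v w) 0 = occupation w (w v)"
proof -
  note measurable_path[OF w, measurable]
  have [measurable]: "cyclic_shift v w \<in> borel_measurable borel"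
    by (intro measurable_path cyclic_shift_in_space w v)
  define I where "I y = (if w y \<le> w v then 1 else 0 :: ennreal)" for y
  \<comment> \<open>The two arcs [v,1] and (0,v], onto which the rotation translates the two parts
    of [0,1].\<close>
  define J1 where "J1 y = indicator {v..1} y * I y" for y
  define J2 where "J2 y = indicator {0<..v} y * I y" for y
  have [measurable]: "J1 \<in> borel_measurable borel" "J2 \<in> borel_measurable borel"
    unfolding J1_def J2_def I_def by measurable
  have "emeasure unit_lborel {x. cyclic_shift v w x \<le> 0} = (\<integral>\<^sup>+x. indicator {0..1} x * indicator {x. cyclic_shift v w x \<le> 0} x \<partial>lborel)"
    by (subst emeasure_density) auto
  also have "\<dots> = (\<integral>\<^sup>+x. J1 (v + 1 * x) + J2 ((v - 1) + 1 * x) \<partial>lborel)"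
  proof (rule nn_integral_cong)
    fix x :: real
    show "indicator {0..1} x * indicator {x. cyclic_shift v w x \<le> 0} x = J1 (v + 1 * x) + J2 ((v - 1) + 1 * x)"
    proof (cases "0 \<le> x \<and> x \<le> 1")
      case True
      have shift: "v + 1 * x = v + x" "v - 1 + 1 * x = v + x - 1" by simp_all
      show ?thesis
      proof (cases "v + x \<le> 1")
        case vx: True
        then have "min 1 (v + x) = v + x" "max 0 (v + x - 1) = 0" by auto
        then show ?thesis unfolding shift using True vx v w01
          by (auto simp: J1_def J2_def I_def cyclic_shift_def indicator_def)
      next
        case vx: False
        then have "min 1 (v + x) = 1" "max 0 (v + x - 1) = v + x - 1" by auto
        then show ?thesis unfolding shift using True vx v w01
          by (auto simp: J1_def J2_def I_def cyclic_shift_def indicator_def)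
      qed
    next
      case False
      then show ?thesis using v by (auto simp: J1_def J2_def indicator_def)
    qed
  qed
  also have "\<dots> = (\<integral>\<^sup>+x. J1 (v + 1 * x) \<partial>lborel) + (\<integral>\<^sup>+x. J2 ((v - 1) + 1 * x) \<partial>lborel)"
    by (intro nn_integral_add) auto
  also have "(\<integral>\<^sup>+x. J1 (v + 1 * x) \<partial>lborel) = (\<integral>\<^sup>+x. J1 x \<partial>lborel)"
    using nn_integral_real_affine[of J1 1 v] by simp
  also have "(\<integral>\<^sup>+x. J2 ((v - 1) + 1 * x) \<partial>lborel) = (\<integral>\<^sup>+x. J2 x \<partial>lborel)"
    using nn_integral_real_affine[of J2 1 "v - 1"] by simp
  also have "(\<integral>\<^sup>+x. J1 x \<partial>lborel) + (\<integral>\<^sup>+x. J2 x \<partial>lborel) = (\<integral>\<^sup>+x. J1 x + J2 x \<partial>lborel)"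
    by (intro nn_integral_add[symmetric]) auto
  also have "\<dots> = (\<integral>\<^sup>+x. indicator {0..1} x * indicator {x. w x \<le> w v} x \<partial>lborel)"
  proof (rule nn_integral_cong_AE)
    show "AE x in lborel. J1 x + J2 x = indicator {0..1} x * indicator {x. w x \<le> w v} x"
      using AE_lborel_singleton[of 0] AE_lborel_singleton[of v]
      by eventually_elim (use v in \<open>auto simp: J1_def J2_def I_def indicator_def\<close>)
  qed
  also have "\<dots> = emeasure unit_lborel {x. w x \<le> w v}"
    by (subst emeasure_density) auto
  finally show ?thesis by (simp add: occupation_def measure_def)
qed

section \<open>The occupation level at a uniform time\<close>

lemma real_distribution_unit_lborel: "real_distribution unit_lborel"
  by (simp add: real_distribution_def real_distribution_axioms_def unit_lborel.prob_space_axioms)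

lemma cdf_unit_lborel: "cdf unit_lborel a = max 0 (min 1 a)"
proof -
  have "emeasure unit_lborel {..a} = emeasure lborel ({0..1} \<inter> {..a})"
    by (intro emeasure_restricted) auto
  also have "{0..1} \<inter> {..a} = {0..min 1 a}" by auto
  also have "emeasure lborel {0..min 1 a} = ennreal (max 0 (min 1 a))" by (cases "0 \<le> a") (auto simp: max_def min_def)
  finally show ?thesis unfolding cdf_def by (intro measure_eq_emeasure_eq_ennreal) auto
qed

lemma measure_unit_lborel_UNIV [simp]: "measure unit_lborel UNIV = 1"
  using unit_lborel.prob_space by simp

text \<open>The probability integral transform. Quantiles exist by the intermediate value theorem;
  the upper estimate uses a quantile of a slightly larger b because the distribution function may be
  constant on an interval.\<close>

lemma distr_cdf_eq_unit_lborel: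
  assumes \<mu>: "real_distribution \<mu>" and atoms: "\<And>x. measure \<mu> {x} = 0"
  shows "distr \<mu> borel (cdf \<mu>) = unit_lborel"
proof -
  interpret \<mu>: real_distribution \<mu> by fact
  have cont: "isCont (cdf \<mu>) x" for x using atoms \<mu>.isCont_cdf by simp
  have mono: "mono (cdf \<mu>)" using \<mu>.cdf_nondecreasing by (auto intro: monoI)
  have [measurable]: "cdf \<mu> \<in> borel_measurable borel" by (rule borel_measurable_mono[OF mono])
  have ivt: "\<exists>y. cdf \<mu> y = a" if a01: "0 < a" "a < 1" for a
  proof -
    obtain l where l: "cdf \<mu> l < a"
      using order_tendstoD(2)[OF \<mu>.cdf_lim_at_bot a01(1)] by (metis eventually_at_bot_linorder order_refl)
    obtain r where r: "a < cdf \<mu> r"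
      using order_tendstoD(1)[OF \<mu>.cdf_lim_at_top_prob a01(2)] by (metis eventually_at_top_linorder order_refl)
    have "l \<le> r" using l r monoD[OF mono, of r l] by linarith
    then show ?thesis using IVT[of "cdf \<mu>" l a r] l r cont by auto
  qed
  have up: "measure \<mu> {y. cdf \<mu> y \<le> a} \<le> b" if ab: "a < b" "0 < b" "b < 1" for a b
  proof -
    obtain y where y: "cdf \<mu> y = b" using ivt ab by blast
    have "{y. cdf \<mu> y \<le> a} \<subseteq> {..y}"
    proof
      fix z assume "z \<in> {y. cdf \<mu> y \<le> a}"
      then have "cdf \<mu> z < cdf \<mu> y" using y ab by simp
      then show "z \<in> {..y}" using monoD[OF mono, of y z] by (cases "z \<le> y") auto
    qed
    then have "measure \<mu> {y. cdf \<mu> y \<le> a} \<le> measure \<mu> {..y}" by (intro \<mu>.finite_measure_mono) auto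
    then show ?thesis using y by (simp add: cdf_def)
  qed
  have lo: "a \<le> measure \<mu> {y. cdf \<mu> y \<le> a}" if a01: "0 < a" "a < 1" for a
  proof -
    obtain y where y: "cdf \<mu> y = a" using ivt a01 by blast
    have "{..y} \<subseteq> {y. cdf \<mu> y \<le> a}" using y monoD[OF mono] by auto
    then have "measure \<mu> {..y} \<le> measure \<mu> {y. cdf \<mu> y \<le> a}" by (intro \<mu>.finite_measure_mono) auto
    then show ?thesis using y by (simp add: cdf_def)
  qed
  have "measure \<mu> {y. cdf \<mu> y \<le> a} = max 0 (min 1 a)" for a
  proof -
    consider "a \<le> 0" | "0 < a" "a < 1" | "1 \<le> a" by linarith
    then show ?thesis
    proof cases
      case 1
      have "measure \<mu> {y. cdf \<mu> y \<le> a} \<le> 0 + e" if "e > 0" for e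
      proof (cases "e < 1")
        case True
        then show ?thesis using up[of a e] 1 that by simp
      next
        case False
        then show ?thesis using \<mu>.prob_le_1[of "{y. cdf \<mu> y \<le> a}"] by linarith
      qed
      then have "measure \<mu> {y. cdf \<mu> y \<le> a} \<le> 0" by (rule field_le_epsilon)
      then show ?thesis using 1 measure_nonneg[of \<mu> "{y. cdf \<mu> y \<le> a}"] by simp
    next
      case 2
      have "measure \<mu> {y. cdf \<mu> y \<le> a} \<le> a + e" if "e > 0" for e
      proof (cases "a + e < 1")
        case True
        then show ?thesis using up[of a "a + e"] 2 that by simp
      next
        case False
        then show ?thesis using \<mu>.prob_le_1[of "{y. cdf \<mu> y \<le> a}"] by linarith
      qed
      then have "measure \<mu> {y. cdf \<mu> y \<le> a} \<le> a" by (rule field_le_epsilon)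
      then show ?thesis using 2 lo[of a] by simp
    next
      case 3
      then have "{y. cdf \<mu> y \<le> a} = UNIV" using \<mu>.cdf_bounded_prob by (auto intro: order_trans)
      then show ?thesis using 3 \<mu>.prob_space by simp
    qed
  qed
  then have "cdf (distr \<mu> borel (cdf \<mu>)) = cdf unit_lborel"
  proof (intro ext)
    fix a
    assume eq: "\<And>a. measure \<mu> {y. cdf \<mu> y \<le> a} = max 0 (min 1 a)"
    have "measure (distr \<mu> borel (cdf \<mu>)) {..a} = measure \<mu> {y. cdf \<mu> y \<le> a}"
      by (subst measure_distr) (auto simp: vimage_def)
    then show "cdf (distr \<mu> borel (cdf \<mu>)) a = cdf unit_lborel a"
      unfolding cdf_unit_lborel cdf_def[of "distr \<mu> borel (cdf \<mu>)"] eq .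
  qed
  then show ?thesis
    by (intro cdf_unique real_distribution_unit_lborel \<mu>.real_distribution_distr) auto
qed

text \<open>The distribution function of the occupation measure is \<open>occupation w\<close>. Its
  value at w v is uniform on [0,1], so the weight reduces to an exponential integral over
  [0,1].\<close>

lemma integral_level_weight:
  assumes w: "w \<in> space path_borel" and atoms: "\<And>y. measure unit_lborel {x. w x = y} = 0"
  shows "(\<integral>v. level_weight \<kappa> w v \<partial>unit_lborel) = 1 - exp (- 2 * \<kappa>)"
proof -
  note measurable_path[OF w, measurable]
  define \<mu> where "\<mu> = distr unit_lborel borel w"
  have \<mu>: "real_distribution \<mu>" unfolding \<mu>_def by (intro unit_lborel.real_distribution_distr) measurable
  have occ: "occupation w y = cdf \<mu> y" for y
    unfolding \<mu>_def cdf_def occupation_def by (subst measure_distr) (auto simp: vimage_def)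
  have "measure \<mu> {y} = 0" for y
    using atoms[of y] unfolding \<mu>_def by (subst measure_distr) (auto simp: vimage_def)
  then have U: "distr \<mu> borel (cdf \<mu>) = unit_lborel" by (intro distr_cdf_eq_unit_lborel \<mu>)
  interpret \<mu>: real_distribution \<mu> by fact
  have [measurable]: "cdf \<mu> \<in> borel_measurable borel"
    using \<mu>.cdf_nondecreasing by (intro borel_measurable_mono monoI)
  have "(\<integral>v. level_weight \<kappa> w v \<partial>unit_lborel) = (\<integral>y. 2 * \<kappa> * exp (- 2 * \<kappa> * cdf \<mu> y) \<partial>\<mu>)"
    unfolding level_weight_def occ by (subst (2) \<mu>_def) (subst integral_distr, auto)
  also have "\<dots> = (\<integral>z. 2 * \<kappa> * exp (- 2 * \<kappa> * z) \<partial>distr \<mu> borel (cdf \<mu>))"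
    by (subst integral_distr) auto
  also have "\<dots> = (\<integral>z. 2 * \<kappa> * exp (- 2 * \<kappa> * z) \<partial>density lborel (\<lambda>x. ennreal (indicator {0..1} x)))"
    unfolding U by (simp add: ennreal_indicator)
  also have "\<dots> = (\<integral>z. indicator {0..1} z *\<^sub>R (2 * \<kappa> * exp (- 2 * \<kappa> * z)) \<partial>lborel)"
    by (intro integral_density) auto
  also have "\<dots> = (- exp (- 2 * \<kappa> * 1)) - (- exp (- 2 * \<kappa> * 0))"
    by (intro integral_FTC_atLeastAtMost)
      (auto intro!: derivative_eq_intros continuous_intros simp flip: has_real_derivative_iff_has_vector_derivative)
  finally show ?thesis by simp
qed

section \<open>Concentration of the weights at the minimum\<close>

lemma level_weight_nonneg: "0 \<le> \<kappa> \<Longrightarrow> 0 \<le> level_weight \<kappa> w v"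
  by (simp add: level_weight_def)

lemma level_weight_le: "0 \<le> \<kappa> \<Longrightarrow> c \<le> occupation w (w v) \<Longrightarrow> level_weight \<kappa> w v \<le> 2 * \<kappa> * exp (- 2 * \<kappa> * c)"
  unfolding level_weight_def by (auto intro!: mult_left_mono)

lemma integrable_level_weight:
  assumes w: "w \<in> space path_borel" and \<kappa>: "0 \<le> \<kappa>"
    and h: "h \<in> borel_measurable borel" "\<And>v. \<bar>h v\<bar> \<le> B"
  shows "integrable unit_lborel (\<lambda>v. h v * level_weight \<kappa> w v)"
proof (rule unit_lborel.integrable_const_bound[of _ "B * (2 * \<kappa>)"])
  have [measurable]: "(\<lambda>v. level_weight \<kappa> w v) \<in> borel_measurable borel"
    using measurable_level_weight_path[OF w] by simp
  show "(\<lambda>v. h v * level_weight \<kappa> w v) \<in> borel_measurable unit_lborel" using h by measurable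
  show "AE v in unit_lborel. norm (h v * level_weight \<kappa> w v) \<le> B * (2 * \<kappa>)"
  proof (intro AE_I2)
    fix v
    have "level_weight \<kappa> w v \<le> 2 * \<kappa>"
      using level_weight_le[OF \<kappa>, of 0 w v] occupation_bounds by simp
    then show "norm (h v * level_weight \<kappa> w v) \<le> B * (2 * \<kappa>)"
      using h(2)[of v] level_weight_nonneg[OF \<kappa>, of w v]
      by (auto simp: abs_mult intro!: mult_mono intro: order_trans[OF abs_ge_zero])
  qed
qed

text \<open>Compactness gives a gap between the minimum and all values at distance at least \<delta>
  from u. By continuity an interval next to u lies below all those values, and its length is the
  bound.\<close>

lemma occupation_away_from_minimum:
  assumes gen: "generic_path w u" and \<delta>: "\<delta> > 0"
  obtains c where "c > 0" "\<And>v. v \<in> {0..1} \<Longrightarrow> \<delta> \<le> \<bar>v - u\<bar> \<Longrightarrow> c \<le> occupation w (w v)"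
proof -
  have w: "w \<in> space path_borel" and u: "0 < u" "u < 1" and min: "\<And>x. x \<in> {0..1} \<Longrightarrow> x \<noteq> u \<Longrightarrow> w u < w x"
    using gen by (auto simp: generic_path_def)
  note measurable_path[OF w, measurable]
  have cont: "continuous_on {0..1} w" using w by (rule path_borel_continuous)
  define K where "K = {v \<in> {0..1}. \<delta> \<le> \<bar>v - u\<bar>}"
  show thesis
  proof (cases "K = {}")
    case True
    show thesis by (rule that[of 1]) (use True in \<open>auto simp: K_def\<close>)
  next
    case False
    have "K = {0..1} \<inter> {v. \<delta> \<le> \<bar>v - u\<bar>}" by (auto simp: K_def)
    then have "compact K" by (auto intro!: compact_Int_closed closed_Collect_le continuous_intros)
    moreover have "continuous_on K w" using cont by (rule continuous_on_subset) (auto simp: K_def)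
    ultimately obtain k where k: "k \<in> K" "\<And>v. v \<in> K \<Longrightarrow> w k \<le> w v"
      using continuous_attains_inf[of K w] False by blast
    have "w u < w k" using k(1) \<delta> by (intro min) (auto simp: K_def)
    then obtain \<eta> where \<eta>: "\<eta> > 0" "\<And>x. x \<in> {0..1} \<Longrightarrow> \<bar>x - u\<bar> < \<eta> \<Longrightarrow> \<bar>w x - w u\<bar> < w k - w u"
      using cont[unfolded continuous_on_iff, rule_format, of u "w k - w u"] u by (auto simp: dist_real_def)
    \<comment> \<open>Chosen so that [u, u + r] lies in [0,1] and strictly within distance \<eta> of
      u.\<close>
    define r where "r = Min {\<eta> / 2, u, 1 - u}"
    have r: "r > 0" "r < \<eta>" "r \<le> u" "r \<le> 1 - u" using \<eta> u by (auto simp: r_def min_less_iff_disj)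
    have "r \<le> occupation w (w v)" if "v \<in> {0..1}" "\<delta> \<le> \<bar>v - u\<bar>" for v
    proof -
      have "w k \<le> w v" using k(2)[of v] that by (simp add: K_def)
      have "w x \<le> w v" if x: "x \<in> {u..u + r}" for x
      proof -
        have "\<bar>w x - w u\<bar> < w k - w u" using x r u by (intro \<eta>(2)) auto
        then show ?thesis using \<open>w k \<le> w v\<close> by linarith
      qed
      then have "measure unit_lborel {u..u + r} \<le> occupation w (w v)"
        unfolding occupation_def by (intro unit_lborel.finite_measure_mono) auto
      moreover have "emeasure unit_lborel {u..u + r} = emeasure lborel ({0..1} \<inter> {u..u + r})"
        by (intro emeasure_restricted) auto
      moreover have "{0..1} \<inter> {u..u + r} = {u..u + r}" using u r by auto
      ultimately show "r \<le> occupation w (w v)" using r by (simp add: measure_def)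
    qed
    then show thesis using that r(1) by blast
  qed
qed

text \<open>An approximate identity: near u the oscillation of h is small, and away from u the
  weight is at most 2 \<kappa> exp (- 2 \<kappa> c) with some c > 0.\<close>

lemma level_weight_concentrates:
  assumes gen: "generic_path w u"
    and h: "h \<in> borel_measurable borel" "\<And>v. \<bar>h v\<bar> \<le> B" "(h \<longlongrightarrow> h u) (at u)"
  shows "((\<lambda>\<kappa>. \<integral>v. h v * level_weight \<kappa> w v \<partial>unit_lborel) \<longlongrightarrow> h u) at_top"
proof -
  have w: "w \<in> space path_borel" and atoms: "\<And>y. measure unit_lborel {x. w x = y} = 0"
    using gen by (auto simp: generic_path_def)
  have B: "0 \<le> B" using h(2)[of 0] by linarith
  have [measurable]: "(\<lambda>v. level_weight \<kappa> w v) \<in> borel_measurable borel" for \<kappa>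
    using measurable_level_weight_path[OF w] by simp
  have small: "((\<lambda>\<kappa>. \<integral>v. (h v - h u) * level_weight \<kappa> w v \<partial>unit_lborel) \<longlongrightarrow> 0) at_top"
  proof (rule tendstoI)
    fix \<epsilon> :: real assume \<epsilon>: "\<epsilon> > 0"
    obtain \<delta> where \<delta>: "\<delta> > 0" "\<And>v. \<bar>v - u\<bar> < \<delta> \<Longrightarrow> \<bar>h v - h u\<bar> \<le> \<epsilon> / 2"
    proof -
      have "\<forall>\<^sub>F v in at u. dist (h v) (h u) < \<epsilon> / 2" using h(3) \<epsilon> by (intro tendstoD) auto
      then obtain d where d: "d > 0" "\<And>v. v \<noteq> u \<Longrightarrow> dist v u < d \<Longrightarrow> dist (h v) (h u) < \<epsilon> / 2"
        by (auto simp: eventually_at)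
      have "\<bar>h v - h u\<bar> \<le> \<epsilon> / 2" if "\<bar>v - u\<bar> < d" for v
        using d(2)[of v] that \<epsilon> by (cases "v = u") (auto simp: dist_real_def)
      then show thesis using that d(1) by blast
    qed
    obtain c where c: "c > 0" "\<And>v. v \<in> {0..1} \<Longrightarrow> \<delta> \<le> \<bar>v - u\<bar> \<Longrightarrow> c \<le> occupation w (w v)"
      using occupation_away_from_minimum[OF gen \<delta>(1)] by blast
    have "((\<lambda>\<kappa>. 2 * B * (2 * \<kappa> * exp (- 2 * \<kappa> * c))) \<longlongrightarrow> 0) at_top"
      using c(1) by real_asymp
    then have "\<forall>\<^sub>F \<kappa> in at_top. 2 * B * (2 * \<kappa> * exp (- 2 * \<kappa> * c)) < \<epsilon> / 2"
      using \<epsilon> by (intro order_tendstoD) auto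
    moreover have "\<forall>\<^sub>F \<kappa> in at_top. (0::real) < \<kappa>" by (rule eventually_gt_at_top)
    ultimately show "\<forall>\<^sub>F \<kappa> in at_top. dist (\<integral>v. (h v - h u) * level_weight \<kappa> w v \<partial>unit_lborel) 0 < \<epsilon>"
    proof eventually_elim
      case (elim \<kappa>)
      have bound: "AE v in unit_lborel. norm ((h v - h u) * level_weight \<kappa> w v) \<le>
          \<epsilon> / 2 * level_weight \<kappa> w v + 2 * B * (2 * \<kappa> * exp (- 2 * \<kappa> * c))"
        using AE_unit_lborel
      proof eventually_elim
        case v: (elim v)
        have hv: "\<bar>h v - h u\<bar> \<le> 2 * B" using h(2)[of v] h(2)[of u] by linarith
        have lw: "0 \<le> level_weight \<kappa> w v" using elim by (intro level_weight_nonneg) auto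
        show ?case
        proof (cases "\<bar>v - u\<bar> < \<delta>")
          case True
          then have "\<bar>h v - h u\<bar> * level_weight \<kappa> w v \<le> \<epsilon> / 2 * level_weight \<kappa> w v"
            using \<delta>(2) lw by (intro mult_right_mono) auto
          moreover have "0 \<le> 2 * B * (2 * \<kappa> * exp (- 2 * \<kappa> * c))" using B elim by simp
          ultimately show ?thesis using lw by (simp add: abs_mult)
        next
          case False
          then have "level_weight \<kappa> w v \<le> 2 * \<kappa> * exp (- 2 * \<kappa> * c)"
            using v elim by (intro level_weight_le c(2)) auto
          then have "\<bar>h v - h u\<bar> * level_weight \<kappa> w v \<le> 2 * B * (2 * \<kappa> * exp (- 2 * \<kappa> * c))"
            using hv lw B by (intro mult_mono) auto
          moreover have "0 \<le> \<epsilon> / 2 * level_weight \<kappa> w v" using lw \<epsilon> by simp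
          ultimately show ?thesis using lw by (simp add: abs_mult)
        qed
      qed
      have i1: "integrable unit_lborel (\<lambda>v. (h v - h u) * level_weight \<kappa> w v)"
      proof (rule integrable_level_weight[OF w])
        show "\<bar>h v - h u\<bar> \<le> 2 * B" for v using h(2)[of v] h(2)[of u] by linarith
      qed (use elim h in auto)
      have i2: "integrable unit_lborel (\<lambda>v. level_weight \<kappa> w v)"
        using integrable_level_weight[OF w, of \<kappa> "\<lambda>_. 1" 1] elim by simp
      have "norm (\<integral>v. (h v - h u) * level_weight \<kappa> w v \<partial>unit_lborel) \<le>
        (\<integral>v. \<epsilon> / 2 * level_weight \<kappa> w v + 2 * B * (2 * \<kappa> * exp (- 2 * \<kappa> * c)) \<partial>unit_lborel)"
        using i1 i2 bound by (intro norm_integral_le_integral) auto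
      also have "\<dots> = \<epsilon> / 2 * (1 - exp (- 2 * \<kappa>)) + 2 * B * (2 * \<kappa> * exp (- 2 * \<kappa> * c))"
        using i2 integral_level_weight[OF w atoms, of \<kappa>]
        by (subst Bochner_Integration.integral_add) (auto simp: unit_lborel.prob_space)
      also have "\<dots> < \<epsilon>"
      proof -
        have "\<epsilon> / 2 * (1 - exp (- 2 * \<kappa>)) \<le> \<epsilon> / 2 * 1" using \<epsilon> by (intro mult_left_mono) auto
        then show ?thesis using elim by linarith
      qed
      finally show ?case by simp
    qed
  qed
  have "((\<lambda>\<kappa>::real. h u * (1 - exp (- 2 * \<kappa>))) \<longlongrightarrow> h u) at_top" by real_asymp
  from tendsto_add[OF small this]
  have lim: "((\<lambda>\<kappa>. (\<integral>v. (h v - h u) * level_weight \<kappa> w v \<partial>unit_lborel) + h u * (1 - exp (- 2 * \<kappa>))) \<longlongrightarrow> h u) at_top"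
    by simp
  show ?thesis
  proof (rule Lim_transform_eventually[OF lim])
    show "\<forall>\<^sub>F \<kappa> in at_top. (\<integral>v. (h v - h u) * level_weight \<kappa> w v \<partial>unit_lborel) + h u * (1 - exp (- 2 * \<kappa>)) =
        (\<integral>v. h v * level_weight \<kappa> w v \<partial>unit_lborel)"
      using eventually_gt_at_top[of 0]
    proof eventually_elim
      case (elim \<kappa>)
      have i: "integrable unit_lborel (\<lambda>v. h v * level_weight \<kappa> w v)" "integrable unit_lborel (\<lambda>v. level_weight \<kappa> w v)"
        using integrable_level_weight[OF w _ h(1,2), of \<kappa>] integrable_level_weight[OF w, of \<kappa> "\<lambda>_. 1" 1] elim by simp_all
      then show ?case using integral_level_weight[OF w atoms, of \<kappa>]
        by (simp add: left_diff_distrib)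
    qed
  qed
qed

text \<open>A measurable version of the argmin: the limit picks out the minimiser of a generic path
  (\<open>argmin_path_eq\<close>); its value on other paths is irrelevant.\<close>

definition argmin_path :: "(real \<Rightarrow> real) \<Rightarrow> real" where
  "argmin_path w = max 0 (min 1 (lim (\<lambda>n. \<integral>v. max 0 (min 1 v) * level_weight (real n) w v \<partial>unit_lborel)))"

definition vervaat :: "(real \<Rightarrow> real) \<Rightarrow> real \<Rightarrow> real" where
  "vervaat w = cyclic_shift (argmin_path w) w"

lemma argmin_path_eq:
  assumes "generic_path w u" shows "argmin_path w = u"
proof -
  have u: "0 < u" "u < 1" using assms by (auto simp: generic_path_def)
  have "((\<lambda>v. max 0 (min 1 v)) \<longlongrightarrow> max 0 (min 1 u)) (at u)" by (intro tendsto_intros)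
  then have "((\<lambda>\<kappa>. \<integral>v. max 0 (min 1 v) * level_weight \<kappa> w v \<partial>unit_lborel) \<longlongrightarrow> max 0 (min 1 u)) at_top"
    by (intro level_weight_concentrates[OF assms, of _ 1]) auto
  from filterlim_compose[OF this filterlim_real_sequentially]
  have "lim (\<lambda>n. \<integral>v. max 0 (min 1 v) * level_weight (real n) w v \<partial>unit_lborel) = max 0 (min 1 u)"
    by (rule limI)
  then show ?thesis using u by (simp add: argmin_path_def)
qed

lemma measurable_argmin_path [measurable]: "argmin_path \<in> borel_measurable path_borel"
proof -
  have [measurable]: "(\<lambda>w. \<integral>v. max 0 (min 1 v) * level_weight (real n) w v \<partial>unit_lborel) \<in> borel_measurable path_borel" for n
    by (intro measurable_level_weight_integral) auto
  show ?thesis unfolding argmin_path_def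
    by (intro borel_measurable_max borel_measurable_min borel_measurable_const borel_measurable_lim_metric) measurable
qed

lemma argmin_path_in: "argmin_path w \<in> {0..1}"
  by (simp add: argmin_path_def)

lemma measurable_vervaat [measurable]: "vervaat \<in> measurable path_borel path_borel"
  unfolding vervaat_def[abs_def]
  by (rule measurable_cyclic_shift[OF measurable_ident_sets[OF refl] measurable_argmin_path argmin_path_in])

lemma vervaat_endpoints:
  assumes "generic_path w u" shows "vervaat w 0 = 0" "vervaat w 1 = 0"
  unfolding vervaat_def argmin_path_eq[OF assms] using assms by (simp_all add: cyclic_shift_def generic_path_def)

lemma vervaat_pos:
  assumes gen: "generic_path w u" and x: "0 < x" "x < 1" shows "0 < vervaat w x"
proof -
  have u: "0 < u" "u < 1" "w 0 = 0" "w 1 = 0" and min: "\<And>x. x \<in> {0..1} \<Longrightarrow> x \<noteq> u \<Longrightarrow> w u < w x"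
    using gen by (auto simp: generic_path_def)
  show ?thesis
  proof (cases "u + x \<le> 1")
    case True
    then have "min 1 (u + x) = u + x" "max 0 (u + x - 1) = 0" by auto
    then show ?thesis using u x True min[of "u + x"] by (simp add: vervaat_def argmin_path_eq[OF gen] cyclic_shift_def)
  next
    case False
    then have "min 1 (u + x) = 1" "max 0 (u + x - 1) = u + x - 1" by auto
    then show ?thesis using u x False min[of "u + x - 1"] by (simp add: vervaat_def argmin_path_eq[OF gen] cyclic_shift_def)
  qed
qed

lemma cyclic_shift_continuous:
  assumes w: "w \<in> space path_borel" and u: "u \<in> {0..1}" and f: "continuous_map path_topology euclideanreal f"
  shows "((\<lambda>v. f (cyclic_shift (max 0 (min 1 v)) w)) \<longlongrightarrow> f (cyclic_shift u w)) (at u)"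
proof (rule continuous_map_path_tendsto[OF f])
  show "cyclic_shift u w \<in> space path_borel" "cyclic_shift (max 0 (min 1 v)) w \<in> space path_borel" for v
    using u by (intro cyclic_shift_in_space w; simp)+
  fix r :: real assume r: "r > 0"
  have "uniformly_continuous_on {0..1} w"
    using path_borel_continuous[OF w] by (intro compact_uniformly_continuous) auto
  \<comment> \<open>The shift contains three values of w that move with v, hence the thirds.\<close>
  from this[unfolded uniformly_continuous_on_def, rule_format, of "r / 3"]
  obtain d where d: "d > 0" "\<And>x y. x \<in> {0..1} \<Longrightarrow> y \<in> {0..1} \<Longrightarrow> dist y x < d \<Longrightarrow> dist (w y) (w x) < r / 3"
    using r by auto
  have lip: "\<bar>min 1 a - min 1 b\<bar> \<le> \<bar>a - b\<bar>" "\<bar>max 0 a - max 0 b\<bar> \<le> \<bar>a - b\<bar>" for a b :: real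
    by (auto simp: min_def max_def)
  have "\<forall>\<^sub>F v in at u. dist v u < d" using d(1) by (auto simp: eventually_at intro: exI[of _ d])
  then show "\<forall>\<^sub>F v in at u. \<forall>x\<in>{0..1}. \<bar>cyclic_shift (max 0 (min 1 v)) w x - cyclic_shift u w x\<bar> \<le> r"
  proof eventually_elim
    case (elim v)
    define c where "c = max 0 (min 1 v)"
    have c: "c \<in> {0..1}" "\<bar>c - u\<bar> < d" using elim u by (auto simp: c_def dist_real_def max_def min_def)
    show ?case
    proof
      fix x :: real assume x: "x \<in> {0..1}"
      have 1: "\<bar>w (min 1 (c + x)) - w (min 1 (u + x))\<bar> < r / 3"
        using d(2)[of "min 1 (u + x)" "min 1 (c + x)"] c u x lip(1)[of "c + x" "u + x"] by (simp add: dist_real_def)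
      have 2: "\<bar>w (max 0 (c + x - 1)) - w (max 0 (u + x - 1))\<bar> < r / 3"
        using d(2)[of "max 0 (u + x - 1)" "max 0 (c + x - 1)"] c u x lip(2)[of "c + x - 1" "u + x - 1"] by (simp add: dist_real_def)
      have 3: "\<bar>w c - w u\<bar> < r / 3" using d(2)[of u c] c u by (auto simp: dist_real_def)
      show "\<bar>cyclic_shift (max 0 (min 1 v)) w x - cyclic_shift u w x\<bar> \<le> r"
      proof -
        have "cyclic_shift c w x - cyclic_shift u w x = (w (min 1 (c + x)) - w (min 1 (u + x))) +
          (w (max 0 (c + x - 1)) - w (max 0 (u + x - 1))) - (w c - w u)"
          using x by (simp add: cyclic_shift_def)
        then show ?thesis using 1 2 3 unfolding c_def[symmetric] by linarith
      qed
    qed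
  qed
qed

section \<open>Cyclic averaging and the limit of the penalised laws\<close>

context brownian_bridge
begin

lemma measurable_penalty_weight: "penalty_weight \<kappa> \<in> borel_measurable path_borel"
proof -
  have "(\<lambda>w. exp (- 2 * \<kappa> * occupation w 0)) \<in> borel_measurable path_borel"
  proof -
    have [measurable]: "(\<lambda>w. occupation w 0) \<in> borel_measurable path_borel"
      by (rule measurable_occupation) auto
    show ?thesis by measurable
  qed
  then show ?thesis by (rule measurable_cong[THEN iffD1, rotated]) (simp add: penalty_weight_occupation)
qed

lemma penalty_weight_bounds:
  assumes "w \<in> space W" "0 \<le> \<kappa>" shows "0 < penalty_weight \<kappa> w" "penalty_weight \<kappa> w \<le> 1"
  using assms occupation_bounds[of w 0] by (auto simp: penalty_weight_occupation space_W)

text \<open>By cyclic exchangeability the shift can be averaged over all starting points.\<close>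

lemma expectation_cyclic_average:
  assumes \<kappa>: "0 \<le> \<kappa>" and f [measurable]: "f \<in> borel_measurable path_borel" and B: "\<And>w. w \<in> space path_borel \<Longrightarrow> \<bar>f w\<bar> \<le> B"
  shows "2 * \<kappa> * expectation (\<lambda>w. f w * penalty_weight \<kappa> w) =
    expectation (\<lambda>w. \<integral>v. f (cyclic_shift (max 0 (min 1 v)) w) * level_weight \<kappa> w v \<partial>unit_lborel)"
proof -
  interpret WU: pair_prob_space W unit_lborel ..
  define G where "G w = f w * (2 * \<kappa> * penalty_weight \<kappa> w)" for w
  have G [measurable]: "G \<in> borel_measurable path_borel"
    unfolding G_def using measurable_penalty_weight by measurable
  have GB: "\<bar>G w\<bar> \<le> B * (2 * \<kappa>)" if "w \<in> space path_borel" for w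
  proof -
    have p: "0 < penalty_weight \<kappa> w" "penalty_weight \<kappa> w \<le> 1" using that \<kappa> penalty_weight_bounds by (auto simp: space_W)
    have "0 \<le> B" using B[OF that] by linarith
    moreover have "2 * \<kappa> * penalty_weight \<kappa> w \<le> 2 * \<kappa> * 1" using p \<kappa> by (intro mult_left_mono) auto
    ultimately show ?thesis using B[OF that] p \<kappa> unfolding G_def abs_mult[of "f w"]
      by (intro mult_mono) auto
  qed
  \<comment> \<open>Truncation to [0,1] defines the shift for all real v, as required for an
    integral against a density on the line.\<close>
  let ?c = "\<lambda>v::real. max 0 (min 1 v)"
  have cyc: "(\<lambda>p. cyclic_shift (?c (snd p)) (fst p)) \<in> measurable (W \<Otimes>\<^sub>M unit_lborel) path_borel"
    by (intro measurable_cyclic_shift) (auto simp: measurable_cong_sets[OF refl sets_W, symmetric])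
  have cyc_in: "cyclic_shift (?c v) w \<in> space path_borel" if "w \<in> space W" for v w
    using that by (intro cyclic_shift_in_space) (auto simp: space_W)
  have "expectation G = (\<integral>v. expectation G \<partial>unit_lborel)" by (simp add: unit_lborel.prob_space)
  also have "\<dots> = (\<integral>v. expectation (\<lambda>w. G (cyclic_shift (?c v) w)) \<partial>unit_lborel)"
  proof (rule Bochner_Integration.integral_cong[OF refl])
    fix v
    have m: "cyclic_shift (?c v) \<in> measurable W path_borel"
      by (intro measurable_cyclic_shift[of "\<lambda>w. w"]) (auto simp: measurable_ident_sets[OF sets_W])
    have "expectation G = (\<integral>w. G w \<partial>distr W path_borel (cyclic_shift (?c v)))"
      by (simp add: distr_cyclic_shift)
    also have "\<dots> = expectation (\<lambda>w. G (cyclic_shift (?c v) w))"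
      by (rule integral_distr[OF m G])
    finally show "expectation G = expectation (\<lambda>w. G (cyclic_shift (?c v) w))" .
  qed
  also have "\<dots> = expectation (\<lambda>w. \<integral>v. G (cyclic_shift (?c v) w) \<partial>unit_lborel)"
  proof (rule WU.Fubini_integral)
    show "integrable (W \<Otimes>\<^sub>M unit_lborel) (\<lambda>(w, v). G (cyclic_shift (?c v) w))"
      using GB cyc_in measurable_compose[OF cyc G]
      by (intro WU.integrable_const_bound[of _ "B * (2 * \<kappa>)"]) (auto simp: split_beta space_pair_measure)
  qed
  also have "\<dots> = expectation (\<lambda>w. \<integral>v. f (cyclic_shift (?c v) w) * level_weight \<kappa> w v \<partial>unit_lborel)"
  proof (rule integral_cong_AE)
    show "(\<lambda>w. \<integral>v. f (cyclic_shift (?c v) w) * level_weight \<kappa> w v \<partial>unit_lborel) \<in> borel_measurable W"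
      using measurable_compose[OF cyc f] by (intro measurable_level_weight_integral sets_W)
    show "(\<lambda>w. \<integral>v. G (cyclic_shift (?c v) w) \<partial>unit_lborel) \<in> borel_measurable W"
      using measurable_compose[OF cyc G] by (intro unit_lborel.borel_measurable_lebesgue_integral) (simp add: split_beta)
    show "AE w in W. (\<integral>v. G (cyclic_shift (?c v) w) \<partial>unit_lborel) =
      (\<integral>v. f (cyclic_shift (?c v) w) * level_weight \<kappa> w v \<partial>unit_lborel)"
      using AE_endpoints AE_space
    proof eventually_elim
      case (elim w)
      have w: "w \<in> space path_borel" using elim by (simp add: space_W)
      have eq: "G (cyclic_shift (?c v) w) = f (cyclic_shift (?c v) w) * level_weight \<kappa> w v" if "0 < v" "v < 1" for v
      proof -
        have "?c v = v" using that by simp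
        then show ?thesis using that elim w
          by (simp add: G_def level_weight_def penalty_weight_occupation[OF cyclic_shift_in_space] occupation_cyclic_shift)
      qed
      have [measurable]: "(\<lambda>v. level_weight \<kappa> w v) \<in> borel_measurable borel"
        using measurable_level_weight_path[OF w] by simp
      have [measurable]: "(\<lambda>v. cyclic_shift (?c v) w) \<in> measurable borel path_borel"
        using w by (intro measurable_cyclic_shift[of "\<lambda>_. w"]) auto
      show ?case
      proof (rule integral_cong_AE)
        show "AE v in unit_lborel. G (cyclic_shift (?c v) w) = f (cyclic_shift (?c v) w) * level_weight \<kappa> w v"
          using AE_unit_lborel by eventually_elim (rule eq; simp)
      qed measurable
    qed
  qed
  finally have "expectation G = expectation (\<lambda>w. \<integral>v. f (cyclic_shift (?c v) w) * level_weight \<kappa> w v \<partial>unit_lborel)" .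
  moreover have "expectation G = 2 * \<kappa> * expectation (\<lambda>w. f w * penalty_weight \<kappa> w)"
    unfolding G_def by (subst integral_mult_right_zero[symmetric]) (simp add: mult_ac)
  ultimately show ?thesis by simp
qed

text \<open>The averaging identity for f = 1: the inner average is the same number for almost every
  path.\<close>

lemma partition_constant_eq:
  assumes "0 \<le> \<kappa>" shows "2 * \<kappa> * partition_constant W \<kappa> = 1 - exp (- 2 * \<kappa>)"
proof -
  have "2 * \<kappa> * partition_constant W \<kappa> = expectation (\<lambda>w. \<integral>v. 1 * level_weight \<kappa> w v \<partial>unit_lborel)"
    using expectation_cyclic_average[of \<kappa> "\<lambda>_. 1" 1] assms by (simp add: partition_constant_def)
  also have "\<dots> = expectation (\<lambda>w. 1 - exp (- 2 * \<kappa>))"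
  proof (rule integral_cong_AE)
    show "(\<lambda>w. \<integral>v. 1 * level_weight \<kappa> w v \<partial>unit_lborel) \<in> borel_measurable W"
      by (intro measurable_level_weight_integral sets_W) auto
    show "AE w in W. (\<integral>v. 1 * level_weight \<kappa> w v \<partial>unit_lborel) = 1 - exp (- 2 * \<kappa>)"
      using AE_no_atoms AE_space by eventually_elim (simp add: integral_level_weight space_W)
  qed auto
  finally show ?thesis by (simp add: prob_space)
qed

lemma partition_constant_pos: "0 < \<kappa> \<Longrightarrow> 0 < partition_constant W \<kappa>"
  using partition_constant_eq[of \<kappa>] by (metis diff_gt_0_iff_gt exp_less_one_iff less_imp_le mult_less_0_iff mult_pos_pos neg_less_0_iff_less zero_less_mult_pos zero_less_numeral mult_minus_left)

lemma integral_penalised_bridge: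
  assumes \<kappa>: "0 < \<kappa>" and f: "f \<in> borel_measurable path_borel"
  shows "(\<integral>w. f w \<partial>penalised_bridge W \<kappa>) = expectation (\<lambda>w. f w * penalty_weight \<kappa> w) / partition_constant W \<kappa>"
proof -
  have "(\<integral>w. f w \<partial>penalised_bridge W \<kappa>) = expectation (\<lambda>w. (inverse (partition_constant W \<kappa>) * penalty_weight \<kappa> w) *\<^sub>R f w)"
    unfolding penalised_bridge_def
  proof (rule integral_density)
    show "f \<in> borel_measurable W" using f by (simp add: measurable_cong_sets[OF sets_W refl])
    show "(\<lambda>w. inverse (partition_constant W \<kappa>) * penalty_weight \<kappa> w) \<in> borel_measurable W"
      using measurable_penalty_weight by (simp add: measurable_cong_sets[OF sets_W refl])
    show "AE w in W. 0 \<le> inverse (partition_constant W \<kappa>) * penalty_weight \<kappa> w"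
      using AE_space by eventually_elim (use partition_constant_pos[OF \<kappa>] penalty_weight_bounds \<kappa> in \<open>auto intro!: mult_nonneg_nonneg less_imp_le\<close>)
  qed
  also have "\<dots> = inverse (partition_constant W \<kappa>) * expectation (\<lambda>w. f w * penalty_weight \<kappa> w)"
    by (subst integral_mult_right_zero[symmetric]) (simp add: mult_ac)
  finally show ?thesis by (simp add: divide_inverse mult.commute)
qed

lemma prob_space_penalised_bridge:
  assumes \<kappa>: "0 < \<kappa>" shows "prob_space (penalised_bridge W \<kappa>)"
proof (rule prob_spaceI)
  have m: "penalty_weight \<kappa> \<in> borel_measurable W"
    using measurable_penalty_weight by (simp add: measurable_cong_sets[OF sets_W refl])
  have "emeasure (penalised_bridge W \<kappa>) (space (penalised_bridge W \<kappa>)) =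
    (\<integral>\<^sup>+w. ennreal (inverse (partition_constant W \<kappa>) * penalty_weight \<kappa> w) \<partial>W)"
    unfolding penalised_bridge_def using m by (simp add: emeasure_density cong: nn_integral_cong)
  also have "\<dots> = ennreal (expectation (\<lambda>w. inverse (partition_constant W \<kappa>) * penalty_weight \<kappa> w))"
  proof (rule nn_integral_eq_integral)
    have "integrable W (penalty_weight \<kappa>)"
      using m penalty_weight_bounds \<kappa> by (intro integrable_const_bound[of _ 1]) (auto simp: abs_of_pos)
    then show "integrable W (\<lambda>w. inverse (partition_constant W \<kappa>) * penalty_weight \<kappa> w)" by simp
    show "AE w in W. 0 \<le> inverse (partition_constant W \<kappa>) * penalty_weight \<kappa> w"
      using AE_space by eventually_elim (use partition_constant_pos[OF \<kappa>] penalty_weight_bounds \<kappa> in \<open>auto intro!: mult_nonneg_nonneg less_imp_le\<close>)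
  qed
  also have "expectation (\<lambda>w. inverse (partition_constant W \<kappa>) * penalty_weight \<kappa> w) = 1"
    using partition_constant_pos[OF \<kappa>] by (simp add: partition_constant_def)
  finally show "emeasure (penalised_bridge W \<kappa>) (space (penalised_bridge W \<kappa>)) = 1" by simp
qed

text \<open>After averaging, the inner integral converges for almost every path, by concentration at
  the minimiser and continuity of the shift, and it is bounded by B. Dividing by 1 - exp (- 2
  \<kappa>) accounts for the partition constant.\<close>

lemma penalised_bridge_tendsto_vervaat:
  assumes f: "continuous_map path_topology euclideanreal f" and B: "\<And>w. w \<in> space path_borel \<Longrightarrow> \<bar>f w\<bar> \<le> B"
  shows "((\<lambda>\<kappa>. \<integral>w. f w \<partial>penalised_bridge W \<kappa>) \<longlongrightarrow> expectation (\<lambda>w. f (vervaat w))) at_top"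
proof -
  have fm [measurable]: "f \<in> borel_measurable path_borel" by (rule continuous_map_path_measurable[OF f])
  let ?c = "\<lambda>v::real. max 0 (min 1 v)"
  define s where "s \<kappa> w = (\<integral>v. f (cyclic_shift (?c v) w) * level_weight \<kappa> w v \<partial>unit_lborel)" for \<kappa> w
  have B0: "0 \<le> B"
  proof -
    obtain w where "w \<in> space W" using not_empty by blast
    then show ?thesis using B[of w] by (auto simp: space_W)
  qed
  have cyc_m: "(\<lambda>v. cyclic_shift (?c v) w) \<in> measurable borel path_borel" if "w \<in> space path_borel" for w
    using that by (intro measurable_cyclic_shift[of "\<lambda>_. w"]) auto
  have lim: "((\<lambda>\<kappa>. expectation (s \<kappa>)) \<longlongrightarrow> expectation (\<lambda>w. f (vervaat w))) at_top"
  proof (rule integral_dominated_convergence_at_top[where w="\<lambda>_. B"])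
    show "(\<lambda>w. f (vervaat w)) \<in> borel_measurable W"
      using measurable_compose[OF measurable_vervaat fm] by (simp add: measurable_cong_sets[OF sets_W refl])
    show "s \<kappa> \<in> borel_measurable W" for \<kappa>
    proof -
      have "(\<lambda>p. cyclic_shift (?c (snd p)) (fst p)) \<in> measurable (W \<Otimes>\<^sub>M unit_lborel) path_borel"
        by (intro measurable_cyclic_shift) (auto simp: measurable_cong_sets[OF refl sets_W, symmetric])
      then show ?thesis unfolding s_def
        by (intro measurable_level_weight_integral sets_W measurable_compose[OF _ fm])
    qed
    show "AE w in W. ((\<lambda>\<kappa>. s \<kappa> w) \<longlongrightarrow> f (vervaat w)) at_top"
      using AE_generic_path AE_space
    proof eventually_elim
      case (elim w)
      then obtain u where gen: "generic_path w u" by blast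
      have w: "w \<in> space path_borel" and u: "u \<in> {0..1}" using gen by (auto simp: generic_path_def)
      have "f (vervaat w) = f (cyclic_shift (?c u) w)" using u by (simp add: vervaat_def argmin_path_eq[OF gen])
      then show ?case unfolding s_def
        using cyclic_shift_continuous[OF w u f] u B cyclic_shift_in_space[OF w] measurable_compose[OF cyc_m[OF w] fm]
        by (simp only:, intro level_weight_concentrates[OF gen, of _ B]) auto
    qed
    show "\<forall>\<^sub>F \<kappa> in at_top. AE w in W. norm (s \<kappa> w) \<le> B"
      using eventually_gt_at_top[of 0]
    proof eventually_elim
      case \<kappa>: (elim \<kappa>)
      show ?case using AE_no_atoms AE_space
      proof eventually_elim
        case (elim w)
        have w: "w \<in> space path_borel" using elim by (simp add: space_W)
        have fB: "\<bar>f (cyclic_shift (?c v) w)\<bar> \<le> B" for v by (intro B cyclic_shift_in_space w) auto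
        have "norm (s \<kappa> w) \<le> (\<integral>v. B * level_weight \<kappa> w v \<partial>unit_lborel)"
          unfolding s_def
        proof (rule norm_integral_le_integral)
          show "integrable unit_lborel (\<lambda>v. f (cyclic_shift (?c v) w) * level_weight \<kappa> w v)"
            using \<kappa> fB measurable_compose[OF cyc_m[OF w] fm] by (intro integrable_level_weight[OF w]) auto
          show "integrable unit_lborel (\<lambda>v. B * level_weight \<kappa> w v)"
            using \<kappa> by (intro integrable_level_weight[OF w]) auto
          show "AE v in unit_lborel. norm (f (cyclic_shift (?c v) w) * level_weight \<kappa> w v) \<le> B * level_weight \<kappa> w v"
            using fB level_weight_nonneg[of \<kappa> w] \<kappa> by (intro AE_I2) (auto simp: abs_mult intro!: mult_right_mono)
        qed
        also have "\<dots> = B * (1 - exp (- 2 * \<kappa>))"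
          using integral_level_weight[OF w, of \<kappa>] elim by simp
        also have "\<dots> \<le> B * 1" using B0 by (intro mult_left_mono) auto
        finally show ?case by simp
      qed
    qed
  qed auto
  have "((\<lambda>\<kappa>::real. 1 - exp (- 2 * \<kappa>)) \<longlongrightarrow> 1) at_top" by real_asymp
  from tendsto_divide[OF lim this]
  have lim': "((\<lambda>\<kappa>. expectation (s \<kappa>) / (1 - exp (- 2 * \<kappa>))) \<longlongrightarrow> expectation (\<lambda>w. f (vervaat w))) at_top" by simp
  show ?thesis
  proof (rule Lim_transform_eventually[OF lim'])
    show "\<forall>\<^sub>F \<kappa> in at_top. expectation (s \<kappa>) / (1 - exp (- 2 * \<kappa>)) = (\<integral>w. f w \<partial>penalised_bridge W \<kappa>)"
      using eventually_gt_at_top[of 0]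
    proof eventually_elim
      case (elim \<kappa>)
      have "expectation (s \<kappa>) = 2 * \<kappa> * expectation (\<lambda>w. f w * penalty_weight \<kappa> w)"
        unfolding s_def using elim B by (subst expectation_cyclic_average[of \<kappa> f B]) auto
      moreover have "1 - exp (- 2 * \<kappa>) = 2 * \<kappa> * partition_constant W \<kappa>"
        using partition_constant_eq[of \<kappa>] elim by simp
      ultimately show ?case using elim by (simp add: integral_penalised_bridge[OF elim fm])
    qed
  qed
qed

end

section \<open>Resampling the penalised bridge\<close>

definition uniformly_converges :: "(nat \<Rightarrow> real \<Rightarrow> real) \<Rightarrow> (real \<Rightarrow> real) \<Rightarrow> bool" where
  "uniformly_converges v w \<longleftrightarrow> (\<forall>r>0. \<forall>\<^sub>F n in sequentially. \<forall>x\<in>{0..1}. \<bar>v n x - w x\<bar> \<le> r)"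

lemma uniformly_converges_pointwise:
  assumes "uniformly_converges v w" "x \<in> {0..1}"
  shows "(\<lambda>n. v n x) \<longlonglongrightarrow> w x"
proof (rule tendstoI)
  fix e :: real assume "e > 0"
  then have "\<forall>\<^sub>F n in sequentially. \<forall>x\<in>{0..1}. \<bar>v n x - w x\<bar> \<le> e / 2"
    using assms(1) unfolding uniformly_converges_def by (meson half_gt_zero)
  then show "\<forall>\<^sub>F n in sequentially. dist (v n x) (w x) < e"
    by eventually_elim (use assms(2) \<open>e > 0\<close> in \<open>fastforce simp: dist_real_def\<close>)
qed

text \<open>The topology comes from the uniform distance, so sequences suffice; this lets continuity
  of functionals be proved by limit theorems.\<close>

lemma continuous_map_path_sequentially:
  fixes f :: "(real \<Rightarrow> real) \<Rightarrow> real"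
  assumes f: "\<And>v w. w \<in> space path_borel \<Longrightarrow> (\<And>n. v n \<in> space path_borel) \<Longrightarrow> uniformly_converges v w \<Longrightarrow> (\<lambda>n. f (v n)) \<longlonglongrightarrow> f w"
  shows "continuous_map path_topology euclideanreal f"
  unfolding continuous_map_def
proof (intro conjI allI impI)
  fix S :: "real set" assume "openin euclideanreal S"
  then have S: "open S" by simp
  show "openin path_topology {w \<in> topspace path_topology. f w \<in> S}"
    unfolding openin_path
  proof (intro conjI ballI)
    fix w assume "w \<in> {w \<in> topspace path_topology. f w \<in> S}"
    then have w: "w \<in> space path_borel" "f w \<in> S" by (auto simp: mspace_eq_space)
    show "\<exists>r>0. \<forall>v\<in>space path_borel. (\<forall>x\<in>{0..1}. \<bar>v x - w x\<bar> \<le> r) \<longrightarrow> v \<in> {w \<in> topspace path_topology. f w \<in> S}"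
    proof (rule ccontr)
      assume neg: "\<not> ?thesis"
      have "\<exists>v. v \<in> space path_borel \<and> (\<forall>x\<in>{0..1}. \<bar>v x - w x\<bar> \<le> 1 / real (Suc n)) \<and> f v \<notin> S" for n
        using neg[unfolded not_ex, rule_format, of "1 / real (Suc n)"] by (auto simp: mspace_eq_space)
      then obtain v where v: "\<And>n. v n \<in> space path_borel" "\<And>n. \<forall>x\<in>{0..1}. \<bar>v n x - w x\<bar> \<le> 1 / real (Suc n)" "\<And>n. f (v n) \<notin> S"
        by metis
      have "uniformly_converges v w"
        unfolding uniformly_converges_def
      proof (intro allI impI)
        fix r :: real assume "r > 0"
        then have "\<forall>\<^sub>F n in sequentially. inverse (real (Suc n)) < r"
          using LIMSEQ_inverse_real_of_nat by (intro order_tendstoD) auto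
        then show "\<forall>\<^sub>F n in sequentially. \<forall>x\<in>{0..1}. \<bar>v n x - w x\<bar> \<le> r"
        proof eventually_elim
          case (elim n)
          then show ?case using v(2)[of n] by (auto simp: inverse_eq_divide simp del: of_nat_Suc intro: order_trans less_imp_le)
        qed
      qed
      then have "(\<lambda>n. f (v n)) \<longlonglongrightarrow> f w" by (intro f w v)
      then have "\<forall>\<^sub>F n in sequentially. f (v n) \<in> S" using S w by (intro topological_tendstoD)
      then show False using v(3) by simp
    qed
  qed (auto simp: mspace_eq_space)
qed auto

lemma path_inf_lipschitz:
  assumes v: "v \<in> space path_borel" and w: "w \<in> space path_borel" and pq: "0 \<le> p" "p \<le> q" "q \<le> 1"
    and r: "\<forall>x\<in>{0..1}. \<bar>v x - w x\<bar> \<le> r"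
  shows "\<bar>path_inf p q v - path_inf p q w\<bar> \<le> r"
proof -
  have c: "continuous_on {p..q} u" if "u \<in> space path_borel" for u
    using path_borel_continuous[OF that] pq by (auto elim!: continuous_on_subset)
  obtain x where x: "x \<in> {p..q}" "path_inf p q v = v x" "\<forall>y\<in>{p..q}. v x \<le> v y"
    by (rule path_inf_attained[OF c[OF v] pq(2)])
  obtain y where y: "y \<in> {p..q}" "path_inf p q w = w y" "\<forall>x\<in>{p..q}. w y \<le> w x"
    by (rule path_inf_attained[OF c[OF w] pq(2)])
  have "v x \<le> v y" "w y \<le> w x" "\<bar>v x - w x\<bar> \<le> r" "\<bar>v y - w y\<bar> \<le> r"
    using x y r pq by auto
  then show ?thesis using x(2) y(2) by linarith
qed

lemma path_inf_uniformly_converges: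
  assumes "\<And>n. v n \<in> space path_borel" "w \<in> space path_borel" "0 \<le> p" "p \<le> q" "q \<le> 1" "uniformly_converges v w"
  shows "(\<lambda>n. path_inf p q (v n)) \<longlonglongrightarrow> path_inf p q w"
proof (rule tendstoI)
  fix e :: real assume e: "e > 0"
  then have "\<forall>\<^sub>F n in sequentially. \<forall>x\<in>{0..1}. \<bar>v n x - w x\<bar> \<le> e / 2"
    using assms(6) unfolding uniformly_converges_def by (meson half_gt_zero)
  then show "\<forall>\<^sub>F n in sequentially. dist (path_inf p q (v n)) (path_inf p q w) < e"
  proof eventually_elim
    case (elim n)
    have "\<bar>path_inf p q (v n) - path_inf p q w\<bar> \<le> e / 2"
      using assms elim by (intro path_inf_lipschitz) auto
    then show ?case using e by (simp add: dist_real_def)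
  qed
qed

lemma bridge_dist:
  assumes "s < t" "x \<in> {s..t}"
  shows "\<bar>bridge s t a b w x - bridge s t a' b' w x\<bar> \<le> \<bar>a - a'\<bar> + \<bar>b - b'\<bar>"
proof -
  define P where "P = (t - x) / (t - s) * (a - a')"
  define Q where "Q = (x - s) / (t - s) * (b - b')"
  have "bridge s t a b w x - bridge s t a' b' w x = P + Q"
    unfolding P_def Q_def using assms by (simp add: bridge_def diff_divide_distrib add_divide_distrib algebra_simps)
  then have eq: "bridge s t a b w x - bridge s t a' b' w x = P + Q" .
  have hP: "\<bar>P\<bar> \<le> 1 * \<bar>a - a'\<bar>"
    unfolding P_def abs_mult using assms by (intro mult_right_mono) (auto simp: divide_simps)
  have hQ: "\<bar>Q\<bar> \<le> 1 * \<bar>b - b'\<bar>"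
    unfolding Q_def abs_mult using assms by (intro mult_right_mono) (auto simp: divide_simps)
  show ?thesis unfolding eq using order_trans[OF abs_triangle_ineq add_mono[OF hP hQ]] by simp
qed

section \<open>Marked bridges on the event of positivity\<close>

context brownian_bridge
begin

text \<open>Not normalised: division by \<open>survival (t - s) a b\<close> gives the expected
  product of marks for the bridge conditioned to stay positive.\<close>

definition positive_marks :: "real \<Rightarrow> real \<Rightarrow> (nat \<Rightarrow> real) \<Rightarrow> nat \<Rightarrow> (nat \<Rightarrow> real \<Rightarrow> real) \<Rightarrow> real \<Rightarrow> real \<Rightarrow> real" where
  "positive_marks s t \<tau> k g a b = expectation (\<lambda>v. (\<Prod>i<k. g i (bridge s t a b v (\<tau> (Suc i)))) *
     indicator {v. \<forall>x\<in>{s..t}. 0 < bridge s t a b v x} v)"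

context
  fixes s t :: real and \<tau> :: "nat \<Rightarrow> real" and k :: nat and g :: "nat \<Rightarrow> real \<Rightarrow> real"
  assumes grid: "grid s t \<tau> k" and g_cont: "\<And>i. continuous_on UNIV (g i)"
    and g01: "\<And>i x. 0 \<le> g i x \<and> g i x \<le> 1"
begin

lemma grid_less: "s < t" using gridD(7)[OF grid] .

lemma measurable_mark: "g i \<in> borel_measurable borel"
  using g_cont by (rule borel_measurable_continuous_onI)

lemma prod_marks_bounds: "0 \<le> (\<Prod>i<k. g i (h i)) \<and> (\<Prod>i<k. g i (h i)) \<le> 1"
  using g01 by (auto intro: prod_nonneg prod_le_1)

lemma measurable_positive_marks_integrand:
  assumes f: "f \<in> measurable M path_borel" and a: "a \<in> borel_measurable M" and b: "b \<in> borel_measurable M"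
  shows "(\<lambda>\<omega>. (\<Prod>i<k. g i (bridge s t (a \<omega>) (b \<omega>) (f \<omega>) (\<tau> (Suc i)))) *
    (indicator {v. \<forall>x\<in>{s..t}. 0 < bridge s t (a \<omega>) (b \<omega>) v x} (f \<omega>) :: real)) \<in> borel_measurable M"
proof -
  have "(\<lambda>\<omega>. bridge s t (a \<omega>) (b \<omega>) (f \<omega>) (\<tau> (Suc i))) \<in> borel_measurable M" if "i < k" for i
    using that gridD(5,6)[OF grid, of "Suc i"] by (intro measurable_bridge f a b grid_less) auto
  then have 1: "(\<lambda>\<omega>. (\<Prod>i<k. g i (bridge s t (a \<omega>) (b \<omega>) (f \<omega>) (\<tau> (Suc i))))) \<in> borel_measurable M"
    by (intro borel_measurable_prod measurable_compose[OF _ measurable_mark]) auto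
  have "(\<lambda>\<omega>. indicator {\<omega> \<in> space M. \<forall>x\<in>{s..t}. 0 < bridge s t (a \<omega>) (b \<omega>) (f \<omega>) x} \<omega> :: real) \<in> borel_measurable M"
    by (intro borel_measurable_indicator sets_bridge_gt[OF f grid_less a b borel_measurable_const])
  then have 2: "(\<lambda>\<omega>. indicator {v. \<forall>x\<in>{s..t}. 0 < bridge s t (a \<omega>) (b \<omega>) v x} (f \<omega>) :: real) \<in> borel_measurable M"
    by (rule measurable_cong[THEN iffD1, rotated]) (auto simp: indicator_def)
  show ?thesis using 1 2 by simp
qed

lemma integrable_positive_marks:
  "integrable W (\<lambda>v. (\<Prod>i<k. g i (bridge s t a b v (\<tau> (Suc i)))) * indicator {v. \<forall>x\<in>{s..t}. 0 < bridge s t a b v x} v)"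
  using measurable_positive_marks_integrand[of "\<lambda>v. v" W "\<lambda>_. a" "\<lambda>_. b"] prod_marks_bounds
  by (intro integrable_const_bound[of _ 1]) (auto simp: measurable_ident_sets[OF sets_W] indicator_def)

lemma positive_marks_bounds: "0 \<le> positive_marks s t \<tau> k g a b" "positive_marks s t \<tau> k g a b \<le> survival (t - s) a b"
proof -
  show "0 \<le> positive_marks s t \<tau> k g a b"
    unfolding positive_marks_def using prod_marks_bounds by (intro integral_nonneg_AE) (auto simp: indicator_def)
  have "{v \<in> space W. \<forall>x\<in>{s..t}. 0 < bridge s t a b v x} \<in> events" using sets_bridge_W[OF grid_less] by auto
  then have "integrable W (indicator {v \<in> space W. \<forall>x\<in>{s..t}. 0 < bridge s t a b v x} :: _ \<Rightarrow> real)"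
    by (intro integrable_real_indicator) (auto simp: emeasure_eq_measure)
  then have "positive_marks s t \<tau> k g a b \<le> expectation (indicator {v \<in> space W. \<forall>x\<in>{s..t}. 0 < bridge s t a b v x})"
    unfolding positive_marks_def using prod_marks_bounds
    by (intro integral_mono integrable_positive_marks) (auto simp: indicator_def)
  also have "\<dots> = survival (t - s) a b"
    using prob_bridge_pos[OF grid_less, of a b] \<open>_ \<in> events\<close> by simp
  finally show "positive_marks s t \<tau> k g a b \<le> survival (t - s) a b" .
qed

lemma positive_marks_killed_chain:
  "ennreal (positive_marks s t \<tau> k g a b * heat (t - s) (b - a)) = killed_chain \<tau> (\<lambda>i x. ennreal (g i x)) k a b"
proof -
  have "killed_chain \<tau> (\<lambda>i x. ennreal (g i x)) k a b =
    (\<integral>\<^sup>+v. (\<Prod>i<k. ennreal (g i (bridge s t a b v (\<tau> (Suc i))))) * indicator {v. \<forall>x\<in>{s..t}. 0 < bridge s t a b v x} v \<partial>W) * ennreal (heat (t - s) (b - a))"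
    using g01 measurable_mark by (intro bridge_positive_fdd[symmetric] grid) auto
  also have "(\<integral>\<^sup>+v. (\<Prod>i<k. ennreal (g i (bridge s t a b v (\<tau> (Suc i))))) * indicator {v. \<forall>x\<in>{s..t}. 0 < bridge s t a b v x} v \<partial>W) =
    (\<integral>\<^sup>+v. ennreal ((\<Prod>i<k. g i (bridge s t a b v (\<tau> (Suc i)))) * indicator {v. \<forall>x\<in>{s..t}. 0 < bridge s t a b v x} v) \<partial>W)"
    using g01 by (intro nn_integral_cong) (auto simp: prod_ennreal indicator_def)
  also have "\<dots> = ennreal (positive_marks s t \<tau> k g a b)"
    unfolding positive_marks_def using prod_marks_bounds
    by (intro nn_integral_eq_integral integrable_positive_marks) (auto simp: indicator_def)
  finally show ?thesis using positive_marks_bounds(1)[of a b] by (simp add: ennreal_mult)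
qed

text \<open>Moving the end values moves the whole bridge uniformly by \<open>bridge_dist\<close>, so
  the indicator of positivity can only fail to converge at paths with minimum exactly 0, a null set
  by \<open>AE_bridge_min\<close>.\<close>

lemma positive_marks_continuous:
  assumes a: "an \<longlonglongrightarrow> a" and b: "bn \<longlonglongrightarrow> b"
  shows "(\<lambda>n. positive_marks s t \<tau> k g (an n) (bn n)) \<longlonglongrightarrow> positive_marks s t \<tau> k g a b"
  unfolding positive_marks_def
proof (rule integral_dominated_convergence[where w="\<lambda>_. 1"])
  have m: "(\<lambda>v. (\<Prod>i<k. g i (bridge s t a b v (\<tau> (Suc i)))) * indicator {v. \<forall>x\<in>{s..t}. 0 < bridge s t a b v x} v) \<in> borel_measurable W" for a b
    using integrable_positive_marks by blast
  show "(\<lambda>v. (\<Prod>i<k. g i (bridge s t a b v (\<tau> (Suc i)))) * indicator {v. \<forall>x\<in>{s..t}. 0 < bridge s t a b v x} v) \<in> borel_measurable W"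
    "(\<lambda>v. (\<Prod>i<k. g i (bridge s t (an n) (bn n) v (\<tau> (Suc i)))) * indicator {v. \<forall>x\<in>{s..t}. 0 < bridge s t (an n) (bn n) v x} v) \<in> borel_measurable W" for n
    by (rule m)+
  show "AE v in W. norm ((\<Prod>i<k. g i (bridge s t (an n) (bn n) v (\<tau> (Suc i)))) * indicator {v. \<forall>x\<in>{s..t}. 0 < bridge s t (an n) (bn n) v x} v) \<le> 1" for n
    using prod_marks_bounds by (intro AE_I2) (auto simp: indicator_def)
  have "(\<lambda>n. \<bar>an n - a\<bar> + \<bar>bn n - b\<bar>) \<longlonglongrightarrow> \<bar>a - a\<bar> + \<bar>b - b\<bar>" by (intro tendsto_intros a b)
  then have ab: "(\<lambda>n. \<bar>an n - a\<bar> + \<bar>bn n - b\<bar>) \<longlonglongrightarrow> 0" by simp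
  have X: "(\<lambda>n. bridge s t (an n) (bn n) v x) \<longlonglongrightarrow> bridge s t a b v x" for v x
    unfolding bridge_def using grid_less by (intro tendsto_intros a b) auto
  show "AE v in W. (\<lambda>n. (\<Prod>i<k. g i (bridge s t (an n) (bn n) v (\<tau> (Suc i)))) * indicator {v. \<forall>x\<in>{s..t}. 0 < bridge s t (an n) (bn n) v x} v)
     \<longlonglongrightarrow> (\<Prod>i<k. g i (bridge s t a b v (\<tau> (Suc i)))) * indicator {v. \<forall>x\<in>{s..t}. 0 < bridge s t a b v x} v"
    using AE_bridge_min[OF grid_less, of 0 a b] AE_space
  proof eventually_elim
    case (elim v)
    have v: "v \<in> space path_borel" using elim by (simp add: space_W)
    have "(\<lambda>n. g i (bridge s t (an n) (bn n) v x)) \<longlonglongrightarrow> g i (bridge s t a b v x)" for i x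
      using g_cont[of i] X by (rule continuous_on_tendsto_compose) auto
    moreover have "\<forall>\<^sub>F n in sequentially. (indicator {v. \<forall>x\<in>{s..t}. 0 < bridge s t (an n) (bn n) v x} v :: real) = indicator {v. \<forall>x\<in>{s..t}. 0 < bridge s t a b v x} v"
    proof (cases "\<forall>x\<in>{s..t}. 0 < bridge s t a b v x")
      case True
      obtain x0 where x0: "x0 \<in> {s..t}" "path_inf s t (bridge s t a b v) = bridge s t a b v x0" "\<forall>y\<in>{s..t}. bridge s t a b v x0 \<le> bridge s t a b v y"
        by (rule path_inf_attained[OF continuous_on_bridge[OF v grid_less] less_imp_le[OF grid_less]])
      have "\<forall>\<^sub>F n in sequentially. \<bar>an n - a\<bar> + \<bar>bn n - b\<bar> < bridge s t a b v x0"
        using True x0(1) by (intro order_tendstoD[OF ab]) auto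
      then show ?thesis
      proof eventually_elim
        case (elim n)
        have "0 < bridge s t (an n) (bn n) v x" if "x \<in> {s..t}" for x
          using bridge_dist[OF grid_less that, of "an n" "bn n" v a b] x0(3) that elim by fastforce
        then show ?case using True by (simp add: indicator_def)
      qed
    next
      case False
      then obtain x where x: "x \<in> {s..t}" "bridge s t a b v x < 0" using elim(1) by (meson not_le)
      have "\<forall>\<^sub>F n in sequentially. bridge s t (an n) (bn n) v x < 0"
        using x(2) by (intro order_tendstoD[OF X])
      then show ?thesis
        by eventually_elim (use x False in \<open>auto simp: indicator_def intro!: bexI[of _ x]\<close>)
    qed
    then have "(\<lambda>n. indicator {v. \<forall>x\<in>{s..t}. 0 < bridge s t (an n) (bn n) v x} v :: real) \<longlonglongrightarrow> indicator {v. \<forall>x\<in>{s..t}. 0 < bridge s t a b v x} v"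
      by (rule tendsto_eventually)
    ultimately show ?case by (intro tendsto_mult tendsto_prod)
  qed
qed auto

lemma measurable_positive_marks:
  "(\<lambda>(a, b). positive_marks s t \<tau> k g a b) \<in> borel_measurable (borel \<Otimes>\<^sub>M borel)"
proof -
  have "continuous_on UNIV (\<lambda>p. positive_marks s t \<tau> k g (fst p) (snd p))"
    unfolding continuous_on_sequentially
  proof (intro allI ballI impI)
    fix x and p :: "real \<times> real" assume "(\<forall>n. x n \<in> UNIV) \<and> x \<longlonglongrightarrow> p"
    then have "x \<longlonglongrightarrow> p" by simp
    then show "((\<lambda>p. positive_marks s t \<tau> k g (fst p) (snd p)) \<circ> x) \<longlonglongrightarrow> positive_marks s t \<tau> k g (fst p) (snd p)"
      unfolding o_def by (intro positive_marks_continuous tendsto_fst tendsto_snd)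
  qed
  then show ?thesis by (simp add: borel_prod case_prod_unfold borel_measurable_continuous_onI)
qed

end

text \<open>On the event of positivity on \<open>[s,t]\<close> the penalty does not see the resampled part of the path.\<close>

lemma penalised_resampling:
  assumes grid: "grid s t \<tau> k" and g_cont: "\<And>i. continuous_on UNIV (g i)" and g01: "\<And>i x. 0 \<le> g i x \<and> g i x \<le> 1"
    and st01: "0 \<le> s" "t \<le> 1"
    and \<Phi> [measurable]: "(\<lambda>(a, b). \<Phi> a b) \<in> borel_measurable (borel \<Otimes>\<^sub>M borel)" and \<Phi>nn: "\<And>a b. 0 \<le> \<Phi> a b"
  shows "(\<integral>\<^sup>+w. ennreal (\<Phi> (w s) (w t) * ((\<Prod>i<k. g i (w (\<tau> (Suc i)))) * (if 0 < path_inf s t w then 1 else 0)) * penalty_weight \<kappa> w) \<partial>W) =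
    (\<integral>\<^sup>+w. ennreal (\<Phi> (w s) (w t) * positive_marks s t \<tau> k g (w s) (w t) * exp (- 2 * \<kappa> * measure unit_lborel {x. x \<notin> {s..t} \<and> w x \<le> 0})) \<partial>W)"
proof -
  note gm = measurable_mark[OF grid g_cont g01]
  note st = gridD(7)[OF grid]
  have st': "s \<in> {0..1}" "t \<in> {0..1}" using st01 st by auto
  have \<tau>01: "\<tau> (Suc i) \<in> {0..1}" "\<tau> (Suc i) \<in> {s..t}" if "i < k" for i
    using gridD(5,6)[OF grid, of "Suc i"] st01 that by auto
  have ev [measurable]: "(\<lambda>w. w s) \<in> borel_measurable path_borel" "(\<lambda>w. w t) \<in> borel_measurable path_borel"
    using st' by (intro measurable_path_eval; simp)+
  have [measurable]: "path_inf s t \<in> borel_measurable path_borel" using st st01 by (intro measurable_path_inf) auto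
  note measurable_penalty_weight [measurable]
  have [measurable]: "(\<lambda>w. \<Prod>i<k. g i (w (\<tau> (Suc i)))) \<in> borel_measurable path_borel"
    using \<tau>01 by (intro borel_measurable_prod measurable_compose[OF measurable_path_eval gm]) auto
  have \<Phi>m [measurable]: "(\<lambda>w. \<Phi> (w s) (w t)) \<in> borel_measurable path_borel"
    using measurable_Pair_compose_split[OF \<Phi> ev] .
  let ?L = "\<lambda>w. ennreal (\<Phi> (w s) (w t) * ((\<Prod>i<k. g i (w (\<tau> (Suc i)))) * (if 0 < path_inf s t w then 1 else 0)) * penalty_weight \<kappa> w)"
  have L: "?L \<in> borel_measurable path_borel" by measurable
  \<comment> \<open>The penalty for the time outside [s,t] alone, which resampling inside leaves
    unchanged.\<close>
  define out where "out w = exp (- 2 * \<kappa> * measure unit_lborel {x. x \<notin> {s..t} \<and> w x \<le> 0})" for w :: "real \<Rightarrow> real"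
  have "(\<integral>\<^sup>+w. ?L w \<partial>W) = (\<integral>\<^sup>+w. \<integral>\<^sup>+v. ?L (splice s t w v) \<partial>W \<partial>W)"
    using st st01 by (intro nn_integral_splice L) auto
  also have "\<dots> = (\<integral>\<^sup>+w. ennreal (\<Phi> (w s) (w t) * positive_marks s t \<tau> k g (w s) (w t) * out w) \<partial>W)"
  proof (rule nn_integral_cong)
    fix w assume w: "w \<in> space W"
    then have wp: "w \<in> space path_borel" by (simp add: space_W)
    let ?I = "\<lambda>v. (\<Prod>i<k. g i (bridge s t (w s) (w t) v (\<tau> (Suc i)))) * indicator {v. \<forall>x\<in>{s..t}. 0 < bridge s t (w s) (w t) v x} v"
    have "(\<integral>\<^sup>+v. ?L (splice s t w v) \<partial>W) = (\<integral>\<^sup>+v. ennreal (\<Phi> (w s) (w t) * out w) * ennreal (?I v) \<partial>W)"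
    proof (rule nn_integral_cong_AE)
      show "AE v in W. ?L (splice s t w v) = ennreal (\<Phi> (w s) (w t) * out w) * ennreal (?I v)"
        using AE_endpoints AE_space
      proof eventually_elim
        case (elim v)
        have vp: "v \<in> space path_borel" using elim by (simp add: space_W)
        have S: "splice s t w v \<in> space path_borel" using wp vp st st01 by (intro splice_in_space) auto
        have inside: "splice s t w v x = bridge s t (w s) (w t) v x" if "x \<in> {s..t}" for x
          using that st01 by (auto simp: splice_def min_def max_def)
        have outside: "splice s t w v x = w x" if "x \<in> {0..1}" "x \<le> s \<or> t \<le> x" for x
          using that st elim(1) by (auto simp: splice_def min_def max_def bridge_start bridge_end)
        have ends: "splice s t w v s = w s" "splice s t w v t = w t" using outside st' by auto
        have ext: "splice s t w v x = w x" if "x \<notin> {0..1}" for x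
          using S wp that by (auto simp: space_path_borel extensional_def)
        have marks: "(\<Prod>i<k. g i (splice s t w v (\<tau> (Suc i)))) = (\<Prod>i<k. g i (bridge s t (w s) (w t) v (\<tau> (Suc i))))"
          using \<tau>01 inside by (intro prod.cong) auto
        have inf: "0 < path_inf s t (splice s t w v) \<longleftrightarrow> (\<forall>x\<in>{s..t}. 0 < bridge s t (w s) (w t) v x)"
        proof -
          have "path_inf s t (splice s t w v) = path_inf s t (bridge s t (w s) (w t) v)"
            unfolding path_inf_def using inside by (auto intro!: INF_cong)
          moreover obtain x where "x \<in> {s..t}" "path_inf s t (bridge s t (w s) (w t) v) = bridge s t (w s) (w t) v x"
            "\<forall>y\<in>{s..t}. bridge s t (w s) (w t) v x \<le> bridge s t (w s) (w t) v y"
            by (rule path_inf_attained[OF continuous_on_bridge[OF vp st] less_imp_le[OF st]])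
          ultimately show ?thesis by (metis less_le_trans)
        qed
        have pen: "penalty_weight \<kappa> (splice s t w v) = out w" if pos: "\<forall>x\<in>{s..t}. 0 < bridge s t (w s) (w t) v x"
        proof -
          have "splice s t w v x \<le> 0 \<longleftrightarrow> x \<notin> {s..t} \<and> w x \<le> 0" for x
          proof (cases "x \<in> {s..t}")
            case True
            then show ?thesis using pos inside[OF True] by (auto simp: not_le)
          next
            case False
            then have "splice s t w v x = w x" using outside[of x] ext[of x] by fastforce
            then show ?thesis using False by simp
          qed
          then show ?thesis unfolding penalty_weight_occupation[OF S] occupation_def out_def by simp
        qed
        show ?case
        proof (cases "\<forall>x\<in>{s..t}. 0 < bridge s t (w s) (w t) v x")
          case True
          have "0 \<le> out w" by (simp add: out_def)
          then show ?thesis using True inf prod_marks_bounds[OF grid g_cont g01] \<Phi>nn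
            by (simp add: ends marks pen ennreal_mult'[symmetric] mult_ac)
        next
          case False
          then have n: "\<not> 0 < path_inf s t (splice s t w v)" and I: "?I v = 0"
            using inf by (auto simp: indicator_def)
          show ?thesis unfolding I using n by simp
        qed
      qed
    qed
    also have "\<dots> = ennreal (\<Phi> (w s) (w t) * out w) * (\<integral>\<^sup>+v. ennreal (?I v) \<partial>W)"
      using borel_measurable_integrable[OF integrable_positive_marks[OF grid g_cont g01, where a="w s" and b="w t"]]
      by (intro nn_integral_cmult) simp
    also have "(\<integral>\<^sup>+v. ennreal (?I v) \<partial>W) = ennreal (positive_marks s t \<tau> k g (w s) (w t))"
      unfolding positive_marks_def using prod_marks_bounds[OF grid g_cont g01]
      by (intro nn_integral_eq_integral integrable_positive_marks[OF grid g_cont g01]) (auto simp: indicator_def)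
    also have "ennreal (\<Phi> (w s) (w t) * out w) * \<dots> = ennreal (\<Phi> (w s) (w t) * positive_marks s t \<tau> k g (w s) (w t) * out w)"
      using \<Phi>nn by (subst ennreal_mult'[symmetric]) (auto simp: out_def mult_ac)
    finally show "(\<integral>\<^sup>+v. ?L (splice s t w v) \<partial>W) = ennreal (\<Phi> (w s) (w t) * positive_marks s t \<tau> k g (w s) (w t) * out w)" .
  qed
  finally show ?thesis unfolding out_def .
qed

lemma positive_marks_one:
  assumes "grid s t \<tau> k" shows "positive_marks s t \<tau> k (\<lambda>_ _. 1) a b = survival (t - s) a b"
proof -
  have "{v \<in> space W. \<forall>x\<in>{s..t}. 0 < bridge s t a b v x} \<in> events" using sets_bridge_W[OF gridD(7)[OF assms]] by auto
  then have "prob {v \<in> space W. \<forall>x\<in>{s..t}. 0 < bridge s t a b v x} = expectation (indicator {v \<in> space W. \<forall>x\<in>{s..t}. 0 < bridge s t a b v x})"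
    by simp
  also have "\<dots> = positive_marks s t \<tau> k (\<lambda>_ _. 1) a b"
    unfolding positive_marks_def by (intro Bochner_Integration.integral_cong) (auto simp: indicator_def)
  finally show ?thesis using prob_bridge_pos[OF gridD(7)[OF assms]] by simp
qed

end

section \<open>Densities of positive bridges and of the excursion\<close>

text \<open>With the starting point stored as coordinate 0, the first kernel takes the same form as
  the others and the chain becomes a single integral over the k later values.\<close>

lemma chain_PiM:
  assumes "sigma_finite_measure M"
    and K: "\<And>i. (\<lambda>(x, y). K i x y) \<in> borel_measurable (M \<Otimes>\<^sub>M M)" and "e \<in> borel_measurable M"
    and a: "a \<in> space M"
  shows "chain K M a k e = (\<integral>\<^sup>+x. (\<Prod>i<k. K i ((x(0 := a)) i) ((x(0 := a)) (Suc i))) * e ((x(0 := a)) k) \<partial>Pi\<^sub>M {1..k} (\<lambda>_. M))"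
  using assms(3)
proof (induction k arbitrary: e)
  case 0
  interpret sigma_finite_measure M by fact
  interpret product_sigma_finite "\<lambda>_::nat. M" by unfold_locales
  show ?case using emeasure_PiM_empty[of "\<lambda>_. M"] by (simp add: space_PiM)
next
  case (Suc k)
  interpret sigma_finite_measure M by fact
  interpret product_sigma_finite "\<lambda>_::nat. M" by unfold_locales
  note K [measurable] Suc.prems [measurable]
  have e' [measurable]: "(\<lambda>x. \<integral>\<^sup>+y. K k x y * e y \<partial>M) \<in> borel_measurable M" by measurable
  let ?P = "\<lambda>x. (\<Prod>i<k. K i ((x(0 := a)) i) ((x(0 := a)) (Suc i)))"
  have coord: "(\<lambda>x. (x(0 := a)) i) \<in> measurable (Pi\<^sub>M {1..n} (\<lambda>_. M)) M" if "i \<le> n" for i n :: nat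
    using that a by (cases "i = 0") (auto intro!: measurable_component_singleton)
  have P: "(\<lambda>x. (\<Prod>i<m. K i ((x(0 := a)) i) ((x(0 := a)) (Suc i)))) \<in> borel_measurable (Pi\<^sub>M {1..n} (\<lambda>_. M))" if "m \<le> n" for m n
    using that by (intro borel_measurable_prod_ennreal measurable_Pair_compose_split[OF K] coord) auto
  have ins: "{1..Suc k} = insert (Suc k) {1..k}" by auto
  have "chain K M a (Suc k) e = (\<integral>\<^sup>+x. ?P x * (\<integral>\<^sup>+y. K k ((x(0 := a)) k) y * e y \<partial>M) \<partial>Pi\<^sub>M {1..k} (\<lambda>_. M))"
    using Suc.IH[OF e'] by simp
  also have "\<dots> = (\<integral>\<^sup>+x. (\<integral>\<^sup>+y. ?P x * (K k ((x(0 := a)) k) y * e y) \<partial>M) \<partial>Pi\<^sub>M {1..k} (\<lambda>_. M))"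
  proof (rule nn_integral_cong)
    fix x assume "x \<in> space (Pi\<^sub>M {1..k} (\<lambda>_. M))"
    then have [measurable]: "(x(0 := a)) k \<in> space M"
      using measurable_space[OF coord[of k k]] by simp
    show "?P x * (\<integral>\<^sup>+y. K k ((x(0 := a)) k) y * e y \<partial>M) = (\<integral>\<^sup>+y. ?P x * (K k ((x(0 := a)) k) y * e y) \<partial>M)"
      using measurable_Pair2[OF K \<open>(x(0 := a)) k \<in> space M\<close>] by (intro nn_integral_cmult[symmetric]) simp
  qed
  also have "\<dots> = (\<integral>\<^sup>+x. (\<integral>\<^sup>+y. (\<lambda>x. (\<Prod>i<Suc k. K i ((x(0 := a)) i) ((x(0 := a)) (Suc i))) * e ((x(0 := a)) (Suc k))) (x(Suc k := y)) \<partial>M) \<partial>Pi\<^sub>M {1..k} (\<lambda>_. M))"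
    by (intro nn_integral_cong) (auto simp: mult.assoc intro!: arg_cong2[where f="(*)"] prod.cong)
  also have "\<dots> = (\<integral>\<^sup>+x. (\<Prod>i<Suc k. K i ((x(0 := a)) i) ((x(0 := a)) (Suc i))) * e ((x(0 := a)) (Suc k)) \<partial>Pi\<^sub>M (insert (Suc k) {1..k}) (\<lambda>_. M))"
  proof (rule product_nn_integral_insert[symmetric])
    show "(\<lambda>x. (\<Prod>i<Suc k. K i ((x(0 := a)) i) ((x(0 := a)) (Suc i))) * e ((x(0 := a)) (Suc k))) \<in> borel_measurable (Pi\<^sub>M (insert (Suc k) {1..k}) (\<lambda>_. M))"
      unfolding ins[symmetric] using P[of "Suc k" "Suc k"] measurable_compose[OF coord[of "Suc k" "Suc k"] Suc.prems]
      by (intro borel_measurable_times_ennreal) auto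
  qed auto
  finally show ?case unfolding ins .
qed

definition excursion_density :: "(nat \<Rightarrow> real) \<Rightarrow> nat \<Rightarrow> (nat \<Rightarrow> real) \<Rightarrow> real" where
  "excursion_density \<tau> n x = (if \<forall>i\<in>{1..n}. 0 < x i
     then 2 * sqrt (2 * pi) * hitting_density (\<tau> 1) (x 1) *
        (\<Prod>i=1..<n. killed_density (\<tau> (Suc i) - \<tau> i) (x i) (x (Suc i))) * hitting_density (1 - \<tau> n) (x n)
     else 0)"

text \<open>The joint density, at the interior grid times, of the Brownian bridge from a to b
  conditioned to stay positive: killed transitions divided by the killed kernel between the
  ends.\<close>

definition positive_bridge_density :: "(nat \<Rightarrow> real) \<Rightarrow> nat \<Rightarrow> real \<Rightarrow> real \<Rightarrow> (nat \<Rightarrow> real) \<Rightarrow> real" where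
  "positive_bridge_density \<tau> n a b x = (if \<forall>i\<in>{1..n}. 0 < x i
     then killed_density (\<tau> 1 - \<tau> 0) a (x 1) *
        (\<Prod>i=1..<n. killed_density (\<tau> (Suc i) - \<tau> i) (x i) (x (Suc i))) * killed_density (\<tau> (Suc n) - \<tau> n) (x n) b
        / killed_density (\<tau> (Suc n) - \<tau> 0) a b
     else 0)"

section \<open>Boundary behaviour of the killed kernel\<close>

lemma killed_density_pos: "0 < d \<Longrightarrow> 0 < x \<Longrightarrow> 0 < y \<Longrightarrow> 0 < killed_density d x y"
  by (simp add: killed_density_heat heat_pos)

lemma killed_density_commute: "killed_density d x y = killed_density d y x"
  by (simp add: killed_density_def heat_commute[of d x] add.commute)

lemma hitting_density_heat: "0 < t \<Longrightarrow> hitting_density t x = heat t x * x / t"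
proof -
  assume t: "0 < t"
  have "sqrt (2 * pi * t ^ 3) = t * sqrt (2 * pi * t)"
    using t by (intro real_sqrt_unique) (auto simp: power_mult_distrib power2_eq_square power3_eq_cube)
  then show ?thesis using t by (simp add: hitting_density_def heat_eq mult_ac)
qed

lemma hitting_density_nonneg: "0 < t \<Longrightarrow> 0 \<le> x \<Longrightarrow> 0 \<le> hitting_density t x"
  by (simp add: hitting_density_def)

lemma one_minus_exp_ratio:
  assumes a: "(an \<longlongrightarrow> 0) F" "\<And>n. an n > (0::real)" and c: "(cn \<longlongrightarrow> c) F" "\<And>n. cn n > 0"
  shows "((\<lambda>n. (1 - exp (- (an n * cn n))) / an n) \<longlongrightarrow> c) F"
proof -
  have l: "((\<lambda>y::real. (1 - exp (- y)) / y) \<longlongrightarrow> 1) (at 0)" by real_asymp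
  have "((\<lambda>n. an n * cn n) \<longlongrightarrow> 0 * c) F" by (intro tendsto_intros a c)
  then have "filterlim (\<lambda>n. an n * cn n) (at 0) F"
    using a(2) c(2) by (auto simp: filterlim_at intro!: always_eventually) (metis less_irrefl)+
  from tendsto_mult[OF filterlim_compose[OF l this] c(1)]
  have "((\<lambda>n. (1 - exp (- (an n * cn n))) / (an n * cn n) * cn n) \<longlongrightarrow> c) F" by simp
  moreover have "(1 - exp (- (an n * cn n))) / (an n * cn n) * cn n = (1 - exp (- (an n * cn n))) / an n" for n
    using c(2)[of n] by simp
  ultimately show ?thesis by simp
qed

lemma heat_tendsto:
  assumes "(dn \<longlongrightarrow> d) F" "(xn \<longlongrightarrow> x) F" "0 < d" "\<And>n. 0 < dn n"
  shows "((\<lambda>n. heat (dn n) (xn n)) \<longlongrightarrow> heat d x) F"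
  using assms unfolding heat_eq[OF assms(3)] heat_eq[OF assms(4)]
  by (intro tendsto_intros) auto

text \<open>The killed kernel vanishes linearly at the boundary, and its slope there is twice the
  hitting density.\<close>

lemma killed_density_ratio_tendsto:
  assumes a: "(an \<longlongrightarrow> 0) F" "\<And>n. an n > 0" and d: "(dn \<longlongrightarrow> d) F" "0 < d" "\<And>n. 0 < dn n" and x: "0 < x"
  shows "((\<lambda>n. killed_density (dn n) (an n) x / an n) \<longlongrightarrow> 2 * hitting_density d x) F"
proof -
  have lim: "((\<lambda>n. heat (dn n) (x - an n) * ((1 - exp (- (an n * (2 * x / dn n)))) / an n)) \<longlongrightarrow> heat d (x - 0) * (2 * x / d)) F"
    using assms by (intro tendsto_mult heat_tendsto one_minus_exp_ratio tendsto_intros) auto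
  have eq: "killed_density (dn n) (an n) x / an n = heat (dn n) (x - an n) * ((1 - exp (- (an n * (2 * x / dn n)))) / an n)" for n
    unfolding killed_density_heat[OF d(3)] by (simp add: mult_ac)
  have "heat d (x - 0) * (2 * x / d) = 2 * hitting_density d x" using d(2) by (simp add: hitting_density_heat)
  then show ?thesis using lim unfolding eq by (simp only:)
qed

text \<open>With both points near the boundary and a time near 1 the kernel behaves like 2 a b /
  sqrt (2 pi).\<close>

lemma killed_density_double_ratio_tendsto:
  assumes a: "(an \<longlongrightarrow> 0) F" "\<And>n. an n > 0" and b: "(bn \<longlongrightarrow> 0) F" "\<And>n. bn n > 0"
    and d: "(dn \<longlongrightarrow> 1) F" "\<And>n. 0 < dn n"
  shows "((\<lambda>n. killed_density (dn n) (an n) (bn n) / (an n * bn n)) \<longlongrightarrow> 2 / sqrt (2 * pi)) F"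
proof -
  have "((\<lambda>n. an n * bn n) \<longlongrightarrow> 0 * 0) F" by (intro tendsto_intros a b)
  then have ab: "((\<lambda>n. an n * bn n) \<longlongrightarrow> 0) F" "\<And>n. an n * bn n > 0" using a b by auto
  have lim: "((\<lambda>n. heat (dn n) (bn n - an n) * ((1 - exp (- ((an n * bn n) * (2 / dn n)))) / (an n * bn n))) \<longlongrightarrow> heat 1 (0 - 0) * (2 / 1)) F"
    using d a b ab by (intro tendsto_mult heat_tendsto one_minus_exp_ratio tendsto_intros) auto
  have eq: "killed_density (dn n) (an n) (bn n) / (an n * bn n) = heat (dn n) (bn n - an n) * ((1 - exp (- ((an n * bn n) * (2 / dn n)))) / (an n * bn n))" for n
    unfolding killed_density_heat[OF d(2)] by (simp add: mult_ac)
  have "heat 1 (0 - 0) * (2 / 1) = 2 / sqrt (2 * pi)" using heat_eq[of 1 0] by simp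
  then show ?thesis using lim unfolding eq by (simp only:)
qed

text \<open>Numerator and denominator are divided by \<open>an n * bn n\<close>. The two end kernels
  contribute a factor 2 each and the denominator 2 / sqrt (2 pi), which is the origin of the
  constant 2 sqrt (2 pi) in the excursion density.\<close>

lemma positive_bridge_density_tendsto:
  assumes \<tau>: "\<And>n. grid (sn n) (tn n) (\<tau>(0 := sn n, Suc k := tn n)) k" and k: "1 \<le> k" and "0 < \<tau> 1" "\<tau> k < 1"
    and s: "sn \<longlonglongrightarrow> 0" and t: "tn \<longlonglongrightarrow> 1" and a: "an \<longlonglongrightarrow> 0" "\<And>n. an n > 0" and b: "bn \<longlonglongrightarrow> 0" "\<And>n. bn n > 0"
  shows "(\<lambda>n. positive_bridge_density (\<tau>(0 := sn n, Suc k := tn n)) k (an n) (bn n) x) \<longlonglongrightarrow> excursion_density \<tau> k x"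
proof (cases "\<forall>i\<in>{1..k}. 0 < x i")
  case True
  then have x: "0 < x 1" "0 < x k" using k by auto
  let ?T = "\<lambda>n. \<tau>(0 := sn n, Suc k := tn n)"
  have d1: "0 < \<tau> 1 - sn n" "0 < tn n - \<tau> k" for n
    using gridD(3)[OF \<tau>[of n], of 0] gridD(3)[OF \<tau>[of n], of k] k by auto
  have d3: "0 < tn n - sn n" for n using gridD(7)[OF \<tau>[of n]] by simp
  define mid where "mid = (\<Prod>i=1..<k. killed_density (\<tau> (Suc i) - \<tau> i) (x i) (x (Suc i)))"
  have mid: "(\<Prod>i=1..<k. killed_density (?T n (Suc i) - ?T n i) (x i) (x (Suc i))) = mid" for n
    unfolding mid_def by (intro prod.cong) auto
  have lims: "(\<lambda>n. \<tau> 1 - sn n) \<longlonglongrightarrow> \<tau> 1" "(\<lambda>n. tn n - \<tau> k) \<longlonglongrightarrow> 1 - \<tau> k" "(\<lambda>n. tn n - sn n) \<longlonglongrightarrow> 1"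
    using tendsto_diff[OF tendsto_const s, of "\<tau> 1"] tendsto_diff[OF t tendsto_const, of "\<tau> k"] tendsto_diff[OF t s] by simp_all
  have l1: "(\<lambda>n. killed_density (\<tau> 1 - sn n) (an n) (x 1) / an n) \<longlonglongrightarrow> 2 * hitting_density (\<tau> 1) (x 1)"
    using killed_density_ratio_tendsto[OF a lims(1) _ d1(1) x(1)] assms by simp
  have l2: "(\<lambda>n. killed_density (tn n - \<tau> k) (bn n) (x k) / bn n) \<longlonglongrightarrow> 2 * hitting_density (1 - \<tau> k) (x k)"
    using killed_density_ratio_tendsto[OF b lims(2) _ d1(2) x(2)] assms by simp
  have l3: "(\<lambda>n. killed_density (tn n - sn n) (an n) (bn n) / (an n * bn n)) \<longlonglongrightarrow> 2 / sqrt (2 * pi)"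
    by (rule killed_density_double_ratio_tendsto[OF a b lims(3) d3])
  have "(\<lambda>n. (killed_density (\<tau> 1 - sn n) (an n) (x 1) / an n) * mid * (killed_density (tn n - \<tau> k) (bn n) (x k) / bn n)
      / (killed_density (tn n - sn n) (an n) (bn n) / (an n * bn n))) \<longlonglongrightarrow>
     (2 * hitting_density (\<tau> 1) (x 1)) * mid * (2 * hitting_density (1 - \<tau> k) (x k)) / (2 / sqrt (2 * pi))"
    by (rule tendsto_divide[OF tendsto_mult[OF tendsto_mult[OF l1 tendsto_const] l2] l3]) simp
  moreover have "(2 * hitting_density (\<tau> 1) (x 1)) * mid * (2 * hitting_density (1 - \<tau> k) (x k)) / (2 / sqrt (2 * pi)) = excursion_density \<tau> k x"
    using True by (simp add: excursion_density_def mid_def)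
  moreover have "(killed_density (\<tau> 1 - sn n) (an n) (x 1) / an n) * mid * (killed_density (tn n - \<tau> k) (bn n) (x k) / bn n)
      / (killed_density (tn n - sn n) (an n) (bn n) / (an n * bn n)) = positive_bridge_density (?T n) k (an n) (bn n) x" for n
    using True k a(2)[of n] b(2)[of n] unfolding positive_bridge_density_def mid
    by (simp add: killed_density_commute[of _ "x k"])
  ultimately show ?thesis by simp
next
  case False
  then show ?thesis unfolding positive_bridge_density_def excursion_density_def if_not_P[OF False] by simp
qed

section \<open>Measurability of the densities and their relation to killed chains\<close>

lemma measurable_killed_density [measurable (raw)]:
  assumes [measurable]: "f \<in> borel_measurable M" "g \<in> borel_measurable M"
  shows "(\<lambda>x. killed_density d (f x) (g x)) \<in> borel_measurable M"
  unfolding killed_density_def normal_density_def by measurable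

lemma measurable_hitting_density [measurable (raw)]:
  assumes [measurable]: "f \<in> borel_measurable M"
  shows "(\<lambda>x. hitting_density t (f x)) \<in> borel_measurable M"
  unfolding hitting_density_def by measurable

lemma measurable_positive_coordinates:
  "{x \<in> space (Pi\<^sub>M {1..n} (\<lambda>_. lborel)). \<forall>i\<in>{1..n::nat}. 0 < (x i :: real)} \<in> sets (Pi\<^sub>M {1..n} (\<lambda>_. lborel))"
proof (rule sets.sets_Collect_finite_All)
  fix i assume "i \<in> {1..n}"
  then have [measurable]: "(\<lambda>x. x i :: real) \<in> borel_measurable (Pi\<^sub>M {1..n} (\<lambda>_. lborel))"
    using measurable_component_singleton[of i "{1..n}" "\<lambda>_. lborel"] by simp
  show "{x \<in> space (Pi\<^sub>M {1..n} (\<lambda>_. lborel)). 0 < (x i :: real)} \<in> sets (Pi\<^sub>M {1..n} (\<lambda>_. lborel))" by measurable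
qed simp

lemma measurable_PiM_coordinate:
  "i \<in> {1..n} \<Longrightarrow> (\<lambda>x. x i :: real) \<in> borel_measurable (Pi\<^sub>M {1..n::nat} (\<lambda>_. lborel))"
  using measurable_component_singleton[of i "{1..n}" "\<lambda>_. lborel"] by simp

lemma measurable_positive_bridge_density:
  assumes "1 \<le> n" shows "positive_bridge_density \<tau> n a b \<in> borel_measurable (Pi\<^sub>M {1..n} (\<lambda>_. lborel))"
proof -
  have "(\<lambda>x. killed_density (\<tau> 1 - \<tau> 0) a (x 1) *
        (\<Prod>i=1..<n. killed_density (\<tau> (Suc i) - \<tau> i) (x i) (x (Suc i))) * killed_density (\<tau> (Suc n) - \<tau> n) (x n) b
        / killed_density (\<tau> (Suc n) - \<tau> 0) a b) \<in> borel_measurable (Pi\<^sub>M {1..n} (\<lambda>_. lborel))"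
    using assms by (intro borel_measurable_times borel_measurable_divide borel_measurable_prod measurable_killed_density measurable_PiM_coordinate borel_measurable_const) auto
  then show ?thesis unfolding positive_bridge_density_def[abs_def]
    by (intro measurable_If measurable_positive_coordinates) auto
qed

lemma measurable_excursion_density:
  assumes "1 \<le> n" shows "excursion_density \<tau> n \<in> borel_measurable (Pi\<^sub>M {1..n} (\<lambda>_. lborel))"
proof -
  have "(\<lambda>x. 2 * sqrt (2 * pi) * hitting_density (\<tau> 1) (x 1) *
        (\<Prod>i=1..<n. killed_density (\<tau> (Suc i) - \<tau> i) (x i) (x (Suc i))) * hitting_density (1 - \<tau> n) (x n)) \<in> borel_measurable (Pi\<^sub>M {1..n} (\<lambda>_. lborel))"
    using assms by (intro borel_measurable_times borel_measurable_prod measurable_killed_density measurable_hitting_density measurable_PiM_coordinate borel_measurable_const) auto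
  then show ?thesis unfolding excursion_density_def[abs_def]
    by (intro measurable_If measurable_positive_coordinates) auto
qed

lemma prod_shift_index: "1 \<le> k \<Longrightarrow> (\<Prod>i<k. f i (Suc i)) = f 0 1 * (\<Prod>i=1..<k. f i (Suc i))" for f :: "nat \<Rightarrow> nat \<Rightarrow> 'a::comm_monoid_mult"
  using prod.atLeast_Suc_lessThan[of 0 k "\<lambda>i. f i (Suc i)"] by (simp add: lessThan_atLeast0)

lemma killed_chain_density:
  assumes grid: "grid s t \<tau> k" and k: "1 \<le> k" and ab: "0 < a" "0 < b"
    and g [measurable]: "\<And>i. g i \<in> borel_measurable borel"
  shows "killed_chain \<tau> g k a b = ennreal (killed_density (t - s) a b) *
    (\<integral>\<^sup>+x. ennreal (positive_bridge_density \<tau> k a b x) * (\<Prod>i<k. g i (x (Suc i))) \<partial>Pi\<^sub>M {1..k} (\<lambda>_. lborel))"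
proof -
  note gap = gridD(3)[OF grid]
  have ts: "\<tau> (Suc k) - \<tau> 0 = t - s" "0 < t - s" using gridD(1,2,7)[OF grid] by auto
  have "killed_chain \<tau> g k a b = (\<integral>\<^sup>+x. (\<Prod>i<k. weighted_killed \<tau> g i ((x(0 := a)) i) ((x(0 := a)) (Suc i))) *
      killed (\<tau> (Suc k) - \<tau> k) ((x(0 := a)) k) b \<partial>Pi\<^sub>M {1..k} (\<lambda>_. lborel))"
    unfolding killed_chain_def
  proof (rule chain_PiM)
    show "(\<lambda>(x, y). weighted_killed \<tau> g i x y) \<in> borel_measurable (lborel \<Otimes>\<^sub>M lborel)" for i
      unfolding weighted_killed_def killed_def by measurable
    show "(\<lambda>x. killed (\<tau> (Suc k) - \<tau> k) x b) \<in> borel_measurable lborel" by simp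
  qed (auto simp: sigma_finite_lborel)
  also have "\<dots> = (\<integral>\<^sup>+x. ennreal (killed_density (t - s) a b) * (ennreal (positive_bridge_density \<tau> k a b x) * (\<Prod>i<k. g i (x (Suc i)))) \<partial>Pi\<^sub>M {1..k} (\<lambda>_. lborel))"
  proof (rule nn_integral_cong)
    fix x :: "nat \<Rightarrow> real"
    let ?y = "x(0 := a)"
    have marks: "(\<Prod>i<k. weighted_killed \<tau> g i (?y i) (?y (Suc i))) = (\<Prod>i<k. killed (\<tau> (Suc i) - \<tau> i) (?y i) (?y (Suc i))) * (\<Prod>i<k. g i (x (Suc i)))"
      by (simp add: weighted_killed_def prod.distrib)
    have "(\<Prod>i<k. killed (\<tau> (Suc i) - \<tau> i) (?y i) (?y (Suc i))) * killed (\<tau> (Suc k) - \<tau> k) (?y k) b =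
      ennreal (killed_density (t - s) a b) * ennreal (positive_bridge_density \<tau> k a b x)"
    proof (cases "\<forall>i\<in>{1..k}. 0 < x i")
      case True
      have pos: "0 < ?y i" if "i \<le> k" for i using True ab that by auto
      have "(\<Prod>i<k. killed (\<tau> (Suc i) - \<tau> i) (?y i) (?y (Suc i))) = (\<Prod>i<k. ennreal (killed_density (\<tau> (Suc i) - \<tau> i) (?y i) (?y (Suc i))))"
        using pos by (intro prod.cong) (auto simp: killed_def simp del: fun_upd_apply)
      also have "\<dots> = ennreal (\<Prod>i<k. killed_density (\<tau> (Suc i) - \<tau> i) (?y i) (?y (Suc i)))"
        using pos gap by (intro prod_ennreal) (auto intro!: less_imp_le killed_density_pos simp del: fun_upd_apply)
      also have "(\<Prod>i<k. killed_density (\<tau> (Suc i) - \<tau> i) (?y i) (?y (Suc i))) =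
         killed_density (\<tau> 1 - \<tau> 0) a (x 1) * (\<Prod>i=1..<k. killed_density (\<tau> (Suc i) - \<tau> i) (x i) (x (Suc i)))"
        using prod_shift_index[OF k, of "\<lambda>i j. killed_density (\<tau> j - \<tau> i) (?y i) (?y j)"] by simp
      finally have 1: "(\<Prod>i<k. killed (\<tau> (Suc i) - \<tau> i) (?y i) (?y (Suc i))) = ennreal (killed_density (\<tau> 1 - \<tau> 0) a (x 1) * (\<Prod>i=1..<k. killed_density (\<tau> (Suc i) - \<tau> i) (x i) (x (Suc i))))" .
      have 2: "killed (\<tau> (Suc k) - \<tau> k) (?y k) b = ennreal (killed_density (\<tau> (Suc k) - \<tau> k) (x k) b)"
        using True k ab by (auto simp: killed_def)
      have p1: "0 \<le> killed_density (\<tau> (Suc k) - \<tau> k) (x k) b"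
        using gap[of k] True k ab by (intro less_imp_le killed_density_pos) auto
      have p2: "0 < killed_density (t - s) a b" using ts ab by (intro killed_density_pos)
      show ?thesis unfolding 1 2 using True p1 p2 ts
        by (simp add: ennreal_mult''[symmetric] ennreal_mult'[symmetric] positive_bridge_density_def)
    next
      case False
      then obtain i where i: "i \<in> {1..k}" "x i \<le> 0" by (auto simp: not_less)
      have "killed (\<tau> (Suc (i - 1)) - \<tau> (i - 1)) (?y (i - 1)) (?y (Suc (i - 1))) = 0"
        using i by (auto simp: killed_def)
      then have "(\<Prod>i<k. killed (\<tau> (Suc i) - \<tau> i) (?y i) (?y (Suc i))) = 0"
        using i by (intro prod_zero bexI[of _ "i - 1"]) auto
      then show ?thesis unfolding positive_bridge_density_def if_not_P[OF False] by simp
    qed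
    note 0 = this
    show "(\<Prod>i<k. weighted_killed \<tau> g i (?y i) (?y (Suc i))) * killed (\<tau> (Suc k) - \<tau> k) (?y k) b =
      ennreal (killed_density (t - s) a b) * (ennreal (positive_bridge_density \<tau> k a b x) * (\<Prod>i<k. g i (x (Suc i))))"
      unfolding marks mult.assoc[symmetric] 0[symmetric] by (simp only: mult_ac)
  qed
  also have "\<dots> = ennreal (killed_density (t - s) a b) *
    (\<integral>\<^sup>+x. ennreal (positive_bridge_density \<tau> k a b x) * (\<Prod>i<k. g i (x (Suc i))) \<partial>Pi\<^sub>M {1..k} (\<lambda>_. lborel))"
  proof (rule nn_integral_cmult)
    have "(\<lambda>x. \<Prod>i<k. g i (x (Suc i))) \<in> borel_measurable (Pi\<^sub>M {1..k} (\<lambda>_. lborel))"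
      by (intro borel_measurable_prod_ennreal measurable_compose[OF measurable_PiM_coordinate g]) auto
    then show "(\<lambda>x. ennreal (positive_bridge_density \<tau> k a b x) * (\<Prod>i<k. g i (x (Suc i)))) \<in> borel_measurable (Pi\<^sub>M {1..k} (\<lambda>_. lborel))"
      using measurable_compose[OF measurable_positive_bridge_density[OF k, of \<tau> a b] measurable_ennreal] by (intro borel_measurable_times_ennreal)
  qed
  finally show ?thesis .
qed

lemma positive_bridge_density_nonneg:
  assumes grid: "grid s t \<tau> k" and k: "1 \<le> k" and ab: "0 < a" "0 < b"
  shows "0 \<le> positive_bridge_density \<tau> k a b x"
  unfolding positive_bridge_density_def
  using gridD(3)[OF grid] gridD(1,2,7)[OF grid] ab k
  by (auto intro!: divide_nonneg_nonneg mult_nonneg_nonneg prod_nonneg less_imp_le[OF killed_density_pos])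

lemma excursion_density_nonneg:
  assumes "\<And>i. 1 \<le> i \<Longrightarrow> i < k \<Longrightarrow> \<tau> i < \<tau> (Suc i)" "0 < \<tau> 1" "\<tau> k < 1" "1 \<le> k"
  shows "0 \<le> excursion_density \<tau> k x"
proof (cases "\<forall>i\<in>{1..k}. 0 < x i")
  case True
  then have "0 < x 1" "0 < x k" using assms(4) by auto
  then have "0 \<le> hitting_density (\<tau> 1) (x 1)" "0 \<le> hitting_density (1 - \<tau> k) (x k)"
    using assms by (auto intro!: hitting_density_nonneg)
  moreover have "0 \<le> (\<Prod>i=1..<k. killed_density (\<tau> (Suc i) - \<tau> i) (x i) (x (Suc i)))"
    using True assms by (intro prod_nonneg ballI less_imp_le[OF killed_density_pos]) auto
  ultimately show ?thesis unfolding excursion_density_def by (simp only: if_P[OF True]) (intro mult_nonneg_nonneg; simp)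
qed (auto simp: excursion_density_def)

section \<open>The law of the Vervaat transform\<close>

lemma path_inf_pos:
  assumes "w \<in> space path_borel" "0 \<le> s" "s \<le> t" "t \<le> 1" "\<And>x. x \<in> {s..t} \<Longrightarrow> 0 < w x"
  shows "0 < path_inf s t w"
proof -
  have "continuous_on {s..t} w" using path_borel_continuous[OF assms(1)] assms by (auto elim: continuous_on_subset)
  from path_inf_attained[OF this assms(3)] show ?thesis using assms(5) by metis
qed

lemma abs_integral_le:
  fixes f g :: "'a \<Rightarrow> real"
  assumes "integrable M f" "integrable M g" "\<And>x. x \<in> space M \<Longrightarrow> \<bar>f x\<bar> \<le> g x"
  shows "\<bar>\<integral>x. f x \<partial>M\<bar> \<le> (\<integral>x. g x \<partial>M)"
  using norm_integral_le_integral[OF assms(1,2)] assms(3) by (simp add: AE_I2)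

section \<open>Finite-dimensional laws of the Vervaat transform\<close>

context brownian_bridge
begin

lemma measurable_vervaat_W: "vervaat \<in> measurable W path_borel"
  using measurable_vervaat by (simp add: measurable_cong_sets[OF sets_W refl])

lemma vervaat_in_space: "w \<in> space W \<Longrightarrow> vervaat w \<in> space path_borel"
  using measurable_space[OF measurable_vervaat_W] .

lemma measurable_vervaat_eval: "x \<in> {0..1} \<Longrightarrow> (\<lambda>w. vervaat w x) \<in> borel_measurable W"
  by (rule measurable_compose[OF measurable_vervaat_W measurable_path_eval])

lemma AE_vervaat_pos: "AE w in W. (\<forall>x. 0 < x \<and> x < 1 \<longrightarrow> 0 < vervaat w x) \<and> vervaat w 0 = 0 \<and> vervaat w 1 = 0"
  using AE_generic_path by eventually_elim (auto intro: vervaat_pos vervaat_endpoints)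

text \<open>The penalised expectations of the two sides differ only off the event of positivity on \<open>[s,t]\<close>,
  and the Vervaat path is positive there. Multiplying by the survival probability instead
  of dividing by it keeps both functionals continuous and bounded.\<close>

lemma vervaat_gibbs:
  assumes grid: "grid s t \<tau> k" and g_cont: "\<And>i. continuous_on UNIV (g i)" and g01: "\<And>i x. 0 \<le> g i x \<and> g i x \<le> 1"
    and st01: "0 < s" "t < 1"
    and Hc: "\<And>an bn a b. an \<longlonglongrightarrow> a \<Longrightarrow> bn \<longlonglongrightarrow> b \<Longrightarrow> (\<lambda>n. H (an n) (bn n)) \<longlonglongrightarrow> H a b"
    and Hm: "(\<lambda>(a, b). H a b) \<in> borel_measurable (borel \<Otimes>\<^sub>M borel)"
    and Hb: "\<And>a b. 0 \<le> H a b" "\<And>a b. H a b \<le> C"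
  shows "expectation (\<lambda>w. H (vervaat w s) (vervaat w t) * survival (t - s) (vervaat w s) (vervaat w t) * (\<Prod>i<k. g i (vervaat w (\<tau> (Suc i))))) =
    expectation (\<lambda>w. H (vervaat w s) (vervaat w t) * positive_marks s t \<tau> k g (vervaat w s) (vervaat w t))"
proof -
  note st = gridD(7)[OF grid]
  have one: "\<And>i::nat. continuous_on UNIV (\<lambda>_::real. 1::real)" "\<And>(i::nat) (x::real). 0 \<le> (1::real) \<and> (1::real) \<le> 1" by auto
  note pm1 = positive_marks_one[OF grid]
  have r_cont: "(\<lambda>n. survival (t - s) (an n) (bn n)) \<longlonglongrightarrow> survival (t - s) a b" if "an \<longlonglongrightarrow> a" "bn \<longlonglongrightarrow> b" for an bn a b
    using positive_marks_continuous[OF grid one that] by (simp add: pm1)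
  have r01: "0 \<le> survival (t - s) a b" "survival (t - s) a b \<le> 1" for a b using survival_bounds[of "t - s"] st by auto
  note pmc = positive_marks_continuous[OF grid g_cont g01]
  have pmb: "0 \<le> positive_marks s t \<tau> k g a b" "positive_marks s t \<tau> k g a b \<le> survival (t - s) a b" for a b
    by (rule positive_marks_bounds[OF grid g_cont g01])+
  note gm = measurable_mark[OF grid g_cont g01]
  note m01 = prod_marks_bounds[OF grid g_cont g01]
  have C: "0 \<le> C" using Hb[of 0 0] by linarith
  define f1 where "f1 w = H (w s) (w t) * survival (t - s) (w s) (w t) * (\<Prod>i<k. g i (w (\<tau> (Suc i))))" for w
  define f2 where "f2 w = H (w s) (w t) * positive_marks s t \<tau> k g (w s) (w t)" for w
  define I where "I w = (if 0 < path_inf s t w then 1 else 0 :: real)" for w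
  \<comment> \<open>A continuous majorant of C times the indicator that the path is not positive on
    [s,t], which is itself not continuous. At a path positive on [s,t] it vanishes for large
    j.\<close>
  define c where "c j w = C * (1 - min 1 (real j * max 0 (path_inf s t w)))" for j w
  have f1b: "0 \<le> f1 w" "f1 w \<le> C" for w
    unfolding f1_def using Hb r01 m01[where h="\<lambda>i. w (\<tau> (Suc i))"] C
      mult_mono[OF mult_mono[OF Hb(2)[of "w s" "w t"] r01(2)[of "w s" "w t"]] conjunct2[OF m01[where h="\<lambda>i. w (\<tau> (Suc i))"]]]
    by (auto intro!: mult_nonneg_nonneg)
  have f2b: "0 \<le> f2 w" "f2 w \<le> C" for w
    unfolding f2_def using Hb pmb C order_trans[OF pmb(2) r01(2)]
      mult_mono[OF Hb(2)[of "w s" "w t"] order_trans[OF pmb(2)[of "w s" "w t"] r01(2)[of "w s" "w t"]]]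
    by (auto intro!: mult_nonneg_nonneg)
  have in01: "s \<in> {0..1}" "t \<in> {0..1}" using st st01 by auto
  have \<tau>01: "\<tau> (Suc i) \<in> {0..1}" if "i < k" for i
    using gridD(5,6)[OF grid, of "Suc i"] st01 that by auto
  have gc: "(\<lambda>n. g i (xn n)) \<longlonglongrightarrow> g i x" if "xn \<longlonglongrightarrow> x" for i xn x
    using continuous_on_tendsto_compose[OF g_cont that] by simp
  have f1c: "continuous_map path_topology euclideanreal f1"
  proof (rule continuous_map_path_sequentially)
    fix v w assume "uniformly_converges v w"
    note u = uniformly_converges_pointwise[OF this]
    show "(\<lambda>n. f1 (v n)) \<longlonglongrightarrow> f1 w"
      unfolding f1_def by (intro tendsto_mult tendsto_prod Hc r_cont gc u in01 \<tau>01) auto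
  qed
  have f2c: "continuous_map path_topology euclideanreal f2"
  proof (rule continuous_map_path_sequentially)
    fix v w assume "uniformly_converges v w"
    note u = uniformly_converges_pointwise[OF this]
    show "(\<lambda>n. f2 (v n)) \<longlonglongrightarrow> f2 w"
      unfolding f2_def by (intro tendsto_mult Hc pmc u in01)
  qed
  have cc: "continuous_map path_topology euclideanreal (c j)" for j
  proof (rule continuous_map_path_sequentially)
    fix v w assume "uniformly_converges v w" "\<And>n. v n \<in> space path_borel" "w \<in> space path_borel"
    note u = path_inf_uniformly_converges[OF this(2,3) _ _ _ this(1)]
    show "(\<lambda>n. c j (v n)) \<longlonglongrightarrow> c j w"
      unfolding c_def using st st01 by (intro tendsto_intros u) auto
  qed
  have cb: "0 \<le> c j w" "c j w \<le> C" for j w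
    unfolding c_def using C by (auto intro!: mult_nonneg_nonneg mult_left_le)
  have toW: "f \<in> borel_measurable W" if "f \<in> borel_measurable path_borel" for f :: "_ \<Rightarrow> real"
    using that by (simp add: measurable_cong_sets[OF sets_W refl])
  note f1m = continuous_map_path_measurable[OF f1c] and f2m = continuous_map_path_measurable[OF f2c] and cm = continuous_map_path_measurable[OF cc]
  note penm = toW[OF measurable_penalty_weight]
  have [measurable]: "I \<in> borel_measurable W"
  proof (rule toW)
    have [measurable]: "path_inf s t \<in> borel_measurable path_borel" using st st01 by (intro measurable_path_inf) auto
    show "I \<in> borel_measurable path_borel" unfolding I_def[abs_def] by measurable
  qed
  note [measurable] = toW[OF f1m] toW[OF f2m] toW[OF cm] penm
  have rm: "(\<lambda>(a, b). survival (t - s) a b) \<in> borel_measurable (borel \<Otimes>\<^sub>M borel)" by measurable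
  have Hrm: "(\<lambda>(a, b). H a b * survival (t - s) a b) \<in> borel_measurable (borel \<Otimes>\<^sub>M borel)"
    using borel_measurable_times[OF Hm rm] by (simp add: case_prod_unfold)
  note pmm = measurable_positive_marks[OF grid g_cont g01]
  have Hpm: "(\<lambda>(a, b). H a b * positive_marks s t \<tau> k g a b) \<in> borel_measurable (borel \<Otimes>\<^sub>M borel)"
    using borel_measurable_times[OF Hm pmm] by (simp add: case_prod_unfold)
  have I01: "0 \<le> I w" "I w \<le> 1" for w by (auto simp: I_def)
  have key: "\<bar>\<integral>w. (f1 w - f2 w) \<partial>penalised_bridge W \<kappa>\<bar> \<le> (\<integral>w. c j w \<partial>penalised_bridge W \<kappa>)" if \<kappa>: "0 < \<kappa>" for \<kappa> j
  proof -
    note pb = penalty_weight_bounds[OF _ less_imp_le[OF \<kappa>]]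
    have int: "integrable W (\<lambda>w. f w * penalty_weight \<kappa> w)" if [measurable]: "f \<in> borel_measurable W" and b: "\<And>w. \<bar>f w\<bar> \<le> B" for f :: "_ \<Rightarrow> real" and B
    proof (rule integrable_const_bound[where B=B])
      show "AE w in W. norm (f w * penalty_weight \<kappa> w) \<le> B"
      proof (rule AE_I2)
        fix w assume "w \<in> space W"
        then show "norm (f w * penalty_weight \<kappa> w) \<le> B"
          using mult_mono[OF b[of w] pb(2)[of w]] pb(1)[of w] b[of w] by (auto simp: abs_mult)
      qed
    qed measurable
    \<comment> \<open>The resampling identity is applied to the marks \<open>g\<close> with factor
      \<open>H * survival\<close>, and backwards to trivial marks with factor
      \<open>H * positive_marks\<close>. Resampling trivial marks yields \<open>survival\<close>, so
      both applications meet in the same middle term.\<close>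
    have nn: "(\<integral>\<^sup>+w. ennreal (f1 w * I w * penalty_weight \<kappa> w) \<partial>W) = (\<integral>\<^sup>+w. ennreal (f2 w * I w * penalty_weight \<kappa> w) \<partial>W)"
    proof -
      have "(\<integral>\<^sup>+w. ennreal (f1 w * I w * penalty_weight \<kappa> w) \<partial>W) =
        (\<integral>\<^sup>+w. ennreal ((H (w s) (w t) * survival (t - s) (w s) (w t)) * ((\<Prod>i<k. g i (w (\<tau> (Suc i)))) * (if 0 < path_inf s t w then 1 else 0)) * penalty_weight \<kappa> w) \<partial>W)"
        by (simp add: f1_def I_def mult.assoc)
      also have "\<dots> = (\<integral>\<^sup>+w. ennreal ((H (w s) (w t) * survival (t - s) (w s) (w t)) * positive_marks s t \<tau> k g (w s) (w t) * exp (- 2 * \<kappa> * measure unit_lborel {x. x \<notin> {s..t} \<and> w x \<le> 0})) \<partial>W)"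
        using st01 Hb r01 by (intro penalised_resampling[OF grid g_cont g01 _ _ Hrm]) (auto intro: less_imp_le)
      also have "\<dots> = (\<integral>\<^sup>+w. ennreal ((H (w s) (w t) * positive_marks s t \<tau> k g (w s) (w t)) * positive_marks s t \<tau> k (\<lambda>_ _. 1) (w s) (w t) * exp (- 2 * \<kappa> * measure unit_lborel {x. x \<notin> {s..t} \<and> w x \<le> 0})) \<partial>W)"
        by (intro nn_integral_cong) (simp add: pm1 mult_ac)
      also have "\<dots> = (\<integral>\<^sup>+w. ennreal ((H (w s) (w t) * positive_marks s t \<tau> k g (w s) (w t)) * ((\<Prod>i<k. 1) * (if 0 < path_inf s t w then 1 else 0)) * penalty_weight \<kappa> w) \<partial>W)"
        using st01 Hb pmb by (intro penalised_resampling[OF grid one _ _ Hpm, symmetric]) (auto intro: less_imp_le)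
      finally show ?thesis by (simp add: f2_def I_def mult.assoc)
    qed
    have e12: "expectation (\<lambda>w. f1 w * I w * penalty_weight \<kappa> w) = expectation (\<lambda>w. f2 w * I w * penalty_weight \<kappa> w)"
    proof -
      have "AE w in W. 0 \<le> f1 w * I w * penalty_weight \<kappa> w" "AE w in W. 0 \<le> f2 w * I w * penalty_weight \<kappa> w"
        using f1b f2b I01 less_imp_le[OF pb(1)] by (auto intro!: AE_I2 mult_nonneg_nonneg)
      then show ?thesis using nn by (subst (1 2) integral_eq_nn_integral) auto
    qed
    have fI: "\<bar>f1 w * I w\<bar> \<le> C" "\<bar>f2 w * I w\<bar> \<le> C" "\<bar>f1 w\<bar> \<le> C" "\<bar>f2 w\<bar> \<le> C" "\<bar>c j w\<bar> \<le> C" for w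
      using f1b[of w] f2b[of w] C cb[of j w] by (auto simp: I_def)
    note ints = int[OF _ fI(1)] int[OF _ fI(2)] int[OF _ fI(3)] int[OF _ fI(4)] int[OF _ fI(5)]
    have "expectation (\<lambda>w. (f1 w - f2 w) * penalty_weight \<kappa> w) = expectation (\<lambda>w. f1 w * penalty_weight \<kappa> w) - expectation (\<lambda>w. f2 w * penalty_weight \<kappa> w)"
      using ints by (simp add: left_diff_distrib)
    also have "\<dots> = (expectation (\<lambda>w. f1 w * penalty_weight \<kappa> w) - expectation (\<lambda>w. f1 w * I w * penalty_weight \<kappa> w)) -
        (expectation (\<lambda>w. f2 w * penalty_weight \<kappa> w) - expectation (\<lambda>w. f2 w * I w * penalty_weight \<kappa> w))"
      using e12 by simp
    also have "\<dots> = expectation (\<lambda>w. (f1 w * penalty_weight \<kappa> w - f1 w * I w * penalty_weight \<kappa> w) - (f2 w * penalty_weight \<kappa> w - f2 w * I w * penalty_weight \<kappa> w))"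
      using ints by simp
    finally have eq: "expectation (\<lambda>w. (f1 w - f2 w) * penalty_weight \<kappa> w) = \<dots>" .
    have "\<bar>expectation (\<lambda>w. (f1 w - f2 w) * penalty_weight \<kappa> w)\<bar> \<le> expectation (\<lambda>w. c j w * penalty_weight \<kappa> w)"
      unfolding eq
    proof (rule abs_integral_le)
      fix w assume w: "w \<in> space W"
      have "\<bar>(f1 w - f2 w) * (1 - I w)\<bar> \<le> c j w"
        using f1b[of w] f2b[of w] cb[of j w] by (auto simp: I_def c_def)
      then have "\<bar>(f1 w - f2 w) * (1 - I w)\<bar> * penalty_weight \<kappa> w \<le> c j w * penalty_weight \<kappa> w"
        using pb(1)[OF w] by (intro mult_right_mono) auto
      moreover have "\<bar>(f1 w - f2 w) * (1 - I w)\<bar> * penalty_weight \<kappa> w = \<bar>((f1 w - f2 w) * (1 - I w)) * penalty_weight \<kappa> w\<bar>"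
        using pb(1)[OF w] by (simp add: abs_mult)
      moreover have "((f1 w - f2 w) * (1 - I w)) * penalty_weight \<kappa> w = (f1 w * penalty_weight \<kappa> w - f1 w * I w * penalty_weight \<kappa> w) - (f2 w * penalty_weight \<kappa> w - f2 w * I w * penalty_weight \<kappa> w)"
        by (simp add: algebra_simps)
      ultimately show "\<bar>(f1 w * penalty_weight \<kappa> w - f1 w * I w * penalty_weight \<kappa> w) - (f2 w * penalty_weight \<kappa> w - f2 w * I w * penalty_weight \<kappa> w)\<bar> \<le> c j w * penalty_weight \<kappa> w"
        by simp
    qed (use ints in auto)
    then show ?thesis
      using partition_constant_pos[OF \<kappa>] integral_penalised_bridge[OF \<kappa> cm] integral_penalised_bridge[OF \<kappa> borel_measurable_diff[OF f1m f2m]]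
      by (simp add: divide_right_mono abs_divide)
  qed
  have f12c: "continuous_map path_topology euclideanreal (\<lambda>w. f1 w - f2 w)"
    by (intro continuous_map_diff f1c f2c)
  have f12b: "\<bar>f1 w - f2 w\<bar> \<le> C" for w using f1b[of w] f2b[of w] by auto
  \<comment> \<open>Both sides of \<open>key\<close> are integrals of bounded continuous
    functionals, so the estimate passes to \<kappa> -> \<infinity> for fixed j; only afterwards does
    j grow.\<close>
  have le: "\<bar>expectation (\<lambda>w. f1 (vervaat w) - f2 (vervaat w))\<bar> \<le> expectation (\<lambda>w. c j (vervaat w))" for j
  proof (rule tendsto_le[OF trivial_limit_at_top_linorder])
    show "((\<lambda>\<kappa>. \<integral>w. c j w \<partial>penalised_bridge W \<kappa>) \<longlongrightarrow> expectation (\<lambda>w. c j (vervaat w))) at_top"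
      using cb by (intro penalised_bridge_tendsto_vervaat cc) auto
    show "((\<lambda>\<kappa>. \<bar>\<integral>w. (f1 w - f2 w) \<partial>penalised_bridge W \<kappa>\<bar>) \<longlongrightarrow> \<bar>expectation (\<lambda>w. f1 (vervaat w) - f2 (vervaat w))\<bar>) at_top"
      using f12b by (intro tendsto_rabs penalised_bridge_tendsto_vervaat f12c) auto
    show "\<forall>\<^sub>F \<kappa> in at_top. \<bar>\<integral>w. (f1 w - f2 w) \<partial>penalised_bridge W \<kappa>\<bar> \<le> (\<integral>w. c j w \<partial>penalised_bridge W \<kappa>)"
      using eventually_gt_at_top[of 0] by eventually_elim (rule key)
  qed
  note Vm = measurable_compose[OF measurable_vervaat_W]
  have "(\<lambda>j. expectation (\<lambda>w. c j (vervaat w))) \<longlonglongrightarrow> expectation (\<lambda>w. 0)"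
  proof (rule integral_dominated_convergence[where w="\<lambda>_. C"])
    show "AE w in W. (\<lambda>j. c j (vervaat w)) \<longlonglongrightarrow> 0"
      using AE_vervaat_pos AE_space
    proof eventually_elim
      case (elim w)
      then have m: "0 < path_inf s t (vervaat w)"
        using st st01 by (intro path_inf_pos vervaat_in_space) auto
      obtain N where N: "1 < real N * path_inf s t (vervaat w)" using reals_Archimedean3[OF m] by auto
      have "\<forall>\<^sub>F j in sequentially. c j (vervaat w) = 0"
        using eventually_ge_at_top[of N]
      proof eventually_elim
        case (elim j)
        then have "real N * path_inf s t (vervaat w) \<le> real j * path_inf s t (vervaat w)"
          using m by (intro mult_right_mono) auto
        then have "1 \<le> real j * path_inf s t (vervaat w)" using N by simp
          then show ?case using m by (simp add: c_def min_absorb1)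
      qed
      then show ?case by (rule tendsto_eventually)
    qed
    show "AE w in W. norm (c j (vervaat w)) \<le> C" for j using cb by auto
  qed (auto intro!: Vm cm)
  then have "\<bar>expectation (\<lambda>w. f1 (vervaat w) - f2 (vervaat w))\<bar> \<le> 0"
    using le by (intro LIMSEQ_le_const) auto
  moreover have "integrable W (\<lambda>w. f1 (vervaat w))" "integrable W (\<lambda>w. f2 (vervaat w))"
    using f1b f2b by (auto intro!: integrable_const_bound[where B=C] Vm f1m f2m)
  ultimately show ?thesis by (simp add: f1_def f2_def)
qed

text \<open>Here the survival probability is divided out: the bounded continuous functions 1 /
  (survival + 1 / (n + 1)) approximate its inverse. Almost surely it is positive, because the
  Vervaat path is positive at s and t.\<close>

lemma vervaat_marks:
  assumes grid: "grid s t \<tau> k" and g_cont: "\<And>i. continuous_on UNIV (g i)" and g01: "\<And>i x. 0 \<le> g i x \<and> g i x \<le> 1"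
    and st01: "0 < s" "t < 1"
  shows "expectation (\<lambda>w. \<Prod>i<k. g i (vervaat w (\<tau> (Suc i)))) =
    expectation (\<lambda>w. positive_marks s t \<tau> k g (vervaat w s) (vervaat w t) / survival (t - s) (vervaat w s) (vervaat w t))"
    (is "?L = ?R")
    and "(\<lambda>w. positive_marks s t \<tau> k g (vervaat w s) (vervaat w t) / survival (t - s) (vervaat w s) (vervaat w t)) \<in> borel_measurable W"
proof -
  note st = gridD(7)[OF grid]
  have one: "\<And>i::nat. continuous_on UNIV (\<lambda>_::real. 1::real)" "\<And>(i::nat) (x::real). 0 \<le> (1::real) \<and> (1::real) \<le> 1" by auto
  have r_cont: "(\<lambda>n. survival (t - s) (an n) (bn n)) \<longlonglongrightarrow> survival (t - s) a b" if "an \<longlonglongrightarrow> a" "bn \<longlonglongrightarrow> b" for an bn a b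
    using positive_marks_continuous[OF grid one that] by (simp add: positive_marks_one[OF grid])
  have r01: "0 \<le> survival (t - s) a b" "survival (t - s) a b \<le> 1" for a b using survival_bounds[of "t - s"] st by auto
  have pmb: "0 \<le> positive_marks s t \<tau> k g a b" "positive_marks s t \<tau> k g a b \<le> survival (t - s) a b" for a b
    by (rule positive_marks_bounds[OF grid g_cont g01])+
  note pmc = positive_marks_continuous[OF grid g_cont g01]
  note gm = measurable_mark[OF grid g_cont g01]
  note m01 = prod_marks_bounds[OF grid g_cont g01]
  have in01: "s \<in> {0..1}" "t \<in> {0..1}" using st st01 by auto
  have \<tau>01: "\<tau> (Suc i) \<in> {0..1}" if "i < k" for i
    using gridD(5,6)[OF grid, of "Suc i"] st01 that by auto
  define H where "H n a b = 1 / (survival (t - s) a b + 1 / real (Suc n))" for n a b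
  have d0: "0 < survival (t - s) a b + 1 / real (Suc n)" for n a b
    using r01(1)[of a b] by (intro add_nonneg_pos) auto
  have H0: "0 \<le> H n a b" for n a b using d0[of a b n] by (simp add: H_def)
  have Hn: "H n a b \<le> real (Suc n)" for n a b
  proof -
    have "1 / (survival (t - s) a b + 1 / real (Suc n)) \<le> 1 / (1 / real (Suc n))"
      using r01(1)[of a b] d0[of a b n] by (intro divide_left_mono) auto
    then show ?thesis by (simp add: H_def)
  qed
  have Hr: "0 \<le> H n a b * survival (t - s) a b" "H n a b * survival (t - s) a b \<le> 1" for n a b
    using d0[of a b n] r01(1)[of a b] by (auto simp: H_def divide_simps)
  have Hpm: "0 \<le> H n a b * positive_marks s t \<tau> k g a b" "H n a b * positive_marks s t \<tau> k g a b \<le> 1" for n a b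
    using mult_left_mono[OF pmb(2)[of a b] H0[of n a b]] Hr(2)[of n a b] H0[of n a b] pmb(1)[of a b] by auto
  have rm: "(\<lambda>(a, b). survival (t - s) a b) \<in> borel_measurable (borel \<Otimes>\<^sub>M borel)" by measurable
  have gibbs: "expectation (\<lambda>w. H n (vervaat w s) (vervaat w t) * survival (t - s) (vervaat w s) (vervaat w t) * (\<Prod>i<k. g i (vervaat w (\<tau> (Suc i))))) =
    expectation (\<lambda>w. H n (vervaat w s) (vervaat w t) * positive_marks s t \<tau> k g (vervaat w s) (vervaat w t))" for n
  proof (rule vervaat_gibbs[OF grid g_cont g01 st01])
    show "(\<lambda>m. H n (an m) (bn m)) \<longlonglongrightarrow> H n a b" if "an \<longlonglongrightarrow> a" "bn \<longlonglongrightarrow> b" for an bn a b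
      unfolding H_def using d0[of a b n] by (intro tendsto_divide tendsto_add tendsto_const r_cont that) auto
    show "(\<lambda>(a, b). H n a b) \<in> borel_measurable (borel \<Otimes>\<^sub>M borel)"
      unfolding H_def using rm by (simp add: case_prod_unfold)
  qed (use H0 Hn in auto)
  have Vs [measurable]: "(\<lambda>w. vervaat w s) \<in> borel_measurable W" "(\<lambda>w. vervaat w t) \<in> borel_measurable W"
    by (intro measurable_vervaat_eval in01)+
  have rV [measurable]: "(\<lambda>w. survival (t - s) (vervaat w s) (vervaat w t)) \<in> borel_measurable W"
    using measurable_compose[OF measurable_Pair[OF Vs] rm] by simp
  have HV [measurable]: "(\<lambda>w. H n (vervaat w s) (vervaat w t)) \<in> borel_measurable W" for n
    unfolding H_def by measurable
  have pV [measurable]: "(\<lambda>w. positive_marks s t \<tau> k g (vervaat w s) (vervaat w t)) \<in> borel_measurable W"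
    using measurable_compose[OF measurable_Pair[OF Vs] measurable_positive_marks[OF grid g_cont g01]] by simp
  have gV [measurable]: "(\<lambda>w. \<Prod>i<k. g i (vervaat w (\<tau> (Suc i)))) \<in> borel_measurable W"
    by (intro borel_measurable_prod measurable_compose[OF measurable_vervaat_eval gm] \<tau>01) auto
  show "(\<lambda>w. positive_marks s t \<tau> k g (vervaat w s) (vervaat w t) / survival (t - s) (vervaat w s) (vervaat w t)) \<in> borel_measurable W"
    by measurable
  have Hlim: "AE w in W. (\<lambda>n. H n (vervaat w s) (vervaat w t)) \<longlonglongrightarrow> 1 / survival (t - s) (vervaat w s) (vervaat w t) \<and> survival (t - s) (vervaat w s) (vervaat w t) > 0"
    using AE_vervaat_pos
  proof eventually_elim
    case (elim w)
    then have p: "0 < vervaat w s" "0 < vervaat w t" using st st01 by auto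
    then have r: "0 < survival (t - s) (vervaat w s) (vervaat w t)" using st by (simp add: survival_def)
    have "(\<lambda>n. 1 / (survival (t - s) (vervaat w s) (vervaat w t) + 1 / real (Suc n))) \<longlonglongrightarrow> 1 / (survival (t - s) (vervaat w s) (vervaat w t) + 0)"
      using r LIMSEQ_inverse_real_of_nat by (intro tendsto_divide tendsto_add tendsto_const) (auto simp: inverse_eq_divide)
    then show ?case using r by (simp add: H_def)
  qed
  have "(\<lambda>n. expectation (\<lambda>w. H n (vervaat w s) (vervaat w t) * survival (t - s) (vervaat w s) (vervaat w t) * (\<Prod>i<k. g i (vervaat w (\<tau> (Suc i)))))) \<longlonglongrightarrow> ?L"
  proof (rule integral_dominated_convergence[where w="\<lambda>_. 1"])
    show "AE w in W. (\<lambda>n. H n (vervaat w s) (vervaat w t) * survival (t - s) (vervaat w s) (vervaat w t) * (\<Prod>i<k. g i (vervaat w (\<tau> (Suc i))))) \<longlonglongrightarrow> (\<Prod>i<k. g i (vervaat w (\<tau> (Suc i))))"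
      using Hlim
    proof eventually_elim
      case (elim w)
      then show ?case
        using tendsto_mult[OF tendsto_mult[OF conjunct1[OF elim] tendsto_const[of "survival (t - s) (vervaat w s) (vervaat w t)"]] tendsto_const[of "\<Prod>i<k. g i (vervaat w (\<tau> (Suc i)))"]]
        by simp
    qed
    show "AE w in W. norm (H n (vervaat w s) (vervaat w t) * survival (t - s) (vervaat w s) (vervaat w t) * (\<Prod>i<k. g i (vervaat w (\<tau> (Suc i))))) \<le> 1" for n
    proof (rule AE_I2)
      fix w
      have "\<bar>H n (vervaat w s) (vervaat w t) * survival (t - s) (vervaat w s) (vervaat w t)\<bar> \<le> 1" "\<bar>\<Prod>i<k. g i (vervaat w (\<tau> (Suc i)))\<bar> \<le> 1"
        using Hr[of n "vervaat w s" "vervaat w t"] m01[where h="\<lambda>i. vervaat w (\<tau> (Suc i))"] by (auto simp: abs_le_iff)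
      then show "norm (H n (vervaat w s) (vervaat w t) * survival (t - s) (vervaat w s) (vervaat w t) * (\<Prod>i<k. g i (vervaat w (\<tau> (Suc i))))) \<le> 1"
        unfolding real_norm_def abs_mult[of _ "prod _ _"] by (intro mult_le_one) auto
    qed
  qed auto
  moreover have "(\<lambda>n. expectation (\<lambda>w. H n (vervaat w s) (vervaat w t) * positive_marks s t \<tau> k g (vervaat w s) (vervaat w t))) \<longlonglongrightarrow> ?R"
  proof (rule integral_dominated_convergence[where w="\<lambda>_. 1"])
    show "AE w in W. (\<lambda>n. H n (vervaat w s) (vervaat w t) * positive_marks s t \<tau> k g (vervaat w s) (vervaat w t)) \<longlonglongrightarrow>
        positive_marks s t \<tau> k g (vervaat w s) (vervaat w t) / survival (t - s) (vervaat w s) (vervaat w t)"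
      using Hlim
    proof eventually_elim
      case (elim w)
      then show ?case
        using tendsto_mult[OF conjunct1[OF elim] tendsto_const[of "positive_marks s t \<tau> k g (vervaat w s) (vervaat w t)"]] by simp
    qed
    show "AE w in W. norm (H n (vervaat w s) (vervaat w t) * positive_marks s t \<tau> k g (vervaat w s) (vervaat w t)) \<le> 1" for n
      using Hpm by auto
  qed auto
  ultimately show "?L = ?R" unfolding gibbs by (rule LIMSEQ_unique)
qed

text \<open>The killed kernel between the ends is the heat kernel times \<open>survival\<close>, so
  the heat kernel cancels.\<close>

lemma positive_marks_ratio:
  assumes grid: "grid s t \<tau> k" and g_cont: "\<And>i. continuous_on UNIV (g i)" and g01: "\<And>i x. 0 \<le> g i x \<and> g i x \<le> 1"
    and k: "1 \<le> k" and ab: "0 < a" "0 < b"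
  shows "(\<integral>\<^sup>+x. ennreal (positive_bridge_density \<tau> k a b x) * (\<Prod>i<k. ennreal (g i (x (Suc i)))) \<partial>Pi\<^sub>M {1..k} (\<lambda>_. lborel)) =
    ennreal (positive_marks s t \<tau> k g a b / survival (t - s) a b)"
proof -
  let ?J = "\<integral>\<^sup>+x. ennreal (positive_bridge_density \<tau> k a b x) * (\<Prod>i<k. ennreal (g i (x (Suc i)))) \<partial>Pi\<^sub>M {1..k} (\<lambda>_. lborel)"
  let ?h = "heat (t - s) (b - a)" and ?r = "survival (t - s) a b"
  have st: "0 < t - s" using gridD(7)[OF grid] by simp
  have pmb: "0 \<le> positive_marks s t \<tau> k g a b" "positive_marks s t \<tau> k g a b \<le> survival (t - s) a b"
    by (rule positive_marks_bounds[OF grid g_cont g01])+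
  have gm: "g i \<in> borel_measurable borel" for i using g_cont by (rule borel_measurable_continuous_onI)
  have h: "0 < ?h" "0 < ?r" using st ab by (auto simp: heat_pos survival_def)
  have "ennreal (positive_marks s t \<tau> k g a b * ?h) = ennreal (?h * ?r) * ?J"
  proof -
    have "ennreal (positive_marks s t \<tau> k g a b * ?h) = killed_chain \<tau> (\<lambda>i x. ennreal (g i x)) k a b"
      by (rule positive_marks_killed_chain[OF grid g_cont g01])
    also have "\<dots> = ennreal (killed_density (t - s) a b) * ?J"
      by (rule killed_chain_density[OF grid k ab]) (use gm in simp)
    also have "killed_density (t - s) a b = ?h * ?r"
      using ab st by (simp add: killed_density_heat survival_def)
    finally show ?thesis .
  qed
  then have eq: "ennreal (positive_marks s t \<tau> k g a b * ?h) = ennreal (?h * ?r) * ?J" .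
  have "?J = ennreal (1 / (?h * ?r)) * (ennreal (?h * ?r) * ?J)"
    using h by (simp add: mult.assoc[symmetric] ennreal_mult[symmetric])
  also have "\<dots> = ennreal (1 / (?h * ?r) * (positive_marks s t \<tau> k g a b * ?h))"
    unfolding eq[symmetric] using h pmb by (intro ennreal_mult[symmetric]) auto
  also have "1 / (?h * ?r) * (positive_marks s t \<tau> k g a b * ?h) = positive_marks s t \<tau> k g a b / ?r"
    using h by simp
  finally show ?thesis .
qed

text \<open>As s -> 0 and t -> 1 the values at s and t tend to 0 through positive values, and the
  conditional densities converge pointwise. The hypothesis \<open>mass\<close> is what Scheffe's
  lemma requires of the limit; \<open>excursion_density_mass\<close> supplies it.\<close>

lemma vervaat_excursion:
  assumes k: "1 \<le> k" and mono: "\<And>i. 1 \<le> i \<Longrightarrow> i < k \<Longrightarrow> \<tau> i < \<tau> (Suc i)" and \<tau>01: "0 < \<tau> 1" "\<tau> k < 1"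
    and g_cont: "\<And>i. continuous_on UNIV (g i)" and g01: "\<And>i x. 0 \<le> g i x \<and> g i x \<le> 1"
    and mass: "(\<integral>\<^sup>+x. ennreal (excursion_density \<tau> k x) \<partial>Pi\<^sub>M {1..k} (\<lambda>_. lborel)) = 1"
  shows "expectation (\<lambda>w. \<Prod>i<k. g i (vervaat w (\<tau> (Suc i)))) =
    (\<integral>x. excursion_density \<tau> k x * (\<Prod>i<k. g i (x (Suc i))) \<partial>Pi\<^sub>M {1..k} (\<lambda>_. lborel))"
proof -
  let ?M = "Pi\<^sub>M {1..k} (\<lambda>_::nat. lborel :: real measure)"
  \<comment> \<open>Half the smaller distance of the first and last time to 0 and 1, so that
    \<open>sn n < \<tau> 1\<close> and \<open>\<tau> k < tn n\<close> for all n.\<close>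
  define \<delta> where "\<delta> = min (\<tau> 1) (1 - \<tau> k) / 2"
  have \<delta>: "0 < \<delta>" "\<delta> < \<tau> 1" "\<delta> < 1 - \<tau> k" using \<tau>01 by (auto simp: \<delta>_def)
  define sn where "sn n = \<delta> / real (Suc n)" for n
  define tn where "tn n = 1 - \<delta> / real (Suc n)" for n
  have dn: "0 < \<delta> / real (Suc n)" "\<delta> / real (Suc n) \<le> \<delta>" for n
    using \<delta> by (auto simp: divide_simps)
  have sn: "0 < sn n" "sn n < \<tau> 1" and tn: "tn n < 1" "\<tau> k < tn n" for n
    unfolding sn_def tn_def using dn[of n] \<delta> by linarith+
  have lim0: "(\<lambda>n. \<delta> / real (Suc n)) \<longlonglongrightarrow> 0"
    using tendsto_mult[OF tendsto_const[of \<delta>] LIMSEQ_inverse_real_of_nat] by (simp add: divide_inverse)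
  have sl: "sn \<longlonglongrightarrow> 0" unfolding sn_def[abs_def] by (rule lim0)
  have tl: "tn \<longlonglongrightarrow> 1" unfolding tn_def[abs_def] using tendsto_diff[OF tendsto_const[of 1] lim0] by simp
  define T where "T n = \<tau>(0 := sn n, Suc k := tn n)" for n
  have grid: "grid (sn n) (tn n) (T n) k" for n
    unfolding grid_def T_def using sn[of n] tn[of n] mono k by (auto simp: less_Suc_eq_le)
  note st = gridD(7)[OF grid]
  have one: "\<And>i::nat. continuous_on UNIV (\<lambda>_::real. 1::real)" "\<And>(i::nat) (x::real). 0 \<le> (1::real) \<and> (1::real) \<le> 1" by auto
  have gm: "g i \<in> borel_measurable borel" for i using g_cont by (rule borel_measurable_continuous_onI)
  let ?G = "\<lambda>x. \<Prod>i<k. g i (x (Suc i))"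
  have G01: "0 \<le> ?G x" "?G x \<le> 1" for x using g01 by (auto intro: prod_nonneg prod_le_1)
  have Gm [measurable]: "?G \<in> borel_measurable ?M"
    by (intro borel_measurable_prod measurable_compose[OF measurable_PiM_coordinate gm]) auto
  note em [measurable] = measurable_excursion_density[OF k, of \<tau>]
  have e0: "0 \<le> excursion_density \<tau> k x" for x by (rule excursion_density_nonneg[OF mono \<tau>01 k])
  have ei: "integrable ?M (excursion_density \<tau> k)"
    using mass em by (intro integrableI_nonneg) (auto simp: e0 simp del: One_nat_def)
  define R where "R n w = positive_marks (sn n) (tn n) (T n) k g (vervaat w (sn n)) (vervaat w (tn n)) / survival (tn n - sn n) (vervaat w (sn n)) (vervaat w (tn n))" for n w
  \<comment> \<open>The left side does not involve s and t, so the expectation of \<open>R n\<close>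
    is the same number for every n.\<close>
  have L: "expectation (\<lambda>w. \<Prod>i<k. g i (vervaat w (\<tau> (Suc i)))) = expectation (R n)" for n
  proof -
    have "expectation (\<lambda>w. \<Prod>i<k. g i (vervaat w (T n (Suc i)))) = expectation (R n)"
      unfolding R_def by (rule vervaat_marks(1)[OF grid g_cont g01 sn(1) tn(1)])
    then show ?thesis by (simp add: T_def)
  qed
  have Rm: "R n \<in> borel_measurable W" for n
    unfolding R_def[abs_def] by (rule vervaat_marks(2)[OF grid g_cont g01 sn(1) tn(1)])
  have Rlim: "(\<lambda>n. R n w) \<longlonglongrightarrow> (\<integral>x. excursion_density \<tau> k x * ?G x \<partial>?M)"
    if w: "w \<in> space W" and pos: "\<And>x. 0 < x \<Longrightarrow> x < 1 \<Longrightarrow> 0 < vervaat w x" and ends: "vervaat w 0 = 0" "vervaat w 1 = 0" for w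
  proof -
    have c: "continuous_on {0..1} (vervaat w)" by (rule path_borel_continuous[OF vervaat_in_space[OF w]])
    have s01: "0 < sn n" "sn n < 1" "0 < tn n" "tn n < 1" for n using sn[of n] tn[of n] st[of n] by auto
    define a where "a n = vervaat w (sn n)" for n
    define b where "b n = vervaat w (tn n)" for n
    have a: "a \<longlonglongrightarrow> 0" "\<And>n. a n > 0"
      using continuous_on_tendsto_compose[OF c sl] s01 ends pos unfolding a_def[abs_def] by (auto intro!: always_eventually less_imp_le)
    have b: "b \<longlonglongrightarrow> 0" "\<And>n. b n > 0"
      using continuous_on_tendsto_compose[OF c tl] s01 ends pos unfolding b_def[abs_def] by (auto intro!: always_eventually less_imp_le)
    define p where "p n = positive_bridge_density (T n) k (a n) (b n)" for n
    have pm [measurable]: "p n \<in> borel_measurable ?M" for n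
      unfolding p_def by (rule measurable_positive_bridge_density[OF k])
    have p0: "0 \<le> p n x" for n x unfolding p_def by (rule positive_bridge_density_nonneg[OF grid k a(2) b(2)])
    have plim: "(\<lambda>n. p n x) \<longlonglongrightarrow> excursion_density \<tau> k x" for x
      unfolding p_def T_def by (rule positive_bridge_density_tendsto[OF grid[unfolded T_def] k \<tau>01 sl tl a b])
    have pmass: "(\<integral>\<^sup>+x. ennreal (p n x) \<partial>?M) = 1" for n
    proof -
      have r: "0 < survival (tn n - sn n) (a n) (b n)" using a(2)[of n] b(2)[of n] st[of n] by (simp add: survival_def)
      have "(\<integral>\<^sup>+x. ennreal (p n x) * (\<Prod>i<k. ennreal 1) \<partial>?M) = ennreal (positive_marks (sn n) (tn n) (T n) k (\<lambda>_ _. 1) (a n) (b n) / survival (tn n - sn n) (a n) (b n))"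
        unfolding p_def by (rule positive_marks_ratio[OF grid one k a(2) b(2)])
      then show ?thesis using r by (simp add: positive_marks_one[OF grid])
    qed
    have pi: "integrable ?M (p n)" for n
      using pmass pm by (intro integrableI_nonneg) (auto simp: p0 simp del: One_nat_def)
    have pG: "integrable ?M (\<lambda>x. p n x * ?G x)" for n
      using G01 p0 by (intro Bochner_Integration.integrable_bound[OF pi[of n]] borel_measurable_times pm em Gm) (auto intro!: mult_left_le simp del: One_nat_def)
    have eG: "integrable ?M (\<lambda>x. excursion_density \<tau> k x * ?G x)"
      using G01 e0 by (intro Bochner_Integration.integrable_bound[OF ei] borel_measurable_times pm em Gm) (auto intro!: mult_left_le simp del: One_nat_def)
    have R: "R n w = (\<integral>x. p n x * ?G x \<partial>?M)" for n
    proof -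
      have "ennreal (R n w) = (\<integral>\<^sup>+x. ennreal (p n x) * (\<Prod>i<k. ennreal (g i (x (Suc i)))) \<partial>?M)"
        unfolding R_def p_def a_def[symmetric] b_def[symmetric]
        by (rule positive_marks_ratio[OF grid g_cont g01 k a(2) b(2), symmetric])
      also have "\<dots> = (\<integral>\<^sup>+x. ennreal (p n x * ?G x) \<partial>?M)"
        using g01 p0 G01 by (intro nn_integral_cong) (simp add: prod_ennreal ennreal_mult)
      also have "\<dots> = ennreal (\<integral>x. p n x * ?G x \<partial>?M)"
        using p0 G01 by (intro nn_integral_eq_integral pG) auto
      finally have "ennreal (R n w) = ennreal (\<integral>x. p n x * ?G x \<partial>?M)" .
      moreover have "0 \<le> R n w"
      proof -
        have "0 \<le> positive_marks (sn n) (tn n) (T n) k g (vervaat w (sn n)) (vervaat w (tn n))"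
          by (rule positive_marks_bounds(1)[OF grid g_cont g01])
        moreover have "0 \<le> survival (tn n - sn n) (vervaat w (sn n)) (vervaat w (tn n))"
          using survival_bounds[of "tn n - sn n"] st[of n] by auto
        ultimately show ?thesis unfolding R_def by simp
      qed
      moreover have "0 \<le> (\<integral>x. p n x * ?G x \<partial>?M)" using p0 G01 by (intro integral_nonneg_AE) auto
      ultimately show ?thesis by simp
    qed
    \<comment> \<open>Scheffe's lemma upgrades pointwise convergence of the densities to convergence
      in L1, which controls the integrals because the product of the marks is at most 1.\<close>
    have "(\<lambda>n. \<integral>\<^sup>+x. norm (p n x - excursion_density \<tau> k x) \<partial>?M) \<longlonglongrightarrow> 0"
      using plim p0 e0 pmass mass pm by (intro Scheffe_lemma2 ei) (auto simp del: One_nat_def)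
    then have l: "(\<lambda>n. enn2real (\<integral>\<^sup>+x. norm (p n x - excursion_density \<tau> k x) \<partial>?M)) \<longlonglongrightarrow> enn2real 0"
      by (intro tendsto_enn2real) auto
    have bound: "\<bar>R n w - (\<integral>x. excursion_density \<tau> k x * ?G x \<partial>?M)\<bar> \<le> enn2real (\<integral>\<^sup>+x. norm (p n x - excursion_density \<tau> k x) \<partial>?M)" for n
    proof -
      have "\<bar>R n w - (\<integral>x. excursion_density \<tau> k x * ?G x \<partial>?M)\<bar> = \<bar>\<integral>x. p n x * ?G x - excursion_density \<tau> k x * ?G x \<partial>?M\<bar>"
        unfolding R using pG eG by simp
      also have "\<dots> \<le> (\<integral>x. norm (p n x - excursion_density \<tau> k x) \<partial>?M)"
      proof (rule abs_integral_le)
        fix x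
        show "\<bar>p n x * ?G x - excursion_density \<tau> k x * ?G x\<bar> \<le> norm (p n x - excursion_density \<tau> k x)"
          unfolding left_diff_distrib[symmetric] abs_mult using G01[of x] by (auto intro!: mult_left_le)
      qed (use pG eG pi ei in auto)
      also have "\<dots> = enn2real (\<integral>\<^sup>+x. norm (p n x - excursion_density \<tau> k x) \<partial>?M)"
        using pm em by (intro integral_eq_nn_integral) (auto simp del: One_nat_def)
      finally show ?thesis .
    qed
    have "(\<lambda>n. R n w - (\<integral>x. excursion_density \<tau> k x * ?G x \<partial>?M)) \<longlonglongrightarrow> 0"
      using bound by (intro Lim_null_comparison[OF _ l[unfolded enn2real_0]] always_eventually) (simp only: real_norm_def simp_thms)
    then show ?thesis by (rule LIM_zero_cancel)
  qed
  have "(\<lambda>n. expectation (R n)) \<longlonglongrightarrow> expectation (\<lambda>w. \<integral>x. excursion_density \<tau> k x * ?G x \<partial>?M)"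
  proof (rule integral_dominated_convergence[where w="\<lambda>_. 1"])
    show "AE w in W. (\<lambda>n. R n w) \<longlonglongrightarrow> (\<integral>x. excursion_density \<tau> k x * ?G x \<partial>?M)"
      using AE_vervaat_pos AE_space by eventually_elim (rule Rlim, auto)
    show "AE w in W. norm (R n w) \<le> 1" for n
    proof (rule AE_I2)
      fix w
      have "0 \<le> positive_marks (sn n) (tn n) (T n) k g (vervaat w (sn n)) (vervaat w (tn n))"
        "positive_marks (sn n) (tn n) (T n) k g (vervaat w (sn n)) (vervaat w (tn n)) \<le> survival (tn n - sn n) (vervaat w (sn n)) (vervaat w (tn n))"
        by (rule positive_marks_bounds[OF grid g_cont g01])+
      then show "norm (R n w) \<le> 1" by (auto simp: R_def divide_simps)
    qed
  qed (use Rm in auto)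
  then have "(\<lambda>n::nat. expectation (\<lambda>w. \<Prod>i<k. g i (vervaat w (\<tau> (Suc i))))) \<longlonglongrightarrow> (\<integral>x. excursion_density \<tau> k x * ?G x \<partial>?M)"
    unfolding L[symmetric] by (simp add: prob_space)
  then show ?thesis by (simp add: LIMSEQ_const_iff)
qed

end

section \<open>Spherical integration\<close>

lemma measure_eqI_atMost:
  fixes M N :: "real measure"
  assumes sets: "sets M = sets borel" "sets N = sets borel"
    and eq: "\<And>s. emeasure M {..s} = emeasure N {..s}" and fin: "\<And>s. emeasure M {..s} \<noteq> \<infinity>"
  shows "M = N"
proof (rule measure_eqI_generator_eq[where \<Omega>=UNIV and E="range (\<lambda>s. {..s})" and A="\<lambda>i. {..real i}"])
  show "Int_stable (range (\<lambda>s::real. {..s}))"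
    by (auto simp: Int_stable_def Int_atMost)
  show "sets M = sigma_sets UNIV (range (\<lambda>s. {..s}))" "sets N = sigma_sets UNIV (range (\<lambda>s. {..s}))"
    unfolding sets borel_eq_atMost by (simp_all add: sets_measure_of)
  show "(\<Union>i. {..real i}) = UNIV" by (auto intro: real_arch_simple)
qed (use eq fin in auto)

lemma nn_integral_lborel_swap:
  fixes f :: "real \<Rightarrow> real \<Rightarrow> ennreal"
  assumes "(\<lambda>(x, y). f x y :: ennreal) \<in> borel_measurable (borel \<Otimes>\<^sub>M borel)"
  shows "(\<integral>\<^sup>+x. \<integral>\<^sup>+y. f x y \<partial>lborel \<partial>lborel) = (\<integral>\<^sup>+y. \<integral>\<^sup>+x. f x y \<partial>lborel \<partial>lborel)"
proof -
  have "(\<lambda>(x, y). f x y) \<in> borel_measurable (lborel \<Otimes>\<^sub>M lborel)"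
    using assms by (simp add: measurable_cong_sets[OF sets_pair_measure_cong[OF sets_lborel sets_lborel] refl])
  then show ?thesis using lborel_pair.Fubini'[of f] by simp
qed

text \<open>The rotation is composed of two one-dimensional affine substitutions, in x for fixed y
  and then in y for a fixed new first coordinate; the factors |c| and 1 / |c| cancel. For c = 0 it
  is a quarter turn, an exchange of the variables up to signs.\<close>

lemma nn_integral_rotation:
  assumes F [measurable]: "(\<lambda>(x, y). F x y :: ennreal) \<in> borel_measurable (borel \<Otimes>\<^sub>M borel)" and cs: "c\<^sup>2 + s\<^sup>2 = (1::real)"
  shows "(\<integral>\<^sup>+y. \<integral>\<^sup>+x. F (c * x - s * y) (s * x + c * y) \<partial>lborel \<partial>lborel) = (\<integral>\<^sup>+y. \<integral>\<^sup>+x. F x y \<partial>lborel \<partial>lborel)"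
proof (cases "c = 0")
  case True
  then have s: "s = 1 \<or> s = -1" using cs by (simp add: power2_eq_1_iff)
  then have s0: "s \<noteq> 0" "- s \<noteq> 0" "ennreal \<bar>s\<bar> = 1" "ennreal \<bar>- s\<bar> = 1" by auto
  have 1: "(\<integral>\<^sup>+x. F u x \<partial>lborel) = (\<integral>\<^sup>+x. F u (s * x) \<partial>lborel)" for u
    using nn_integral_real_affine[of "F u" s 0] s0 by simp
  have "(\<integral>\<^sup>+u. \<integral>\<^sup>+v. F u v \<partial>lborel \<partial>lborel) = (\<integral>\<^sup>+y. \<integral>\<^sup>+v. F (- s * y) v \<partial>lborel \<partial>lborel)"
    using nn_integral_real_affine[of "\<lambda>u. \<integral>\<^sup>+v. F u v \<partial>lborel" "- s" 0] s0 by simp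
  also have "\<dots> = (\<integral>\<^sup>+y. \<integral>\<^sup>+x. F (- s * y) (s * x) \<partial>lborel \<partial>lborel)" by (subst 1) simp
  finally show ?thesis using True nn_integral_lborel_swap[OF F] by simp
next
  case False
  have s2: "1 - s\<^sup>2 = c * c" using cs by (simp add: power2_eq_square)
  have 1: "(\<integral>\<^sup>+u. F u ((s * u + y) / c) \<partial>lborel) = ennreal \<bar>c\<bar> * (\<integral>\<^sup>+x. F (c * x - s * y) (s * x + c * y) \<partial>lborel)" for y
  proof -
    have "(s * (- (s * y) + c * x) + y) / c = s * x + c * y" for x
    proof -
      have "s * (- (s * y) + c * x) + y = c * (s * x) + (1 - s\<^sup>2) * y" by (simp add: algebra_simps power2_eq_square)
      also have "\<dots> = c * (s * x + c * y)" unfolding s2 by (simp add: algebra_simps)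
      finally show ?thesis using False by simp
    qed
    then show ?thesis
      using False by (subst nn_integral_real_affine[where c=c and t="- (s * y)"]) (auto simp: add.commute)
  qed
  have 2: "(\<integral>\<^sup>+y. F u ((s * u + y) / c) \<partial>lborel) = ennreal \<bar>c\<bar> * (\<integral>\<^sup>+v. F u v \<partial>lborel)" for u
  proof -
    have "(\<integral>\<^sup>+v. F u v \<partial>lborel) = ennreal \<bar>1 / c\<bar> * (\<integral>\<^sup>+y. F u (s * u / c + 1 / c * y) \<partial>lborel)"
      using False by (intro nn_integral_real_affine) auto
    then show ?thesis
      using False by (simp add: add_divide_distrib mult.assoc[symmetric] ennreal_mult[symmetric])
  qed
  have "ennreal \<bar>c\<bar> * (\<integral>\<^sup>+y. \<integral>\<^sup>+x. F (c * x - s * y) (s * x + c * y) \<partial>lborel \<partial>lborel) = (\<integral>\<^sup>+y. \<integral>\<^sup>+u. F u ((s * u + y) / c) \<partial>lborel \<partial>lborel)"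
    unfolding 1 by (intro nn_integral_cmult[symmetric]) measurable
  also have "\<dots> = (\<integral>\<^sup>+u. \<integral>\<^sup>+y. F u ((s * u + y) / c) \<partial>lborel \<partial>lborel)"
    by (rule nn_integral_lborel_swap) measurable
  also have "\<dots> = ennreal \<bar>c\<bar> * (\<integral>\<^sup>+u. \<integral>\<^sup>+v. F u v \<partial>lborel \<partial>lborel)"
    unfolding 2 by (intro nn_integral_cmult) measurable
  also have "(\<integral>\<^sup>+u. \<integral>\<^sup>+v. F u v \<partial>lborel \<partial>lborel) = (\<integral>\<^sup>+v. \<integral>\<^sup>+u. F u v \<partial>lborel \<partial>lborel)"
    by (rule nn_integral_lborel_swap[OF F])
  finally show ?thesis using False by (simp add: ennreal_mult_cancel_left)
qed

text \<open>The rotation with cosine a / \<rho> and sine b / \<rho> carries the linear form to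
  \<rho> x and preserves the squared norm.\<close>

lemma nn_integral_rotate_to_axis:
  assumes [measurable]: "(\<lambda>(z, q). E z q :: ennreal) \<in> borel_measurable (borel \<Otimes>\<^sub>M borel)"
  shows "(\<integral>\<^sup>+y. \<integral>\<^sup>+x. E (a * x + b * y) (x\<^sup>2 + y\<^sup>2) \<partial>lborel \<partial>lborel) =
    (\<integral>\<^sup>+y. \<integral>\<^sup>+x. E (sqrt (a\<^sup>2 + b\<^sup>2) * x) (x\<^sup>2 + y\<^sup>2) \<partial>lborel \<partial>lborel)"
proof (cases "a = 0 \<and> b = 0")
  case False
  define \<rho> where "\<rho> = sqrt (a\<^sup>2 + b\<^sup>2)"
  have \<rho>: "0 < \<rho>" "\<rho> * \<rho> = a\<^sup>2 + b\<^sup>2"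
    using False by (auto simp: \<rho>_def sum_power2_gt_zero_iff)
  define c s where "c = a / \<rho>" and "s = b / \<rho>"
  have cs: "c\<^sup>2 + s\<^sup>2 = 1"
  proof -
    have "a\<^sup>2 + b\<^sup>2 \<noteq> 0" using \<rho> by (metis mult_pos_pos less_irrefl)
    then show ?thesis unfolding c_def s_def power_divide add_divide_distrib[symmetric] power2_eq_square[of \<rho>] \<rho>(2) by simp
  qed
  have ab: "a = \<rho> * c" "b = \<rho> * s" using \<rho> by (auto simp: c_def s_def)
  have 1: "a * (c * x - s * y) + b * (s * x + c * y) = \<rho> * x" for x y
  proof -
    have "a * (c * x - s * y) + b * (s * x + c * y) = \<rho> * ((c\<^sup>2 + s\<^sup>2) * x)"
      unfolding ab by (simp add: algebra_simps power2_eq_square)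
    then show ?thesis by (simp add: cs)
  qed
  have 2: "(c * x - s * y)\<^sup>2 + (s * x + c * y)\<^sup>2 = x\<^sup>2 + y\<^sup>2" for x y
  proof -
    have "(c * x - s * y)\<^sup>2 + (s * x + c * y)\<^sup>2 = (c\<^sup>2 + s\<^sup>2) * (x\<^sup>2 + y\<^sup>2)"
      by (simp add: algebra_simps power2_eq_square)
    then show ?thesis by (simp add: cs)
  qed
  show ?thesis
    using nn_integral_rotation[of "\<lambda>x y. E (a * x + b * y) (x\<^sup>2 + y\<^sup>2)", OF _ cs] by (simp add: 1 2 \<rho>_def[symmetric])
qed simp

text \<open>The image of planar Lebesgue measure under the squared norm is determined by the areas
  pi q of the discs, hence has constant density pi on the half line.\<close>

lemma nn_integral_polar:
  fixes H :: "real \<Rightarrow> ennreal"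
  assumes [measurable]: "H \<in> borel_measurable borel"
  shows "(\<integral>\<^sup>+y. \<integral>\<^sup>+x. H (x\<^sup>2 + y\<^sup>2) \<partial>lborel \<partial>lborel) = (\<integral>\<^sup>+q. ennreal pi * indicator {0..} q * H q \<partial>lborel)"
proof -
  let ?r = "\<lambda>p::real \<times> real. (snd p)\<^sup>2 + (fst p)\<^sup>2"
  have [measurable]: "?r \<in> borel_measurable borel" by (intro borel_measurable_continuous_onI continuous_intros)
  have eq: "distr lborel borel ?r = density lborel (\<lambda>q. ennreal pi * indicator {0..} q)"
  proof (rule measure_eqI_atMost)
    have A: "emeasure (distr lborel borel ?r) {..q} = ennreal (pi * max 0 q)" for q
    proof -
      have "emeasure (distr lborel borel ?r) {..q} = emeasure lborel {p. ?r p \<le> q}"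
        by (subst emeasure_distr) (auto simp: vimage_def)
      also have "\<dots> = ennreal (pi * max 0 q)"
      proof (cases "0 \<le> q")
        case True
        have "{p. ?r p \<le> q} = cball 0 (sqrt q)"
          using True by (auto simp: norm_Pair add.commute split: prod.splits)
        then show ?thesis using True by (simp add: emeasure_cball unit_ball_vol_2 ennreal_mult)
      next
        case False
        then have "{p. ?r p \<le> q} = {}" by (auto simp: not_le intro: less_le_trans)
        then show ?thesis using False by simp
      qed
      finally show ?thesis .
    qed
    show "emeasure (distr lborel borel ?r) {..q} \<noteq> \<infinity>" for q by (simp add: A)
    show "emeasure (distr lborel borel ?r) {..q} = emeasure (density lborel (\<lambda>q. ennreal pi * indicator {0..} q)) {..q}" for q
    proof -
      have "emeasure (density lborel (\<lambda>q. ennreal pi * indicator {0..} q)) {..q} = (\<integral>\<^sup>+x. ennreal pi * indicator {0..q} x \<partial>lborel)"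
        by (subst emeasure_density) (auto intro!: nn_integral_cong simp: indicator_def)
      also have "\<dots> = ennreal pi * ennreal (max 0 q)"
        by (subst nn_integral_cmult) (auto simp: max_def emeasure_lborel_Icc_eq)
      finally show ?thesis unfolding A by (simp add: ennreal_mult)
    qed
  qed simp_all
  have "(\<integral>\<^sup>+y. \<integral>\<^sup>+x. H (x\<^sup>2 + y\<^sup>2) \<partial>lborel \<partial>lborel) = (\<integral>\<^sup>+p. H (?r p) \<partial>(lborel \<Otimes>\<^sub>M lborel))"
    by (subst lborel.nn_integral_fst[symmetric]) simp_all
  also have "\<dots> = (\<integral>\<^sup>+q. H q \<partial>distr lborel borel ?r)"
    unfolding lborel_prod by (subst nn_integral_distr) auto
  also have "\<dots> = (\<integral>\<^sup>+q. ennreal pi * indicator {0..} q * H q \<partial>lborel)"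
    unfolding eq by (subst nn_integral_density) auto
  finally show ?thesis .
qed

text \<open>Again by comparing measures of half lines; this passes from the squared radius to the
  radius.\<close>

lemma nn_integral_square_substitution:
  fixes H :: "real \<Rightarrow> ennreal"
  assumes [measurable]: "H \<in> borel_measurable borel"
  shows "(\<integral>\<^sup>+q. indicator {0..} q * H q \<partial>lborel) = (\<integral>\<^sup>+r. ennreal (2 * r) * indicator {0..} r * H (r\<^sup>2) \<partial>lborel)"
proof -
  let ?M = "density lborel (\<lambda>r. ennreal (2 * r) * indicator {0..} r)"
  have eq: "distr ?M borel (\<lambda>r. r\<^sup>2) = density lborel (indicator {0..})"
  proof (rule measure_eqI_atMost)
    have A: "emeasure (distr ?M borel (\<lambda>r. r\<^sup>2)) {..q} = ennreal (max 0 q)" for q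
    proof -
      have "emeasure (distr ?M borel (\<lambda>r. r\<^sup>2)) {..q} = (\<integral>\<^sup>+r. ennreal (2 * r) * indicator {0..} r * indicator {r. r\<^sup>2 \<le> q} r \<partial>lborel)"
        by (subst emeasure_distr) (auto simp: vimage_def emeasure_density)
      also have "\<dots> = ennreal (max 0 q)"
      proof (cases "0 \<le> q")
        case True
        have "(\<integral>\<^sup>+r. ennreal (2 * r) * indicator {0..} r * indicator {r. r\<^sup>2 \<le> q} r \<partial>lborel) = (\<integral>\<^sup>+r. ennreal (2 * r) * indicator {0..sqrt q} r \<partial>lborel)"
          using True by (intro nn_integral_cong) (auto simp: indicator_def real_le_rsqrt sqrt_ge_absD abs_le_square_iff[symmetric] dest: real_le_rsqrt sqrt_ge_absD)
        also have "\<dots> = ennreal ((sqrt q)\<^sup>2 - 0\<^sup>2)"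
          using True by (intro nn_integral_FTC_Icc) (auto intro!: derivative_eq_intros)
        finally show ?thesis using True by simp
      next
        case False
        then have "{r. r\<^sup>2 \<le> q} = {}" by (auto simp: not_le intro: less_le_trans)
        then show ?thesis using False by simp
      qed
      finally show ?thesis .
    qed
    show "emeasure (distr ?M borel (\<lambda>r. r\<^sup>2)) {..q} \<noteq> \<infinity>" for q by (simp add: A)
    show "emeasure (distr ?M borel (\<lambda>r. r\<^sup>2)) {..q} = emeasure (density lborel (indicator {0..})) {..q}" for q
    proof -
      have "emeasure (density lborel (indicator {0..})) {..q} = (\<integral>\<^sup>+x. indicator {0..q} x \<partial>lborel)"
        by (subst emeasure_density, simp, simp, rule nn_integral_cong, simp add: indicator_def)
      also have "\<dots> = ennreal (max 0 q)"
        by (auto simp: max_def emeasure_lborel_Icc_eq)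
      finally show ?thesis unfolding A by simp
    qed
  qed simp_all
  have "(\<integral>\<^sup>+q. indicator {0..} q * H q \<partial>lborel) = (\<integral>\<^sup>+q. H q \<partial>distr ?M borel (\<lambda>r. r\<^sup>2))"
    unfolding eq by (subst nn_integral_density) auto
  also have "\<dots> = (\<integral>\<^sup>+r. ennreal (2 * r) * indicator {0..} r * H (r\<^sup>2) \<partial>lborel)"
    by (subst nn_integral_distr) (auto simp: nn_integral_density)
  finally show ?thesis .
qed

lemma nn_integral_exp_Icc:
  assumes "0 \<le> r"
  shows "(\<integral>\<^sup>+y. ennreal (exp (c * y)) * indicator {-r..r} y \<partial>lborel) = ennreal (if c = 0 then 2 * r else (exp (c * r) - exp (- (c * r))) / c)"
proof (cases "c = 0")
  case True
  then show ?thesis using assms by (simp add: emeasure_lborel_Icc_eq)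
next
  case False
  have "(\<integral>\<^sup>+y. ennreal (exp (c * y)) * indicator {-r..r} y \<partial>lborel) = ennreal (exp (c * r) / c - exp (c * (- r)) / c)"
    using assms False by (intro nn_integral_FTC_Icc) (auto intro!: derivative_eq_intros)
  then show ?thesis using False by (simp add: diff_divide_distrib)
qed

text \<open>Two rotations, in the (y,z) and then in the (x,y) plane, turn the linear form into
  \<rho> x. Polar coordinates in the (y,z) plane and Fubini leave the integral of exp (\<rho> x)
  over [-r,r]; as Archimedes knew, a coordinate of a uniform point on the sphere is uniform.\<close>

lemma nn_integral_spherical:
  fixes f :: "real \<Rightarrow> ennreal"
  assumes [measurable]: "f \<in> borel_measurable borel"
  shows "(\<integral>\<^sup>+z. \<integral>\<^sup>+y. \<integral>\<^sup>+x. ennreal (exp (a * x + b * y + c * z)) * f (x\<^sup>2 + y\<^sup>2 + z\<^sup>2) \<partial>lborel \<partial>lborel \<partial>lborel) =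
    (\<integral>\<^sup>+r. ennreal (2 * pi * r * (let \<rho> = sqrt (a\<^sup>2 + b\<^sup>2 + c\<^sup>2) in if \<rho> = 0 then 2 * r else (exp (\<rho> * r) - exp (- (\<rho> * r))) / \<rho>)) * indicator {0..} r * f (r\<^sup>2) \<partial>lborel)"
proof -
  define \<sigma> where "\<sigma> = sqrt (b\<^sup>2 + c\<^sup>2)"
  define \<rho> where "\<rho> = sqrt (a\<^sup>2 + b\<^sup>2 + c\<^sup>2)"
  have \<sigma>: "sqrt (a\<^sup>2 + \<sigma>\<^sup>2) = \<rho>" by (simp add: \<sigma>_def \<rho>_def add.assoc)
  have "(\<integral>\<^sup>+z. \<integral>\<^sup>+y. \<integral>\<^sup>+x. ennreal (exp (a * x + b * y + c * z)) * f (x\<^sup>2 + y\<^sup>2 + z\<^sup>2) \<partial>lborel \<partial>lborel \<partial>lborel) =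
    (\<integral>\<^sup>+z. \<integral>\<^sup>+y. (\<lambda>u q. \<integral>\<^sup>+x. ennreal (exp (a * x + u)) * f (x\<^sup>2 + q) \<partial>lborel) (b * y + c * z) (y\<^sup>2 + z\<^sup>2) \<partial>lborel \<partial>lborel)"
    by (simp add: add.assoc)
  also have "\<dots> = (\<integral>\<^sup>+z. \<integral>\<^sup>+y. (\<lambda>u q. \<integral>\<^sup>+x. ennreal (exp (a * x + u)) * f (x\<^sup>2 + q) \<partial>lborel) (\<sigma> * y) (y\<^sup>2 + z\<^sup>2) \<partial>lborel \<partial>lborel)"
    unfolding \<sigma>_def by (rule nn_integral_rotate_to_axis) measurable
  also have "\<dots> = (\<integral>\<^sup>+z. \<integral>\<^sup>+y. \<integral>\<^sup>+x. (\<lambda>u q. ennreal (exp u) * f (q + z\<^sup>2)) (a * x + \<sigma> * y) (x\<^sup>2 + y\<^sup>2) \<partial>lborel \<partial>lborel \<partial>lborel)"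
    by (simp add: add.assoc)
  also have "\<dots> = (\<integral>\<^sup>+z. \<integral>\<^sup>+y. \<integral>\<^sup>+x. (\<lambda>u q. ennreal (exp u) * f (q + z\<^sup>2)) (\<rho> * x) (x\<^sup>2 + y\<^sup>2) \<partial>lborel \<partial>lborel \<partial>lborel)"
    unfolding \<sigma>[symmetric] by (subst nn_integral_rotate_to_axis) auto
  also have "\<dots> = (\<integral>\<^sup>+z. \<integral>\<^sup>+y. \<integral>\<^sup>+x. ennreal (exp (\<rho> * x)) * f (x\<^sup>2 + (y\<^sup>2 + z\<^sup>2)) \<partial>lborel \<partial>lborel \<partial>lborel)"
    by (simp add: add.assoc)
  also have "\<dots> = (\<integral>\<^sup>+z. \<integral>\<^sup>+x. \<integral>\<^sup>+y. ennreal (exp (\<rho> * x)) * f (x\<^sup>2 + (y\<^sup>2 + z\<^sup>2)) \<partial>lborel \<partial>lborel \<partial>lborel)"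
    by (intro nn_integral_cong nn_integral_lborel_swap) measurable
  also have "\<dots> = (\<integral>\<^sup>+x. \<integral>\<^sup>+z. \<integral>\<^sup>+y. ennreal (exp (\<rho> * x)) * f (x\<^sup>2 + (y\<^sup>2 + z\<^sup>2)) \<partial>lborel \<partial>lborel \<partial>lborel)"
    by (intro nn_integral_lborel_swap) measurable
  also have "\<dots> = (\<integral>\<^sup>+x. \<integral>\<^sup>+q. ennreal pi * indicator {0..} q * (ennreal (exp (\<rho> * x)) * f (x\<^sup>2 + q)) \<partial>lborel \<partial>lborel)"
    by (intro nn_integral_cong nn_integral_polar) measurable
  \<comment> \<open>The polar variable is shifted by x^2, so that q becomes the squared norm in
    space.\<close>
  also have "\<dots> = (\<integral>\<^sup>+x. \<integral>\<^sup>+q. ennreal pi * (if x\<^sup>2 \<le> q then 1 else 0) * (ennreal (exp (\<rho> * x)) * f q) \<partial>lborel \<partial>lborel)"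
  proof (rule nn_integral_cong)
    fix x :: real
    show "(\<integral>\<^sup>+q. ennreal pi * indicator {0..} q * (ennreal (exp (\<rho> * x)) * f (x\<^sup>2 + q)) \<partial>lborel) = (\<integral>\<^sup>+q. ennreal pi * (if x\<^sup>2 \<le> q then 1 else 0) * (ennreal (exp (\<rho> * x)) * f q) \<partial>lborel)"
      by (subst (2) nn_integral_real_affine[where c=1 and t="x\<^sup>2"]) (auto intro!: nn_integral_cong simp: indicator_def)
  qed
  also have "\<dots> = (\<integral>\<^sup>+q. \<integral>\<^sup>+x. ennreal pi * (if x\<^sup>2 \<le> q then 1 else 0) * (ennreal (exp (\<rho> * x)) * f q) \<partial>lborel \<partial>lborel)"
    by (intro nn_integral_lborel_swap) measurable
  also have "\<dots> = (\<integral>\<^sup>+q. indicator {0..} q * (\<integral>\<^sup>+x. ennreal pi * f q * (ennreal (exp (\<rho> * x)) * indicator {- sqrt q..sqrt q} x) \<partial>lborel) \<partial>lborel)"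
  proof (rule nn_integral_cong)
    fix q :: real
    show "(\<integral>\<^sup>+x. ennreal pi * (if x\<^sup>2 \<le> q then 1 else 0) * (ennreal (exp (\<rho> * x)) * f q) \<partial>lborel) =
      indicator {0..} q * (\<integral>\<^sup>+x. ennreal pi * f q * (ennreal (exp (\<rho> * x)) * indicator {- sqrt q..sqrt q} x) \<partial>lborel)"
    proof (cases "0 \<le> q")
      case True
      have "x\<^sup>2 \<le> q \<longleftrightarrow> - sqrt q \<le> x \<and> x \<le> sqrt q" for x
        using True by (metis abs_le_iff minus_le_iff real_sqrt_abs real_sqrt_le_iff)
      then show ?thesis using True by (auto intro!: nn_integral_cong simp: indicator_def mult_ac)
    next
      case False
      then have "\<not> x\<^sup>2 \<le> q" for x using zero_le_power2[of x] by linarith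
      then show ?thesis using False by simp
    qed
  qed
  also have "\<dots> = (\<integral>\<^sup>+q. indicator {0..} q * (\<lambda>q. ennreal pi * f q * ennreal (if \<rho> = 0 then 2 * sqrt q else (exp (\<rho> * sqrt q) - exp (- (\<rho> * sqrt q))) / \<rho>)) q \<partial>lborel)"
  proof (rule nn_integral_cong)
    fix q :: real
    have "(\<integral>\<^sup>+x. ennreal pi * f q * (ennreal (exp (\<rho> * x)) * indicator {- sqrt q..sqrt q} x) \<partial>lborel) =
      ennreal pi * f q * (\<integral>\<^sup>+x. ennreal (exp (\<rho> * x)) * indicator {- sqrt q..sqrt q} x \<partial>lborel)"
      by (intro nn_integral_cmult) measurable
    then show "indicator {0..} q * (\<integral>\<^sup>+x. ennreal pi * f q * (ennreal (exp (\<rho> * x)) * indicator {- sqrt q..sqrt q} x) \<partial>lborel) =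
      indicator {0..} q * (\<lambda>q. ennreal pi * f q * ennreal (if \<rho> = 0 then 2 * sqrt q else (exp (\<rho> * sqrt q) - exp (- (\<rho> * sqrt q))) / \<rho>)) q"
      using nn_integral_exp_Icc[of "sqrt q" \<rho>] by (cases "0 \<le> q") simp_all
  qed
  also have "\<dots> = (\<integral>\<^sup>+r. ennreal (2 * r) * indicator {0..} r * (\<lambda>q. ennreal pi * f q * ennreal (if \<rho> = 0 then 2 * sqrt q else (exp (\<rho> * sqrt q) - exp (- (\<rho> * sqrt q))) / \<rho>)) (r\<^sup>2) \<partial>lborel)"
    by (rule nn_integral_square_substitution) measurable
  also have "\<dots> = (\<integral>\<^sup>+r. ennreal (2 * pi * r * (if \<rho> = 0 then 2 * r else (exp (\<rho> * r) - exp (- (\<rho> * r))) / \<rho>)) * indicator {0..} r * f (r\<^sup>2) \<partial>lborel)"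
  proof (rule nn_integral_cong)
    fix r :: real
    show "ennreal (2 * r) * indicator {0..} r * (\<lambda>q. ennreal pi * f q * ennreal (if \<rho> = 0 then 2 * sqrt q else (exp (\<rho> * sqrt q) - exp (- (\<rho> * sqrt q))) / \<rho>)) (r\<^sup>2) =
      ennreal (2 * pi * r * (if \<rho> = 0 then 2 * r else (exp (\<rho> * r) - exp (- (\<rho> * r))) / \<rho>)) * indicator {0..} r * f (r\<^sup>2)"
    proof (cases "0 \<le> r")
      case True
      let ?A = "if \<rho> = 0 then 2 * r else (exp (\<rho> * r) - exp (- (\<rho> * r))) / \<rho>"
      have "0 \<le> \<rho>" by (simp add: \<rho>_def)
      then have A: "0 \<le> ?A" using True by (auto intro!: divide_nonneg_nonneg)
      have "ennreal (2 * pi * r * ?A) = ennreal (2 * r) * ennreal pi * ennreal ?A"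
        using True A by (simp add: ennreal_mult[symmetric] mult_ac)
      then show ?thesis using True by (simp add: mult_ac)
    qed simp
  qed
  finally show ?thesis unfolding Let_def \<rho>_def .
qed

text \<open>The transition density of the three-dimensional Bessel process: the killed kernel
  transformed by the harmonic function r. The value at \<rho> = 0 is the limit identified in
  \<open>killed_density_ratio_tendsto\<close>.\<close>

definition radial_kernel :: "real \<Rightarrow> real \<Rightarrow> real \<Rightarrow> ennreal" where
  "radial_kernel d \<rho> r = (if 0 < r then ennreal (if \<rho> = 0 then 2 * r * hitting_density d r else r / \<rho> * killed_density d \<rho> r) else 0)"

lemma measurable_radial_kernel: "(\<lambda>(\<rho>, r). radial_kernel d \<rho> r) \<in> borel_measurable (borel \<Otimes>\<^sub>M borel)"
  unfolding radial_kernel_def by measurable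

text \<open>Expanding the squares separates a radial Gaussian factor from the exponential of a
  linear form, to which \<open>nn_integral_spherical\<close> applies.\<close>

lemma nn_integral_radial:
  assumes d: "0 < d" and [measurable]: "h \<in> borel_measurable borel"
  shows "(\<integral>\<^sup>+z. \<integral>\<^sup>+y. \<integral>\<^sup>+x. ennreal (heat d (x - a) * heat d (y - b) * heat d (z - c)) * h (sqrt (x\<^sup>2 + y\<^sup>2 + z\<^sup>2)) \<partial>lborel \<partial>lborel \<partial>lborel) =
    (\<integral>\<^sup>+r. radial_kernel d (sqrt (a\<^sup>2 + b\<^sup>2 + c\<^sup>2)) r * h r \<partial>lborel)"
proof -
  define \<rho> where "\<rho> = sqrt (a\<^sup>2 + b\<^sup>2 + c\<^sup>2)"
  have \<rho>: "0 \<le> \<rho>" "\<rho>\<^sup>2 = a\<^sup>2 + b\<^sup>2 + c\<^sup>2" by (simp_all add: \<rho>_def)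
  define C where "C = exp (- (\<rho>\<^sup>2 / (2 * d))) / (2 * pi * d * sqrt (2 * pi * d))"
  have C: "0 < C" using d by (simp add: C_def)
  define f where "f q = ennreal (exp (- (q / (2 * d)))) * h (sqrt q)" for q
  have [measurable]: "f \<in> borel_measurable borel" unfolding f_def by measurable
  have split: "heat d (x - a) * heat d (y - b) * heat d (z - c) =
     C * (exp (a / d * x + b / d * y + c / d * z) * exp (- ((x\<^sup>2 + y\<^sup>2 + z\<^sup>2) / (2 * d))))" for x y z
  proof -
    have s: "sqrt (2 * pi * d) * sqrt (2 * pi * d) = 2 * pi * d" using d by simp
    have e: "- (x - a)\<^sup>2 / (2 * d) + - (y - b)\<^sup>2 / (2 * d) + - (z - c)\<^sup>2 / (2 * d) =
      - (\<rho>\<^sup>2 / (2 * d)) + ((a / d * x + b / d * y + c / d * z) + - ((x\<^sup>2 + y\<^sup>2 + z\<^sup>2) / (2 * d)))"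
      using d unfolding \<rho>(2) by (simp add: field_simps power2_eq_square)
    have "heat d (x - a) * heat d (y - b) * heat d (z - c) =
      exp (- (x - a)\<^sup>2 / (2 * d) + - (y - b)\<^sup>2 / (2 * d) + - (z - c)\<^sup>2 / (2 * d)) / (sqrt (2 * pi * d) * sqrt (2 * pi * d) * sqrt (2 * pi * d))"
      unfolding heat_eq[OF d] exp_add by simp
    then show ?thesis unfolding e s exp_add[of "- (\<rho>\<^sup>2 / (2 * d))"] exp_add[of _ "- ((x\<^sup>2 + y\<^sup>2 + z\<^sup>2) / (2 * d))"] by (simp add: C_def)
  qed
  have "(\<integral>\<^sup>+z. \<integral>\<^sup>+y. \<integral>\<^sup>+x. ennreal (heat d (x - a) * heat d (y - b) * heat d (z - c)) * h (sqrt (x\<^sup>2 + y\<^sup>2 + z\<^sup>2)) \<partial>lborel \<partial>lborel \<partial>lborel) =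
    (\<integral>\<^sup>+z. \<integral>\<^sup>+y. \<integral>\<^sup>+x. ennreal C * (ennreal (exp (a / d * x + b / d * y + c / d * z)) * f (x\<^sup>2 + y\<^sup>2 + z\<^sup>2)) \<partial>lborel \<partial>lborel \<partial>lborel)"
    unfolding split f_def using C by (simp add: ennreal_mult mult.assoc)
  also have "\<dots> = ennreal C * (\<integral>\<^sup>+z. \<integral>\<^sup>+y. \<integral>\<^sup>+x. ennreal (exp (a / d * x + b / d * y + c / d * z)) * f (x\<^sup>2 + y\<^sup>2 + z\<^sup>2) \<partial>lborel \<partial>lborel \<partial>lborel)"
    by (subst nn_integral_cmult[symmetric]; (subst nn_integral_cmult[symmetric])?; (subst nn_integral_cmult[symmetric])?; (intro nn_integral_cong)?; measurable)
  also have "\<dots> = ennreal C * (\<integral>\<^sup>+r. ennreal (2 * pi * r * (let \<rho> = sqrt ((a/d)\<^sup>2 + (b/d)\<^sup>2 + (c/d)\<^sup>2) in if \<rho> = 0 then 2 * r else (exp (\<rho> * r) - exp (- (\<rho> * r))) / \<rho>)) * indicator {0..} r * f (r\<^sup>2) \<partial>lborel)"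
    by (subst nn_integral_spherical) simp_all
  also have "sqrt ((a/d)\<^sup>2 + (b/d)\<^sup>2 + (c/d)\<^sup>2) = \<rho> / d"
    using d by (simp add: \<rho>_def power_divide add_divide_distrib[symmetric] real_sqrt_divide)
  also have "ennreal C * (\<integral>\<^sup>+r. ennreal (2 * pi * r * (let \<rho> = \<rho> / d in if \<rho> = 0 then 2 * r else (exp (\<rho> * r) - exp (- (\<rho> * r))) / \<rho>)) * indicator {0..} r * f (r\<^sup>2) \<partial>lborel) =
    (\<integral>\<^sup>+r. ennreal C * (ennreal (2 * pi * r * (let \<rho> = \<rho> / d in if \<rho> = 0 then 2 * r else (exp (\<rho> * r) - exp (- (\<rho> * r))) / \<rho>)) * indicator {0..} r * f (r\<^sup>2)) \<partial>lborel)"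
    by (intro nn_integral_cmult[symmetric]) (auto simp: Let_def)
  also have "\<dots> = (\<integral>\<^sup>+r. radial_kernel d \<rho> r * h r \<partial>lborel)"
  proof (rule nn_integral_cong)
    fix r :: real
    let ?A = "if \<rho> / d = 0 then 2 * r else (exp (\<rho> / d * r) - exp (- (\<rho> / d * r))) / (\<rho> / d)"
    show "ennreal C * (ennreal (2 * pi * r * (let \<rho> = \<rho> / d in if \<rho> = 0 then 2 * r else (exp (\<rho> * r) - exp (- (\<rho> * r))) / \<rho>)) * indicator {0..} r * f (r\<^sup>2)) = radial_kernel d \<rho> r * h r"
    proof (cases "0 < r")
      case True
      have A: "0 \<le> ?A" using True \<rho>(1) d by (auto intro!: divide_nonneg_nonneg mult_nonneg_nonneg)
      have "C * (2 * pi * r * ?A * exp (- (r\<^sup>2 / (2 * d)))) = (if \<rho> = 0 then 2 * r * hitting_density d r else r / \<rho> * killed_density d \<rho> r)"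
      proof (cases "\<rho> = 0")
        case True
        have "C = 1 / (2 * pi * d * sqrt (2 * pi * d))" using True by (simp add: C_def)
        then show ?thesis using True d by (simp add: hitting_density_heat[OF d] heat_eq[OF d] field_simps power2_eq_square)
      next
        case False
        let ?e = "exp (- (\<rho>\<^sup>2 / (2 * d))) * exp (- (r\<^sup>2 / (2 * d)))"
        define D where "D = exp (\<rho> / d * r) - exp (- (\<rho> / d * r))"
        have e1: "exp (- (r - \<rho>)\<^sup>2 / (2 * d)) = ?e * exp (\<rho> / d * r)"
          unfolding exp_add[symmetric] using d by (simp add: field_simps power2_eq_square)
        have e2: "exp (- (r + \<rho>)\<^sup>2 / (2 * d)) = ?e * exp (- (\<rho> / d * r))"
          unfolding exp_add[symmetric] using d by (simp add: field_simps power2_eq_square)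
        have k: "killed_density d \<rho> r = ?e * (exp (\<rho> / d * r) - exp (- (\<rho> / d * r))) / sqrt (2 * pi * d)"
          unfolding killed_density_def heat_eq[OF d] e1 e2 by (simp add: right_diff_distrib diff_divide_distrib)
        have "C * (2 * pi * r * ?A * exp (- (r\<^sup>2 / (2 * d)))) = ?e * (exp (\<rho> / d * r) - exp (- (\<rho> / d * r))) * ((2 * pi * r / (\<rho> / d)) / (2 * pi * d * sqrt (2 * pi * d)))"
          unfolding C_def D_def[symmetric] using False d by (simp add: mult_ac)
        also have "(2 * pi * r / (\<rho> / d)) / (2 * pi * d * sqrt (2 * pi * d)) = r / \<rho> / sqrt (2 * pi * d)"
          using False d by simp
        finally show ?thesis using False unfolding k by (simp add: mult_ac)
      qed
      then have "radial_kernel d \<rho> r = ennreal (C * (2 * pi * r * ?A * exp (- (r\<^sup>2 / (2 * d)))))"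
        using True by (simp add: radial_kernel_def)
      also have "\<dots> = ennreal C * (ennreal (2 * pi * r * ?A) * ennreal (exp (- (r\<^sup>2 / (2 * d)))))"
        using A C True by (simp only: ennreal_mult mult_nonneg_nonneg exp_ge_zero less_imp_le pi_ge_zero zero_le_numeral)
      finally have "radial_kernel d \<rho> r * h r = ennreal C * (ennreal (2 * pi * r * ?A) * (ennreal (exp (- (r\<^sup>2 / (2 * d)))) * h r))"
        by (simp only: mult.assoc)
      then show ?thesis using True unfolding Let_def by (simp add: f_def)
    next
      case False
      then show ?thesis by (cases "r = 0") (simp_all add: radial_kernel_def)
    qed
  qed
  finally show ?thesis unfolding \<rho>_def .
qed

section \<open>The three-dimensional Bessel bridge\<close>

text \<open>The three-dimensional heat kernel as a function of the Euclidean norm.\<close>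

definition heat3 :: "real \<Rightarrow> real \<Rightarrow> real" where
  "heat3 d r = heat d r * (heat d 0)\<^sup>2"

lemma heat3_pos: "0 < d \<Longrightarrow> 0 < heat3 d r"
  unfolding heat3_def by (intro mult_pos_pos zero_less_power heat_pos)

lemma heat3_eq: "0 < d \<Longrightarrow> heat3 d (sqrt (x\<^sup>2 + y\<^sup>2 + z\<^sup>2)) = heat d x * heat d y * heat d z"
proof -
  assume d: "0 < d"
  have "exp (- (x\<^sup>2 + y\<^sup>2 + z\<^sup>2) / (2 * d)) = exp (- x\<^sup>2 / (2 * d)) * exp (- y\<^sup>2 / (2 * d)) * exp (- z\<^sup>2 / (2 * d))"
    unfolding exp_add[symmetric] by (simp add: add_divide_distrib diff_divide_distrib)
  then show ?thesis by (simp add: heat3_def heat_eq[OF d] power2_eq_square)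
qed

lemma measurable_heat3 [measurable]: "heat3 d \<in> borel_measurable borel"
  unfolding heat3_def[abs_def] by measurable

text \<open>The density at time q of a Brownian bridge ending in 0 at time 1, given its value x at
  time p.\<close>

definition bridge_density :: "real \<Rightarrow> real \<Rightarrow> real \<Rightarrow> real \<Rightarrow> real" where
  "bridge_density p q x y = heat (q - p) (y - x) * heat (1 - q) y / heat (1 - p) x"

lemma measurable_bridge_density [measurable (raw)]:
  assumes [measurable]: "f \<in> borel_measurable M" "g \<in> borel_measurable M"
  shows "(\<lambda>x. bridge_density p q (f x) (g x)) \<in> borel_measurable M"
  unfolding bridge_density_def normal_density_def by measurable

text \<open>The terminal factors of the three coordinates multiply to \<open>heat3\<close>, a
  function of the norm alone. Hence the step depends on its starting point only through the norm,
  which makes the radius Markov.\<close>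

lemma nn_integral_bridge_density_radial:
  assumes pq: "p < q" "q < 1" and u [measurable]: "u \<in> borel_measurable borel"
  shows "(\<integral>\<^sup>+z. ennreal (bridge_density p q c z) * (\<integral>\<^sup>+y. ennreal (bridge_density p q b y) * (\<integral>\<^sup>+x. ennreal (bridge_density p q a x) * u (sqrt (x\<^sup>2 + y\<^sup>2 + z\<^sup>2)) \<partial>lborel) \<partial>lborel) \<partial>lborel) =
    ennreal (1 / heat3 (1 - p) (sqrt (a\<^sup>2 + b\<^sup>2 + c\<^sup>2))) *
      (\<integral>\<^sup>+r. radial_kernel (q - p) (sqrt (a\<^sup>2 + b\<^sup>2 + c\<^sup>2)) r * (ennreal (heat3 (1 - q) r) * u r) \<partial>lborel)"
proof -
  define C where "C = 1 / heat3 (1 - p) (sqrt (a\<^sup>2 + b\<^sup>2 + c\<^sup>2))"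
  have C: "0 \<le> C" using pq by (simp add: C_def less_imp_le heat3_pos)
  have [measurable]: "(\<lambda>r. ennreal (heat3 (1 - q) r) * u r) \<in> borel_measurable borel" by measurable
  have bd0: "0 \<le> bridge_density p q x y" for x y by (simp add: bridge_density_def)
  have split: "ennreal (bridge_density p q c z) * (ennreal (bridge_density p q b y) * (ennreal (bridge_density p q a x) * u (sqrt (x\<^sup>2 + y\<^sup>2 + z\<^sup>2)))) =
    ennreal C * (ennreal (heat (q - p) (x - a) * heat (q - p) (y - b) * heat (q - p) (z - c)) * (ennreal (heat3 (1 - q) (sqrt (x\<^sup>2 + y\<^sup>2 + z\<^sup>2))) * u (sqrt (x\<^sup>2 + y\<^sup>2 + z\<^sup>2))))" for x y z
  proof -
    have "bridge_density p q c z * (bridge_density p q b y * bridge_density p q a x) =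
      C * ((heat (q - p) (x - a) * heat (q - p) (y - b) * heat (q - p) (z - c)) * heat3 (1 - q) (sqrt (x\<^sup>2 + y\<^sup>2 + z\<^sup>2)))"
      using pq by (simp add: C_def bridge_density_def heat3_eq mult_ac)
    then have "ennreal (bridge_density p q c z) * (ennreal (bridge_density p q b y) * ennreal (bridge_density p q a x)) =
      ennreal C * (ennreal (heat (q - p) (x - a) * heat (q - p) (y - b) * heat (q - p) (z - c)) * ennreal (heat3 (1 - q) (sqrt (x\<^sup>2 + y\<^sup>2 + z\<^sup>2))))"
      using C bd0 pq by (simp add: ennreal_mult[symmetric] less_imp_le[OF heat3_pos])
    then show ?thesis unfolding mult.assoc[symmetric] by (simp only: mult.assoc)
  qed
  have "(\<integral>\<^sup>+z. ennreal (bridge_density p q c z) * (\<integral>\<^sup>+y. ennreal (bridge_density p q b y) * (\<integral>\<^sup>+x. ennreal (bridge_density p q a x) * u (sqrt (x\<^sup>2 + y\<^sup>2 + z\<^sup>2)) \<partial>lborel) \<partial>lborel) \<partial>lborel) =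
    (\<integral>\<^sup>+z. \<integral>\<^sup>+y. \<integral>\<^sup>+x. ennreal (bridge_density p q c z) * (ennreal (bridge_density p q b y) * (ennreal (bridge_density p q a x) * u (sqrt (x\<^sup>2 + y\<^sup>2 + z\<^sup>2)))) \<partial>lborel \<partial>lborel \<partial>lborel)"
  proof (rule nn_integral_cong)
    fix z
    have "(\<integral>\<^sup>+y. ennreal (bridge_density p q b y) * (\<integral>\<^sup>+x. ennreal (bridge_density p q a x) * u (sqrt (x\<^sup>2 + y\<^sup>2 + z\<^sup>2)) \<partial>lborel) \<partial>lborel) =
      (\<integral>\<^sup>+y. \<integral>\<^sup>+x. ennreal (bridge_density p q b y) * (ennreal (bridge_density p q a x) * u (sqrt (x\<^sup>2 + y\<^sup>2 + z\<^sup>2))) \<partial>lborel \<partial>lborel)"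
      by (intro nn_integral_cong nn_integral_cmult[symmetric]) measurable
    then have "ennreal (bridge_density p q c z) * (\<integral>\<^sup>+y. ennreal (bridge_density p q b y) * (\<integral>\<^sup>+x. ennreal (bridge_density p q a x) * u (sqrt (x\<^sup>2 + y\<^sup>2 + z\<^sup>2)) \<partial>lborel) \<partial>lborel) =
      (\<integral>\<^sup>+y. ennreal (bridge_density p q c z) * (\<integral>\<^sup>+x. ennreal (bridge_density p q b y) * (ennreal (bridge_density p q a x) * u (sqrt (x\<^sup>2 + y\<^sup>2 + z\<^sup>2))) \<partial>lborel) \<partial>lborel)"
      by (simp add: nn_integral_cmult)
    also have "\<dots> = (\<integral>\<^sup>+y. \<integral>\<^sup>+x. ennreal (bridge_density p q c z) * (ennreal (bridge_density p q b y) * (ennreal (bridge_density p q a x) * u (sqrt (x\<^sup>2 + y\<^sup>2 + z\<^sup>2)))) \<partial>lborel \<partial>lborel)"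
      by (intro nn_integral_cong nn_integral_cmult[symmetric]) measurable
    finally show "ennreal (bridge_density p q c z) * (\<integral>\<^sup>+y. ennreal (bridge_density p q b y) * (\<integral>\<^sup>+x. ennreal (bridge_density p q a x) * u (sqrt (x\<^sup>2 + y\<^sup>2 + z\<^sup>2)) \<partial>lborel) \<partial>lborel) = \<dots>" .
  qed
  also have "\<dots> = (\<integral>\<^sup>+z. \<integral>\<^sup>+y. \<integral>\<^sup>+x. ennreal C * (ennreal (heat (q - p) (x - a) * heat (q - p) (y - b) * heat (q - p) (z - c)) *
      (\<lambda>r. ennreal (heat3 (1 - q) r) * u r) (sqrt (x\<^sup>2 + y\<^sup>2 + z\<^sup>2))) \<partial>lborel \<partial>lborel \<partial>lborel)"
    unfolding split ..
  also have "\<dots> = ennreal C * (\<integral>\<^sup>+z. \<integral>\<^sup>+y. \<integral>\<^sup>+x. ennreal (heat (q - p) (x - a) * heat (q - p) (y - b) * heat (q - p) (z - c)) *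
      (\<lambda>r. ennreal (heat3 (1 - q) r) * u r) (sqrt (x\<^sup>2 + y\<^sup>2 + z\<^sup>2)) \<partial>lborel \<partial>lborel \<partial>lborel)"
    by (subst nn_integral_cmult[symmetric]; (subst nn_integral_cmult[symmetric])?; (subst nn_integral_cmult[symmetric])?; (intro nn_integral_cong)?; measurable)
  also have "(\<integral>\<^sup>+z. \<integral>\<^sup>+y. \<integral>\<^sup>+x. ennreal (heat (q - p) (x - a) * heat (q - p) (y - b) * heat (q - p) (z - c)) *
      (\<lambda>r. ennreal (heat3 (1 - q) r) * u r) (sqrt (x\<^sup>2 + y\<^sup>2 + z\<^sup>2)) \<partial>lborel \<partial>lborel \<partial>lborel) =
    (\<integral>\<^sup>+r. radial_kernel (q - p) (sqrt (a\<^sup>2 + b\<^sup>2 + c\<^sup>2)) r * (ennreal (heat3 (1 - q) r) * u r) \<partial>lborel)"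
    using pq by (intro nn_integral_radial) auto
  finally show ?thesis unfolding C_def .
qed

definition radius :: "(nat \<Rightarrow> real \<Rightarrow> real) \<Rightarrow> real \<Rightarrow> real" where
  "radius b x = L2_set (\<lambda>i. b i x) {..<3}"

lemma radius_eq: "radius b x = sqrt ((b 0 x)\<^sup>2 + (b 1 x)\<^sup>2 + (b 2 x)\<^sup>2)"
  by (simp add: radius_def L2_set_def eval_nat_numeral)

section \<open>The radius of three independent bridges\<close>

context brownian_bridge
begin

abbreviation W3 :: "(nat \<Rightarrow> real \<Rightarrow> real) measure" where
  "W3 \<equiv> Pi\<^sub>M {..<3} (\<lambda>_. W)"

lemma measurable_coordinate: "i < 3 \<Longrightarrow> x \<in> {0..1} \<Longrightarrow> (\<lambda>b. b i x) \<in> borel_measurable W3"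
  using measurable_compose[OF measurable_component_singleton[of i "{..<3}" "\<lambda>_. W"] measurable_eval[of x]] by simp

lemma measurable_coordinate_compose:
  "f \<in> measurable M W3 \<Longrightarrow> i < 3 \<Longrightarrow> x \<in> {0..1} \<Longrightarrow> (\<lambda>\<omega>. f \<omega> i x) \<in> borel_measurable M"
  using measurable_compose[OF _ measurable_coordinate] .

lemma measurable_radius: "x \<in> {0..1} \<Longrightarrow> (\<lambda>b. radius b x) \<in> borel_measurable W3"
proof -
  assume x: "x \<in> {0..1}"
  note [measurable] = measurable_coordinate[of 0, OF _ x] measurable_coordinate[of 1, OF _ x] measurable_coordinate[of 2, OF _ x]
  show ?thesis unfolding radius_eq by measurable
qed

text \<open>The Markov property of one coordinate, the others being held fixed by Fubini.
  \<open>P\<close> sees only the past of all coordinates, while \<open>K\<close> may see the future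
  of the others but not coordinate \<open>j\<close>.\<close>

lemma resample_coordinate:
  assumes pq: "0 \<le> p" "p < q" "q < 1" and j: "j < 3"
    and P: "P \<in> borel_measurable W3"
    and past: "\<And>b b'. (\<And>i x. i < 3 \<Longrightarrow> 0 \<le> x \<Longrightarrow> x \<le> p \<Longrightarrow> b i x = b' i x) \<Longrightarrow> P b = P b'"
    and K: "(\<lambda>(b, y). K b y) \<in> borel_measurable (W3 \<Otimes>\<^sub>M borel)" and K_upd: "\<And>b w y. K (b(j := w)) y = K b y"
  shows "(\<integral>\<^sup>+b. P b * K b (b j q) \<partial>W3) = (\<integral>\<^sup>+b. P b * (\<integral>\<^sup>+y. ennreal (bridge_density p q (b j p) y) * K b y \<partial>lborel) \<partial>W3)"
proof -
  interpret product_sigma_finite "\<lambda>_::nat. W" by unfold_locales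
  let ?I = "{..<3} - {j}"
  have bm: "(\<lambda>y. ennreal (bridge_density p q c y)) \<in> borel_measurable borel" for c by measurable
  have ins: "insert j ?I = {..<3}" using j by auto
  have ev [measurable]: "(\<lambda>b. b j p) \<in> borel_measurable W3" "(\<lambda>b. b j q) \<in> borel_measurable W3"
    using pq j by (auto intro!: measurable_coordinate)
  note [measurable] = P K
  have br: "bridge 0 1 0 0 w x = w x" for w x by (simp add: bridge_def)
  have m1: "(\<lambda>b. P b * K b (b j q)) \<in> borel_measurable W3"
    using measurable_Pair_compose_split[OF K measurable_ident_sets[OF refl] ev(2)] P by (auto intro!: borel_measurable_times_ennreal)
  have m2: "(\<lambda>b. P b * (\<integral>\<^sup>+y. ennreal (bridge_density p q (b j p) y) * K b y \<partial>lborel)) \<in> borel_measurable W3"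
    by measurable
  have "(\<integral>\<^sup>+b. P b * K b (b j q) \<partial>W3) = (\<integral>\<^sup>+b. \<integral>\<^sup>+w. P (b(j := w)) * K b (w q) \<partial>W \<partial>Pi\<^sub>M ?I (\<lambda>_. W))"
    using product_nn_integral_insert[of ?I j "\<lambda>b. P b * K b (b j q)", unfolded ins, OF _ _ m1] by (simp add: K_upd)
  also have "\<dots> = (\<integral>\<^sup>+b. \<integral>\<^sup>+w. P (b(j := w)) * (\<integral>\<^sup>+y. ennreal (bridge_density p q (w p) y) * K b y \<partial>lborel) \<partial>W \<partial>Pi\<^sub>M ?I (\<lambda>_. W))"
  proof (rule nn_integral_cong)
    fix b assume b: "b \<in> space (Pi\<^sub>M ?I (\<lambda>_. W))"
    have upd: "(\<lambda>w. b(j := w)) \<in> measurable W W3"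
      using measurable_component_update[OF b, of j] unfolding ins by simp
    obtain w0 where "w0 \<in> space W" using not_empty by auto
    then have "b(j := w0) \<in> space W3" using measurable_space[OF upd] by blast
    from measurable_Pair2[OF K this] have Kb [measurable]: "K b \<in> borel_measurable borel" by (simp add: K_upd)
    have "(\<lambda>(w, z). P (b(j := w)) * K b z) \<in> borel_measurable (W \<Otimes>\<^sub>M borel)"
      using measurable_compose[OF upd P] by measurable
    then have \<Phi>: "(\<lambda>(w, z). P (b(j := w)) * K b z) \<in> borel_measurable (path_borel \<Otimes>\<^sub>M borel)"
      by (simp add: measurable_cong_sets[OF sets_pair_measure_cong[OF sets_W refl] refl])
    have "(\<integral>\<^sup>+w. P (b(j := w)) * K b (bridge 0 1 0 0 w q) \<partial>W) =
      (\<integral>\<^sup>+w. \<integral>\<^sup>+y. ennreal (heat (q - p) (y - bridge 0 1 0 0 w p) * heat (1 - q) (0 - y) /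
        heat (1 - p) (0 - bridge 0 1 0 0 w p)) * (P (b(j := w)) * K b y) \<partial>lborel \<partial>W)"
    proof (rule nn_integral_bridge_step[OF pq \<Phi>])
      fix w w' :: "real \<Rightarrow> real" and z
      assume eq: "\<And>x. 0 \<le> x \<Longrightarrow> x \<le> (p - 0) / (1 - 0) \<Longrightarrow> w x = w' x"
      have "P (b(j := w)) = P (b(j := w'))" by (rule past) (use eq in auto)
      then show "P (b(j := w)) * K b z = P (b(j := w')) * K b z" by simp
    qed
    also have "\<dots> = (\<integral>\<^sup>+w. \<integral>\<^sup>+y. P (b(j := w)) * (ennreal (bridge_density p q (w p) y) * K b y) \<partial>lborel \<partial>W)"
      by (simp add: br bridge_density_def mult.left_commute)
    also have "\<dots> = (\<integral>\<^sup>+w. P (b(j := w)) * (\<integral>\<^sup>+y. ennreal (bridge_density p q (w p) y) * K b y \<partial>lborel) \<partial>W)"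
      using bm Kb by (intro nn_integral_cong nn_integral_cmult) simp
    finally show "(\<integral>\<^sup>+w. P (b(j := w)) * K b (w q) \<partial>W) = \<dots>" unfolding br .
  qed
  also have "\<dots> = (\<integral>\<^sup>+b. P b * (\<integral>\<^sup>+y. ennreal (bridge_density p q (b j p) y) * K b y \<partial>lborel) \<partial>W3)"
    using product_nn_integral_insert[of ?I j "\<lambda>b. P b * (\<integral>\<^sup>+y. ennreal (bridge_density p q (b j p) y) * K b y \<partial>lborel)", unfolded ins, OF _ _ m2]
    by (simp add: K_upd)
  finally show ?thesis .
qed

text \<open>The coordinates are resampled one after another, until the radius at time q depends only
  on three integration variables; spherical integration turns these into one radial step.\<close>

lemma bessel_step:
  assumes pq: "0 \<le> p" "p < q" "q < 1" and P: "P \<in> borel_measurable W3"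
    and past: "\<And>b b'. (\<And>i x. i < 3 \<Longrightarrow> 0 \<le> x \<Longrightarrow> x \<le> p \<Longrightarrow> b i x = b' i x) \<Longrightarrow> P b = P b'"
    and u [measurable]: "u \<in> borel_measurable borel"
  shows "(\<integral>\<^sup>+b. P b * u (radius b q) \<partial>W3) =
    (\<integral>\<^sup>+b. P b * (ennreal (1 / heat3 (1 - p) (radius b p)) *
      (\<integral>\<^sup>+r. radial_kernel (q - p) (radius b p) r * (ennreal (heat3 (1 - q) r) * u r) \<partial>lborel)) \<partial>W3)"
proof -
  have pq01: "p \<in> {0..1}" "q \<in> {0..1}" using pq by auto
  have lt3: "0 < (3::nat)" "1 < (3::nat)" "2 < (3::nat)" by auto
  note m = measurable_coordinate_compose[OF measurable_fst[of W3 borel]]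
  note m1 [measurable] = m[OF lt3(2) pq01(2)] m[OF lt3(3) pq01(2)]
  let ?d = "\<lambda>x y. ennreal (bridge_density p q x y)"
  have K1: "(\<lambda>(b, x). (\<lambda>b x. u (sqrt (x\<^sup>2 + (b 1 q)\<^sup>2 + (b 2 q)\<^sup>2))) b x) \<in> borel_measurable (W3 \<Otimes>\<^sub>M borel)"
    by measurable
  have "(\<lambda>(a, c, y). \<integral>\<^sup>+x. ?d a x * u (sqrt (x\<^sup>2 + y\<^sup>2 + c\<^sup>2)) \<partial>lborel) \<in> borel_measurable (borel \<Otimes>\<^sub>M borel \<Otimes>\<^sub>M borel)"
    by measurable
  from measurable_compose[OF measurable_Pair[OF m[OF lt3(1) pq01(1)] measurable_Pair[OF m[OF lt3(3) pq01(2)] measurable_snd]] this]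
  have K2: "(\<lambda>(b, y). (\<lambda>b y. \<integral>\<^sup>+x. ?d (b 0 p) x * u (sqrt (x\<^sup>2 + y\<^sup>2 + (b 2 q)\<^sup>2)) \<partial>lborel) b y) \<in> borel_measurable (W3 \<Otimes>\<^sub>M borel)"
    by (simp add: case_prod_unfold)
  have "(\<lambda>(a, a', z). \<integral>\<^sup>+y. ?d a' y * (\<integral>\<^sup>+x. ?d a x * u (sqrt (x\<^sup>2 + y\<^sup>2 + z\<^sup>2)) \<partial>lborel) \<partial>lborel) \<in> borel_measurable (borel \<Otimes>\<^sub>M borel \<Otimes>\<^sub>M borel)"
    by measurable
  from measurable_compose[OF measurable_Pair[OF m[OF lt3(1) pq01(1)] measurable_Pair[OF m[OF lt3(2) pq01(1)] measurable_snd]] this]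
  have K3: "(\<lambda>(b, z). (\<lambda>b z. \<integral>\<^sup>+y. ?d (b 1 p) y * (\<integral>\<^sup>+x. ?d (b 0 p) x * u (sqrt (x\<^sup>2 + y\<^sup>2 + z\<^sup>2)) \<partial>lborel) \<partial>lborel) b z) \<in> borel_measurable (W3 \<Otimes>\<^sub>M borel)"
    by (simp add: case_prod_unfold)
  have r1: "(\<integral>\<^sup>+b. P b * u (sqrt ((b 0 q)\<^sup>2 + (b 1 q)\<^sup>2 + (b 2 q)\<^sup>2)) \<partial>W3) =
    (\<integral>\<^sup>+b. P b * (\<integral>\<^sup>+x. ?d (b 0 p) x * u (sqrt (x\<^sup>2 + (b 1 q)\<^sup>2 + (b 2 q)\<^sup>2)) \<partial>lborel) \<partial>W3)"
    by (rule resample_coordinate[OF pq lt3(1) P past K1]) simp_all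
  have r2: "(\<integral>\<^sup>+b. P b * (\<integral>\<^sup>+x. ?d (b 0 p) x * u (sqrt (x\<^sup>2 + (b 1 q)\<^sup>2 + (b 2 q)\<^sup>2)) \<partial>lborel) \<partial>W3) =
    (\<integral>\<^sup>+b. P b * (\<integral>\<^sup>+y. ?d (b 1 p) y * (\<integral>\<^sup>+x. ?d (b 0 p) x * u (sqrt (x\<^sup>2 + y\<^sup>2 + (b 2 q)\<^sup>2)) \<partial>lborel) \<partial>lborel) \<partial>W3)"
    by (rule resample_coordinate[OF pq lt3(2) P past K2]) simp_all
  have r3: "(\<integral>\<^sup>+b. P b * (\<integral>\<^sup>+y. ?d (b 1 p) y * (\<integral>\<^sup>+x. ?d (b 0 p) x * u (sqrt (x\<^sup>2 + y\<^sup>2 + (b 2 q)\<^sup>2)) \<partial>lborel) \<partial>lborel) \<partial>W3) =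
    (\<integral>\<^sup>+b. P b * (\<integral>\<^sup>+z. ?d (b 2 p) z * (\<integral>\<^sup>+y. ?d (b 1 p) y * (\<integral>\<^sup>+x. ?d (b 0 p) x * u (sqrt (x\<^sup>2 + y\<^sup>2 + z\<^sup>2)) \<partial>lborel) \<partial>lborel) \<partial>lborel) \<partial>W3)"
    by (rule resample_coordinate[OF pq lt3(3) P past K3]) simp_all
  show ?thesis
    unfolding radius_eq r1 r2 r3 nn_integral_bridge_density_radial[OF pq(2,3) u] ..
qed

lemma prob_space_W3: "prob_space W3"
  by (intro prob_space_PiM prob_space_axioms)

text \<open>The telescoping of \<open>bridge_fdd\<close> with \<open>heat3\<close> as terminal
  kernel. The chain starts at 0 because all three coordinates vanish almost surely at time
  0.\<close>

lemma bessel_fdd: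
  assumes \<tau>: "\<tau> 0 = 0" "\<And>i. i < k \<Longrightarrow> \<tau> i < \<tau> (Suc i)" "\<tau> k < 1"
    and g [measurable]: "\<And>i. g i \<in> borel_measurable borel" and h: "h \<in> borel_measurable borel"
  shows "(\<integral>\<^sup>+b. (\<Prod>i<k. g i (radius b (\<tau> (Suc i)))) * h (radius b (\<tau> k)) \<partial>W3) * ennreal (heat3 1 0) =
    chain (\<lambda>i \<rho> r. radial_kernel (\<tau> (Suc i) - \<tau> i) \<rho> r * g i r) lborel 0 k (\<lambda>\<rho>. ennreal (heat3 (1 - \<tau> k) \<rho>) * h \<rho>)"
  using \<tau> h
proof (induction k arbitrary: h)
  case 0
  interpret W3: prob_space W3 by (rule prob_space_W3)
  have "AE b in W3. \<forall>i\<in>{..<3}. b i 0 = 0"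
  proof (intro eventually_ball_finite ballI)
    fix i :: nat assume "i \<in> {..<3}"
    then show "AE b in W3. b i 0 = 0"
      by (intro AE_PiM_component[where P="\<lambda>w. w 0 = 0"] prob_space_axioms) (use AE_endpoints in auto)
  qed simp
  then have "AE b in W3. h (radius b 0) = h 0"
    by eventually_elim (simp add: radius_def L2_set_def)
  then have "(\<integral>\<^sup>+b. h (radius b 0) \<partial>W3) = (\<integral>\<^sup>+b. h 0 \<partial>W3)" by (rule nn_integral_cong_AE)
  then show ?case using 0 by (simp add: W3.emeasure_space_1 mult.commute)
next
  case (Suc k)
  note Suc.prems(4) [measurable] measurable_radial_kernel [measurable]
  have mono: "\<tau> i \<le> \<tau> j" if "i \<le> j" "j \<le> Suc k" for i j
    using that Suc.prems(2) by (induction j) (auto simp: le_Suc_eq less_imp_le intro: order_trans less_imp_le)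
  have in01: "0 \<le> \<tau> i" "\<tau> i < 1" if "i \<le> Suc k" for i
    using mono[of 0 i] mono[of i "Suc k"] that Suc.prems(1,3) by auto
  define P where "P b = (\<Prod>i<k. g i (radius b (\<tau> (Suc i))))" for b
  have P: "P \<in> borel_measurable W3"
    unfolding P_def[abs_def] using in01 by (intro borel_measurable_prod_ennreal measurable_compose[OF measurable_radius g]) (auto intro: less_imp_le)
  define H where "H \<rho> = ennreal (1 / heat3 (1 - \<tau> k) \<rho>) *
      (\<integral>\<^sup>+r. radial_kernel (\<tau> (Suc k) - \<tau> k) \<rho> r * (ennreal (heat3 (1 - \<tau> (Suc k)) r) * (g k r * h r)) \<partial>lborel)" for \<rho>
  have H: "H \<in> borel_measurable borel" unfolding H_def[abs_def] by measurable
  have "(\<integral>\<^sup>+b. (\<Prod>i<Suc k. g i (radius b (\<tau> (Suc i)))) * h (radius b (\<tau> (Suc k))) \<partial>W3) =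
    (\<integral>\<^sup>+b. P b * (\<lambda>r. g k r * h r) (radius b (\<tau> (Suc k))) \<partial>W3)"
    by (simp add: P_def mult.assoc)
  also have "\<dots> = (\<integral>\<^sup>+b. P b * H (radius b (\<tau> k)) \<partial>W3)"
    unfolding H_def
  proof (rule bessel_step[OF _ _ _ P])
    fix b b' :: "nat \<Rightarrow> real \<Rightarrow> real" assume eq: "\<And>i x. i < 3 \<Longrightarrow> 0 \<le> x \<Longrightarrow> x \<le> \<tau> k \<Longrightarrow> b i x = b' i x"
    have "radius b (\<tau> (Suc i)) = radius b' (\<tau> (Suc i))" if "i < k" for i
      unfolding radius_def L2_set_def using that in01[of "Suc i"] mono[of "Suc i" k]
      by (intro arg_cong[where f=sqrt] sum.cong refl) (simp add: eq)
    then show "P b = P b'" by (simp add: P_def)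
  qed (use in01[of k] Suc.prems in auto)
  also have "\<dots> * ennreal (heat3 1 0) =
    chain (\<lambda>i \<rho> r. radial_kernel (\<tau> (Suc i) - \<tau> i) \<rho> r * g i r) lborel 0 k (\<lambda>\<rho>. ennreal (heat3 (1 - \<tau> k) \<rho>) * H \<rho>)"
    unfolding P_def using Suc.prems in01[of k] by (intro Suc.IH H) auto
  also have "(\<lambda>\<rho>. ennreal (heat3 (1 - \<tau> k) \<rho>) * H \<rho>) =
    (\<lambda>\<rho>. \<integral>\<^sup>+r. (radial_kernel (\<tau> (Suc k) - \<tau> k) \<rho> r * g k r) * (ennreal (heat3 (1 - \<tau> (Suc k)) r) * h r) \<partial>lborel)"
  proof
    fix \<rho>
    have "0 < heat3 (1 - \<tau> k) \<rho>" using in01[of k] by (intro heat3_pos) auto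
    then have "ennreal (heat3 (1 - \<tau> k) \<rho>) * H \<rho> = (\<integral>\<^sup>+r. radial_kernel (\<tau> (Suc k) - \<tau> k) \<rho> r * (ennreal (heat3 (1 - \<tau> (Suc k)) r) * (g k r * h r)) \<partial>lborel)"
      by (simp add: H_def mult.assoc[symmetric] ennreal_mult[symmetric] less_imp_le)
    also have "\<dots> = (\<integral>\<^sup>+r. (radial_kernel (\<tau> (Suc k) - \<tau> k) \<rho> r * g k r) * (ennreal (heat3 (1 - \<tau> (Suc k)) r) * h r) \<partial>lborel)"
      by (simp only: mult_ac)
    finally show "ennreal (heat3 (1 - \<tau> k) \<rho>) * H \<rho> = \<dots>" .
  qed
  finally show ?case by simp
qed

text \<open>The ratios of consecutive radii in the radial kernels telescope to the last radius,
  which turns the terminal heat kernel into a hitting density. The other hitting density comes from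
  the first step, which starts at radius 0.\<close>

lemma bessel_excursion:
  assumes k: "1 \<le> k" and mono: "\<And>i. 1 \<le> i \<Longrightarrow> i < k \<Longrightarrow> \<tau> i < \<tau> (Suc i)" and \<tau>01: "0 < \<tau> 1" "\<tau> k < 1"
    and g [measurable]: "\<And>i. g i \<in> borel_measurable borel"
  shows "(\<integral>\<^sup>+b. (\<Prod>i<k. g i (radius b (\<tau> (Suc i)))) \<partial>W3) =
    (\<integral>\<^sup>+x. ennreal (excursion_density \<tau> k x) * (\<Prod>i<k. g i (x (Suc i))) \<partial>Pi\<^sub>M {1..k} (\<lambda>_. lborel))"
proof -
  note measurable_radial_kernel [measurable]
  define T where "T = \<tau>(0 := 0)"
  have T: "T 0 = 0" "T (Suc i) = \<tau> (Suc i)" "1 \<le> i \<Longrightarrow> T i = \<tau> i" for i by (auto simp: T_def)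
  have Tmono: "T i < T (Suc i)" if "i < k" for i
    using that mono[of i] \<tau>01 by (cases "i = 0") (auto simp: T_def)
  let ?M = "Pi\<^sub>M {1..k} (\<lambda>_. lborel :: real measure)"
  let ?y = "\<lambda>x::nat \<Rightarrow> real. x(0 := 0)"
  have h0: "0 < heat3 1 0" by (simp add: heat3_pos)
  have heat30: "heat3 1 0 = 1 / (2 * pi * sqrt (2 * pi))"
    using heat_eq[of 1 0] by (simp add: heat3_def power2_eq_square)
  have "(\<integral>\<^sup>+b. (\<Prod>i<k. g i (radius b (\<tau> (Suc i)))) \<partial>W3) * ennreal (heat3 1 0) =
    (\<integral>\<^sup>+b. (\<Prod>i<k. g i (radius b (T (Suc i)))) * (\<lambda>_. 1) (radius b (T k)) \<partial>W3) * ennreal (heat3 1 0)"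
    by (simp add: T(2))
  also have "\<dots> = chain (\<lambda>i \<rho> r. radial_kernel (T (Suc i) - T i) \<rho> r * g i r) lborel 0 k (\<lambda>\<rho>. ennreal (heat3 (1 - T k) \<rho>) * (\<lambda>_. 1) \<rho>)"
    using \<tau>01 T(3)[OF k] Tmono by (intro bessel_fdd T g) auto
  also have "\<dots> = (\<integral>\<^sup>+x. (\<Prod>i<k. radial_kernel (T (Suc i) - T i) (?y x i) (?y x (Suc i)) * g i (?y x (Suc i))) * (ennreal (heat3 (1 - T k) (?y x k)) * 1) \<partial>?M)"
    by (rule chain_PiM) (measurable, auto simp: sigma_finite_lborel)
  also have "\<dots> = (\<integral>\<^sup>+x. ennreal (heat3 1 0) * (ennreal (excursion_density \<tau> k x) * (\<Prod>i<k. g i (x (Suc i)))) \<partial>?M)"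
  proof (rule nn_integral_cong)
    fix x :: "nat \<Rightarrow> real"
    have "(\<Prod>i<k. radial_kernel (T (Suc i) - T i) (?y x i) (x (Suc i))) * ennreal (heat3 (1 - \<tau> k) (x k)) =
      ennreal (heat3 1 0) * ennreal (excursion_density \<tau> k x)"
    proof (cases "\<forall>i\<in>{1..k}. 0 < x i")
      case True
      have prods: "(\<Prod>i<m. radial_kernel (T (Suc i) - T i) (?y x i) (x (Suc i))) =
        ennreal (2 * x m * hitting_density (\<tau> 1) (x 1) * (\<Prod>i=1..<m. killed_density (\<tau> (Suc i) - \<tau> i) (x i) (x (Suc i))))"
        if "1 \<le> m" "m \<le> k" for m
        using that
      proof (induction m rule: nat_induct_at_least)
        case base
        have "0 < x 1" using True base by auto
        then show ?case by (simp add: radial_kernel_def T)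
      next
        case (Suc m)
        have xm: "0 < x m" "0 < x (Suc m)" "0 < x 1" using True Suc by auto
        have p: "0 \<le> hitting_density (\<tau> 1) (x 1)" "0 \<le> (\<Prod>i=1..<m. killed_density (\<tau> (Suc i) - \<tau> i) (x i) (x (Suc i)))"
          "0 < killed_density (\<tau> (Suc m) - \<tau> m) (x m) (x (Suc m))"
          using True Suc xm mono \<tau>01 by (auto intro!: prod_nonneg hitting_density_nonneg less_imp_le[OF killed_density_pos] killed_density_pos simp: less_imp_le)
        have rk: "radial_kernel (T (Suc m) - T m) (?y x m) (x (Suc m)) = ennreal (x (Suc m) / x m * killed_density (\<tau> (Suc m) - \<tau> m) (x m) (x (Suc m)))"
          using xm Suc by (simp add: radial_kernel_def T)
        have "(\<Prod>i<Suc m. radial_kernel (T (Suc i) - T i) (?y x i) (x (Suc i))) =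
          ennreal ((2 * x m * hitting_density (\<tau> 1) (x 1) * (\<Prod>i=1..<m. killed_density (\<tau> (Suc i) - \<tau> i) (x i) (x (Suc i)))) *
            (x (Suc m) / x m * killed_density (\<tau> (Suc m) - \<tau> m) (x m) (x (Suc m))))"
          unfolding prod.lessThan_Suc rk using Suc p xm by (subst ennreal_mult) auto
        also have "(2 * x m * hitting_density (\<tau> 1) (x 1) * (\<Prod>i=1..<m. killed_density (\<tau> (Suc i) - \<tau> i) (x i) (x (Suc i)))) *
            (x (Suc m) / x m * killed_density (\<tau> (Suc m) - \<tau> m) (x m) (x (Suc m))) =
          2 * x (Suc m) * hitting_density (\<tau> 1) (x 1) * (\<Prod>i=1..<Suc m. killed_density (\<tau> (Suc i) - \<tau> i) (x i) (x (Suc i)))"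
          using xm Suc by (simp add: prod.atLeastLessThan_Suc)
        finally show ?case .
      qed
      have x: "0 < x k" "0 < x 1" using True k by auto
      have e0: "0 \<le> excursion_density \<tau> k x" by (rule excursion_density_nonneg[OF mono \<tau>01 k])
      \<comment> \<open>The constant matches: \<open>heat3 1 0\<close> is 1 / (2 pi sqrt (2 pi)),
        and 2 sqrt (2 pi) times this is 1 / pi.\<close>
      have end_eq: "heat3 (1 - \<tau> k) (x k) * (2 * x k) = hitting_density (1 - \<tau> k) (x k) / pi"
      proof -
        have d: "0 < 1 - \<tau> k" using \<tau>01 by simp
        have s: "(heat (1 - \<tau> k) 0)\<^sup>2 = 1 / (2 * pi * (1 - \<tau> k))" using d by (simp add: heat_eq power_divide)
        show ?thesis unfolding heat3_def s hitting_density_heat[OF d] using d by (simp add: field_simps)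
      qed
      have "(2 * x k * hitting_density (\<tau> 1) (x 1) * (\<Prod>i=1..<k. killed_density (\<tau> (Suc i) - \<tau> i) (x i) (x (Suc i)))) * heat3 (1 - \<tau> k) (x k) =
        (heat3 (1 - \<tau> k) (x k) * (2 * x k)) * (hitting_density (\<tau> 1) (x 1) * (\<Prod>i=1..<k. killed_density (\<tau> (Suc i) - \<tau> i) (x i) (x (Suc i))))"
        by (simp only: mult_ac)
      also have "\<dots> = heat3 1 0 * excursion_density \<tau> k x"
        unfolding end_eq heat30 excursion_density_def if_P[OF True] by (simp add: field_simps)
      finally have e: "(2 * x k * hitting_density (\<tau> 1) (x 1) * (\<Prod>i=1..<k. killed_density (\<tau> (Suc i) - \<tau> i) (x i) (x (Suc i)))) * heat3 (1 - \<tau> k) (x k) = heat3 1 0 * excursion_density \<tau> k x" .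
      have "0 \<le> heat3 (1 - \<tau> k) (x k)" using \<tau>01 by (simp add: less_imp_le heat3_pos)
      then show ?thesis unfolding prods[OF k order_refl]
        using e0 h0 by (simp only: ennreal_mult''[symmetric] e less_imp_le)
    next
      case False
      then obtain i where i: "i \<in> {1..k}" "x i \<le> 0" by (auto simp: not_less)
      then have "radial_kernel (T (Suc (i - 1)) - T (i - 1)) (?y x (i - 1)) (x (Suc (i - 1))) = 0"
        by (simp add: radial_kernel_def)
      then have "(\<Prod>i<k. radial_kernel (T (Suc i) - T i) (?y x i) (x (Suc i))) = 0"
        using i by (intro prod_zero bexI[of _ "i - 1"]) auto
      then show ?thesis unfolding excursion_density_def if_not_P[OF False] by simp
    qed
    note 0 = this
    have y: "?y x (Suc i) = x (Suc i)" for i by simp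
    have yk: "?y x k = x k" using k by simp
    show "(\<Prod>i<k. radial_kernel (T (Suc i) - T i) (?y x i) (?y x (Suc i)) * g i (?y x (Suc i))) * (ennreal (heat3 (1 - T k) (?y x k)) * 1) =
      ennreal (heat3 1 0) * (ennreal (excursion_density \<tau> k x) * (\<Prod>i<k. g i (x (Suc i))))"
      unfolding y yk T(3)[OF k] prod.distrib mult.assoc[symmetric] 0[symmetric] by (simp only: mult_ac mult_1_right mult_1_left)
  qed
  also have "\<dots> = ennreal (heat3 1 0) * (\<integral>\<^sup>+x. ennreal (excursion_density \<tau> k x) * (\<Prod>i<k. g i (x (Suc i))) \<partial>?M)"
  proof (rule nn_integral_cmult)
    have "(\<lambda>x. \<Prod>i<k. g i (x (Suc i))) \<in> borel_measurable ?M"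
      by (intro borel_measurable_prod_ennreal measurable_compose[OF measurable_PiM_coordinate g]) auto
    then show "(\<lambda>x. ennreal (excursion_density \<tau> k x) * (\<Prod>i<k. g i (x (Suc i)))) \<in> borel_measurable ?M"
      using measurable_compose[OF measurable_excursion_density[OF k, of \<tau>] measurable_ennreal] by (intro borel_measurable_times_ennreal)
  qed
  finally show ?thesis using h0 by (simp add: mult.commute[of _ "ennreal (heat3 1 0)"] ennreal_mult_cancel_left)
qed

end

section \<open>Identification of the limit\<close>

text \<open>The continuous marks are replaced by indicators one coordinate at a time.\<close>

lemma marks_determine_boxes:
  fixes t :: "nat \<Rightarrow> real"
  assumes M: "prob_space M" "sets M = sets path_borel" and N: "prob_space N" "sets N = sets path_borel"
    and t: "\<And>i. i < k \<Longrightarrow> t i \<in> {0..1}"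
    and eq: "\<And>g :: nat \<Rightarrow> real \<Rightarrow> real. (\<And>i. continuous_on UNIV (g i)) \<Longrightarrow> (\<And>i x. 0 \<le> g i x \<and> g i x \<le> 1) \<Longrightarrow>
      (\<integral>\<^sup>+w. (\<Prod>i<k. ennreal (g i (w (t i)))) \<partial>M) = (\<integral>\<^sup>+w. (\<Prod>i<k. ennreal (g i (w (t i)))) \<partial>N)"
    and B: "\<And>i. i < k \<Longrightarrow> B i \<in> sets borel"
  shows "(\<integral>\<^sup>+w. (\<Prod>i<k. indicator (B i) (w (t i))) \<partial>M) = (\<integral>\<^sup>+w. (\<Prod>i<k. indicator (B i) (w (t i))) \<partial>N)"
proof -
  have ev: "(\<lambda>w. w (t i)) \<in> borel_measurable L" if "i < k" "sets L = sets path_borel" for i and L :: "(real \<Rightarrow> real) measure"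
    unfolding measurable_cong_sets[OF that(2) refl] by (rule measurable_path_eval[OF t[OF that(1)]])
  have "(\<integral>\<^sup>+w. (\<Prod>i<k. if i < m then indicator (B i) (w (t i)) else ennreal (g i (w (t i)))) \<partial>M) =
    (\<integral>\<^sup>+w. (\<Prod>i<k. if i < m then indicator (B i) (w (t i)) else ennreal (g i (w (t i)))) \<partial>N)"
    if "m \<le> k" "\<And>i. continuous_on UNIV (g i)" "\<And>i x. 0 \<le> g i x \<and> g i x \<le> 1" for m and g :: "nat \<Rightarrow> real \<Rightarrow> real"
    using that
  proof (induction m arbitrary: g)
    case 0
    then show ?case using eq by simp
  next
    case (Suc m)
    then have m: "m < k" by simp
    have gm: "g i \<in> borel_measurable borel" for i using Suc.prems(2) by (rule borel_measurable_continuous_onI)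
    define F where "F w = (\<Prod>i\<in>{..<k} - {m}. if i < m then indicator (B i) (w (t i)) else ennreal (g i (w (t i))))" for w
    have F1: "F w \<le> 1" for w
      unfolding F_def using Suc.prems(3) by (intro prod_le_1) (auto simp: indicator_def)
    have split: "(\<Prod>i<k. f i w) = F w * f m w" if "\<And>i. i \<noteq> m \<Longrightarrow> f i w = (if i < m then indicator (B i) (w (t i)) else ennreal (g i (w (t i))))" for f :: "nat \<Rightarrow> (real \<Rightarrow> real) \<Rightarrow> ennreal" and w
    proof -
      have "(\<Prod>i<k. f i w) = f m w * (\<Prod>i\<in>{..<k} - {m}. f i w)" using m by (intro prod.remove) auto
      also have "(\<Prod>i\<in>{..<k} - {m}. f i w) = F w" unfolding F_def using that by (intro prod.cong) auto
      finally show ?thesis by (simp add: mult.commute)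
    qed
    have Fm: "F \<in> borel_measurable L" if "sets L = sets path_borel" for L
      unfolding F_def[abs_def]
      using ev[OF _ that] B measurable_compose[OF ev[OF _ that] gm]
      by (intro borel_measurable_prod_ennreal) (auto intro!: measurable_compose[OF ev[OF _ that] borel_measurable_indicator])
    \<comment> \<open>With the other factors as density only the law of \<open>w (t m)\<close> is
      left, so comparing half lines suffices.\<close>
    let ?D = "\<lambda>L. distr (density L F) borel (\<lambda>w. w (t m))"
    have evD: "(\<lambda>w. w (t m)) \<in> measurable (density L F) borel" if "sets L = sets path_borel" for L
      using ev[OF m, of "density L F"] that by simp
    have D: "emeasure (?D L) A = (\<integral>\<^sup>+w. F w * indicator A (w (t m)) \<partial>L)"
      if L: "sets L = sets path_borel" and A: "A \<in> sets borel" for L A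
    proof -
      have "emeasure (?D L) A = emeasure (density L F) ((\<lambda>w. w (t m)) -` A \<inter> space L)"
        using emeasure_distr[OF evD[OF L] A] by simp
      also have "\<dots> = (\<integral>\<^sup>+w. F w * indicator ((\<lambda>w. w (t m)) -` A \<inter> space L) w \<partial>L)"
        using measurable_sets[OF ev[OF m L] A] by (intro emeasure_density Fm L) auto
      also have "\<dots> = (\<integral>\<^sup>+w. F w * indicator A (w (t m)) \<partial>L)"
        by (intro nn_integral_cong) (auto simp: indicator_def)
      finally show ?thesis .
    qed
    \<comment> \<open>Continuous ramps that decrease to the indicator of
      \<open>{..s}\<close>.\<close>
    have lim: "(\<lambda>n. \<integral>\<^sup>+w. F w * ennreal (max 0 (min 1 (1 - real n * (w (t m) - s)))) \<partial>L) \<longlonglongrightarrow> emeasure (?D L) {..s}"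
      if L: "sets L = sets path_borel" "prob_space L" for L s
    proof -
      interpret L: prob_space L by fact
      have gs: "(\<lambda>x. max 0 (min 1 (1 - real n * (x - s)))) \<in> borel_measurable borel" for n by measurable
      show ?thesis unfolding D[OF L(1) atMost_borel]
      proof (rule nn_integral_dominated_convergence[where w="\<lambda>_. 1"])
        show "(\<lambda>w. F w * ennreal (max 0 (min 1 (1 - real n * (w (t m) - s))))) \<in> borel_measurable L" for n
          using Fm[OF L(1)] measurable_compose[OF measurable_compose[OF ev[OF m L(1)] gs] measurable_ennreal]
          by (intro borel_measurable_times_ennreal)
        show "(\<lambda>w. F w * indicator {..s} (w (t m))) \<in> borel_measurable L"
          using Fm[OF L(1)] by (intro borel_measurable_times_ennreal measurable_compose[OF ev[OF m L(1)] borel_measurable_indicator]) auto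
        show "AE w in L. F w * ennreal (max 0 (min 1 (1 - real n * (w (t m) - s)))) \<le> 1" for n
        proof (rule AE_I2)
          fix w
          have "ennreal (max 0 (min 1 (1 - real n * (w (t m) - s)))) \<le> 1" by simp
          then show "F w * ennreal (max 0 (min 1 (1 - real n * (w (t m) - s)))) \<le> 1"
            using mult_mono[OF F1[of w], of _ 1] by simp
        qed
        show "AE w in L. (\<lambda>n. F w * ennreal (max 0 (min 1 (1 - real n * (w (t m) - s))))) \<longlonglongrightarrow> F w * indicator {..s} (w (t m))"
        proof (rule AE_I2)
          fix w
          have "\<forall>\<^sub>F n in sequentially. max 0 (min 1 (1 - real n * (w (t m) - s))) = indicator {..s} (w (t m))"
          proof (cases "w (t m) \<le> s")
            case True
            then have "real n * (w (t m) - s) \<le> 0" for n by (simp add: mult_nonneg_nonpos)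
            then show ?thesis using True by (intro always_eventually) (simp add: min_def)
          next
            case False
            then obtain n0 where n0: "1 < real n0 * (w (t m) - s)" using reals_Archimedean3[of "w (t m) - s"] by auto
            show ?thesis using eventually_ge_at_top[of n0]
            proof eventually_elim
              case (elim n)
              then have "real n0 * (w (t m) - s) \<le> real n * (w (t m) - s)" using False by (intro mult_right_mono) auto
              then have "1 - real n * (w (t m) - s) \<le> 0" using n0 by linarith
              then show ?case using False by (simp add: max_def)
            qed
          qed
          then have "\<forall>\<^sub>F n in sequentially. F w * ennreal (max 0 (min 1 (1 - real n * (w (t m) - s)))) = F w * indicator {..s} (w (t m))"
            by eventually_elim (simp add: ennreal_indicator)
          then show "(\<lambda>n. F w * ennreal (max 0 (min 1 (1 - real n * (w (t m) - s))))) \<longlonglongrightarrow> F w * indicator {..s} (w (t m))"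
            by (rule tendsto_eventually)
        qed
      qed (simp_all add: L.emeasure_space_1)
    qed
    have "?D M = ?D N"
    proof (rule measure_eqI_atMost)
      fix s :: real
      have "(\<integral>\<^sup>+w. F w * ennreal (max 0 (min 1 (1 - real n * (w (t m) - s)))) \<partial>M) = (\<integral>\<^sup>+w. F w * ennreal (max 0 (min 1 (1 - real n * (w (t m) - s)))) \<partial>N)" for n
      proof -
        define g' where "g' = g(m := \<lambda>x. max 0 (min 1 (1 - real n * (x - s))))"
        have "continuous_on UNIV (\<lambda>x. max 0 (min 1 (1 - real n * (x - s))))" by (intro continuous_intros)
        then have c: "continuous_on UNIV (g' i)" for i using Suc.prems(2) by (simp add: g'_def)
        have b: "0 \<le> g' i x \<and> g' i x \<le> 1" for i x using Suc.prems(3) by (simp add: g'_def)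
        have "(\<Prod>i<k. if i < m then indicator (B i) (w (t i)) else ennreal (g' i (w (t i)))) = F w * ennreal (max 0 (min 1 (1 - real n * (w (t m) - s))))" for w
          using split[where f="\<lambda>i w. if i < m then indicator (B i) (w (t i)) else ennreal (g' i (w (t i)))" and w=w] by (simp add: g'_def)
        note p = this
        have "(\<integral>\<^sup>+w. (\<Prod>i<k. if i < m then indicator (B i) (w (t i)) else ennreal (g' i (w (t i)))) \<partial>M) =
          (\<integral>\<^sup>+w. (\<Prod>i<k. if i < m then indicator (B i) (w (t i)) else ennreal (g' i (w (t i)))) \<partial>N)"
          by (rule Suc.IH[OF less_imp_le[OF m] c b])
        then show ?thesis unfolding p .
      qed
      from LIMSEQ_unique[OF lim[OF M(2,1), of s, unfolded this] lim[OF N(2,1), of s]]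
      show "emeasure (?D M) {..s} = emeasure (?D N) {..s}" .
      have "emeasure (?D M) {..s} \<le> (\<integral>\<^sup>+w. 1 \<partial>M)"
        unfolding D[OF M(2) atMost_borel] using F1 by (intro nn_integral_mono) (auto simp: indicator_def)
      then show "emeasure (?D M) {..s} \<noteq> \<infinity>"
        using prob_space.emeasure_space_1[OF M(1)] by (auto simp: top_unique)
    qed simp_all
    then have "emeasure (?D M) (B m) = emeasure (?D N) (B m)" by simp
    then have e: "(\<integral>\<^sup>+w. F w * indicator (B m) (w (t m)) \<partial>M) = (\<integral>\<^sup>+w. F w * indicator (B m) (w (t m)) \<partial>N)"
      using D[OF M(2) B[OF m]] D[OF N(2) B[OF m]] by simp
    have "(\<Prod>i<k. if i < Suc m then indicator (B i) (w (t i)) else ennreal (g i (w (t i)))) = F w * indicator (B m) (w (t m))" for w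
      using split[where f="\<lambda>i w. if i < Suc m then indicator (B i) (w (t i)) else ennreal (g i (w (t i)))" and w=w] by (simp add: less_Suc_eq)
    then show ?case using e by simp
  qed
  \<comment> \<open>At m = k all continuous marks have been replaced, so any admissible
    \<open>g\<close> serves.\<close>
  from this[of k "\<lambda>_ _. 0"] show ?thesis by simp
qed

lemma ball_atLeast1AtMost: "(\<forall>i\<in>{1..n}. Q i) \<longleftrightarrow> (\<forall>i<n. Q (Suc i))"
proof
  assume "\<forall>i<n. Q (Suc i)"
  then show "\<forall>i\<in>{1..n}. Q i"
    by (metis Suc_le_eq atLeastAtMost_iff less_eq_Suc_le not0_implies_Suc not_one_le_zero)
qed auto

lemma indicator_ball: "(\<Prod>i<n. indicator (A i) (x i) :: ennreal) = (if \<forall>i<n. x i \<in> A i then 1 else 0)" for n :: nat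
  by (auto intro!: prod.neutral prod_zero simp: indicator_def)

section \<open>Comparison of the laws on the path space\<close>

context brownian_bridge
begin

abbreviation bessel3 :: "(real \<Rightarrow> real) measure" where
  "bessel3 \<equiv> bessel_bridge_law W 3"

lemma bessel3_eq: "bessel3 = distr W3 path_borel (\<lambda>b. \<lambda>x\<in>{0..1}. radius b x)"
  by (simp add: bessel_bridge_law_def radius_def)

lemma measurable_radius_path: "(\<lambda>b. \<lambda>x\<in>{0..1}. radius b x) \<in> measurable W3 path_borel"
proof (rule measurable_path_borel)
  fix b assume b: "b \<in> space W3"
  then have "b i \<in> space path_borel" if "i < 3" for i using that by (auto simp: space_PiM space_W)
  then have "continuous_on {0..1} (b i)" if "i < 3" for i using that by (intro path_borel_continuous) auto
  then have "continuous_on {0..1} (\<lambda>x. radius b x)"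
    unfolding radius_eq by (intro continuous_intros) auto
  then have "continuous_on {0..1} (\<lambda>x\<in>{0..1}. radius b x)" by (rule continuous_on_cong[THEN iffD1, rotated 2]) auto
  then show "(\<lambda>x\<in>{0..1}. radius b x) \<in> space path_borel" by (simp add: space_path_borel)
next
  fix x :: real assume "0 < x" "x < 1"
  then show "(\<lambda>b. (\<lambda>x\<in>{0..1}. radius b x) x) \<in> borel_measurable W3" using measurable_radius[of x] by simp
qed

lemma prob_space_bessel3: "prob_space bessel3"
  unfolding bessel3_eq by (rule prob_space.prob_space_distr[OF prob_space_W3 measurable_radius_path])

lemma sets_bessel3: "sets bessel3 = sets path_borel"
  by (simp add: bessel3_eq)

lemma bessel3_excursion:
  assumes k: "1 \<le> k" and mono: "\<And>i. 1 \<le> i \<Longrightarrow> i < k \<Longrightarrow> \<tau> i < \<tau> (Suc i)" and \<tau>01: "0 < \<tau> 1" "\<tau> k < 1"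
    and \<tau>: "\<And>i. i < k \<Longrightarrow> \<tau> (Suc i) \<in> {0..1}"
    and g: "\<And>i. i < k \<Longrightarrow> g i \<in> borel_measurable borel"
  shows "(\<integral>\<^sup>+w. (\<Prod>i<k. g i (w (\<tau> (Suc i)))) \<partial>bessel3) =
    (\<integral>\<^sup>+x. ennreal (excursion_density \<tau> k x) * (\<Prod>i<k. g i (x (Suc i))) \<partial>Pi\<^sub>M {1..k} (\<lambda>_. lborel))"
proof -
  \<comment> \<open>\<open>bessel_excursion\<close> asks for all marks to be measurable, so those
    beyond the range are set to 0.\<close>
  define g' where "g' i = (if i < k then g i else (\<lambda>_. 0))" for i
  have g': "g' i \<in> borel_measurable borel" for i using g by (simp add: g'_def)
  have "(\<lambda>w. \<Prod>i<k. g i (w (\<tau> (Suc i)))) \<in> borel_measurable path_borel"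
    by (intro borel_measurable_prod_ennreal measurable_compose[OF measurable_path_eval g] \<tau>) auto
  then have "(\<integral>\<^sup>+w. (\<Prod>i<k. g i (w (\<tau> (Suc i)))) \<partial>bessel3) = (\<integral>\<^sup>+b. (\<Prod>i<k. g i ((\<lambda>x\<in>{0..1}. radius b x) (\<tau> (Suc i)))) \<partial>W3)"
    unfolding bessel3_eq by (intro nn_integral_distr[OF measurable_radius_path]) simp
  also have "\<dots> = (\<integral>\<^sup>+b. (\<Prod>i<k. g' i (radius b (\<tau> (Suc i)))) \<partial>W3)"
    using \<tau> by (intro nn_integral_cong prod.cong) (auto simp: g'_def)
  also have "\<dots> = (\<integral>\<^sup>+x. ennreal (excursion_density \<tau> k x) * (\<Prod>i<k. g' i (x (Suc i))) \<partial>Pi\<^sub>M {1..k} (\<lambda>_. lborel))"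
    by (rule bessel_excursion[OF k mono \<tau>01 g'])
  also have "\<dots> = (\<integral>\<^sup>+x. ennreal (excursion_density \<tau> k x) * (\<Prod>i<k. g i (x (Suc i))) \<partial>Pi\<^sub>M {1..k} (\<lambda>_. lborel))"
    by (intro nn_integral_cong arg_cong2[where f="(*)"] prod.cong refl) (simp add: g'_def)
  finally show ?thesis .
qed

lemma increasing_times:
  fixes \<tau> :: "nat \<Rightarrow> real"
  assumes mono: "\<And>i. 1 \<le> i \<Longrightarrow> i < k \<Longrightarrow> \<tau> i < \<tau> (Suc i)" and \<tau>01: "0 < \<tau> 1" "\<tau> k < 1" and i: "i < k"
  shows "0 < \<tau> (Suc i)" "\<tau> (Suc i) < 1"
proof -
  have "\<tau> i \<le> \<tau> j" if "1 \<le> i" "i \<le> j" "j \<le> k" for i j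
    using that(2,3,1)
  proof (induction j rule: dec_induct)
    case (step j)
    then show ?case using mono[of j] by auto
  qed simp
  from this[of 1 "Suc i"] this[of "Suc i" k] show "0 < \<tau> (Suc i)" "\<tau> (Suc i) < 1" using \<tau>01 i by auto
qed

text \<open>With all marks equal to 1 the Bessel side is the total mass of a probability measure, so
  no integral of the density has to be evaluated.\<close>

lemma excursion_density_mass:
  assumes k: "1 \<le> k" and mono: "\<And>i. 1 \<le> i \<Longrightarrow> i < k \<Longrightarrow> \<tau> i < \<tau> (Suc i)" and \<tau>01: "0 < \<tau> 1" "\<tau> k < 1"
  shows "(\<integral>\<^sup>+x. ennreal (excursion_density \<tau> k x) \<partial>Pi\<^sub>M {1..k} (\<lambda>_. lborel)) = 1"
proof -
  interpret B: prob_space bessel3 by (rule prob_space_bessel3)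
  have "(\<integral>\<^sup>+w. (\<Prod>i<k. (\<lambda>_. 1) (w (\<tau> (Suc i)))) \<partial>bessel3) =
    (\<integral>\<^sup>+x. ennreal (excursion_density \<tau> k x) * (\<Prod>i<k. (\<lambda>_. 1) (x (Suc i))) \<partial>Pi\<^sub>M {1..k} (\<lambda>_. lborel))"
    using increasing_times[of k \<tau>] mono \<tau>01 by (intro bessel3_excursion[OF k]) (auto intro: less_imp_le)
  then show ?thesis by (simp add: B.emeasure_space_1)
qed

lemma normalised_excursion_law_bessel3: "normalised_excursion_law bessel3"
  unfolding normalised_excursion_law_def
proof (intro conjI allI impI prob_space_bessel3 sets_bessel3)
  fix n :: nat and t :: "nat \<Rightarrow> real"
  assume A: "1 \<le> n \<and> strict_mono_on {1..n} t \<and> 0 < t 1 \<and> t n < 1"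
  then have n: "1 \<le> n" and t01: "0 < t 1" "t n < 1" by auto
  have mono: "t i < t (Suc i)" if "1 \<le> i" "i < n" for i
    using A that by (auto intro!: strict_mono_onD[of "{1..n}" t])
  have t: "0 < t (Suc i)" "t (Suc i) < 1" if "i < n" for i
    using increasing_times[of n t i] mono t01 that by auto
  have tin: "t (Suc i) \<in> {0..1}" if "i < n" for i using t[OF that] by simp
  let ?N = "Pi\<^sub>M {1..n} (\<lambda>_. lborel :: real measure)"
  let ?X = "\<lambda>w. \<lambda>i\<in>{1..n}. w (t i) :: real"
  let ?f = "\<lambda>x. ennreal (excursion_density t n x)"
  have tin': "\<forall>i\<in>{1..n}. t i \<in> {0..1}" unfolding ball_atLeast1AtMost using tin by auto
  have X: "?X \<in> measurable bessel3 ?N"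
  proof (rule measurable_restrict)
    fix i assume "i \<in> {1..n}"
    then have "(\<lambda>w. w (t i)) \<in> borel_measurable path_borel" using tin' by (intro measurable_path_eval) auto
    then show "(\<lambda>w. w (t i)) \<in> measurable bessel3 lborel" unfolding measurable_cong_sets[OF sets_bessel3 sets_lborel] .
  qed
  have f: "?f \<in> borel_measurable ?N"
    by (rule measurable_compose[OF measurable_excursion_density[OF n] measurable_ennreal])
  have "distr bessel3 ?N ?X = density ?N ?f"
  proof (rule measure_eqI_PiM_finite)
    fix A assume "\<And>i. i \<in> {1..n} \<Longrightarrow> A i \<in> sets (lborel :: real measure)"
    then have As: "A i \<in> sets borel" if "i \<in> {1..n}" for i using that by simp
    have PiE: "Pi\<^sub>E {1..n} A \<in> sets ?N" using As by (intro sets_PiM_I_finite) auto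
    have ind: "indicator (Pi\<^sub>E {1..n} A) x = (\<Prod>i<n. indicator (A (Suc i)) (x (Suc i)) :: ennreal)" if "x \<in> extensional {1..n}" for x
      using that ball_atLeast1AtMost[of n "\<lambda>i. x i \<in> A i"] unfolding indicator_ball by (simp add: indicator_def PiE_iff del: One_nat_def)
    have "emeasure (distr bessel3 ?N ?X) (Pi\<^sub>E {1..n} A) = (\<integral>\<^sup>+x. indicator (Pi\<^sub>E {1..n} A) x \<partial>distr bessel3 ?N ?X)"
      using PiE by simp
    also have "\<dots> = (\<integral>\<^sup>+w. indicator (Pi\<^sub>E {1..n} A) (?X w) \<partial>bessel3)"
      using PiE by (intro nn_integral_distr[OF X] borel_measurable_indicator) simp
    also have "\<dots> = (\<integral>\<^sup>+w. (\<Prod>i<n. indicator (A (Suc i)) (w (t (Suc i)))) \<partial>bessel3)"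
      by (subst ind) (auto intro!: nn_integral_cong prod.cong)
    also have "\<dots> = (\<integral>\<^sup>+x. ?f x * (\<Prod>i<n. indicator (A (Suc i)) (x (Suc i))) \<partial>?N)"
      using As by (intro bessel3_excursion[OF n mono t01 tin] borel_measurable_indicator) auto
    also have "\<dots> = (\<integral>\<^sup>+x. ?f x * indicator (Pi\<^sub>E {1..n} A) x \<partial>?N)"
      by (intro nn_integral_cong) (simp add: ind space_PiM PiE_iff del: One_nat_def)
    also have "\<dots> = emeasure (density ?N ?f) (Pi\<^sub>E {1..n} A)"
      using PiE by (intro emeasure_density[symmetric] f)
    finally show "emeasure (distr bessel3 ?N ?X) (Pi\<^sub>E {1..n} A) = emeasure (density ?N ?f) (Pi\<^sub>E {1..n} A)" .
  next
    interpret D: prob_space "distr bessel3 ?N ?X" by (rule prob_space.prob_space_distr[OF prob_space_bessel3 X])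
    show "range (\<lambda>_::nat. Pi\<^sub>E {1..n} (\<lambda>_. UNIV)) \<subseteq> prod_algebra {1..n} (\<lambda>_. lborel :: real measure)"
      by (auto intro!: prod_algebraI_finite)
    show "(\<Union>i::nat. Pi\<^sub>E {1..n} (\<lambda>_. UNIV)) = space ?N" by (simp add: space_PiM)
    show "emeasure (distr bessel3 ?N ?X) (Pi\<^sub>E {1..n} (\<lambda>_. UNIV)) \<noteq> \<infinity>"
      unfolding infinity_ennreal_def by (rule D.emeasure_finite)
  qed simp_all
  moreover have "?f = (\<lambda>x. if \<forall>i\<in>{1..n}. 0 < x i
               then ennreal (2 * sqrt (2 * pi) * hitting_density (t 1) (x 1) *
                      (\<Prod>i=1..<n. killed_density (t (Suc i) - t i) (x i) (x (Suc i))) *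
                      hitting_density (1 - t n) (x n))
               else 0)"
    unfolding excursion_density_def by (intro ext) (auto simp only: ennreal_0 split: if_splits)
  ultimately show "distributed bessel3 ?N ?X (\<lambda>x. if \<forall>i\<in>{1..n}. 0 < x i
               then ennreal (2 * sqrt (2 * pi) * hitting_density (t 1) (x 1) *
                      (\<Prod>i=1..<n. killed_density (t (Suc i) - t i) (x i) (x (Suc i))) *
                      hitting_density (1 - t n) (x n))
               else 0)"
    using X f unfolding distributed_def by simp
qed

text \<open>Tested with continuous marks, both laws give the integral against the excursion density.
  \<open>marks_determine_boxes\<close> passes to boxes, which determine a law on the path
  space.\<close>

lemma distr_vervaat: "distr W path_borel vervaat = bessel3"
proof (rule measure_eqI_path)
  let ?V = "distr W path_borel vervaat"
  have V: "prob_space ?V" by (rule prob_space_distr[OF measurable_vervaat_W])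
  interpret V: prob_space ?V by (rule V)
  interpret B: prob_space bessel3 by (rule prob_space_bessel3)
  show "finite_measure ?V" "finite_measure bessel3" by unfold_locales
  show "sets ?V = sets path_borel" "sets bessel3 = sets path_borel" by (simp_all add: sets_bessel3)
  fix I :: "real set" and B :: "real \<Rightarrow> real set"
  assume I: "finite I" "I \<subseteq> {0<..<1}" and B: "\<And>t. t \<in> I \<Longrightarrow> B t \<in> sets borel"
  have spB: "space bessel3 = space path_borel" by (rule sets_eq_imp_space_eq[OF sets_bessel3])
  show "emeasure ?V {w \<in> space path_borel. \<forall>t\<in>I. w t \<in> B t} = emeasure bessel3 {w \<in> space path_borel. \<forall>t\<in>I. w t \<in> B t}"
  proof (cases "I = {}")
    case True
    then show ?thesis using V.emeasure_space_1 B.emeasure_space_1 by (simp add: spB)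
  next
    case False
    define l where "l = sorted_list_of_set I"
    define k where "k = length l"
    \<comment> \<open>Times are numbered from 1, list positions from 0.\<close>
    define \<tau> where "\<tau> i = l ! (i - 1)" for i
    have set_l: "set l = I" using I by (simp add: l_def)
    have k: "1 \<le> k" using False set_l by (cases l) (auto simp: k_def)
    have \<tau>I: "\<tau> (Suc i) \<in> I" if "i < k" for i using that set_l by (auto simp: \<tau>_def k_def)
    have mono: "\<tau> i < \<tau> (Suc i)" if "1 \<le> i" "i < k" for i
      using that sorted_wrt_nth_less[OF strict_sorted_list_of_set[of I], of "i - 1" i] by (simp add: \<tau>_def k_def l_def)
    have \<tau>01: "0 < \<tau> 1" "\<tau> k < 1" using \<tau>I[of 0] \<tau>I[of "k - 1"] k I(2) by auto
    have \<tau>in: "\<tau> (Suc i) \<in> {0..1}" if "i < k" for i using \<tau>I[OF that] I(2) by force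
    have ballI: "(\<forall>t\<in>I. w t \<in> B t) \<longleftrightarrow> (\<forall>i<k. w (\<tau> (Suc i)) \<in> B (\<tau> (Suc i)))" for w :: "real \<Rightarrow> real"
      unfolding set_l[symmetric] by (simp add: \<tau>_def k_def all_set_conv_all_nth)
    have em: "emeasure L {w \<in> space path_borel. \<forall>t\<in>I. w t \<in> B t} = (\<integral>\<^sup>+w. (\<Prod>i<k. indicator (B (\<tau> (Suc i))) (w (\<tau> (Suc i)))) \<partial>L)"
      if L: "sets L = sets path_borel" for L
    proof -
      have sp: "space L = space path_borel" by (rule sets_eq_imp_space_eq[OF L])
      have "{w \<in> space path_borel. \<forall>t\<in>I. w t \<in> B t} \<in> sets path_borel"
      proof (rule sets.sets_Collect_finite_All[OF _ I(1)])
        fix t assume "t \<in> I"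
        then show "{w \<in> space path_borel. w t \<in> B t} \<in> sets path_borel"
          using measurable_sets[OF measurable_path_eval B, of t t] I(2) by (force simp: vimage_def Int_def conj_commute)
      qed
      then have "emeasure L {w \<in> space path_borel. \<forall>t\<in>I. w t \<in> B t} = (\<integral>\<^sup>+w. indicator {w \<in> space path_borel. \<forall>t\<in>I. w t \<in> B t} w \<partial>L)"
        using L by simp
      also have "\<dots> = (\<integral>\<^sup>+w. (\<Prod>i<k. indicator (B (\<tau> (Suc i))) (w (\<tau> (Suc i)))) \<partial>L)"
        unfolding indicator_ball by (intro nn_integral_cong) (simp add: indicator_def sp ballI)
      finally show ?thesis .
    qed
    have marks: "(\<integral>\<^sup>+w. (\<Prod>i<k. ennreal (g i (w (\<tau> (Suc i))))) \<partial>?V) = (\<integral>\<^sup>+w. (\<Prod>i<k. ennreal (g i (w (\<tau> (Suc i))))) \<partial>bessel3)"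
      if g_cont: "\<And>i. continuous_on UNIV (g i)" and g01: "\<And>i x. 0 \<le> g i x \<and> g i x \<le> 1" for g :: "nat \<Rightarrow> real \<Rightarrow> real"
    proof -
      have gm: "g i \<in> borel_measurable borel" for i using g_cont by (rule borel_measurable_continuous_onI)
      have gm': "(\<lambda>x. ennreal (g i x)) \<in> borel_measurable borel" for i using gm by simp
      have G: "(\<Prod>i<k. ennreal (g i (h i))) = ennreal (\<Prod>i<k. g i (h i))" "0 \<le> (\<Prod>i<k. g i (h i))" "(\<Prod>i<k. g i (h i)) \<le> 1" for h
        using g01 by (auto simp: prod_ennreal intro: prod_nonneg prod_le_1)
      let ?M = "Pi\<^sub>M {1..k} (\<lambda>_. lborel :: real measure)"
      let ?G = "\<lambda>x. \<Prod>i<k. g i (x (Suc i))"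
      note em = measurable_excursion_density[OF k, of \<tau>]
      have e0: "0 \<le> excursion_density \<tau> k x" for x by (rule excursion_density_nonneg[OF mono \<tau>01 k])
      have mass: "(\<integral>\<^sup>+x. ennreal (excursion_density \<tau> k x) \<partial>?M) = 1" by (rule excursion_density_mass[OF k mono \<tau>01])
      have ei: "integrable ?M (excursion_density \<tau> k)"
        using mass em by (intro integrableI_nonneg) (auto simp: e0 simp del: One_nat_def)
      have Gm: "?G \<in> borel_measurable ?M"
        by (intro borel_measurable_prod measurable_compose[OF measurable_PiM_coordinate gm]) auto
      have eG: "integrable ?M (\<lambda>x. excursion_density \<tau> k x * ?G x)"
        using G(2,3) e0 by (intro Bochner_Integration.integrable_bound[OF ei] borel_measurable_times em Gm) (auto intro!: mult_left_le simp del: One_nat_def)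
      have Vm: "(\<lambda>w. \<Prod>i<k. g i (vervaat w (\<tau> (Suc i)))) \<in> borel_measurable W"
        by (intro borel_measurable_prod measurable_compose[OF measurable_vervaat_eval gm] \<tau>in) auto
      have "(\<lambda>w. \<Prod>i<k. ennreal (g i (w (\<tau> (Suc i))))) \<in> borel_measurable path_borel"
        by (intro borel_measurable_prod_ennreal measurable_compose[OF measurable_path_eval gm'] \<tau>in) auto
      then have "(\<integral>\<^sup>+w. (\<Prod>i<k. ennreal (g i (w (\<tau> (Suc i))))) \<partial>?V) = (\<integral>\<^sup>+w. ennreal (\<Prod>i<k. g i (vervaat w (\<tau> (Suc i)))) \<partial>W)"
        by (simp add: nn_integral_distr[OF measurable_vervaat_W] G(1))
      also have "\<dots> = ennreal (expectation (\<lambda>w. \<Prod>i<k. g i (vervaat w (\<tau> (Suc i)))))"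
        using G(2,3) Vm by (intro nn_integral_eq_integral integrable_const_bound[where B=1]) auto
      also have "\<dots> = ennreal (\<integral>x. excursion_density \<tau> k x * ?G x \<partial>?M)"
        by (simp only: vervaat_excursion[OF k mono \<tau>01 g_cont g01 mass])
      also have "\<dots> = (\<integral>\<^sup>+x. ennreal (excursion_density \<tau> k x * ?G x) \<partial>?M)"
        using G(2) e0 by (intro nn_integral_eq_integral[symmetric] eG) auto
      also have "\<dots> = (\<integral>\<^sup>+x. ennreal (excursion_density \<tau> k x) * (\<Prod>i<k. ennreal (g i (x (Suc i)))) \<partial>?M)"
        by (intro nn_integral_cong) (simp only: G(1) ennreal_mult[OF e0 G(2)])
      also have "\<dots> = (\<integral>\<^sup>+w. (\<Prod>i<k. ennreal (g i (w (\<tau> (Suc i))))) \<partial>bessel3)"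
        by (rule bessel3_excursion[OF k mono \<tau>01 \<tau>in gm', symmetric])
      finally show ?thesis .
    qed
    show ?thesis
      unfolding em[OF sets_bessel3] em[of ?V, OF sets_distr]
      using B \<tau>I by (intro marks_determine_boxes[where t="\<lambda>i. \<tau> (Suc i)", OF V _ prob_space_bessel3 sets_bessel3 \<tau>in marks]) auto
  qed
qed

lemma penalised_bridge_converges: "converges_weakly path_topology (penalised_bridge W) bessel3 at_top"
  unfolding converges_weakly_def
proof (intro allI impI)
  fix f :: "(real \<Rightarrow> real) \<Rightarrow> real"
  assume "continuous_map path_topology euclideanreal f \<and> bounded (f ` topspace path_topology)"
  then have f: "continuous_map path_topology euclideanreal f" and "bounded (f ` topspace path_topology)" by auto
  then obtain C where "\<And>w. w \<in> space path_borel \<Longrightarrow> \<bar>f w\<bar> \<le> C"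
    by (auto simp: bounded_iff mspace_eq_space)
  from penalised_bridge_tendsto_vervaat[OF f this]
  have "((\<lambda>\<kappa>. \<integral>w. f w \<partial>penalised_bridge W \<kappa>) \<longlongrightarrow> expectation (\<lambda>w. f (vervaat w))) at_top" .
  also have "expectation (\<lambda>w. f (vervaat w)) = (\<integral>w. f w \<partial>bessel3)"
    unfolding distr_vervaat[symmetric]
    by (rule integral_distr[symmetric, OF measurable_vervaat_W continuous_map_path_measurable[OF f]])
  finally show "((\<lambda>\<kappa>. \<integral>w. f w \<partial>penalised_bridge W \<kappa>) \<longlongrightarrow> (\<integral>w. f w \<partial>bessel3)) at_top" .
qed

end

theorem theorem1p2:
  fixes W :: "(real \<Rightarrow> real) measure"
  assumes "brownian_bridge_law W"
  shows "(\<forall>\<kappa>>0. partition_constant W \<kappa> > 0 \<and> prob_space (penalised_bridge W \<kappa>)) \<and>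
         converges_weakly path_topology (penalised_bridge W) (bessel_bridge_law W 3) at_top \<and>
         normalised_excursion_law (bessel_bridge_law W 3)"
proof -
  interpret brownian_bridge W by unfold_locales (fact assms)
  show ?thesis
    using partition_constant_pos prob_space_penalised_bridge penalised_bridge_converges normalised_excursion_law_bessel3 by blast
qed

end
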